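(* The fibration over $\mathbf{Set}$ of symmetric multicategories is equivalent to the fibration over $\mathbf{Set}$ whose objects are weakly cartesian analytic monads (on slices $\mathbf{Set}_{/O}$) and whose morphisms are weakly cartesian morphisms of monads whose functor parts are pullback functors. Under this correspondence the free symmetric multicategories correspond to the free analytic monads.
   Context: Notation: $[n]=\{0,\dots,n\}$, $(n]=\{1,\dots,n\}$; $S_n$ is the group of permutations of $(n]$, acting on $[n]$ with $0$ fixed. For $u:O\to Q$, $u^*:\mathbf{Set}_{/Q}\to\mathbf{Set}_{/O}$ is the pullback functor. Symmetric multicategories. A symmetric multicategory is a small symmetric multicategory in the usual sense (coloured symmetric operad in $\mathbf{Set}$); morphisms are the usual multifunctors. The category of symmetric multicategories is fibred over $\mathbf{Set}$ by sending a symmetric multicategory to its set of objects. The underlying data of a symmetric multicategory with object set $O$ form a symmetric signature over $O$: a family of sets $(A_n)_{n\in\omega}$ with right $S_n$-actions and, for each $a\in A_n$ (write $|a|=n$), a function $\partial^A_a:[n]\to O$ with $\partial^A_{a\cdot\sigma}=\partial^A_a\circ\sigma$. A morphism of symmetric signatures over $u:O\to Q$ is a family of equivariant maps $f$ with $\partial^B_{f(a)}=u\circ\partial^A_a$. A free symmetric multicategory is a value of the left adjoint to the forgetful functor from symmetric multicategories to the category $Sig_s$ of symmetric signatures. Analytic functors. For a symmetric signature $A$ over $O$ and $d^X:X\to O$, $A\star X$ is the quotient of $\{(a,\vec{x}):a\in A,\ \vec{x}:(|a|]\to X,\ d^X\circ\vec{x}=\partial^A_a|_{(|a|]}\}$ by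 $(a,\vec{x})\sim(a\cdot\sigma,\vec{x}\circ\sigma)$ for $\sigma\in S_{|a|}$, mapped to $O$ by $[a,\vec{x}]\mapsto\partial^A_a(0)$. An analytic functor on $\mathbf{Set}_{/O}$ is an endofunctor isomorphic to $A\star(-)$ for some symmetric signature $A$ over $O$ (equivalently, a finitary endofunctor that weakly preserves wide pullbacks). Morphisms of analytic functors $P\to R$ over $u:O\to Q$ are the weakly cartesian natural transformations $Pu^*\to u^*R$. Analytic monads. A natural transformation is weakly cartesian if its naturality squares are weak pullbacks. A weakly cartesian analytic monad on $\mathbf{Set}_{/O}$ is a monad whose functor part is analytic (finitary and weakly preserving wide pullbacks) and whose unit and multiplication are weakly cartesian. A morphism over $u:O\to Q$ from a monad $(M',\eta',\mu')$ on $\mathbf{Set}_{/O}$ to $(M,\eta,\mu)$ on $\mathbf{Set}_{/Q}$ is a weakly cartesian natural transformation $f:M'u^*\to u^*M$ such that $f\circ\eta'_{u^*}=u^*\eta$ and $f\circ\mu'_{u^*}=u^*\mu\circ f_M\circ M'f$. The projection sends a monad on $\mathbf{Set}_{/O}$ to $O$. A free analytic monad is a value of the left adjoint to the forgetful functor from weakly cartesian analytic monads (with these morphisms) to analytic functors. *)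

theory Defs
  imports Main "HOL-Library.FuncSet" "HOL-Combinatorics.Permutations"
begin

unbundle cardinal_syntax

section \<open>Categories, functors, natural transformations\<close>

text \<open>
  Every arrow carries its source and target, so that hom-sets are disjoint and
  equality of arrows is equality of source, data and target.
\<close>

datatype ('o, 'd) arrow = Arrow (src: 'o) (dat: 'd) (tgt: 'o)

record ('o, 'd) category =
  Obj :: "'o set"
  Arr :: "('o, 'd) arrow set"
  Idn :: "'o \<Rightarrow> ('o, 'd) arrow"
  Cmp :: "('o, 'd) arrow \<Rightarrow> ('o, 'd) arrow \<Rightarrow> ('o, 'd) arrow"  \<comment> \<open>\<open>Cmp C g f\<close> is \<open>g\<close> after \<open>f\<close>\<close>

definition Hom :: "('o, 'd) category \<Rightarrow> 'o \<Rightarrow> 'o \<Rightarrow> ('o, 'd) arrow set" where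
  "Hom C a b = {f \<in> Arr C. src f = a \<and> tgt f = b}"

definition is_category :: "('o, 'd) category \<Rightarrow> bool" where
  "is_category C \<longleftrightarrow>
    (\<forall>f \<in> Arr C. src f \<in> Obj C \<and> tgt f \<in> Obj C) \<and>
    (\<forall>a \<in> Obj C. Idn C a \<in> Hom C a a) \<and>
    (\<forall>f \<in> Arr C. \<forall>g \<in> Arr C. tgt f = src g \<longrightarrow> Cmp C g f \<in> Hom C (src f) (tgt g)) \<and>
    (\<forall>f \<in> Arr C. Cmp C f (Idn C (src f)) = f \<and> Cmp C (Idn C (tgt f)) f = f) \<and>
    (\<forall>f \<in> Arr C. \<forall>g \<in> Arr C. \<forall>h \<in> Arr C. tgt f = src g \<longrightarrow> tgt g = src h \<longrightarrow>
       Cmp C h (Cmp C g f) = Cmp C (Cmp C h g) f)"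

definition inverse_arrows ::
    "('o, 'd) category \<Rightarrow> ('o, 'd) arrow \<Rightarrow> ('o, 'd) arrow \<Rightarrow> bool" where
  "inverse_arrows C f g \<longleftrightarrow> f \<in> Arr C \<and> g \<in> Hom C (tgt f) (src f) \<and>
     Cmp C g f = Idn C (src f) \<and> Cmp C f g = Idn C (tgt f)"

definition is_iso :: "('o, 'd) category \<Rightarrow> ('o, 'd) arrow \<Rightarrow> bool" where
  "is_iso C f \<longleftrightarrow> (\<exists>g. inverse_arrows C f g)"

definition inv_arrow :: "('o, 'd) category \<Rightarrow> ('o, 'd) arrow \<Rightarrow> ('o, 'd) arrow" where
  "inv_arrow C f = (THE g. inverse_arrows C f g)"

record ('o, 'd, 'p, 'e) func =
  omap :: "'o \<Rightarrow> 'p"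
  amap :: "('o, 'd) arrow \<Rightarrow> ('p, 'e) arrow"

definition is_functor ::
    "('o, 'd) category \<Rightarrow> ('p, 'e) category \<Rightarrow> ('o, 'd, 'p, 'e) func \<Rightarrow> bool" where
  "is_functor C D F \<longleftrightarrow> is_category C \<and> is_category D \<and>
    (\<forall>a \<in> Obj C. omap F a \<in> Obj D) \<and>
    (\<forall>f \<in> Arr C. amap F f \<in> Hom D (omap F (src f)) (omap F (tgt f))) \<and>
    (\<forall>a \<in> Obj C. amap F (Idn C a) = Idn D (omap F a)) \<and>
    (\<forall>f \<in> Arr C. \<forall>g \<in> Arr C. tgt f = src g \<longrightarrow>
       amap F (Cmp C g f) = Cmp D (amap F g) (amap F f))"

definition id_func :: "('o, 'd, 'o, 'd) func" where
  "id_func = \<lparr>omap = (\<lambda>a. a), amap = (\<lambda>f. f)\<rparr>"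

definition comp_func ::
    "('p, 'e, 'q, 'k) func \<Rightarrow> ('o, 'd, 'p, 'e) func \<Rightarrow> ('o, 'd, 'q, 'k) func"
    (infixr "\<bullet>" 70) where
  "G \<bullet> F = \<lparr>omap = (\<lambda>a. omap G (omap F a)), amap = (\<lambda>f. amap G (amap F f))\<rparr>"

definition nat_trans ::
    "('o, 'd) category \<Rightarrow> ('p, 'e) category \<Rightarrow> ('o, 'd, 'p, 'e) func \<Rightarrow>
     ('o, 'd, 'p, 'e) func \<Rightarrow> ('o \<Rightarrow> ('p, 'e) arrow) \<Rightarrow> bool" where
  "nat_trans C D F G \<alpha> \<longleftrightarrow> is_functor C D F \<and> is_functor C D G \<and>
    (\<forall>a \<in> Obj C. \<alpha> a \<in> Hom D (omap F a) (omap G a)) \<and>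
    (\<forall>f \<in> Arr C. Cmp D (\<alpha> (tgt f)) (amap F f) = Cmp D (amap G f) (\<alpha> (src f)))"

definition nat_iso ::
    "('o, 'd) category \<Rightarrow> ('p, 'e) category \<Rightarrow> ('o, 'd, 'p, 'e) func \<Rightarrow>
     ('o, 'd, 'p, 'e) func \<Rightarrow> ('o \<Rightarrow> ('p, 'e) arrow) \<Rightarrow> bool" where
  "nat_iso C D F G \<alpha> \<longleftrightarrow> nat_trans C D F G \<alpha> \<and> (\<forall>a \<in> Obj C. is_iso D (\<alpha> a))"

text \<open>
  \<open>weak_pullback C p q f g\<close>: the square \<open>f \<circ> p = g \<circ> q\<close> commutes and every cone over the
  cospan \<open>f, g\<close> factors, not necessarily uniquely, through \<open>p, q\<close>.
\<close>

definition weak_pullback ::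
    "('o, 'd) category \<Rightarrow> ('o, 'd) arrow \<Rightarrow> ('o, 'd) arrow \<Rightarrow> ('o, 'd) arrow \<Rightarrow>
     ('o, 'd) arrow \<Rightarrow> bool" where
  "weak_pullback C p q f g \<longleftrightarrow>
    p \<in> Hom C (src p) (src f) \<and> q \<in> Hom C (src p) (src g) \<and>
    f \<in> Hom C (src f) (tgt f) \<and> g \<in> Hom C (src g) (tgt f) \<and>
    Cmp C f p = Cmp C g q \<and>
    (\<forall>z \<in> Obj C. \<forall>a \<in> Hom C z (src f). \<forall>b \<in> Hom C z (src g). Cmp C f a = Cmp C g b \<longrightarrow>
       (\<exists>h \<in> Hom C z (src p). Cmp C p h = a \<and> Cmp C q h = b))"

definition weakly_cartesian ::
    "('o, 'd) category \<Rightarrow> ('p, 'e) category \<Rightarrow> ('o, 'd, 'p, 'e) func \<Rightarrow>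
     ('o, 'd, 'p, 'e) func \<Rightarrow> ('o \<Rightarrow> ('p, 'e) arrow) \<Rightarrow> bool" where
  "weakly_cartesian C D F G \<alpha> \<longleftrightarrow> nat_trans C D F G \<alpha> \<and>
    (\<forall>f \<in> Arr C. weak_pullback D (amap F f) (\<alpha> (src f)) (\<alpha> (tgt f)) (amap G f))"

definition is_monad ::
    "('o, 'd) category \<Rightarrow> ('o, 'd, 'o, 'd) func \<Rightarrow> ('o \<Rightarrow> ('o, 'd) arrow) \<Rightarrow>
     ('o \<Rightarrow> ('o, 'd) arrow) \<Rightarrow> bool" where
  "is_monad C T \<eta> \<mu> \<longleftrightarrow>
    is_functor C C T \<and> nat_trans C C id_func T \<eta> \<and> nat_trans C C (T \<bullet> T) T \<mu> \<and>
    (\<forall>a \<in> Obj C.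
       Cmp C (\<mu> a) (\<eta> (omap T a)) = Idn C (omap T a) \<and>
       Cmp C (\<mu> a) (amap T (\<eta> a)) = Idn C (omap T a) \<and>
       Cmp C (\<mu> a) (\<mu> (omap T a)) = Cmp C (\<mu> a) (amap T (\<mu> a)))"

definition slice ::
    "('o, 'd) category \<Rightarrow> 'o \<Rightarrow> (('o, 'd) arrow, ('o, 'd) arrow) category" where
  "slice C c = \<lparr>
     Obj = {x \<in> Arr C. tgt x = c},
     Arr = {Arrow x h y | x h y. x \<in> Arr C \<and> tgt x = c \<and> y \<in> Arr C \<and> tgt y = c \<and>
              h \<in> Hom C (src x) (src y) \<and> Cmp C y h = x},
     Idn = (\<lambda>x. Arrow x (Idn C (src x)) x),
     Cmp = (\<lambda>g f. Arrow (src f) (Cmp C (dat g) (dat f)) (tgt g))\<rparr>"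


section \<open>Adjunctions and free objects\<close>

definition adjunction ::
    "('o, 'd) category \<Rightarrow> ('p, 'e) category \<Rightarrow> ('o, 'd, 'p, 'e) func \<Rightarrow>
     ('p, 'e, 'o, 'd) func \<Rightarrow> ('o \<Rightarrow> ('o, 'd) arrow) \<Rightarrow> ('p \<Rightarrow> ('p, 'e) arrow) \<Rightarrow> bool" where
  "adjunction C D L U \<eta> \<epsilon> \<longleftrightarrow>
    is_functor C D L \<and> is_functor D C U \<and>
    nat_trans C C id_func (U \<bullet> L) \<eta> \<and> nat_trans D D (L \<bullet> U) id_func \<epsilon> \<and>
    (\<forall>a \<in> Obj C. Cmp D (\<epsilon> (omap L a)) (amap L (\<eta> a)) = Idn D (omap L a)) \<and>
    (\<forall>b \<in> Obj D. Cmp C (amap U (\<epsilon> b)) (\<eta> (omap U b)) = Idn C (omap U b))"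

definition left_adjoint ::
    "('o, 'd) category \<Rightarrow> ('p, 'e) category \<Rightarrow> ('o, 'd, 'p, 'e) func \<Rightarrow>
     ('p, 'e, 'o, 'd) func \<Rightarrow> bool" where
  "left_adjoint C D L U \<longleftrightarrow> (\<exists>\<eta> \<epsilon>. adjunction C D L U \<eta> \<epsilon>)"

text \<open>
  The left adjoint is determined only up to isomorphism, and any choice is allowed here; so
  the class of free objects is closed under isomorphism.
\<close>

definition free_object ::
    "('o, 'd) category \<Rightarrow> ('p, 'e) category \<Rightarrow> ('p, 'e, 'o, 'd) func \<Rightarrow> 'p \<Rightarrow> bool" where
  "free_object C D U b \<longleftrightarrow> (\<exists>L. left_adjoint C D L U \<and> (\<exists>a \<in> Obj C. b = omap L a))"


section \<open>Fibrations and their equivalences\<close>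

definition cartesian_arrow ::
    "('o, 'd) category \<Rightarrow> ('b, 'k) category \<Rightarrow> ('o, 'd, 'b, 'k) func \<Rightarrow>
     ('o, 'd) arrow \<Rightarrow> bool" where
  "cartesian_arrow E B p \<phi> \<longleftrightarrow> \<phi> \<in> Arr E \<and>
    (\<forall>\<psi> \<in> Arr E. \<forall>w \<in> Hom B (omap p (src \<psi>)) (omap p (src \<phi>)).
       tgt \<psi> = tgt \<phi> \<longrightarrow> amap p \<psi> = Cmp B (amap p \<phi>) w \<longrightarrow>
       (\<exists>!\<chi>. \<chi> \<in> Hom E (src \<psi>) (src \<phi>) \<and> amap p \<chi> = w \<and> Cmp E \<phi> \<chi> = \<psi>))"

definition fibration ::
    "('o, 'd) category \<Rightarrow> ('b, 'k) category \<Rightarrow> ('o, 'd, 'b, 'k) func \<Rightarrow> bool" where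
  "fibration E B p \<longleftrightarrow> is_functor E B p \<and>
    (\<forall>e \<in> Obj E. \<forall>u \<in> Arr B. tgt u = omap p e \<longrightarrow>
       (\<exists>\<phi>. cartesian_arrow E B p \<phi> \<and> tgt \<phi> = e \<and> amap p \<phi> = u))"

definition fibred_functor ::
    "('b, 'k) category \<Rightarrow> ('o, 'd) category \<Rightarrow> ('o, 'd, 'b, 'k) func \<Rightarrow>
     ('p, 'e) category \<Rightarrow> ('p, 'e, 'b, 'k) func \<Rightarrow> ('o, 'd, 'p, 'e) func \<Rightarrow> bool" where
  "fibred_functor B E p E' p' F \<longleftrightarrow> is_functor E E' F \<and>
    (\<forall>a \<in> Obj E. omap p' (omap F a) = omap p a) \<and>
    (\<forall>f \<in> Arr E. amap p' (amap F f) = amap p f) \<and>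
    (\<forall>f. cartesian_arrow E B p f \<longrightarrow> cartesian_arrow E' B p' (amap F f))"

definition vertical_iso ::
    "('b, 'k) category \<Rightarrow> ('o, 'd) category \<Rightarrow> ('o, 'd, 'b, 'k) func \<Rightarrow>
     ('o, 'd, 'o, 'd) func \<Rightarrow> ('o, 'd, 'o, 'd) func \<Rightarrow> ('o \<Rightarrow> ('o, 'd) arrow) \<Rightarrow> bool" where
  "vertical_iso B E p F G \<alpha> \<longleftrightarrow> nat_iso E E F G \<alpha> \<and>
    (\<forall>a \<in> Obj E. amap p (\<alpha> a) = Idn B (omap p a))"

definition fibration_equivalence ::
    "('b, 'k) category \<Rightarrow> ('o, 'd) category \<Rightarrow> ('o, 'd, 'b, 'k) func \<Rightarrow>
     ('p, 'e) category \<Rightarrow> ('p, 'e, 'b, 'k) func \<Rightarrow> ('o, 'd, 'p, 'e) func \<Rightarrow> bool" where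
  "fibration_equivalence B E p E' p' F \<longleftrightarrow>
    fibration E B p \<and> fibration E' B p' \<and> fibred_functor B E p E' p' F \<and>
    (\<exists>G. fibred_functor B E' p' E p G \<and>
       (\<exists>\<alpha>. vertical_iso B E p id_func (G \<bullet> F) \<alpha>) \<and>
       (\<exists>\<beta>. vertical_iso B E' p' (F \<bullet> G) id_func \<beta>))"


section \<open>The category of small sets\<close>

text \<open>
  A small set is a subset of \<open>'v\<close> of cardinality less than that of \<open>'v\<close>.  The main theorem
  assumes \<open>|UNIV :: 'v set|\<close> uncountable and regular.  When that cardinal is inaccessible the
  small sets are, up to bijection, the sets of a Grothendieck universe.
\<close>

type_synonym 'v fn = "('v set, 'v \<Rightarrow> 'v) arrow"

definition small :: "'v set \<Rightarrow> bool" where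
  "small X \<longleftrightarrow> |X| <o |UNIV :: 'v set|"

definition Sets :: "('v set, 'v \<Rightarrow> 'v) category" where
  "Sets = \<lparr>
     Obj = {X. small X},
     Arr = {Arrow X f Y | X f Y. small X \<and> small Y \<and> f \<in> X \<rightarrow>\<^sub>E Y},
     Idn = (\<lambda>X. Arrow X (\<lambda>x \<in> X. x) X),
     Cmp = (\<lambda>g f. Arrow (src f) (compose (src f) (dat g) (dat f)) (tgt g))\<rparr>"

abbreviation Slice :: "'v set \<Rightarrow> ('v fn, 'v fn) category" where
  "Slice Q \<equiv> slice Sets Q"

text \<open>The function on elements underlying an arrow of a slice.\<close>

abbreviation elt_map :: "('v fn, 'v fn) arrow \<Rightarrow> 'v \<Rightarrow> 'v" where
  "elt_map h \<equiv> dat (dat h)"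

text \<open>
  Pullbacks are formed with a fixed encoding of pairs, that is, an injection
  \<open>'v \<times> 'v \<Rightarrow> 'v\<close>, which exists because \<open>'v\<close> is infinite.
\<close>

definition vpair :: "'v \<times> 'v \<Rightarrow> 'v" where
  "vpair = (SOME p. inj p)"

definition vfst :: "'v \<Rightarrow> 'v" where "vfst z = fst (inv vpair z)"

definition vsnd :: "'v \<Rightarrow> 'v" where "vsnd z = snd (inv vpair z)"

definition pb_obj :: "'v fn \<Rightarrow> 'v fn \<Rightarrow> 'v fn" where
  "pb_obj u x =
    (let Z = {vpair (a, e) | a e. a \<in> src u \<and> e \<in> src x \<and> dat u a = dat x e}
     in Arrow Z (\<lambda>z \<in> Z. vfst z) (src u))"

definition pb :: "'v fn \<Rightarrow> ('v fn, 'v fn, 'v fn, 'v fn) func" where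
  "pb u = \<lparr>
     omap = pb_obj u,
     amap = (\<lambda>h. Arrow (pb_obj u (src h))
       (Arrow (src (pb_obj u (src h)))
         (\<lambda>z \<in> src (pb_obj u (src h)). vpair (vfst z, elt_map h (vsnd z)))
         (src (pb_obj u (tgt h))))
       (pb_obj u (tgt h)))\<rparr>"

text \<open>
  Pullback is functorial in the base only up to the canonical isomorphisms
  \<open>id\<^sup>* x \<cong> x\<close> and \<open>(v \<circ> u)\<^sup>* x \<cong> u\<^sup>* (v\<^sup>* x)\<close>.
\<close>

definition pb_id :: "'v set \<Rightarrow> 'v fn \<Rightarrow> ('v fn, 'v fn) arrow" where
  "pb_id Q x =
    (let y = pb_obj (Idn Sets Q) x in Arrow y (Arrow (src y) (\<lambda>z \<in> src y. vsnd z) (src x)) x)"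

definition pb_cmp :: "'v fn \<Rightarrow> 'v fn \<Rightarrow> 'v fn \<Rightarrow> ('v fn, 'v fn) arrow" where
  "pb_cmp v u x =
    (let y = pb_obj (Cmp Sets v u) x; y' = pb_obj u (pb_obj v x)
     in Arrow y
       (Arrow (src y) (\<lambda>z \<in> src y. vpair (vfst z, vpair (dat u (vfst z), vsnd z))) (src y')) y')"


section \<open>Symmetric signatures and symmetric multicategories\<close>

text \<open>
  An \<open>n\<close>-ary operation \<open>a\<close> is passed around as the pair \<open>(n, a)\<close>.  The boundary of \<open>(n, a)\<close> is a
  function on \<open>{0..n}\<close> whose value at \<open>0\<close> is the output colour; its values beyond \<open>n\<close> are
  irrelevant.
\<close>

record 'v sig =
  colours :: "'v set"
  ops :: "nat \<Rightarrow> 'v set"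
  act :: "nat \<times> 'v \<Rightarrow> (nat \<Rightarrow> nat) \<Rightarrow> 'v"
  bnd :: "nat \<times> 'v \<Rightarrow> nat \<Rightarrow> 'v"

definition is_sig :: "('v, 'z) sig_scheme \<Rightarrow> bool" where
  "is_sig A \<longleftrightarrow> small (colours A) \<and> (\<forall>n. small (ops A n)) \<and>
    (\<forall>n. \<forall>a \<in> ops A n.
       (\<forall>i \<in> {0..n}. bnd A (n, a) i \<in> colours A) \<and>
       act A (n, a) id = a \<and>
       (\<forall>\<sigma>. \<sigma> permutes {1..n} \<longrightarrow>
          act A (n, a) \<sigma> \<in> ops A n \<and>
          (\<forall>i \<in> {0..n}. bnd A (n, act A (n, a) \<sigma>) i = bnd A (n, a) (\<sigma> i)) \<and>
          (\<forall>\<tau>. \<tau> permutes {1..n} \<longrightarrow>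
             act A (n, act A (n, a) \<sigma>) \<tau> = act A (n, a) (\<sigma> \<circ> \<tau>))))"

type_synonym 'v sig_map = "'v fn \<times> (nat \<Rightarrow> 'v \<Rightarrow> 'v)"

definition is_sig_mor ::
    "('v, 'z) sig_scheme \<Rightarrow> ('v, 'z) sig_scheme \<Rightarrow> 'v sig_map \<Rightarrow> bool" where
  "is_sig_mor A B = (\<lambda>(u, f).
    u \<in> Hom Sets (colours A) (colours B) \<and>
    (\<forall>n. f n \<in> ops A n \<rightarrow>\<^sub>E ops B n) \<and>
    (\<forall>n. \<forall>a \<in> ops A n.
       (\<forall>\<sigma>. \<sigma> permutes {1..n} \<longrightarrow> f n (act A (n, a) \<sigma>) = act B (n, f n a) \<sigma>) \<and>
       (\<forall>i \<in> {0..n}. bnd B (n, f n a) i = dat u (bnd A (n, a) i))))"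

definition sig_id ::
    "('v, 'z) sig_scheme \<Rightarrow> (('v, 'z) sig_scheme, 'v sig_map) arrow" where
  "sig_id A = Arrow A (Idn Sets (colours A), \<lambda>n. \<lambda>a \<in> ops A n. a) A"

definition sig_cmp ::
    "(('v, 'z) sig_scheme, 'v sig_map) arrow \<Rightarrow> (('v, 'z) sig_scheme, 'v sig_map) arrow \<Rightarrow>
     (('v, 'z) sig_scheme, 'v sig_map) arrow" where
  "sig_cmp G F = Arrow (src F)
     (Cmp Sets (fst (dat G)) (fst (dat F)),
      \<lambda>n. compose (ops (src F) n) (snd (dat G) n) (snd (dat F) n))
     (tgt G)"

definition Sig :: "('v sig, 'v sig_map) category" where
  "Sig = \<lparr>
     Obj = {A. is_sig A},
     Arr = {Arrow A f B | A f B. is_sig A \<and> is_sig B \<and> is_sig_mor A B f},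
     Idn = sig_id,
     Cmp = sig_cmp\<rparr>"

text \<open>
  \<open>ident\<close> gives the identity operations and \<open>subst M (n, a) [(k\<^sub>1, b\<^sub>1), \<dots>, (k\<^sub>n, b\<^sub>n)]\<close> is the
  composite \<open>a\<langle>b\<^sub>1, \<dots>, b\<^sub>n\<rangle>\<close>, of arity \<open>k\<^sub>1 + \<dots> + k\<^sub>n\<close>.
\<close>

record 'v multicat = "'v sig" +
  ident :: "'v \<Rightarrow> 'v"
  subst :: "nat \<times> 'v \<Rightarrow> (nat \<times> 'v) list \<Rightarrow> 'v"

definition arity_sum :: "(nat \<times> 'v) list \<Rightarrow> nat" where
  "arity_sum bs = sum_list (map fst bs)"

definition msubst ::
    "('v, 'z) multicat_scheme \<Rightarrow> nat \<times> 'v \<Rightarrow> (nat \<times> 'v) list \<Rightarrow> nat \<times> 'v" where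
  "msubst M a bs = (arity_sum bs, subst M a bs)"

definition arg :: "'b list \<Rightarrow> nat \<Rightarrow> 'b" where
  "arg bs i = bs ! (i - 1)"  \<comment> \<open>inputs are numbered from 1, list positions from 0\<close>

definition substitutable ::
    "('v, 'z) multicat_scheme \<Rightarrow> nat \<times> 'v \<Rightarrow> (nat \<times> 'v) list \<Rightarrow> bool" where
  "substitutable M p bs \<longleftrightarrow>
    snd p \<in> ops M (fst p) \<and> length bs = fst p \<and>
    (\<forall>i \<in> {1..fst p}. snd (arg bs i) \<in> ops M (fst (arg bs i)) \<and>
       bnd M (arg bs i) 0 = bnd M p i)"

text \<open>
  \<open>pos bs i j\<close> is the position, among the inputs of \<open>a\<langle>b\<^sub>1, \<dots>, b\<^sub>n\<rangle>\<close>, of the \<open>j\<close>-th input of \<open>b\<^sub>i\<close>.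
\<close>

definition pos :: "(nat \<times> 'v) list \<Rightarrow> nat \<Rightarrow> nat \<Rightarrow> nat" where
  "pos bs i j = arity_sum (take (i - 1) bs) + j"

definition permute_args :: "'b list \<Rightarrow> (nat \<Rightarrow> nat) \<Rightarrow> 'b list" where
  "permute_args bs \<sigma> = map (\<lambda>i. arg bs (\<sigma> i)) [1..<Suc (length bs)]"

text \<open>
  The two equivariance axioms are
  \<open>(a \<cdot> \<sigma>)\<langle>b\<^bsub>\<sigma>(1)\<^esub>, \<dots>, b\<^bsub>\<sigma>(n)\<^esub>\<rangle> = a\<langle>b\<^sub>1, \<dots>, b\<^sub>n\<rangle> \<cdot> \<rho>\<close> with \<open>\<rho>\<close> the permutation of blocks induced by \<open>\<sigma>\<close>,
  and \<open>a\<langle>b\<^sub>1 \<cdot> \<tau>\<^sub>1, \<dots>, b\<^sub>n \<cdot> \<tau>\<^sub>n\<rangle> = a\<langle>b\<^sub>1, \<dots>, b\<^sub>n\<rangle> \<cdot> \<rho>\<close> with \<open>\<rho>\<close> the juxtaposition of the \<open>\<tau>\<^sub>i\<close>.  In both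
  cases \<open>\<rho>\<close> exists and is uniquely determined by the condition imposed on it.
\<close>

definition is_multicat :: "('v, 'z) multicat_scheme \<Rightarrow> bool" where
  "is_multicat M \<longleftrightarrow> is_sig M \<and>
    (\<forall>c \<in> colours M. ident M c \<in> ops M 1 \<and>
       bnd M (1, ident M c) 0 = c \<and> bnd M (1, ident M c) 1 = c) \<and>
    (\<forall>a bs. substitutable M a bs \<longrightarrow>
       subst M a bs \<in> ops M (arity_sum bs) \<and>
       bnd M (msubst M a bs) 0 = bnd M a 0 \<and>
       (\<forall>i \<in> {1..fst a}. \<forall>j \<in> {1..fst (arg bs i)}.
          bnd M (msubst M a bs) (pos bs i j) = bnd M (arg bs i) j)) \<and>
    (\<forall>n. \<forall>a \<in> ops M n.
       msubst M (1, ident M (bnd M (n, a) 0)) [(n, a)] = (n, a) \<and>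
       msubst M (n, a) (map (\<lambda>i. (1, ident M (bnd M (n, a) i))) [1..<Suc n]) = (n, a)) \<and>
    (\<forall>a bs css. substitutable M a bs \<longrightarrow> length css = length bs \<longrightarrow>
       (\<forall>i < length bs. substitutable M (bs ! i) (css ! i)) \<longrightarrow>
       msubst M a (map2 (msubst M) bs css) = msubst M (msubst M a bs) (concat css)) \<and>
    (\<forall>n a bs \<sigma> \<rho>. substitutable M (n, a) bs \<longrightarrow> \<sigma> permutes {1..n} \<longrightarrow>
       \<rho> permutes {1..arity_sum bs} \<longrightarrow>
       (\<forall>i \<in> {1..n}. \<forall>j \<in> {1..fst (arg bs (\<sigma> i))}.
          \<rho> (pos (permute_args bs \<sigma>) i j) = pos bs (\<sigma> i) j) \<longrightarrow>
       subst M (n, act M (n, a) \<sigma>) (permute_args bs \<sigma>) = act M (msubst M (n, a) bs) \<rho>) \<and>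
    (\<forall>n a bs \<tau> \<rho>. substitutable M (n, a) bs \<longrightarrow>
       (\<forall>i \<in> {1..n}. \<tau> i permutes {1..fst (arg bs i)}) \<longrightarrow>
       \<rho> permutes {1..arity_sum bs} \<longrightarrow>
       (\<forall>i \<in> {1..n}. \<forall>j \<in> {1..fst (arg bs i)}. \<rho> (pos bs i j) = pos bs i (\<tau> i j)) \<longrightarrow>
       subst M (n, a) (map (\<lambda>i. (fst (arg bs i), act M (arg bs i) (\<tau> i))) [1..<Suc n])
         = act M (msubst M (n, a) bs) \<rho>)"

definition is_multifunctor ::
    "('v, 'z) multicat_scheme \<Rightarrow> ('v, 'z) multicat_scheme \<Rightarrow> 'v sig_map \<Rightarrow> bool" where
  "is_multifunctor M N = (\<lambda>(u, f).
    is_sig_mor M N (u, f) \<and>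
    (\<forall>c \<in> colours M. f 1 (ident M c) = ident N (dat u c)) \<and>
    (\<forall>n a bs. substitutable M (n, a) bs \<longrightarrow>
       f (arity_sum bs) (subst M (n, a) bs)
         = subst N (n, f n a) (map (\<lambda>(k, b). (k, f k b)) bs)))"

definition Multicat :: "('v multicat, 'v sig_map) category" where
  "Multicat = \<lparr>
     Obj = {M. is_multicat M},
     Arr = {Arrow M f N | M f N. is_multicat M \<and> is_multicat N \<and> is_multifunctor M N f},
     Idn = sig_id,
     Cmp = sig_cmp\<rparr>"

definition colours_func :: "('v multicat, 'v sig_map, 'v set, 'v \<Rightarrow> 'v) func" where
  "colours_func = \<lparr>omap = colours, amap = (\<lambda>F. fst (dat F))\<rparr>"

definition multicat_forget :: "('v multicat, 'v sig_map, 'v sig, 'v sig_map) func" where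
  "multicat_forget = \<lparr>
     omap = sig.truncate,
     amap = (\<lambda>F. Arrow (sig.truncate (src F)) (dat F) (sig.truncate (tgt F)))\<rparr>"


section \<open>Analytic functors and analytic monads\<close>

text \<open>
  The elements of \<open>A \<star> x\<close> are equivalence classes, hence not elements of \<open>'v\<close>.  So \<open>A \<star> (-)\<close> is
  described by the underlying set, the map to the colours and the action on slice arrows, and
  an endofunctor of \<open>Slice Q\<close> is compared with it by a natural family of bijections over \<open>Q\<close>.
\<close>

definition star_pre ::
    "('v, 'z) sig_scheme \<Rightarrow> 'v fn \<Rightarrow> (nat \<times> 'v \<times> (nat \<Rightarrow> 'v)) set" where
  "star_pre A x = {(n, a, xs). a \<in> ops A n \<and> xs \<in> {1..n} \<rightarrow>\<^sub>E src x \<and>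
     (\<forall>i \<in> {1..n}. dat x (xs i) = bnd A (n, a) i)}"

definition star_rel ::
    "('v, 'z) sig_scheme \<Rightarrow> 'v fn \<Rightarrow> (nat \<times> 'v \<times> (nat \<Rightarrow> 'v)) rel" where
  "star_rel A x = {((n, a, xs), (n, act A (n, a) \<sigma>, xs \<circ> \<sigma>)) | n a xs \<sigma>.
     (n, a, xs) \<in> star_pre A x \<and> \<sigma> permutes {1..n}}"

definition star :: "('v, 'z) sig_scheme \<Rightarrow> 'v fn \<Rightarrow> (nat \<times> 'v \<times> (nat \<Rightarrow> 'v)) set set" where
  "star A x = star_pre A x // star_rel A x"

definition star_proj :: "('v, 'z) sig_scheme \<Rightarrow> (nat \<times> 'v \<times> (nat \<Rightarrow> 'v)) set \<Rightarrow> 'v" where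
  "star_proj A c = the_elem ((\<lambda>(n, a, xs). bnd A (n, a) 0) ` c)"

definition star_map ::
    "('v, 'z) sig_scheme \<Rightarrow> ('v fn, 'v fn) arrow \<Rightarrow> (nat \<times> 'v \<times> (nat \<Rightarrow> 'v)) set \<Rightarrow>
     (nat \<times> 'v \<times> (nat \<Rightarrow> 'v)) set" where
  "star_map A h c =
     star_rel A (tgt h) `` ((\<lambda>(n, a, xs). (n, a, compose {1..n} (elt_map h) xs)) ` c)"

definition analytic :: "'v set \<Rightarrow> ('v fn, 'v fn, 'v fn, 'v fn) func \<Rightarrow> bool" where
  "analytic Q P \<longleftrightarrow> is_functor (Slice Q) (Slice Q) P \<and>
    (\<exists>(A :: 'v sig) \<theta>. is_sig A \<and> colours A = Q \<and>
       (\<forall>x \<in> Obj (Slice Q).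
          bij_betw (\<theta> x) (src (omap P x)) (star A x) \<and>
          (\<forall>e \<in> src (omap P x). star_proj A (\<theta> x e) = dat (omap P x) e)) \<and>
       (\<forall>h \<in> Arr (Slice Q). \<forall>e \<in> src (omap P (src h)).
          \<theta> (tgt h) (elt_map (amap P h) e) = star_map A h (\<theta> (src h) e)))"

record 'v anfunc =
  base :: "'v set"
  fctr :: "('v fn, 'v fn, 'v fn, 'v fn) func"

definition is_anfunc :: "('v, 'z) anfunc_scheme \<Rightarrow> bool" where
  "is_anfunc P \<longleftrightarrow> small (base P) \<and> analytic (base P) (fctr P)"

type_synonym 'v an_map = "'v fn \<times> ('v fn \<Rightarrow> ('v fn, 'v fn) arrow)"

text \<open>
  A morphism over \<open>u\<close> is a family indexed by the objects of the slice over the target of \<open>u\<close>; it is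
  required to be \<open>extensional\<close> so that equality of morphisms is equality of components.
\<close>

definition is_an_mor ::
    "('v, 'z) anfunc_scheme \<Rightarrow> ('v, 'z) anfunc_scheme \<Rightarrow> 'v an_map \<Rightarrow> bool" where
  "is_an_mor P R = (\<lambda>(u, f).
    u \<in> Hom Sets (base P) (base R) \<and>
    f \<in> extensional (Obj (Slice (base R))) \<and>
    weakly_cartesian (Slice (base R)) (Slice (base P)) (fctr P \<bullet> pb u) (pb u \<bullet> fctr R) f)"

definition an_id ::
    "('v, 'z) anfunc_scheme \<Rightarrow> (('v, 'z) anfunc_scheme, 'v an_map) arrow" where
  "an_id P = Arrow P
     (Idn Sets (base P),
      \<lambda>x \<in> Obj (Slice (base P)).
        Cmp (Slice (base P))
          (inv_arrow (Slice (base P)) (pb_id (base P) (omap (fctr P) x)))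
          (amap (fctr P) (pb_id (base P) x)))
     P"

text \<open>
  For \<open>F = (u, f) : P \<rightarrow> R\<close> and \<open>G = (v, g) : R \<rightarrow> S\<close> the composite has at \<open>x\<close> the component
  \<open>P (v \<circ> u)\<^sup>* x \<cong> P u\<^sup>* v\<^sup>* x \<rightarrow> u\<^sup>* R v\<^sup>* x \<rightarrow> u\<^sup>* v\<^sup>* S x \<cong> (v \<circ> u)\<^sup>* S x\<close>.
\<close>

definition an_cmp ::
    "(('v, 'z) anfunc_scheme, 'v an_map) arrow \<Rightarrow> (('v, 'z) anfunc_scheme, 'v an_map) arrow \<Rightarrow>
     (('v, 'z) anfunc_scheme, 'v an_map) arrow" where
  "an_cmp G F =
    (let P = src F; S = tgt G; u = fst (dat F); f = snd (dat F); v = fst (dat G); g = snd (dat G);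
         C = Slice (base P)
     in Arrow P
       (Cmp Sets v u,
        \<lambda>x \<in> Obj (Slice (base S)).
          Cmp C (inv_arrow C (pb_cmp v u (omap (fctr S) x)))
            (Cmp C (amap (pb u) (g x))
              (Cmp C (f (pb_obj v x)) (amap (fctr P) (pb_cmp v u x)))))
       S)"

definition An :: "('v anfunc, 'v an_map) category" where
  "An = \<lparr>
     Obj = {P. is_anfunc P},
     Arr = {Arrow P f R | P f R. is_anfunc P \<and> is_anfunc R \<and> is_an_mor P R f},
     Idn = an_id,
     Cmp = an_cmp\<rparr>"

record 'v anmonad = "'v anfunc" +
  eta :: "'v fn \<Rightarrow> ('v fn, 'v fn) arrow"
  mu :: "'v fn \<Rightarrow> ('v fn, 'v fn) arrow"

definition is_anmonad :: "('v, 'z) anmonad_scheme \<Rightarrow> bool" where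
  "is_anmonad M \<longleftrightarrow> is_anfunc M \<and>
    (let C = Slice (base M); T = fctr M in
       is_monad C T (eta M) (mu M) \<and>
       weakly_cartesian C C id_func T (eta M) \<and>
       weakly_cartesian C C (T \<bullet> T) T (mu M))"

definition is_anmonad_mor ::
    "('v, 'z) anmonad_scheme \<Rightarrow> ('v, 'z) anmonad_scheme \<Rightarrow> 'v an_map \<Rightarrow> bool" where
  "is_anmonad_mor M' M = (\<lambda>(u, f).
    is_an_mor M' M (u, f) \<and>
    (\<forall>x \<in> Obj (Slice (base M)).
       (let C = Slice (base M') in
         Cmp C (f x) (eta M' (pb_obj u x)) = amap (pb u) (eta M x) \<and>
         Cmp C (f x) (mu M' (pb_obj u x))
           = Cmp C (amap (pb u) (mu M x))
               (Cmp C (f (omap (fctr M) x)) (amap (fctr M') (f x))))))"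

definition AnMonad :: "('v anmonad, 'v an_map) category" where
  "AnMonad = \<lparr>
     Obj = {M. is_anmonad M},
     Arr = {Arrow M' f M | M' f M. is_anmonad M' \<and> is_anmonad M \<and> is_anmonad_mor M' M f},
     Idn = an_id,
     Cmp = an_cmp\<rparr>"

definition base_func :: "('v anmonad, 'v an_map, 'v set, 'v \<Rightarrow> 'v) func" where
  "base_func = \<lparr>omap = base, amap = (\<lambda>F. fst (dat F))\<rparr>"

definition anmonad_forget :: "('v anmonad, 'v an_map, 'v anfunc, 'v an_map) func" where
  "anmonad_forget = \<lparr>
     omap = anfunc.truncate,
     amap = (\<lambda>F. Arrow (anfunc.truncate (src F)) (dat F) (anfunc.truncate (tgt F)))\<rparr>"

end

theory Submission
  imports Defs "HOL-Library.Countable_Set"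
begin

text \<open>
  Every element of an analytic functor \<open>P x = A \<star> x\<close> is named by an operation of \<open>A\<close> applied to elements of
  \<open>x\<close>, uniquely up to permutation.  Weakly cartesian transformations preserve generic elements, those named
  by an operation applied to distinct variables; hence transformations \<open>P u\<^sup>* \<rightarrow> u\<^sup>* R\<close> are the same thing as
  maps of signatures over \<open>u\<close>, and signatures are equivalent to analytic functors.  In the same way a
  weakly cartesian unit and multiplication on \<open>P\<close> are the same thing as identities and a substitution on
  \<open>A\<close>, and the monad laws evaluated at generic elements are the axioms of a multicategory.

  Both equivalences are spans of functors that are fully faithful and surjective on objects, and the
  forgetful functors match along them.  So universal arrows, and with them free objects, are carried from one
  side to the other, and it suffices to reindex multicategories along maps of colours and to construct the
  free multicategory on a signature.
\<close>

section \<open>Categories and universal arrows\<close>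

lemma cat_cmp: "is_category C \<Longrightarrow> f \<in> Hom C a b \<Longrightarrow> g \<in> Hom C b c \<Longrightarrow> Cmp C g f \<in> Hom C a c"
  unfolding is_category_def Hom_def by auto

lemma cat_idn: "is_category C \<Longrightarrow> a \<in> Obj C \<Longrightarrow> Idn C a \<in> Hom C a a"
  unfolding is_category_def by auto

lemma cat_obj: "is_category C \<Longrightarrow> f \<in> Hom C a b \<Longrightarrow> a \<in> Obj C \<and> b \<in> Obj C"
  unfolding is_category_def Hom_def by auto

lemma cat_idl: "is_category C \<Longrightarrow> f \<in> Hom C a b \<Longrightarrow> Cmp C (Idn C b) f = f"
  unfolding is_category_def Hom_def by auto

lemma cat_idr: "is_category C \<Longrightarrow> f \<in> Hom C a b \<Longrightarrow> Cmp C f (Idn C a) = f"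
  unfolding is_category_def Hom_def by auto

lemma cat_assoc: "is_category C \<Longrightarrow> f \<in> Hom C a b \<Longrightarrow> g \<in> Hom C b c \<Longrightarrow> h \<in> Hom C c d \<Longrightarrow>
   Cmp C h (Cmp C g f) = Cmp C (Cmp C h g) f"
  unfolding is_category_def Hom_def by auto

lemma Hom_Arr: "f \<in> Hom C a b \<longleftrightarrow> f \<in> Arr C \<and> src f = a \<and> tgt f = b"
  unfolding Hom_def by auto

lemma func_hom: "is_functor C D F \<Longrightarrow> f \<in> Hom C a b \<Longrightarrow> amap F f \<in> Hom D (omap F a) (omap F b)"
  unfolding is_functor_def Hom_def by auto

lemma func_obj: "is_functor C D F \<Longrightarrow> a \<in> Obj C \<Longrightarrow> omap F a \<in> Obj D"
  unfolding is_functor_def by auto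

lemma func_cmp: "is_functor C D F \<Longrightarrow> f \<in> Hom C a b \<Longrightarrow> g \<in> Hom C b c \<Longrightarrow>
   amap F (Cmp C g f) = Cmp D (amap F g) (amap F f)"
  unfolding is_functor_def Hom_def by auto

lemma func_idn: "is_functor C D F \<Longrightarrow> a \<in> Obj C \<Longrightarrow> amap F (Idn C a) = Idn D (omap F a)"
  unfolding is_functor_def by auto

lemma func_cat: "is_functor C D F \<Longrightarrow> is_category C" "is_functor C D F \<Longrightarrow> is_category D"
  unfolding is_functor_def by auto

lemma is_functorI:
  assumes "is_category C" "is_category D" "\<And>a. a \<in> Obj C \<Longrightarrow> omap F a \<in> Obj D"
    and "\<And>f a b. f \<in> Hom C a b \<Longrightarrow> amap F f \<in> Hom D (omap F a) (omap F b)"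
    and "\<And>a. a \<in> Obj C \<Longrightarrow> amap F (Idn C a) = Idn D (omap F a)"
    and "\<And>f g a b c. f \<in> Hom C a b \<Longrightarrow> g \<in> Hom C b c \<Longrightarrow>
        amap F (Cmp C g f) = Cmp D (amap F g) (amap F f)"
  shows "is_functor C D F"
  unfolding is_functor_def using assms by (auto simp: Hom_Arr)

lemma is_functor_id: "is_category C \<Longrightarrow> is_functor C C id_func"
  by (rule is_functorI) (auto simp: id_func_def)

lemma is_functor_comp: "is_functor C D F \<Longrightarrow> is_functor D E G \<Longrightarrow> is_functor C E (G \<bullet> F)"
  by (rule is_functorI)
    (auto simp: comp_func_def func_cat func_obj func_idn intro: func_hom func_cmp
      dest: func_cat, (metis func_cmp func_hom)+)

lemma nat_transI:
  assumes "is_functor C D F" "is_functor C D G"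
    "\<And>a. a \<in> Obj C \<Longrightarrow> \<alpha> a \<in> Hom D (omap F a) (omap G a)"
    "\<And>f a b. f \<in> Hom C a b \<Longrightarrow> Cmp D (\<alpha> b) (amap F f) = Cmp D (amap G f) (\<alpha> a)"
  shows "nat_trans C D F G \<alpha>"
  unfolding nat_trans_def using assms by (auto simp: Hom_Arr)

lemma nat_nat: "nat_trans C D F G \<alpha> \<Longrightarrow> f \<in> Hom C a b \<Longrightarrow>
    Cmp D (\<alpha> b) (amap F f) = Cmp D (amap G f) (\<alpha> a)"
  unfolding nat_trans_def Hom_def by auto

lemma nat_hom: "nat_trans C D F G \<alpha> \<Longrightarrow> a \<in> Obj C \<Longrightarrow> \<alpha> a \<in> Hom D (omap F a) (omap G a)"
  unfolding nat_trans_def by auto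

definition universal_arrow ::
    "('o, 'd) category \<Rightarrow> ('p, 'e) category \<Rightarrow> ('p, 'e, 'o, 'd) func \<Rightarrow> 'o \<Rightarrow> 'p \<Rightarrow>
     ('o, 'd) arrow \<Rightarrow> bool" where
  "universal_arrow C D U a b e \<longleftrightarrow> b \<in> Obj D \<and> e \<in> Hom C a (omap U b) \<and>
     (\<forall>b' \<in> Obj D. \<forall>g \<in> Hom C a (omap U b'). \<exists>!h. h \<in> Hom D b b' \<and> Cmp C (amap U h) e = g)"

lemma universal_arrow_of_adjunction:
  assumes adj: "adjunction C D L U \<eta> \<epsilon>" and a: "a \<in> Obj C"
  shows "universal_arrow C D U a (omap L a) (\<eta> a)"
proof -
  from adj have L: "is_functor C D L" and U: "is_functor D C U"
    and eta: "nat_trans C C id_func (U \<bullet> L) \<eta>" and eps: "nat_trans D D (L \<bullet> U) id_func \<epsilon>"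
    and t1: "\<And>a. a \<in> Obj C \<Longrightarrow> Cmp D (\<epsilon> (omap L a)) (amap L (\<eta> a)) = Idn D (omap L a)"
    and t2: "\<And>b. b \<in> Obj D \<Longrightarrow> Cmp C (amap U (\<epsilon> b)) (\<eta> (omap U b)) = Idn C (omap U b)"
    unfolding adjunction_def by auto
  note C = func_cat(1)[OF L] and D = func_cat(2)[OF L]
  have La: "omap L a \<in> Obj D" using func_obj[OF L a] .
  have ea: "\<eta> a \<in> Hom C a (omap U (omap L a))"
    using nat_hom[OF eta a] by (simp add: id_func_def comp_func_def)
  have "\<exists>!h. h \<in> Hom D (omap L a) b' \<and> Cmp C (amap U h) (\<eta> a) = g"
    if b': "b' \<in> Obj D" and g: "g \<in> Hom C a (omap U b')" for b' g
  proof (rule ex1I[of _ "Cmp D (\<epsilon> b') (amap L g)"])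
    have eb: "\<epsilon> b' \<in> Hom D (omap L (omap U b')) b'"
      using nat_hom[OF eps b'] by (simp add: id_func_def comp_func_def)
    note Lg = func_hom[OF L g]
    have "amap U (Cmp D (\<epsilon> b') (amap L g)) = Cmp C (amap U (\<epsilon> b')) (amap U (amap L g))"
      using func_cmp[OF U Lg eb] .
    hence "Cmp C (amap U (Cmp D (\<epsilon> b') (amap L g))) (\<eta> a) =
        Cmp C (amap U (\<epsilon> b')) (Cmp C (amap U (amap L g)) (\<eta> a))"
      using cat_assoc[OF C ea func_hom[OF U Lg] func_hom[OF U eb]] by simp
    also have "Cmp C (amap U (amap L g)) (\<eta> a) = Cmp C (\<eta> (omap U b')) g"
      using nat_nat[OF eta g] by (simp add: id_func_def comp_func_def)
    also have "Cmp C (amap U (\<epsilon> b')) (Cmp C (\<eta> (omap U b')) g) =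
        Cmp C (Cmp C (amap U (\<epsilon> b')) (\<eta> (omap U b'))) g"
      using nat_hom[OF eta func_obj[OF U b']] func_hom[OF U eb]
      by (intro cat_assoc[OF C g]) (auto simp: id_func_def comp_func_def)
    also have "\<dots> = g" using t2[OF b'] cat_idl[OF C g] by simp
    finally show "Cmp D (\<epsilon> b') (amap L g) \<in> Hom D (omap L a) b' \<and>
        Cmp C (amap U (Cmp D (\<epsilon> b') (amap L g))) (\<eta> a) = g"
      using cat_cmp[OF D Lg eb] by simp
  next
    fix h assume h: "h \<in> Hom D (omap L a) b' \<and> Cmp C (amap U h) (\<eta> a) = g"
    hence h1: "h \<in> Hom D (omap L a) b'" and h2: "Cmp C (amap U h) (\<eta> a) = g" by auto
    have eb: "\<epsilon> b' \<in> Hom D (omap L (omap U b')) b'"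
      using nat_hom[OF eps b'] by (simp add: id_func_def comp_func_def)
    have eLa: "\<epsilon> (omap L a) \<in> Hom D (omap L (omap U (omap L a))) (omap L a)"
      using nat_hom[OF eps La] by (simp add: id_func_def comp_func_def)
    note Uh = func_hom[OF U h1]
    have "Cmp D (\<epsilon> b') (amap L g) = Cmp D (\<epsilon> b') (Cmp D (amap L (amap U h)) (amap L (\<eta> a)))"
      using func_cmp[OF L ea Uh] h2 by simp
    also have "\<dots> = Cmp D (Cmp D (\<epsilon> b') (amap L (amap U h))) (amap L (\<eta> a))"
      using cat_assoc[OF D func_hom[OF L ea] func_hom[OF L Uh] eb] .
    also have "Cmp D (\<epsilon> b') (amap L (amap U h)) = Cmp D h (\<epsilon> (omap L a))"
      using nat_nat[OF eps h1] by (simp add: id_func_def comp_func_def)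
    also have "Cmp D (Cmp D h (\<epsilon> (omap L a))) (amap L (\<eta> a)) =
        Cmp D h (Cmp D (\<epsilon> (omap L a)) (amap L (\<eta> a)))"
      using cat_assoc[OF D func_hom[OF L ea] eLa h1] by simp
    also have "\<dots> = h" using t1[OF a] cat_idr[OF D h1] by simp
    finally show "h = Cmp D (\<epsilon> b') (amap L g)" ..
  qed
  thus ?thesis unfolding universal_arrow_def using La ea by auto
qed

lemma left_adjoint_of_universal_arrows:
  assumes U: "is_functor D C U"
    and univ: "\<And>a. a \<in> Obj C \<Longrightarrow> universal_arrow C D U a (F a) (e a)"
  shows "\<exists>L. left_adjoint C D L U \<and> omap L = F"
proof -
  note C = func_cat(2)[OF U] and D = func_cat(1)[OF U]
  define tr where "tr a b g = (THE h. h \<in> Hom D (F a) b \<and> Cmp C (amap U h) (e a) = g)" for a b g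
  have Fa: "F a \<in> Obj D" and ea: "e a \<in> Hom C a (omap U (F a))" if "a \<in> Obj C" for a
    using univ[OF that] unfolding universal_arrow_def by auto
  have tr: "tr a b g \<in> Hom D (F a) b \<and> Cmp C (amap U (tr a b g)) (e a) = g"
    if "a \<in> Obj C" "g \<in> Hom C a (omap U b)" "b \<in> Obj D" for a b g
    unfolding tr_def by (rule theI') (use univ[OF that(1)] that in \<open>auto simp: universal_arrow_def\<close>)
  have uniq: "h = h'" if "a \<in> Obj C" "h \<in> Hom D (F a) b" "h' \<in> Hom D (F a) b"
    "Cmp C (amap U h) (e a) = Cmp C (amap U h') (e a)" for a b h h'
  proof -
    have "b \<in> Obj D" using cat_obj[OF D that(2)] by simp
    moreover have "Cmp C (amap U h) (e a) \<in> Hom C a (omap U b)"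
      using cat_cmp[OF C ea[OF that(1)] func_hom[OF U that(2)]] .
    ultimately have "\<exists>!k. k \<in> Hom D (F a) b \<and> Cmp C (amap U k) (e a) = Cmp C (amap U h) (e a)"
      using univ[OF that(1)] unfolding universal_arrow_def by blast
    thus ?thesis using that by metis
  qed
  define L where "L = \<lparr>omap = F, amap = (\<lambda>f. tr (src f) (F (tgt f)) (Cmp C (e (tgt f)) f))\<rparr>"
  define \<epsilon> where "\<epsilon> b = tr (omap U b) b (Idn C (omap U b))" for b
  have Lf: "amap L f \<in> Hom D (F a) (F b)"
    and Lf2: "Cmp C (amap U (amap L f)) (e a) = Cmp C (e b) f" if f: "f \<in> Hom C a b" for f a b
  proof -
    have ab: "a \<in> Obj C" "b \<in> Obj C" and st: "src f = a" "tgt f = b"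
      using cat_obj[OF C f] f by (auto simp: Hom_Arr)
    show "amap L f \<in> Hom D (F a) (F b)" "Cmp C (amap U (amap L f)) (e a) = Cmp C (e b) f"
      using tr[OF ab(1) cat_cmp[OF C f ea[OF ab(2)]] Fa[OF ab(2)]] by (auto simp: L_def st)
  qed
  have oL: "omap L = F" by (simp add: L_def)
  have LF: "is_functor C D L"
  proof (rule is_functorI[OF C D], unfold oL)
    fix a assume a: "a \<in> Obj C"
    show "F a \<in> Obj D" using Fa[OF a] .
    show "amap L (Idn C a) = Idn D (F a)"
      by (rule uniq[OF a Lf[OF cat_idn[OF C a]] cat_idn[OF D Fa[OF a]]])
        (simp add: Lf2[OF cat_idn[OF C a]] func_idn[OF U Fa[OF a]] cat_idl[OF C ea[OF a]]
          cat_idr[OF C ea[OF a]])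
  next
    fix f g a b c assume f: "f \<in> Hom C a b" and g: "g \<in> Hom C b c"
    have a: "a \<in> Obj C" and b: "b \<in> Obj C" and c: "c \<in> Obj C"
      using cat_obj[OF C f] cat_obj[OF C g] by auto
    note gf = cat_cmp[OF C f g]
    have "Cmp C (amap U (Cmp D (amap L g) (amap L f))) (e a) =
       Cmp C (Cmp C (amap U (amap L g)) (amap U (amap L f))) (e a)"
      using func_cmp[OF U Lf[OF f] Lf[OF g]] by simp
    also have "\<dots> = Cmp C (amap U (amap L g)) (Cmp C (e b) f)"
      using cat_assoc[OF C ea[OF a] func_hom[OF U Lf[OF f]] func_hom[OF U Lf[OF g]]] Lf2[OF f] by simp
    also have "\<dots> = Cmp C (Cmp C (e c) g) f"
      using cat_assoc[OF C f ea[OF b] func_hom[OF U Lf[OF g]]] Lf2[OF g] by simp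
    also have "\<dots> = Cmp C (amap U (amap L (Cmp C g f))) (e a)"
      using cat_assoc[OF C f g ea[OF c]] Lf2[OF gf] by simp
    finally show "amap L (Cmp C g f) = Cmp D (amap L g) (amap L f)"
      by (intro uniq[OF a Lf[OF gf] cat_cmp[OF D Lf[OF f] Lf[OF g]]]) simp
  qed (fact Lf)
  have eps: "\<epsilon> b \<in> Hom D (F (omap U b)) b"
    "Cmp C (amap U (\<epsilon> b)) (e (omap U b)) = Idn C (omap U b)" if b: "b \<in> Obj D" for b
    using tr[OF func_obj[OF U b] cat_idn[OF C func_obj[OF U b]] b] by (auto simp: \<epsilon>_def)
  have "adjunction C D L U e \<epsilon>"
    unfolding adjunction_def
  proof (intro conjI ballI LF U)
    show "nat_trans C C id_func (U \<bullet> L) e"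
      by (rule nat_transI[OF is_functor_id[OF C] is_functor_comp[OF LF U]])
        (auto simp: id_func_def comp_func_def oL ea Lf2)
    show "nat_trans D D (L \<bullet> U) id_func \<epsilon>"
    proof (rule nat_transI[OF is_functor_comp[OF U LF] is_functor_id[OF D]])
      fix a assume "a \<in> Obj D" thus "\<epsilon> a \<in> Hom D (omap (L \<bullet> U) a) (omap id_func a)"
        using eps by (auto simp: id_func_def comp_func_def oL)
    next
      fix f a b assume f: "f \<in> Hom D a b"
      have a: "a \<in> Obj D" and b: "b \<in> Obj D" using cat_obj[OF D f] by auto
      note Uf = func_hom[OF U f] and Ua = func_obj[OF U a] and Ub = func_obj[OF U b]
      have "Cmp C (amap U (Cmp D (\<epsilon> b) (amap L (amap U f)))) (e (omap U a)) =
        Cmp C (amap U (\<epsilon> b)) (Cmp C (amap U (amap L (amap U f))) (e (omap U a)))"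
        using func_cmp[OF U Lf[OF Uf] eps(1)[OF b]]
          cat_assoc[OF C ea[OF Ua] func_hom[OF U Lf[OF Uf]] func_hom[OF U eps(1)[OF b]]] by simp
      also have "\<dots> = amap U f"
        using Lf2[OF Uf] cat_assoc[OF C Uf ea[OF Ub] func_hom[OF U eps(1)[OF b]]] eps(2)[OF b]
          cat_idl[OF C Uf] by simp
      also have "\<dots> = Cmp C (amap U (Cmp D f (\<epsilon> a))) (e (omap U a))"
        using func_cmp[OF U eps(1)[OF a] f] eps(2)[OF a] cat_idr[OF C Uf]
          cat_assoc[OF C ea[OF Ua] func_hom[OF U eps(1)[OF a]] Uf] by simp
      finally show "Cmp D (\<epsilon> b) (amap (L \<bullet> U) f) = Cmp D (amap id_func f) (\<epsilon> a)"
        using cat_cmp[OF D Lf[OF Uf] eps(1)[OF b]] cat_cmp[OF D eps(1)[OF a] f]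
        by (intro uniq[OF Ua]) (auto simp: id_func_def comp_func_def)
    qed
  next
    fix a assume a: "a \<in> Obj C"
    have Lh: "amap L (e a) \<in> Hom D (F a) (F (omap U (F a)))" using Lf[OF ea[OF a]] .
    note e1 = eps[OF Fa[OF a]]
    have "Cmp C (amap U (Cmp D (\<epsilon> (F a)) (amap L (e a)))) (e a) =
        Cmp C (amap U (\<epsilon> (F a))) (Cmp C (e (omap U (F a))) (e a))"
      using func_cmp[OF U Lh e1(1)] Lf2[OF ea[OF a]]
        cat_assoc[OF C ea[OF a] func_hom[OF U Lh] func_hom[OF U e1(1)]] by simp
    also have "\<dots> = e a"
      using cat_assoc[OF C ea[OF a] ea[OF func_obj[OF U Fa[OF a]]] func_hom[OF U e1(1)]] e1(2)
        cat_idl[OF C ea[OF a]] by simp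
    also have "\<dots> = Cmp C (amap U (Idn D (F a))) (e a)"
      using func_idn[OF U Fa[OF a]] cat_idl[OF C ea[OF a]] by simp
    finally show "Cmp D (\<epsilon> (omap L a)) (amap L (e a)) = Idn D (omap L a)"
      unfolding oL by (intro uniq[OF a cat_cmp[OF D Lh e1(1)] cat_idn[OF D Fa[OF a]]])
  next
    fix b assume "b \<in> Obj D"
    thus "Cmp C (amap U (\<epsilon> b)) (e (omap U b)) = Idn C (omap U b)" using eps by simp
  qed
  thus ?thesis unfolding left_adjoint_def using oL by blast
qed

lemma left_adjoint_exists:
  assumes U: "is_functor D C U"
    and ex: "\<And>a. a \<in> Obj C \<Longrightarrow> \<exists>b e. universal_arrow C D U a b e"
  shows "\<exists>L. left_adjoint C D L U"
proof -
  have "\<forall>a \<in> Obj C. \<exists>p. universal_arrow C D U a (fst p) (snd p)"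
    using ex by (metis fst_conv snd_conv)
  then obtain p where "\<And>a. a \<in> Obj C \<Longrightarrow> universal_arrow C D U a (fst (p a)) (snd (p a))" by metis
  thus ?thesis using left_adjoint_of_universal_arrows[OF U, of "\<lambda>a. fst (p a)" "\<lambda>a. snd (p a)"] by blast
qed

lemma free_object_iff:
  assumes U: "is_functor D C U"
    and ex: "\<And>a. a \<in> Obj C \<Longrightarrow> \<exists>b e. universal_arrow C D U a b e"
  shows "free_object C D U b \<longleftrightarrow> (\<exists>a \<in> Obj C. \<exists>e. universal_arrow C D U a b e)"
proof
  assume "free_object C D U b"
  thus "\<exists>a \<in> Obj C. \<exists>e. universal_arrow C D U a b e"
    unfolding free_object_def left_adjoint_def using universal_arrow_of_adjunction[of C D _ U] by metis
next
  assume "\<exists>a \<in> Obj C. \<exists>e. universal_arrow C D U a b e"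
  then obtain a e where a: "a \<in> Obj C" and e: "universal_arrow C D U a b e" by blast
  have "\<forall>a' \<in> Obj C. \<exists>p. universal_arrow C D U a' (fst p) (snd p) \<and> (a' = a \<longrightarrow> fst p = b)"
    using ex e by (metis fst_conv snd_conv)
  then obtain p where p: "\<And>a'. a' \<in> Obj C \<Longrightarrow>
      universal_arrow C D U a' (fst (p a')) (snd (p a')) \<and> (a' = a \<longrightarrow> fst (p a') = b)"
    by metis
  obtain L where "left_adjoint C D L U" "omap L = (\<lambda>a. fst (p a))"
    using left_adjoint_of_universal_arrows[OF U, of "\<lambda>a. fst (p a)" "\<lambda>a. snd (p a)"] p by auto
  thus "free_object C D U b"
    unfolding free_object_def using p[OF a] a by (intro exI[of _ L]) auto
qed

section \<open>Correspondences\<close>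

text \<open>
  An equivalence given as a span \<open>C \<leftarrow> K \<rightarrow> D\<close> of fully faithful functors that are surjective on
  objects: \<open>K\<close> indexes objects on both sides and \<open>\<Phi>\<close> identifies the hom-sets.  That \<open>D\<close> is a
  category is a consequence.
\<close>

locale correspondence =
  fixes C :: "('o, 'd) category" and D :: "('p, 'e) category"
    and K :: "'k set" and l :: "'k \<Rightarrow> 'o" and r :: "'k \<Rightarrow> 'p"
    and \<Phi> :: "'k \<Rightarrow> 'k \<Rightarrow> ('o, 'd) arrow \<Rightarrow> ('p, 'e) arrow"
  assumes C: "is_category C"
    and D_Arr: "\<And>f. f \<in> Arr D \<Longrightarrow> src f \<in> Obj D \<and> tgt f \<in> Obj D"
    and l_obj: "\<And>k. k \<in> K \<Longrightarrow> l k \<in> Obj C" and r_obj: "\<And>k. k \<in> K \<Longrightarrow> r k \<in> Obj D"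
    and l_ex: "\<And>c. c \<in> Obj C \<Longrightarrow> \<exists>k\<in>K. l k = c" and r_ex: "\<And>d. d \<in> Obj D \<Longrightarrow> \<exists>k\<in>K. r k = d"
    and bij: "\<And>k k'. k \<in> K \<Longrightarrow> k' \<in> K \<Longrightarrow> bij_betw (\<Phi> k k') (Hom C (l k) (l k')) (Hom D (r k) (r k'))"
    and cmp: "\<And>k k' k'' f g. k \<in> K \<Longrightarrow> k' \<in> K \<Longrightarrow> k'' \<in> K \<Longrightarrow> f \<in> Hom C (l k) (l k') \<Longrightarrow>
       g \<in> Hom C (l k') (l k'') \<Longrightarrow> \<Phi> k k'' (Cmp C g f) = Cmp D (\<Phi> k' k'' g) (\<Phi> k k' f)"
    and idn: "\<And>k. k \<in> K \<Longrightarrow> \<Phi> k k (Idn C (l k)) = Idn D (r k)"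
begin

lemma hom: "k \<in> K \<Longrightarrow> k' \<in> K \<Longrightarrow> f \<in> Hom C (l k) (l k') \<Longrightarrow> \<Phi> k k' f \<in> Hom D (r k) (r k')"
  using bij bij_betwE by blast

lemma preimage: "k \<in> K \<Longrightarrow> k' \<in> K \<Longrightarrow> g \<in> Hom D (r k) (r k') \<Longrightarrow>
    \<exists>f \<in> Hom C (l k) (l k'). \<Phi> k k' f = g"
  using bij by (metis bij_betw_def imageE)

lemma inject: "k \<in> K \<Longrightarrow> k' \<in> K \<Longrightarrow> f \<in> Hom C (l k) (l k') \<Longrightarrow> f' \<in> Hom C (l k) (l k') \<Longrightarrow>
    \<Phi> k k' f = \<Phi> k k' f' \<Longrightarrow> f = f'"
  using bij by (metis bij_betw_def inj_onD)

lemma D: "is_category D"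
  unfolding is_category_def
proof (intro conjI ballI impI)
  fix a assume "a \<in> Obj D"
  then obtain k where k: "k \<in> K" "r k = a" using r_ex by blast
  show "Idn D a \<in> Hom D a a" using idn[OF k(1)] hom[OF k(1,1) cat_idn[OF C l_obj[OF k(1)]]] k by simp
next
  fix f assume f: "f \<in> Arr D"
  obtain k k' where k: "k \<in> K" "k' \<in> K" "r k = src f" "r k' = tgt f"
    using D_Arr[OF f] r_ex by metis
  obtain f0 where f0: "f0 \<in> Hom C (l k) (l k')" "\<Phi> k k' f0 = f"
    using preimage[OF k(1,2), of f] f k by (auto simp: Hom_Arr)
  show "Cmp D f (Idn D (src f)) = f"
    using cmp[OF k(1,1,2) cat_idn[OF C l_obj[OF k(1)]] f0(1)] idn[OF k(1)] cat_idr[OF C f0(1)] f0 k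
    by simp
  show "Cmp D (Idn D (tgt f)) f = f"
    using cmp[OF k(1,2,2) f0(1) cat_idn[OF C l_obj[OF k(2)]]] idn[OF k(2)] cat_idl[OF C f0(1)] f0 k
    by simp
next
  fix f g assume f: "f \<in> Arr D" and g: "g \<in> Arr D" and fg: "tgt f = src g"
  obtain k k' k'' where k: "k \<in> K" "k' \<in> K" "k'' \<in> K" "r k = src f" "r k' = tgt f" "r k'' = tgt g"
    using D_Arr[OF f] D_Arr[OF g] r_ex by metis
  obtain f0 g0 where f0: "f0 \<in> Hom C (l k) (l k')" "\<Phi> k k' f0 = f"
    and g0: "g0 \<in> Hom C (l k') (l k'')" "\<Phi> k' k'' g0 = g"
    using preimage[OF k(1,2), of f] preimage[OF k(2,3), of g] f g k fg by (auto simp: Hom_Arr)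
  show "Cmp D g f \<in> Hom D (src f) (tgt g)"
    using hom[OF k(1,3) cat_cmp[OF C f0(1) g0(1)]] cmp[OF k(1-3) f0(1) g0(1)] f0 g0 k by simp
  fix h assume h: "h \<in> Arr D" and gh: "tgt g = src h"
  obtain k3 where k3: "k3 \<in> K" "r k3 = tgt h" using D_Arr[OF h] r_ex by metis
  obtain h0 where h0: "h0 \<in> Hom C (l k'') (l k3)" "\<Phi> k'' k3 h0 = h"
    using preimage[OF k(3) k3(1), of h] h gh k k3 by (auto simp: Hom_Arr)
  show "Cmp D h (Cmp D g f) = Cmp D (Cmp D h g) f"
    using cat_assoc[OF C f0(1) g0(1) h0(1)] cmp[OF k(1-3) f0(1) g0(1)] cmp[OF k(2,3) k3(1) g0(1) h0(1)]
      cmp[OF k(1,3) k3(1) cat_cmp[OF C f0(1) g0(1)] h0(1)]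
      cmp[OF k(1,2) k3(1) f0(1) cat_cmp[OF C g0(1) h0(1)]] f0 g0 h0 by simp
qed (use D_Arr in auto)

definition \<Psi> where "\<Psi> k k' = inv_into (Hom C (l k) (l k')) (\<Phi> k k')"

lemma \<Psi>_hom: "k \<in> K \<Longrightarrow> k' \<in> K \<Longrightarrow> g \<in> Hom D (r k) (r k') \<Longrightarrow> \<Psi> k k' g \<in> Hom C (l k) (l k')"
  unfolding \<Psi>_def using bij by (metis bij_betw_def inv_into_into)

lemma \<Phi>\<Psi>: "k \<in> K \<Longrightarrow> k' \<in> K \<Longrightarrow> g \<in> Hom D (r k) (r k') \<Longrightarrow> \<Phi> k k' (\<Psi> k k' g) = g"
  unfolding \<Psi>_def using bij by (metis bij_betw_inv_into_right)

lemma \<Psi>\<Phi>: "k \<in> K \<Longrightarrow> k' \<in> K \<Longrightarrow> f \<in> Hom C (l k) (l k') \<Longrightarrow> \<Psi> k k' (\<Phi> k k' f) = f"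
  unfolding \<Psi>_def using bij by (metis bij_betw_inv_into_left)

lemma flip: "correspondence D C K r l \<Psi>"
proof
  show "is_category D" by (rule D)
  show "src f \<in> Obj C \<and> tgt f \<in> Obj C" if "f \<in> Arr C" for f
    using C that unfolding is_category_def by auto
  show "bij_betw (\<Psi> k k') (Hom D (r k) (r k')) (Hom C (l k) (l k'))" if "k \<in> K" "k' \<in> K" for k k'
    unfolding \<Psi>_def using bij_betw_inv_into[OF bij[OF that]] .
  show "\<Psi> k k'' (Cmp D g f) = Cmp C (\<Psi> k' k'' g) (\<Psi> k k' f)"
    if "k \<in> K" "k' \<in> K" "k'' \<in> K" "f \<in> Hom D (r k) (r k')" "g \<in> Hom D (r k') (r k'')" for k k' k'' f g
  proof -
    note f = \<Psi>_hom[OF that(1,2,4)] and g = \<Psi>_hom[OF that(2,3,5)]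
    show ?thesis
      using cmp[OF that(1,2,3) f g] \<Phi>\<Psi>[OF that(1,2,4)] \<Phi>\<Psi>[OF that(2,3,5)]
        \<Psi>\<Phi>[OF that(1,3) cat_cmp[OF C f g]] by simp
  qed
  show "\<Psi> k k (Idn D (r k)) = Idn C (l k)" if "k \<in> K" for k
    using \<Psi>\<Phi>[OF that that cat_idn[OF C l_obj[OF that]]] idn[OF that] by simp
qed (use l_obj r_obj l_ex r_ex in auto)

definition E :: "('o \<Rightarrow> 'k) \<Rightarrow> ('o, 'd, 'p, 'e) func" where
  "E s = \<lparr>omap = (\<lambda>c. r (s c)), amap = (\<lambda>f. \<Phi> (s (src f)) (s (tgt f)) f)\<rparr>"

lemma E_functor:
  assumes s: "\<And>c. c \<in> Obj C \<Longrightarrow> s c \<in> K \<and> l (s c) = c"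
  shows "is_functor C D (E s)"
proof (rule is_functorI[OF C D])
  fix a assume a: "a \<in> Obj C"
  show "omap (E s) a \<in> Obj D" using s[OF a] r_obj by (simp add: E_def)
  show "amap (E s) (Idn C a) = Idn D (omap (E s) a)"
    using s[OF a] cat_idn[OF C a] idn[of "s a"] by (auto simp: E_def Hom_Arr)
next
  fix f a b assume f: "f \<in> Hom C a b"
  show "amap (E s) f \<in> Hom D (omap (E s) a) (omap (E s) b)"
    using hom[of "s a" "s b" f] s cat_obj[OF C f] f by (auto simp: E_def Hom_Arr)
  fix g c assume g: "g \<in> Hom C b c"
  have "Cmp C g f \<in> Hom C a c" using cat_cmp[OF C f g] .
  thus "amap (E s) (Cmp C g f) = Cmp D (amap (E s) g) (amap (E s) f)"
    using cmp[of "s a" "s b" "s c" f g] s cat_obj[OF C f] cat_obj[OF C g] f g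
    by (auto simp: E_def Hom_Arr)
qed

end

locale fibred_correspondence = correspondence C D K l r \<Phi>
  for C :: "('o, 'd) category" and D :: "('p, 'e) category"
    and K :: "'k set" and l r \<Phi> +
  fixes B :: "('b, 'c) category" and p :: "('o, 'd, 'b, 'c) func" and q :: "('p, 'e, 'b, 'c) func"
  assumes p_functor: "is_functor C B p"
    and q_obj: "\<And>k. k \<in> K \<Longrightarrow> omap q (r k) = omap p (l k)"
    and q_arr: "\<And>k k' f. k \<in> K \<Longrightarrow> k' \<in> K \<Longrightarrow> f \<in> Hom C (l k) (l k') \<Longrightarrow> amap q (\<Phi> k k' f) = amap p f"
begin

lemma q_\<Psi>: "k \<in> K \<Longrightarrow> k' \<in> K \<Longrightarrow> g \<in> Hom D (r k) (r k') \<Longrightarrow> amap p (\<Psi> k k' g) = amap q g"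
  using q_arr[of k k' "\<Psi> k k' g"] \<Psi>_hom \<Phi>\<Psi> by simp

lemma q_functor: "is_functor D B q"
proof (rule is_functorI[OF D func_cat(2)[OF p_functor]])
  fix a assume "a \<in> Obj D"
  then obtain k where k: "k \<in> K" "r k = a" using r_ex by blast
  show "omap q a \<in> Obj B" using q_obj[OF k(1)] func_obj[OF p_functor l_obj[OF k(1)]] k by simp
  show "amap q (Idn D a) = Idn B (omap q a)"
    using q_obj[OF k(1)] q_arr[OF k(1,1) cat_idn[OF C l_obj[OF k(1)]]] idn[OF k(1)] k
      func_idn[OF p_functor l_obj[OF k(1)]] by simp
next
  fix f a b assume f: "f \<in> Hom D a b"
  obtain k k' where k: "k \<in> K" "k' \<in> K" "r k = a" "r k' = b"
    using cat_obj[OF D f] r_ex by metis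
  show "amap q f \<in> Hom B (omap q a) (omap q b)"
    using q_\<Psi>[OF k(1,2), of f] f k q_obj[OF k(1)] q_obj[OF k(2)]
      func_hom[OF p_functor \<Psi>_hom[OF k(1,2), of f]] by auto
  fix g c assume g: "g \<in> Hom D b c"
  obtain k'' where k'': "k'' \<in> K" "r k'' = c"
    using cat_obj[OF D g] r_ex by metis
  have f': "f \<in> Hom D (r k) (r k')" and g': "g \<in> Hom D (r k') (r k'')" using f g k k'' by auto
  show "amap q (Cmp D g f) = Cmp B (amap q g) (amap q f)"
    using func_cmp[OF p_functor \<Psi>_hom[OF k(1,2) f'] \<Psi>_hom[OF k(2) k''(1) g']]
      q_\<Psi>[OF k(1,2) f'] q_\<Psi>[OF k(2) k''(1) g']
      q_\<Psi>[OF k(1) k''(1) cat_cmp[OF D f' g']]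
      correspondence.cmp[OF flip k(1,2) k''(1) f' g'] by simp
qed

lemma flip_fibred: "fibred_correspondence D C K r l \<Psi> B q p"
proof -
  interpret F: correspondence D C K r l \<Psi> by (rule flip)
  show ?thesis
    by unfold_locales (auto simp: q_functor q_obj q_\<Psi>)
qed

lemma cartesian_image:
  assumes k: "k \<in> K" "k' \<in> K" and f: "f \<in> Hom C (l k) (l k')" and cart: "cartesian_arrow C B p f"
  shows "cartesian_arrow D B q (\<Phi> k k' f)"
  unfolding cartesian_arrow_def
proof (intro conjI ballI impI)
  note Ff = hom[OF k f]
  thus "\<Phi> k k' f \<in> Arr D" by (simp add: Hom_Arr)
  have st: "src (\<Phi> k k' f) = r k" "tgt (\<Phi> k k' f) = r k'" "src f = l k" "tgt f = l k'"
    using Ff f by (auto simp: Hom_Arr)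
  fix g w assume g: "g \<in> Arr D" and w: "w \<in> Hom B (omap q (src g)) (omap q (src (\<Phi> k k' f)))"
    and t: "tgt g = tgt (\<Phi> k k' f)" and gw: "amap q g = Cmp B (amap q (\<Phi> k k' f)) w"
  obtain k0 where k0: "k0 \<in> K" "r k0 = src g" using D_Arr[OF g] r_ex by blast
  have g': "g \<in> Hom D (r k0) (r k')" using g t st k0 by (simp add: Hom_Arr)
  from \<Psi>_hom[OF k0(1) k(2) g']
  have st2: "src (\<Psi> k0 k' g) = l k0" "tgt (\<Psi> k0 k' g) = l k'" "\<Psi> k0 k' g \<in> Arr C"
    by (auto simp: Hom_Arr)
  have "w \<in> Hom B (omap p (src (\<Psi> k0 k' g))) (omap p (src f))"
    using w st st2 q_obj[OF k0(1)] q_obj[OF k(1)] k0 by simp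
  moreover have "amap p (\<Psi> k0 k' g) = Cmp B (amap p f) w"
    using gw q_\<Psi>[OF k0(1) k(2) g'] q_arr[OF k f] by simp
  ultimately have ex: "\<exists>!h. h \<in> Hom C (l k0) (l k) \<and> amap p h = w \<and> Cmp C f h = \<Psi> k0 k' g"
    using cart st st2 unfolding cartesian_arrow_def by metis
  then obtain h where h: "h \<in> Hom C (l k0) (l k)" "amap p h = w" "Cmp C f h = \<Psi> k0 k' g" by blast
  show "\<exists>!h. h \<in> Hom D (src g) (src (\<Phi> k k' f)) \<and> amap q h = w \<and> Cmp D (\<Phi> k k' f) h = g"
    unfolding st k0(2)[symmetric]
  proof (rule ex1I[of _ "\<Phi> k0 k h"])
    show "\<Phi> k0 k h \<in> Hom D (r k0) (r k) \<and> amap q (\<Phi> k0 k h) = w \<and> Cmp D (\<Phi> k k' f) (\<Phi> k0 k h) = g"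
      using hom[OF k0(1) k(1) h(1)] q_arr[OF k0(1) k(1) h(1)] h cmp[OF k0(1) k h(1) f]
        \<Phi>\<Psi>[OF k0(1) k(2) g'] by simp
  next
    fix h' assume h': "h' \<in> Hom D (r k0) (r k) \<and> amap q h' = w \<and> Cmp D (\<Phi> k k' f) h' = g"
    hence H: "\<Psi> k0 k h' \<in> Hom C (l k0) (l k)" using \<Psi>_hom[OF k0(1) k(1)] by blast
    have "Cmp C f (\<Psi> k0 k h') = \<Psi> k0 k' g"
      using correspondence.cmp[OF flip k0(1) k, of h' "\<Phi> k k' f"] h' Ff \<Psi>\<Phi>[OF k f] by simp
    moreover have "amap p (\<Psi> k0 k h') = w" using q_\<Psi>[OF k0(1) k(1)] h' by simp
    ultimately have "\<Psi> k0 k h' = h" using ex h H by blast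
    thus "h' = \<Phi> k0 k h" using \<Phi>\<Psi>[OF k0(1) k(1)] h' by auto
  qed
qed

lemma fibration_image:
  assumes "fibration C B p"
  shows "fibration D B q"
  unfolding fibration_def
proof (intro conjI ballI impI q_functor)
  fix d u assume d: "d \<in> Obj D" and u: "u \<in> Arr B" "tgt u = omap q d"
  obtain k where k: "k \<in> K" "r k = d" using r_ex[OF d] by blast
  obtain f where f: "cartesian_arrow C B p f" "tgt f = l k" "amap p f = u"
    using assms l_obj[OF k(1)] u q_obj[OF k(1)] k(2) unfolding fibration_def by metis
  hence fa: "f \<in> Arr C" by (simp add: cartesian_arrow_def)
  then obtain k0 where k0: "k0 \<in> K" "l k0 = src f"
    using l_ex cat_obj[OF C, of f "src f" "tgt f"] by (auto simp: Hom_Arr)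
  have f': "f \<in> Hom C (l k0) (l k)" using fa f k0 by (simp add: Hom_Arr)
  show "\<exists>\<phi>. cartesian_arrow D B q \<phi> \<and> tgt \<phi> = d \<and> amap q \<phi> = u"
    using cartesian_image[OF k0(1) k(1) f' f(1)] hom[OF k0(1) k(1) f'] q_arr[OF k0(1) k(1) f'] f k
    by (intro exI[of _ "\<Phi> k0 k f"]) (auto simp: Hom_Arr)
qed

lemma E_fibred:
  assumes s: "\<And>c. c \<in> Obj C \<Longrightarrow> s c \<in> K \<and> l (s c) = c"
  shows "fibred_functor B C p D q (E s)"
proof -
  have f: "f \<in> Hom C (l (s (src f))) (l (s (tgt f)))" "s (src f) \<in> K" "s (tgt f) \<in> K"
    if "f \<in> Arr C" for f
    using that s cat_obj[OF C, of f "src f" "tgt f"] by (auto simp: Hom_Arr)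
  show ?thesis
    unfolding fibred_functor_def
    using E_functor[OF s] s q_obj q_arr[OF f(2,3,1)] cartesian_image[OF f(2,3,1)]
    by (auto simp: E_def cartesian_arrow_def)
qed

lemma round_trip:
  assumes s: "\<And>c. c \<in> Obj C \<Longrightarrow> s c \<in> K \<and> l (s c) = c"
    and t: "\<And>d. d \<in> Obj D \<Longrightarrow> t d \<in> K \<and> r (t d) = d"
  defines "G \<equiv> correspondence.E l \<Psi> t"
  shows "\<exists>\<alpha>. vertical_iso B C p id_func (G \<bullet> E s) \<alpha>" "\<exists>\<alpha>. vertical_iso B C p (G \<bullet> E s) id_func \<alpha>"
proof -
  interpret F: fibred_correspondence D C K r l \<Psi> B q p by (rule flip_fibred)
  have Gdef: "G = F.E t" by (simp add: G_def)
  define t' where "t' c = t (r (s c))" for c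
  have t': "t' c \<in> K" "r (t' c) = r (s c)" if "c \<in> Obj C" for c
    using t[OF r_obj[of "s c"]] s[OF that] by (auto simp: t'_def)
  have o: "omap (G \<bullet> E s) c = l (t' c)" for c by (simp add: Gdef F.E_def E_def comp_func_def t'_def)
  define i where "i c = \<Psi> (s c) (t' c) (Idn D (r (s c)))" for c
  define j where "j c = \<Psi> (t' c) (s c) (Idn D (r (s c)))" for c
  have idh: "Idn D (r (s c)) \<in> Hom D (r (s c)) (r (s c))" if "c \<in> Obj C" for c
    using cat_idn[OF D] r_obj s[OF that] by blast
  have i: "i c \<in> Hom C c (l (t' c))" and j: "j c \<in> Hom C (l (t' c)) c" if "c \<in> Obj C" for c
    using \<Psi>_hom[of "s c" "t' c"] \<Psi>_hom[of "t' c" "s c"] s[OF that] t'[OF that] idh[OF that]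
    by (auto simp: i_def j_def)
  have ij: "Cmp C (i c) (j c) = Idn C (l (t' c))" and ji: "Cmp C (j c) (i c) = Idn C c"
    if "c \<in> Obj C" for c
    using F.cmp[of "t' c" "s c" "t' c" "Idn D (r (s c))" "Idn D (r (s c))"] F.idn[of "t' c"]
      F.cmp[of "s c" "t' c" "s c" "Idn D (r (s c))" "Idn D (r (s c))"] F.idn[of "s c"]
      s[OF that] t'[OF that] idh[OF that] cat_idl[OF D idh[OF that]]
    by (auto simp: i_def j_def)
  have vi: "amap p (i c) = Idn B (omap p c)" and vj: "amap p (j c) = Idn B (omap p (l (t' c)))"
    if "c \<in> Obj C" for c
    using F.q_arr[of "s c" "t' c" "Idn D (r (s c))"] F.q_arr[of "t' c" "s c" "Idn D (r (s c))"]
     s[OF that] t'[OF that] idh[OF that] func_idn[OF q_functor, of "r (s c)"] r_obj[of "s c"]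
     q_obj[of "s c"] q_obj[of "t' c"]
    by (auto simp: i_def j_def)
  note GE = is_functor_comp[OF E_functor[OF s] F.E_functor[OF t], folded Gdef]
  have am: "amap (G \<bullet> E s) f = \<Psi> (t' a) (t' b) (\<Phi> (s a) (s b) f)" if f: "f \<in> Hom C a b" for f a b
  proof -
    have "a \<in> Obj C" "b \<in> Obj C" using cat_obj[OF C f] by auto
    hence "\<Phi> (s a) (s b) f \<in> Hom D (r (s a)) (r (s b))" using hom[of "s a" "s b" f] s f by simp
    thus ?thesis using f by (auto simp: Gdef F.E_def E_def comp_func_def t'_def Hom_Arr)
  qed
  have nat: "Cmp C (i b) f = Cmp C (amap (G \<bullet> E s) f) (i a)"
     "Cmp C (j b) (amap (G \<bullet> E s) f) = Cmp C f (j a)" if f: "f \<in> Hom C a b" for f a b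
  proof -
    have a: "a \<in> Obj C" and b: "b \<in> Obj C" using cat_obj[OF C f] by auto
    have Pf: "\<Phi> (s a) (s b) f \<in> Hom D (r (s a)) (r (s b))" using hom[of "s a" "s b" f] s a b f by simp
    have ff: "\<Psi> (s a) (s b) (\<Phi> (s a) (s b) f) = f" using \<Psi>\<Phi>[of "s a" "s b" f] s a b f by simp
    note H = s[OF a] s[OF b] t'[OF a] t'[OF b] idh[OF a] idh[OF b] cat_idl[OF D Pf] cat_idr[OF D Pf] Pf ff
    show "Cmp C (i b) f = Cmp C (amap (G \<bullet> E s) f) (i a)"
      unfolding am[OF f] i_def
      using F.cmp[of "s a" "s b" "t' b" "\<Phi> (s a) (s b) f" "Idn D (r (s b))"]
       F.cmp[of "s a" "t' a" "t' b" "Idn D (r (s a))" "\<Phi> (s a) (s b) f"] H by simp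
    show "Cmp C (j b) (amap (G \<bullet> E s) f) = Cmp C f (j a)"
      unfolding am[OF f] j_def
      using F.cmp[of "t' a" "t' b" "s b" "\<Phi> (s a) (s b) f" "Idn D (r (s b))"]
       F.cmp[of "t' a" "s a" "s b" "Idn D (r (s a))" "\<Phi> (s a) (s b) f"] H by simp
  qed
  have "vertical_iso B C p id_func (G \<bullet> E s) i"
    unfolding vertical_iso_def nat_iso_def
  proof (intro conjI ballI vi)
    show "nat_trans C C id_func (G \<bullet> E s) i"
      using i nat(1) by (intro nat_transI is_functor_id C GE) (auto simp: id_func_def o)
    fix c assume c: "c \<in> Obj C"
    show "is_iso C (i c)" unfolding is_iso_def inverse_arrows_def
      using i[OF c] j[OF c] ij[OF c] ji[OF c] by (intro exI[of _ "j c"]) (auto simp: Hom_Arr)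
  qed
  thus "\<exists>\<alpha>. vertical_iso B C p id_func (G \<bullet> E s) \<alpha>" by blast
  have "vertical_iso B C p (G \<bullet> E s) id_func j"
    unfolding vertical_iso_def nat_iso_def
  proof (intro conjI ballI)
    show "nat_trans C C (G \<bullet> E s) id_func j"
      using j nat(2) by (intro nat_transI is_functor_id C GE) (auto simp: id_func_def o)
    fix c assume c: "c \<in> Obj C"
    show "is_iso C (j c)" unfolding is_iso_def inverse_arrows_def
      using i[OF c] j[OF c] ij[OF c] ji[OF c] by (intro exI[of _ "i c"]) (auto simp: Hom_Arr)
    show "amap p (j c) = Idn B (omap p c)"
      using vj[OF c] q_obj[of "t' c"] q_obj[of "s c"] t'[OF c] s[OF c] by simp
  qed
  thus "\<exists>\<alpha>. vertical_iso B C p (G \<bullet> E s) id_func \<alpha>" by blast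
qed

lemma E_fibration_equivalence:
  assumes fib: "fibration C B p" and s: "\<And>c. c \<in> Obj C \<Longrightarrow> s c \<in> K \<and> l (s c) = c"
  shows "fibration_equivalence B C p D q (E s)"
proof -
  interpret F: fibred_correspondence D C K r l \<Psi> B q p by (rule flip_fibred)
  obtain t where t: "\<And>d. d \<in> Obj D \<Longrightarrow> t d \<in> K \<and> r (t d) = d" using r_ex by metis
  have PP: "F.\<Psi> k k' f = \<Phi> k k' f" if "k \<in> K" "k' \<in> K" "f \<in> Hom C (l k) (l k')" for k k' f
    using F.\<Psi>\<Phi>[OF that(1,2) hom[OF that]] \<Psi>\<Phi>[OF that] by simp
  obtain \<beta> where \<beta>: "vertical_iso B D q (correspondence.E r F.\<Psi> s \<bullet> F.E t) id_func \<beta>"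
    using F.round_trip(2)[OF t s] by blast
  have EE: "omap (correspondence.E r F.\<Psi> s) c = omap (E s) c" for c
    using E_def correspondence.E_def[OF F.flip] by simp
  have EA: "amap (correspondence.E r F.\<Psi> s) f = amap (E s) f" if "f \<in> Arr C" for f
    unfolding correspondence.E_def[OF F.flip] E_def
    using that s cat_obj[OF C, of f "src f" "tgt f"] PP[of "s (src f)" "s (tgt f)" f]
    by (auto simp: Hom_Arr)
  have "vertical_iso B D q (E s \<bullet> F.E t) id_func \<beta>"
  proof -
    have "amap (F.E t) f \<in> Arr C" if "f \<in> Arr D" for f
      using func_hom[OF F.E_functor[OF t], of f "src f" "tgt f"] that by (auto simp: Hom_Arr)
    hence "amap (correspondence.E r F.\<Psi> s \<bullet> F.E t) f = amap (E s \<bullet> F.E t) f" if "f \<in> Arr D" for f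
      using EA that by (simp add: comp_func_def)
    moreover have "omap (correspondence.E r F.\<Psi> s \<bullet> F.E t) = omap (E s \<bullet> F.E t)"
      using EE by (simp add: comp_func_def)
    moreover have "is_functor D D (E s \<bullet> F.E t)"
      by (rule is_functor_comp[OF F.E_functor[OF t] E_functor[OF s]])
    ultimately show ?thesis using \<beta>
      unfolding vertical_iso_def nat_iso_def nat_trans_def by simp
  qed
  thus ?thesis
    unfolding fibration_equivalence_def
    using fib fibration_image[OF fib] E_fibred[OF s] F.E_fibred[OF t] round_trip(1)[OF s t] by blast
qed

end

lemma universal_arrow_transport:
  assumes c1: "correspondence C D K l r \<Phi>" and c2: "correspondence C' D' K' l' r' \<Phi>'"
    and U: "is_functor C' C U"
    and j: "\<And>k. k \<in> K' \<Longrightarrow> j k \<in> K \<and> l (j k) = omap U (l' k) \<and> r (j k) = omap V (r' k)"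
    and ja: "\<And>k k' f. k \<in> K' \<Longrightarrow> k' \<in> K' \<Longrightarrow> f \<in> Hom C' (l' k) (l' k') \<Longrightarrow>
       amap V (\<Phi>' k k' f) = \<Phi> (j k) (j k') (amap U f)"
    and k: "k \<in> K" "k' \<in> K'"
    and univ: "universal_arrow C C' U (l k) (l' k') e"
  shows "universal_arrow D D' V (r k) (r' k') (\<Phi> k (j k') e)"
proof -
  interpret X: correspondence C D K l r \<Phi> by (rule c1)
  interpret Y: correspondence C' D' K' l' r' \<Phi>' by (rule c2)
  note jk = j[OF k(2)]
  have e: "e \<in> Hom C (l k) (l (j k'))" using univ jk by (simp add: universal_arrow_def)
  have "\<exists>!h. h \<in> Hom D' (r' k') b' \<and> Cmp D (amap V h) (\<Phi> k (j k') e) = g"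
    if b': "b' \<in> Obj D'" and g: "g \<in> Hom D (r k) (omap V b')" for b' g
  proof -
    obtain k2 where k2: "k2 \<in> K'" "r' k2 = b'" using Y.r_ex[OF b'] by blast
    note jk2 = j[OF k2(1)]
    have g': "g \<in> Hom D (r k) (r (j k2))" using g jk2 k2 by simp
    obtain g0 where g0: "g0 \<in> Hom C (l k) (l (j k2))" "\<Phi> k (j k2) g0 = g"
      using X.preimage[OF k(1) _ g'] jk2 by blast
    hence "\<exists>!h. h \<in> Hom C' (l' k') (l' k2) \<and> Cmp C (amap U h) e = g0"
      using univ Y.l_obj[OF k2(1)] jk2 unfolding universal_arrow_def by simp
    moreover have *: "Cmp D (amap V (\<Phi>' k' k2 h)) (\<Phi> k (j k') e) = \<Phi> k (j k2) (Cmp C (amap U h) e)"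
      if "h \<in> Hom C' (l' k') (l' k2)" for h
      using ja[OF k(2) k2(1) that] X.cmp[OF k(1) _ _ e, of "j k2" "amap U h"] jk jk2
        func_hom[OF U that] by simp
    ultimately obtain h where h: "h \<in> Hom C' (l' k') (l' k2)" "Cmp C (amap U h) e = g0"
      and un: "\<And>h'. h' \<in> Hom C' (l' k') (l' k2) \<Longrightarrow> Cmp C (amap U h') e = g0 \<Longrightarrow> h' = h" by blast
    show ?thesis unfolding k2(2)[symmetric]
    proof (rule ex1I[of _ "\<Phi>' k' k2 h"])
      show "\<Phi>' k' k2 h \<in> Hom D' (r' k') (r' k2) \<and> Cmp D (amap V (\<Phi>' k' k2 h)) (\<Phi> k (j k') e) = g"
        using Y.hom[OF k(2) k2(1) h(1)] *[OF h(1)] h(2) g0 by simp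
      fix h' assume h': "h' \<in> Hom D' (r' k') (r' k2) \<and> Cmp D (amap V h') (\<Phi> k (j k') e) = g"
      then obtain h0 where h0: "h0 \<in> Hom C' (l' k') (l' k2)" "\<Phi>' k' k2 h0 = h'"
        using Y.preimage[OF k(2) k2(1)] by blast
      have "Cmp C (amap U h0) e \<in> Hom C (l k) (l (j k2))"
        using cat_cmp[OF X.C e, of "amap U h0"] func_hom[OF U h0(1)] jk jk2 by simp
      hence "Cmp C (amap U h0) e = g0"
        using X.inject[OF k(1), of "j k2" _ g0] jk2 g0 *[OF h0(1)] h0 h' by simp
      thus "h' = \<Phi>' k' k2 h" using un[OF h0(1)] h0 by simp
    qed
  qed
  thus ?thesis
    unfolding universal_arrow_def using X.hom[OF k(1) _ e] jk Y.r_obj[OF k(2)] by simp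
qed

section \<open>Small sets\<close>

locale universe =
  fixes ty :: "'v itself"
  assumes uncountable: "natLeq <o |UNIV :: 'v set|"
    and regular: "regularCard |UNIV :: 'v set|"
begin

lemma infinite_UNIV: "infinite (UNIV :: 'v set)"
proof -
  have "natLeq \<le>o |UNIV :: 'v set|" using uncountable by (rule ordLess_imp_ordLeq)
  thus ?thesis using infinite_iff_natLeq_ordLeq by blast
qed

lemma less_image: "|A| <o |UNIV :: 'v set| \<Longrightarrow> |f ` A| <o |UNIV :: 'v set|"
  using card_of_image ordLeq_ordLess_trans by blast

lemma less_subset: "|B| <o |UNIV :: 'v set| \<Longrightarrow> A \<subseteq> B \<Longrightarrow> |A| <o |UNIV :: 'v set|"
  using card_of_mono1 ordLeq_ordLess_trans by blast

lemma less_UN: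
  "|I| <o |UNIV :: 'v set| \<Longrightarrow> (\<And>i. i \<in> I \<Longrightarrow> |A i| <o |UNIV :: 'v set| ) \<Longrightarrow>
    |\<Union>i\<in>I. A i| <o |UNIV :: 'v set|"
  by (rule stable_UNION[OF regularCard_stable[OF card_of_Card_order _ regular]])
    (simp_all add: Field_card_of infinite_UNIV)

lemma less_nat: "|UNIV :: nat set| <o |UNIV :: 'v set|"
  using card_of_nat uncountable ordIso_ordLess_trans by blast

lemma less_countable: "countable A \<Longrightarrow> |A| <o |UNIV :: 'v set|"
proof -
  assume "countable A"
  then obtain f :: "_ \<Rightarrow> nat" where "inj_on f A" unfolding countable_def by blast
  hence "|A| \<le>o |UNIV :: nat set|" using card_of_ordLeq by blast
  thus ?thesis using less_nat ordLeq_ordLess_trans by blast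
qed

lemma less_finite: "finite A \<Longrightarrow> |A| <o |UNIV :: 'v set|"
  by (intro less_countable countable_finite)

lemma less_Times:
  assumes "|A| <o |UNIV :: 'v set|" "|B| <o |UNIV :: 'v set|"
  shows "|A \<times> B| <o |UNIV :: 'v set|"
proof -
  have "A \<times> B = (\<Union>a\<in>A. Pair a ` B)" by auto
  thus ?thesis using less_UN[OF assms(1) less_image[OF assms(2)], of Pair] by simp
qed

lemma less_lists:
  assumes A: "|A| <o |UNIV :: 'v set|"
  shows "|lists A| <o |UNIV :: 'v set|"
proof -
  have "|{xs \<in> lists A. length xs = n}| <o |UNIV :: 'v set|" for n
  proof (induction n)
    case 0
    have "{xs \<in> lists A. length xs = 0} = {[]}" by auto
    thus ?case using less_finite[of "{[]}"] by simp
  next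
    case (Suc n)
    have "{xs \<in> lists A. length xs = Suc n} \<subseteq> (\<lambda>(x, xs). x # xs) ` (A \<times> {xs \<in> lists A. length xs = n})"
      by (force simp: length_Suc_conv)
    thus ?case using less_subset[OF less_image[OF less_Times[OF A Suc], of "\<lambda>(x, xs). x # xs"]] by simp
  qed
  moreover have "lists A = (\<Union>n\<in>UNIV. {xs \<in> lists A. length xs = n})" by auto
  ultimately show ?thesis using less_UN[OF less_nat, of "\<lambda>n. {xs \<in> lists A. length xs = n}"] by simp
qed

lemma less_encode:
  "|A| <o |UNIV :: 'v set| \<Longrightarrow> \<exists>f :: _ \<Rightarrow> 'v. inj_on f A"
  using card_of_ordLeq[of A "UNIV :: 'v set"] ordLess_imp_ordLeq by blast

lemma inj_vpair: "inj (vpair :: 'v \<times> 'v \<Rightarrow> 'v)"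
proof -
  have "|(UNIV :: 'v set) \<times> (UNIV :: 'v set)| \<le>o |UNIV :: 'v set|"
    by (rule ordIso_imp_ordLeq[OF card_of_Times_same_infinite[OF infinite_UNIV]])
  then obtain f :: "'v \<times> 'v \<Rightarrow> 'v" where "inj_on f (UNIV \<times> UNIV)"
    unfolding card_of_ordLeq[symmetric] by blast
  hence "inj f" by simp
  thus ?thesis unfolding vpair_def by (rule someI[where P = inj])
qed

lemma vpair_simps [simp]:
  "vfst (vpair (a :: 'v, b)) = a" "vsnd (vpair (a, b)) = b"
  "vpair (a, b) = vpair (c, d) \<longleftrightarrow> a = c \<and> b = d"
  using inj_vpair by (auto simp: vfst_def vsnd_def inv_f_f dest: injD)

definition vnat :: "nat \<Rightarrow> 'v" where "vnat = (SOME f. inj f)"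

lemma vnat_inj [simp]: "vnat m = vnat n \<longleftrightarrow> m = n"
proof -
  have "\<exists>f :: nat \<Rightarrow> 'v. inj f" using infinite_UNIV infinite_countable_subset by blast
  hence "inj vnat" unfolding vnat_def by (rule someI_ex)
  thus ?thesis by (auto dest: injD)
qed

primrec vlist :: "'v list \<Rightarrow> 'v" where
  "vlist [] = vnat 0"
| "vlist (x # xs) = vpair (x, vlist xs)"

lemma vlist_inj: "length xs = length ys \<Longrightarrow> vlist xs = vlist ys \<Longrightarrow> xs = ys"
  by (induction xs ys rule: list_induct2) auto

end

section \<open>Slices of the category of small sets\<close>

lemma Sets_Hom: "f \<in> Hom Sets X Y \<longleftrightarrow> small X \<and> small Y \<and> src f = X \<and> tgt f = Y \<and> dat f \<in> X \<rightarrow>\<^sub>E Y"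
  unfolding Hom_def Sets_def by (cases f) auto

lemma is_category_Sets: "is_category Sets"
  unfolding is_category_def
proof (intro conjI ballI impI)
  fix f assume "f \<in> Arr (Sets :: ('v set, 'v \<Rightarrow> 'v) category)"
  thus "Cmp Sets f (Idn Sets (src f)) = f" "Cmp Sets (Idn Sets (tgt f)) f = f"
    by (auto simp: Sets_def compose_def PiE_iff extensional_def fun_eq_iff) (metis+)?
next
  fix f g h :: "'v fn" assume "f \<in> Arr Sets" "g \<in> Arr Sets" "h \<in> Arr Sets" "tgt f = src g" "tgt g = src h"
  thus "Cmp Sets h (Cmp Sets g f) = Cmp Sets (Cmp Sets h g) f"
    by (auto simp: Sets_def compose_def PiE_iff extensional_def fun_eq_iff)
next
  fix f g :: "'v fn" assume "f \<in> Arr Sets" "g \<in> Arr Sets" "tgt f = src g"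
  thus "Cmp Sets g f \<in> Hom Sets (src f) (tgt g)"
    unfolding Hom_def by (auto simp: Sets_def compose_def PiE_iff)
qed (auto simp: Sets_def Hom_def)

lemma Hom_slice_iff: "h \<in> Hom (slice C c) x y \<longleftrightarrow> x \<in> Arr C \<and> tgt x = c \<and> y \<in> Arr C \<and> tgt y = c \<and>
    dat h \<in> Hom C (src x) (src y) \<and> Cmp C y (dat h) = x \<and> src h = x \<and> tgt h = y"
  unfolding Hom_def slice_def by (cases h) auto

lemma is_category_slice:
  assumes C: "is_category C"
  shows "is_category (slice C c)"
proof -
  have obj: "x \<in> Hom C (src x) c" if "x \<in> Arr C" "tgt x = c" for x using that by (simp add: Hom_Arr)
  have id: "Idn (slice C c) x \<in> Hom (slice C c) x x" if "x \<in> Obj (slice C c)" for x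
  proof -
    have x: "x \<in> Arr C" "tgt x = c" using that by (auto simp: slice_def)
    thus ?thesis using cat_idn[OF C, of "src x"] cat_obj[OF C obj, of x] cat_idr[OF C obj, of x]
      unfolding Hom_slice_iff by (simp add: slice_def)
  qed
  have cmp: "Cmp (slice C c) g f \<in> Hom (slice C c) x z"
    if f: "f \<in> Hom (slice C c) x y" and g: "g \<in> Hom (slice C c) y z" for f g x y z
    using f g cat_cmp[OF C, of "dat f" _ _ "dat g"] cat_assoc[OF C, of "dat f" _ _ "dat g" _ z c] obj[of z]
    by (auto simp: Hom_slice_iff) (auto simp: slice_def)
  show ?thesis
    unfolding is_category_def
  proof (intro conjI ballI impI)
    fix f assume "f \<in> Arr (slice C c)"
    thus "src f \<in> Obj (slice C c)" "tgt f \<in> Obj (slice C c)" by (auto simp: slice_def)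
  next
    fix f g assume "f \<in> Arr (slice C c)" "g \<in> Arr (slice C c)" "tgt f = src g"
    thus "Cmp (slice C c) g f \<in> Hom (slice C c) (src f) (tgt g)"
      by (intro cmp) (auto simp: Hom_Arr)
  next
    fix f assume "f \<in> Arr (slice C c)"
    thus "Cmp (slice C c) f (Idn (slice C c) (src f)) = f" "Cmp (slice C c) (Idn (slice C c) (tgt f)) f = f"
      by (auto simp: slice_def cat_idr[OF C] cat_idl[OF C])
  next
    fix f g h assume "f \<in> Arr (slice C c)" "g \<in> Arr (slice C c)" "h \<in> Arr (slice C c)"
      "tgt f = src g" "tgt g = src h"
    thus "Cmp (slice C c) h (Cmp (slice C c) g f) = Cmp (slice C c) (Cmp (slice C c) h g) f"
      by (auto simp: slice_def cat_assoc[OF C])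
  qed (use id in auto)
qed

lemmas is_category_Slice = is_category_slice[OF is_category_Sets]

lemma Slice_Obj: "x \<in> Obj (Slice Q) \<longleftrightarrow> tgt x = Q \<and> small (src x) \<and> small Q \<and> dat x \<in> src x \<rightarrow>\<^sub>E Q"
  unfolding slice_def by (cases x) (auto simp: Sets_def)

definition sarr :: "'v fn \<Rightarrow> ('v \<Rightarrow> 'v) \<Rightarrow> 'v fn \<Rightarrow> ('v fn, 'v fn) arrow" where
  "sarr x f y = Arrow x (Arrow (src x) (restrict f (src x)) (src y)) y"

definition over :: "'v fn \<Rightarrow> ('v \<Rightarrow> 'v) \<Rightarrow> 'v fn \<Rightarrow> bool" where
  "over x f y \<longleftrightarrow> (\<forall>e \<in> src x. f e \<in> src y \<and> dat y (f e) = dat x e)"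

lemma sarr_simps [simp]:
  "src (sarr x f y) = x" "tgt (sarr x f y) = y" "e \<in> src x \<Longrightarrow> elt_map (sarr x f y) e = f e"
  by (auto simp: sarr_def)

lemma sarr_cong: "(\<And>e. e \<in> src x \<Longrightarrow> f e = g e) \<Longrightarrow> sarr x f y = sarr x g y"
  by (auto simp: sarr_def intro!: restrict_ext)

lemma Slice_Hom: "h \<in> Hom (Slice Q) x y \<longleftrightarrow>
   x \<in> Obj (Slice Q) \<and> y \<in> Obj (Slice Q) \<and> h = sarr x (elt_map h) y \<and> over x (elt_map h) y"
proof
  assume h: "h \<in> Hom (Slice Q) x y"
  obtain k where k: "h = Arrow x k y" using h by (cases h) (auto simp: Hom_slice_iff)
  have *: "x \<in> Arr Sets" "tgt x = Q" "y \<in> Arr Sets" "tgt y = Q" "k \<in> Hom Sets (src x) (src y)"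
     "Cmp Sets y k = x" using h k by (auto simp: Hom_slice_iff)
  have "k = Arrow (src x) (restrict (dat k) (src x)) (src y)"
    using *(5) by (cases k) (auto simp: Sets_Hom)
  moreover have "dat x = compose (src x) (dat y) (dat k)"
    using *(5) arg_cong[OF *(6), of dat] by (simp add: Sets_def Hom_Arr)
  ultimately show "x \<in> Obj (Slice Q) \<and> y \<in> Obj (Slice Q) \<and> h = sarr x (elt_map h) y \<and> over x (elt_map h) y"
    using * k by (auto simp: slice_def sarr_def over_def Sets_Hom compose_def)
next
  assume *: "x \<in> Obj (Slice Q) \<and> y \<in> Obj (Slice Q) \<and> h = sarr x (elt_map h) y \<and> over x (elt_map h) y"
  then obtain f where f: "h = sarr x f y" by blast
  hence o: "over x f y" using * by (auto simp: over_def)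
  have "x \<in> Obj (Slice Q)" "y \<in> Obj (Slice Q)" using * by auto
  moreover have "dat x = compose (src x) (dat y) (restrict f (src x))"
    using o \<open>x \<in> Obj _\<close> by (auto simp: over_def compose_def Slice_Obj fun_eq_iff PiE_iff extensional_def)
  moreover have "restrict f (src x) \<in> src x \<rightarrow>\<^sub>E src y" using o by (auto simp: over_def)
  moreover have "Cmp Sets y (Arrow (src x) (restrict f (src x)) (src y)) =
      Arrow (src x) (compose (src x) (dat y) (restrict f (src x))) (tgt y)"
    by (simp add: Sets_def)
  moreover have "Arrow (src x) (restrict f (src x)) (src y) \<in> Hom Sets (src x) (src y)"
    using o \<open>x \<in> Obj _\<close> \<open>y \<in> Obj _\<close> by (auto simp: Sets_Hom over_def Slice_Obj)
  ultimately show "h \<in> Hom (Slice Q) x y" unfolding f Hom_slice_iff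
    by (cases x) (auto simp: sarr_def slice_def)
qed

lemma sarr_Hom: "x \<in> Obj (Slice Q) \<Longrightarrow> y \<in> Obj (Slice Q) \<Longrightarrow> over x f y \<Longrightarrow> sarr x f y \<in> Hom (Slice Q) x y"
proof -
  assume *: "x \<in> Obj (Slice Q)" "y \<in> Obj (Slice Q)" "over x f y"
  have "sarr x (elt_map (sarr x f y)) y = sarr x f y" by (rule sarr_cong) simp
  moreover have "over x (elt_map (sarr x f y)) y" using *(3) by (simp add: over_def)
  ultimately show ?thesis using * by (auto simp: Slice_Hom)
qed

lemma Slice_elt: "h \<in> Hom (Slice Q) x y \<Longrightarrow> e \<in> src x \<Longrightarrow> elt_map h e \<in> src y \<and> dat y (elt_map h e) = dat x e"
  by (auto simp: Slice_Hom over_def)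

lemma Slice_ext:
  "h \<in> Hom (Slice Q) x y \<Longrightarrow> h' \<in> Hom (Slice Q) x y \<Longrightarrow> (\<And>e. e \<in> src x \<Longrightarrow> elt_map h e = elt_map h' e) \<Longrightarrow> h = h'"
  using sarr_cong[of x "elt_map h" "elt_map h'" y] unfolding Slice_Hom by simp

lemma Slice_dat_src: "h \<in> Hom (Slice Q) x y \<Longrightarrow> src (dat h) = src x"
  unfolding Slice_Hom by (metis arrow.sel(1) arrow.sel(2) sarr_def)

lemma Slice_Cmp [simp]:
  assumes f: "f \<in> Hom (Slice Q) x y" and e: "e \<in> src x"
  shows "elt_map (Cmp (Slice P) g f) e = elt_map g (elt_map f e)"
  using Slice_dat_src[OF f] e by (auto simp: slice_def Sets_def compose_def)

lemma Slice_Idn [simp]: "e \<in> src x \<Longrightarrow> elt_map (Idn (Slice Q) x) e = e"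
  by (auto simp: slice_def Sets_def)

lemma Slice_inv:
  assumes f: "f \<in> Hom (Slice Q) x y" and b: "bij_betw (elt_map f) (src x) (src y)"
  shows "inv_arrow (Slice Q) f \<in> Hom (Slice Q) y x"
    and "e \<in> src x \<Longrightarrow> elt_map (inv_arrow (Slice Q) f) (elt_map f e) = e"
proof -
  define g where "g = inv_into (src x) (elt_map f)"
  have st: "src f = x" "tgt f = y" using f by (auto simp: Hom_Arr)
  have xy: "x \<in> Obj (Slice Q)" "y \<in> Obj (Slice Q)" using f by (auto simp: Slice_Hom)
  have g: "e \<in> src x \<Longrightarrow> g (elt_map f e) = e" for e using b by (simp add: g_def bij_betw_inv_into_left)
  have g2: "e \<in> src y \<Longrightarrow> g e \<in> src x \<and> elt_map f (g e) = e" for e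
    using b by (metis bij_betw_imp_surj_on bij_betw_inv_into_right g_def inv_into_into)
  have o: "over y g x" unfolding over_def
  proof
    fix e assume e: "e \<in> src y"
    show "g e \<in> src x \<and> dat x (g e) = dat y e" using g2[OF e] Slice_elt[OF f, of "g e"] by simp
  qed
  note gh = sarr_Hom[OF xy(2,1) o]
  note C = is_category_Slice[of Q]
  have inv: "inverse_arrows (Slice Q) f (sarr y g x)"
    unfolding inverse_arrows_def st
  proof (intro conjI gh)
    show "Cmp (Slice Q) (sarr y g x) f = Idn (Slice Q) x"
      using g Slice_elt[OF f]
      by (intro Slice_ext[OF cat_cmp[OF C f gh] cat_idn[OF C xy(1)]]) (simp add: Slice_Cmp[OF f])
    show "Cmp (Slice Q) f (sarr y g x) = Idn (Slice Q) y"
      using g2 by (intro Slice_ext[OF cat_cmp[OF C gh f] cat_idn[OF C xy(2)]]) (simp add: Slice_Cmp[OF gh])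
  qed (use f in \<open>simp add: Hom_Arr\<close>)
  have "inv_arrow (Slice Q) f = sarr y g x"
    unfolding inv_arrow_def
  proof (rule the_equality)
    show "inverse_arrows (Slice Q) f (sarr y g x)" by (rule inv)
    fix k assume k: "inverse_arrows (Slice Q) f k"
    hence kh: "k \<in> Hom (Slice Q) y x" by (simp add: inverse_arrows_def st)
    show "k = sarr y g x"
    proof (rule Slice_ext[OF kh gh])
      fix e assume e: "e \<in> src y"
      have "elt_map (Cmp (Slice Q) k f) (g e) = elt_map (Idn (Slice Q) x) (g e)"
        using k by (simp add: inverse_arrows_def st)
      thus "elt_map k e = elt_map (sarr y g x) e"
        using g2[OF e] e by (simp add: Slice_Cmp[OF f])
    qed
  qed
  thus "inv_arrow (Slice Q) f \<in> Hom (Slice Q) y x"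
    "e \<in> src x \<Longrightarrow> elt_map (inv_arrow (Slice Q) f) (elt_map f e) = e"
    using gh g Slice_elt[OF f] by auto
qed

context universe
begin

definition pt :: "'v set \<Rightarrow> 'v \<Rightarrow> 'v fn" where
  "pt Q c = Arrow {vnat 0} (\<lambda>_ \<in> {vnat 0}. c) Q"

lemma pt_Obj: "small Q \<Longrightarrow> c \<in> Q \<Longrightarrow> pt Q c \<in> Obj (Slice Q)"
  by (auto simp: pt_def Slice_Obj small_def less_finite)

lemma weak_pullback_Slice:
  fixes p q f g :: "('v fn, 'v fn) arrow"
  assumes p: "p \<in> Hom (Slice Q) w x" and q: "q \<in> Hom (Slice Q) w y"
    and f: "f \<in> Hom (Slice Q) x z" and g: "g \<in> Hom (Slice Q) y z"
    and comm: "Cmp (Slice Q) f p = Cmp (Slice Q) g q"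
  shows "weak_pullback (Slice Q) p q f g \<longleftrightarrow>
    (\<forall>a \<in> src x. \<forall>b \<in> src y. elt_map f a = elt_map g b \<longrightarrow>
      (\<exists>e \<in> src w. elt_map p e = a \<and> elt_map q e = b))" (is "_ \<longleftrightarrow> ?R")
proof -
  have st: "src p = w" "tgt p = x" "src q = w" "tgt q = y" "src f = x" "tgt f = z" "src g = y" "tgt g = z"
    using p q f g by (auto simp: Hom_Arr)
  note C = is_category_Slice[of Q]
  have O: "w \<in> Obj (Slice Q)" "x \<in> Obj (Slice Q)" "y \<in> Obj (Slice Q)" using p f g by (auto simp: Slice_Hom)
  show ?thesis
  proof
    assume wp: "weak_pullback (Slice Q) p q f g"
    show ?R
    proof (intro ballI impI)
      fix a b assume a: "a \<in> src x" and b: "b \<in> src y" and ab: "elt_map f a = elt_map g b"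
      have dd: "dat x a = dat y b" using Slice_elt[OF f a] Slice_elt[OF g b] ab by simp
      let ?t = "pt Q (dat x a)"
      have t: "?t \<in> Obj (Slice Q)" using O(2) a by (intro pt_Obj) (auto simp: Slice_Obj)
      have ha: "sarr ?t (\<lambda>_. a) x \<in> Hom (Slice Q) ?t x"
        using a by (intro sarr_Hom[OF t O(2)]) (auto simp: over_def pt_def)
      have hb: "sarr ?t (\<lambda>_. b) y \<in> Hom (Slice Q) ?t y"
        using b dd by (intro sarr_Hom[OF t O(3)]) (auto simp: over_def pt_def)
      have "Cmp (Slice Q) f (sarr ?t (\<lambda>_. a) x) = Cmp (Slice Q) g (sarr ?t (\<lambda>_. b) y)"
        by (rule Slice_ext[OF cat_cmp[OF C ha f] cat_cmp[OF C hb g]])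
          (simp add: ab Slice_Cmp[OF ha] Slice_Cmp[OF hb])
      then obtain h where h: "h \<in> Hom (Slice Q) ?t w"
        "Cmp (Slice Q) p h = sarr ?t (\<lambda>_. a) x" "Cmp (Slice Q) q h = sarr ?t (\<lambda>_. b) y"
        using wp t ha hb unfolding weak_pullback_def st by blast
      have v: "vnat 0 \<in> src ?t" by (simp add: pt_def)
      show "\<exists>e\<in>src w. elt_map p e = a \<and> elt_map q e = b"
        using Slice_elt[OF h(1) v] Slice_Cmp[OF h(1) v, of Q p] Slice_Cmp[OF h(1) v, of Q q] h(2,3) v
        by (intro bexI[of _ "elt_map h (vnat 0)"]) auto
    qed
  next
    assume R: ?R
    show "weak_pullback (Slice Q) p q f g"
      unfolding weak_pullback_def st
    proof (intro conjI p q f g comm ballI impI)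
      fix t a b assume a: "a \<in> Hom (Slice Q) t x" and b: "b \<in> Hom (Slice Q) t y"
        and ab: "Cmp (Slice Q) f a = Cmp (Slice Q) g b"
      have "\<exists>d\<in>src w. elt_map p d = elt_map a e \<and> elt_map q d = elt_map b e" if e: "e \<in> src t" for e
        using R Slice_elt[OF a e] Slice_elt[OF b e] Slice_Cmp[OF a e, of Q f] Slice_Cmp[OF b e, of Q g] ab
        by metis
      then obtain d where d: "\<And>e. e \<in> src t \<Longrightarrow> d e \<in> src w \<and> elt_map p (d e) = elt_map a e \<and> elt_map q (d e) = elt_map b e"
        by metis
      have t: "t \<in> Obj (Slice Q)" using a by (simp add: Slice_Hom)
      have o: "over t d w" unfolding over_def
      proof
        fix e assume e: "e \<in> src t"
        show "d e \<in> src w \<and> dat w (d e) = dat t e"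
          using d[OF e] Slice_elt[OF p, of "d e"] Slice_elt[OF a e] by simp
      qed
      note dh = sarr_Hom[OF t O(1) o]
      show "\<exists>h\<in>Hom (Slice Q) t w. Cmp (Slice Q) p h = a \<and> Cmp (Slice Q) q h = b"
      proof (intro bexI[OF _ dh] conjI)
        show "Cmp (Slice Q) p (sarr t d w) = a"
          by (rule Slice_ext[OF cat_cmp[OF C dh p] a]) (simp add: Slice_Cmp[OF dh] d)
        show "Cmp (Slice Q) q (sarr t d w) = b"
          by (rule Slice_ext[OF cat_cmp[OF C dh q] b]) (simp add: Slice_Cmp[OF dh] d)
      qed
    qed
  qed
qed

lemma pb_obj_simps:
  fixes u x :: "'v fn"
  shows "src (pb_obj u x) = {vpair (a, e) | a e. a \<in> src u \<and> e \<in> src x \<and> dat u a = dat x e}"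
    and "tgt (pb_obj u x) = src u"
    and "z \<in> src (pb_obj u x) \<Longrightarrow> dat (pb_obj u x) z = vfst z"
  by (auto simp: pb_obj_def Let_def)

lemma pb_mem [simp]:
  "vpair (a, e) \<in> src (pb_obj u x) \<longleftrightarrow> a \<in> src u \<and> e \<in> src x \<and> dat u a = dat x e"
  for u x :: "'v fn"
  by (auto simp: pb_obj_simps)

lemma pb_dat [simp]:
  "a \<in> src u \<Longrightarrow> e \<in> src x \<Longrightarrow> dat u a = dat x e \<Longrightarrow> dat (pb_obj u x) (vpair (a, e)) = a"
  for u x :: "'v fn"
  using pb_obj_simps(3)[of "vpair (a, e)" u x] by simp

lemma pb_memE:
  assumes "z \<in> src (pb_obj u x)"
  obtains a e where "z = vpair (a :: 'v, e)" "a \<in> src u" "e \<in> src x" "dat u a = dat x e"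
    "dat (pb_obj u x) z = a"
  using assms pb_obj_simps(3)[OF assms] by (auto simp: pb_obj_simps)

lemma pb_obj_Obj:
  fixes u x :: "'v fn"
  assumes u: "u \<in> Hom Sets Q R" and x: "x \<in> Obj (Slice R)"
  shows "pb_obj u x \<in> Obj (Slice Q)"
proof -
  have "src (pb_obj u x) \<subseteq> vpair ` (Q \<times> src x)" using u by (auto simp: pb_obj_simps Sets_Hom)
  moreover have "|vpair ` (Q \<times> src x)| <o |UNIV :: 'v set|"
    using u x by (intro less_image less_Times) (auto simp: Sets_Hom Slice_Obj small_def)
  ultimately have "small (src (pb_obj u x))" unfolding small_def using less_subset by blast
  thus ?thesis using u x
    by (auto simp: Slice_Obj Sets_Hom pb_obj_simps(2)) (auto simp: pb_obj_def Let_def)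
qed

lemma amap_pb: "amap (pb u) h = sarr (pb_obj u (src h)) (\<lambda>z. vpair (vfst z, elt_map h (vsnd z))) (pb_obj u (tgt h))"
  by (simp add: pb_def sarr_def)

lemma omap_pb [simp]: "omap (pb u) = pb_obj u"
  by (simp add: pb_def)

lemma pb_hom:
  fixes u :: "'v fn"
  assumes u: "u \<in> Hom Sets Q R" and h: "h \<in> Hom (Slice R) x y"
  shows "amap (pb u) h \<in> Hom (Slice Q) (pb_obj u x) (pb_obj u y)"
proof -
  have xy: "x \<in> Obj (Slice R)" "y \<in> Obj (Slice R)" using h by (auto simp: Slice_Hom)
  have "over (pb_obj u x) (\<lambda>z. vpair (vfst z, elt_map h (vsnd z))) (pb_obj u y)"
    unfolding over_def using Slice_elt[OF h] by (auto elim!: pb_memE)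
  thus ?thesis using h sarr_Hom[OF pb_obj_Obj[OF u xy(1)] pb_obj_Obj[OF u xy(2)]]
    by (auto simp: amap_pb Hom_Arr)
qed

lemma pb_elt [simp]: "h \<in> Hom (Slice R) x y \<Longrightarrow> z \<in> src (pb_obj u x) \<Longrightarrow>
    elt_map (amap (pb u) h) z = vpair (vfst z, elt_map h (vsnd z))"
  by (auto simp: amap_pb Hom_Arr)

lemma is_functor_pb:
  fixes u :: "'v fn"
  assumes u: "u \<in> Hom Sets Q R"
  shows "is_functor (Slice R) (Slice Q) (pb u)"
proof (rule is_functorI[OF is_category_Slice is_category_Slice])
  note CQ = is_category_Slice[of Q] and CR = is_category_Slice[of R]
  fix a assume a: "a \<in> Obj (Slice R)"
  show "omap (pb u) a \<in> Obj (Slice Q)" using pb_obj_Obj[OF u a] by simp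
  show "amap (pb u) (Idn (Slice R) a) = Idn (Slice Q) (omap (pb u) a)"
    using pb_hom[OF u cat_idn[OF CR a]] cat_idn[OF CQ pb_obj_Obj[OF u a]] cat_idn[OF CR a]
    by (intro Slice_ext[of _ Q "pb_obj u a" "pb_obj u a"]) (auto elim!: pb_memE)
next
  note CQ = is_category_Slice[of Q] and CR = is_category_Slice[of R]
  fix f a b assume f: "f \<in> Hom (Slice R) a b"
  show "amap (pb u) f \<in> Hom (Slice Q) (omap (pb u) a) (omap (pb u) b)" using pb_hom[OF u f] by simp
  fix g c assume g: "g \<in> Hom (Slice R) b c"
  show "amap (pb u) (Cmp (Slice R) g f) = Cmp (Slice Q) (amap (pb u) g) (amap (pb u) f)"
  proof (rule Slice_ext[OF pb_hom[OF u cat_cmp[OF CR f g]] cat_cmp[OF CQ pb_hom[OF u f] pb_hom[OF u g]]])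
    fix e assume e: "e \<in> src (pb_obj u a)"
    show "elt_map (amap (pb u) (Cmp (Slice R) g f)) e = elt_map (Cmp (Slice Q) (amap (pb u) g) (amap (pb u) f)) e"
      using e Slice_elt[OF pb_hom[OF u f] e] Slice_Cmp[OF pb_hom[OF u f] e] cat_cmp[OF CR f g] f g
      by (auto simp: Slice_Cmp[OF f] elim!: pb_memE)
  qed
qed

lemma pb_id_Hom:
  fixes x :: "'v fn"
  assumes x: "x \<in> Obj (Slice Q)"
  shows "pb_id Q x \<in> Hom (Slice Q) (pb_obj (Idn Sets Q) x) x"
    and "bij_betw (elt_map (pb_id Q x)) (src (pb_obj (Idn Sets Q) x)) (src x)"
    and "z \<in> src (pb_obj (Idn Sets Q) x) \<Longrightarrow> elt_map (pb_id Q x) z = vsnd z"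
proof -
  have "small Q" using x by (simp add: Slice_Obj)
  hence Q: "Q \<in> Obj Sets" by (simp add: Sets_def)
  have P: "pb_id Q x = sarr (pb_obj (Idn Sets Q) x) vsnd x"
    by (simp add: pb_id_def sarr_def Let_def)
  have id: "src (Idn Sets Q) = Q" "a \<in> Q \<Longrightarrow> dat (Idn Sets Q) a = a" for a :: 'v by (auto simp: Sets_def)
  have dQ: "e \<in> src x \<Longrightarrow> dat x e \<in> Q" for e using x by (auto simp: Slice_Obj)
  have "over (pb_obj (Idn Sets Q) x) vsnd x" by (auto simp: over_def id elim!: pb_memE)
  thus "pb_id Q x \<in> Hom (Slice Q) (pb_obj (Idn Sets Q) x) x"
    unfolding P by (rule sarr_Hom[OF pb_obj_Obj[OF cat_idn[OF is_category_Sets Q] x] x])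
  show e: "elt_map (pb_id Q x) z = vsnd z" if "z \<in> src (pb_obj (Idn Sets Q) x)" for z using that by (simp add: P)
  show "bij_betw (elt_map (pb_id Q x)) (src (pb_obj (Idn Sets Q) x)) (src x)"
    by (rule bij_betw_byWitness[where f' = "\<lambda>a. vpair (dat x a, a)"])
      (auto simp: e id dQ elim!: pb_memE)
qed

lemma pb_cmp_Hom:
  fixes x u v :: "'v fn"
  assumes u: "u \<in> Hom Sets Q R" and v: "v \<in> Hom Sets R S" and x: "x \<in> Obj (Slice S)"
  shows "pb_cmp v u x \<in> Hom (Slice Q) (pb_obj (Cmp Sets v u) x) (pb_obj u (pb_obj v x))"
    and "bij_betw (elt_map (pb_cmp v u x)) (src (pb_obj (Cmp Sets v u) x)) (src (pb_obj u (pb_obj v x)))"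
    and "z \<in> src (pb_obj (Cmp Sets v u) x) \<Longrightarrow>
       elt_map (pb_cmp v u x) z = vpair (vfst z, vpair (dat u (vfst z), vsnd z))"
proof -
  let ?c = "\<lambda>z. vpair (vfst z, vpair (dat u (vfst z), vsnd z))"
  have P: "pb_cmp v u x = sarr (pb_obj (Cmp Sets v u) x) ?c (pb_obj u (pb_obj v x))"
    by (simp add: pb_cmp_def sarr_def Let_def)
  have id: "src (Cmp Sets v u) = Q" "a \<in> Q \<Longrightarrow> dat (Cmp Sets v u) a = dat v (dat u a)" for a
    using u by (auto simp: Sets_def Hom_def compose_def)
  have uQ: "a \<in> Q \<Longrightarrow> dat u a \<in> R" "src u = Q" "src v = R" for a using u v by (auto simp: Sets_Hom)
  have "over (pb_obj (Cmp Sets v u) x) ?c (pb_obj u (pb_obj v x))"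
    by (auto simp: over_def id uQ elim!: pb_memE)
  thus "pb_cmp v u x \<in> Hom (Slice Q) (pb_obj (Cmp Sets v u) x) (pb_obj u (pb_obj v x))"
    unfolding P
    by (rule sarr_Hom[OF pb_obj_Obj[OF cat_cmp[OF is_category_Sets u v] x] pb_obj_Obj[OF u pb_obj_Obj[OF v x]]])
  show e: "elt_map (pb_cmp v u x) z = ?c z" if "z \<in> src (pb_obj (Cmp Sets v u) x)" for z using that by (simp add: P)
  show "bij_betw (elt_map (pb_cmp v u x)) (src (pb_obj (Cmp Sets v u) x)) (src (pb_obj u (pb_obj v x)))"
    by (rule bij_betw_byWitness[where f' = "\<lambda>a. vpair (vfst a, vsnd (vsnd a))"])
      (auto simp: e id uQ elim!: pb_memE)
qed

end

section \<open>Positions in lists\<close>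

lemma arg_map: "i \<in> {1..length xs} \<Longrightarrow> arg (map f xs) i = f (arg xs i)"
  by (auto simp: arg_def intro!: nth_map)

lemma list_arg_ext:
  assumes "length xs = length ys" and "\<And>i. i \<in> {1..length xs} \<Longrightarrow> arg xs i = arg ys i"
  shows "xs = ys"
proof (rule nth_equalityI[OF assms(1)])
  fix i assume "i < length xs"
  thus "xs ! i = ys ! i" using assms(2)[of "Suc i"] by (simp add: arg_def)
qed

lemma set_arg: "set xs = arg xs ` {1..length xs}"
proof -
  have "set xs = (\<lambda>i. xs ! i) ` {..<length xs}" by (auto simp: set_conv_nth)
  also have "{..<length xs} = (\<lambda>i. i - 1) ` {1..length xs}"
  proof
    show "{..<length xs} \<subseteq> (\<lambda>i. i - 1) ` {1..length xs}"
    proof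
      fix i assume "i \<in> {..<length xs}"
      thus "i \<in> (\<lambda>i. i - 1) ` {1..length xs}" by (intro image_eqI[of _ _ "Suc i"]) auto
    qed
  qed auto
  finally show ?thesis by (simp add: image_image arg_def)
qed

lemma arg_in_set: "i \<in> {1..length xs} \<Longrightarrow> arg xs i \<in> set xs"
  by (auto simp: set_arg)

lemma distinct_arg: "distinct xs \<Longrightarrow> i \<in> {1..length xs} \<Longrightarrow> j \<in> {1..length xs} \<Longrightarrow> arg xs i = arg xs j \<longleftrightarrow> i = j"
  by (auto simp: arg_def nth_eq_iff_index_eq)

lemma arg_upt: "i \<in> {1..n} \<Longrightarrow> arg (map f [1..<Suc n]) i = f i"
  by (auto simp: arg_def simp del: upt_Suc)

lemmas arg_upt_simps = arg_upt arg_upt[unfolded One_nat_def]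

lemma length_permute_args [simp]: "length (permute_args xs \<sigma>) = length xs"
  by (simp add: permute_args_def del: upt_Suc)

lemma arg_permute_args: "i \<in> {1..length xs} \<Longrightarrow> arg (permute_args xs \<sigma>) i = arg xs (\<sigma> i)"
  unfolding permute_args_def by (rule arg_upt)

lemma permute_args_id [simp]: "permute_args xs id = xs"
  by (rule list_arg_ext) (auto simp: arg_permute_args)

lemma permute_args_comp:
  assumes "\<tau> permutes {1..length xs}"
  shows "permute_args (permute_args xs \<sigma>) \<tau> = permute_args xs (\<sigma> \<circ> \<tau>)"
  by (rule list_arg_ext) (use permutes_in_image[OF assms] in \<open>auto simp: arg_permute_args\<close>)

lemma map_permute_args:
  assumes "\<sigma> permutes {1..length xs}"
  shows "map f (permute_args xs \<sigma>) = permute_args (map f xs) \<sigma>"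
  by (rule list_arg_ext) (use permutes_in_image[OF assms] in \<open>auto simp: arg_permute_args arg_map\<close>)

lemma set_permute_args:
  assumes "\<sigma> permutes {1..length xs}"
  shows "set (permute_args xs \<sigma>) = set xs"
proof -
  have "set (permute_args xs \<sigma>) = arg xs ` (\<sigma> ` {1..length xs})"
    unfolding set_arg image_image by (simp add: arg_permute_args)
  thus ?thesis using permutes_image[OF assms] by (simp add: set_arg[of xs])
qed

lemma distinct_permute_args:
  assumes "\<sigma> permutes {1..length xs}" "distinct xs"
  shows "distinct (permute_args xs \<sigma>)"
  using assms set_permute_args[OF assms(1)]
  by (metis card_distinct distinct_card length_permute_args)

lemma permute_args_inject:
  assumes "\<sigma> permutes {1..length xs}" "\<tau> permutes {1..length xs}" "distinct xs"
    "permute_args xs \<sigma> = permute_args xs \<tau>"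
  shows "\<sigma> = \<tau>"
proof
  fix i show "\<sigma> i = \<tau> i"
  proof (cases "i \<in> {1..length xs}")
    case True
    thus ?thesis using assms(4) distinct_arg[OF assms(3)] permutes_in_image[OF assms(1)]
      permutes_in_image[OF assms(2)] arg_permute_args[OF True, of \<sigma>] arg_permute_args[OF True, of \<tau>] by metis
  next
    case False
    thus ?thesis using assms(1,2) by (simp add: permutes_not_in)
  qed
qed

lemma permute_args_inv:
  assumes "\<sigma> permutes {1..length xs}"
  shows "permute_args (permute_args xs \<sigma>) (inv \<sigma>) = xs" "permute_args (permute_args xs (inv \<sigma>)) \<sigma> = xs"
  using assms by (simp_all add: permute_args_comp permutes_inv permutes_inv_o)

lemma permute_args_exists:
  assumes "distinct xs" "set ys = set xs" "length ys = length xs"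
  shows "\<exists>\<sigma>. \<sigma> permutes {1..length xs} \<and> ys = permute_args xs \<sigma>"
proof -
  let ?N = "{1..length xs}"
  have dy: "distinct ys" using assms by (metis card_distinct distinct_card)
  have bx: "bij_betw (arg xs) ?N (set xs)"
    unfolding bij_betw_def inj_on_def using distinct_arg[OF assms(1)] by (simp add: set_arg)
  have "bij_betw (arg ys) {1..length ys} (set ys)"
    unfolding bij_betw_def inj_on_def using distinct_arg[OF dy] by (simp add: set_arg[of ys])
  hence b: "bij_betw (arg ys) ?N (set xs)" unfolding assms(2,3) .
  define g where "g = inv_into ?N (arg xs) \<circ> arg ys"
  have g: "bij_betw g ?N ?N" unfolding g_def
    by (rule bij_betw_trans[OF b bij_betw_inv_into[OF bx]])
  define \<sigma> where "\<sigma> i = (if i \<in> ?N then g i else i)" for i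
  have "\<sigma> permutes ?N"
  proof (rule bij_imp_permutes)
    show "bij_betw \<sigma> ?N ?N" using g by (rule bij_betw_cong[THEN iffD1, rotated]) (simp add: \<sigma>_def)
  qed (simp only: \<sigma>_def if_False)
  moreover have "ys = permute_args xs \<sigma>"
  proof (rule list_arg_ext)
    fix i assume "i \<in> {1..length ys}"
    hence i: "i \<in> ?N" using assms(3) by simp
    have "arg ys i \<in> set xs" using b i bij_betwE by blast
    thus "arg ys i = arg (permute_args xs \<sigma>) i"
      using i bx arg_permute_args[OF i] by (simp add: \<sigma>_def g_def bij_betw_inv_into_right)
  qed (simp add: assms(3))
  ultimately show ?thesis by blast
qed

lemma arity_sum_simps [simp]:
  "arity_sum [] = 0" "arity_sum (b # bs) = fst b + arity_sum bs"
  by (simp_all add: arity_sum_def)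

lemma length_concat_blocks: "map length yss = map fst bs \<Longrightarrow> length (concat yss) = arity_sum bs"
  by (simp add: length_concat arity_sum_def)

lemma arg_concat_pos:
  assumes "map length yss = map fst bs" "i \<in> {1..length bs}" "j \<in> {1..fst (arg bs i)}"
  shows "arg (concat yss) (pos bs i j) = arg (arg yss i) j"
  using assms
proof (induction bs arbitrary: yss i)
  case Nil
  thus ?case by simp
next
  case (Cons b bs)
  then obtain ys zss where y: "yss = ys # zss" and l: "length ys = fst b" "map length zss = map fst bs"
    by (cases yss) auto
  show ?case
  proof (cases "i = 1")
    case True
    thus ?thesis using Cons.prems l by (auto simp: y arg_def pos_def nth_append)
  next
    case False
    then obtain i' where i': "i = Suc i'" "i' \<in> {1..length bs}" using Cons.prems(2)
      by (cases i) auto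
    then obtain k where k: "i' = Suc k" by (cases i') auto
    have "arg (b # bs) i = arg bs i'" "arg yss i = arg zss i'"
      using i' k by (auto simp: y arg_def)
    moreover have "pos (b # bs) i j = fst b + pos bs i' j" by (simp add: pos_def i' k)
    moreover have "pos bs i' j \<ge> 1" using Cons.prems(3) by (simp add: pos_def)
    moreover have "arg (concat yss) (fst b + p) = arg (concat zss) p" if "p \<ge> 1" for p
      using that l by (cases p) (auto simp: y arg_def nth_append)
    ultimately show ?thesis using Cons.IH[OF l(2) i'(2)] Cons.prems(3) by simp
  qed
qed

definition inputs :: "(nat \<times> 'v) list \<Rightarrow> (nat \<times> nat) set" where
  "inputs bs = (SIGMA i:{1..length bs}. {1..fst (arg bs i)})"

lemma pos_bij: "bij_betw (\<lambda>(i, j). pos bs i j) (inputs bs) {1..arity_sum bs}"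
proof -
  define yss where "yss = map (\<lambda>i. map (Pair i) [1..<Suc (fst (arg bs i))]) [1..<Suc (length bs)]"
  have fit: "map length yss = map fst bs"
    by (rule list_arg_ext) (auto simp: yss_def arg_map[of _ bs fst] comp_def arg_upt_simps simp del: upt_Suc)
  have A: "arg (concat yss) (pos bs i j) = (i, j)" if "(i, j) \<in> inputs bs" for i j
    using that arg_concat_pos[OF fit, of i j] by (auto simp: inputs_def yss_def arg_upt_simps simp del: upt_Suc)
  have R: "pos bs i j \<in> {1..arity_sum bs}" if "(i, j) \<in> inputs bs" for i j
  proof -
    have i: "i - 1 < length bs" and j: "1 \<le> j" "j \<le> fst (bs ! (i - 1))"
      using that by (auto simp: inputs_def arg_def)
    have "arity_sum bs = arity_sum (take (i - 1) bs) + arity_sum (drop (i - 1) bs)"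
      unfolding arity_sum_def by (metis append_take_drop_id map_append sum_list_append)
    also have "drop (i - 1) bs = bs ! (i - 1) # drop i bs"
      using Cons_nth_drop_Suc[OF i] that by (auto simp: inputs_def)
    finally show ?thesis using j by (auto simp: pos_def)
  qed
  have dist: "distinct (concat yss)"
  proof -
    have *: "distinct (concat (map (\<lambda>i. map (Pair i) (f i)) is))"
      if "distinct is" "\<And>i. distinct (f i)" for f :: "nat \<Rightarrow> nat list" and "is" :: "nat list"
      using that by (induction "is") (auto simp: distinct_map inj_on_def)
    show ?thesis unfolding yss_def by (rule *) (rule distinct_upt)+
  qed
  have "inj_on (\<lambda>(i, j). pos bs i j) (inputs bs)"
  proof (rule inj_onI, clarify)
    fix i j i' j' assume 1: "(i, j) \<in> inputs bs" "(i', j') \<in> inputs bs" and 2: "pos bs i j = pos bs i' j'"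
    have "(i, j) = arg (concat yss) (pos bs i j)" by (rule A[OF 1(1), symmetric])
    also have "\<dots> = (i', j')" unfolding 2 by (rule A[OF 1(2)])
    finally show "i = i' \<and> j = j'" unfolding prod.inject .
  qed
  moreover have "{1..arity_sum bs} \<subseteq> (\<lambda>(i, j). pos bs i j) ` inputs bs"
  proof
    fix p assume p: "p \<in> {1..arity_sum bs}"
    hence p': "p \<in> {1..length (concat yss)}" using length_concat_blocks[OF fit] by simp
    obtain i j where ij: "arg (concat yss) p = (i, j)" by fastforce
    hence "(i, j) \<in> set (concat yss)" using arg_in_set[OF p'] by simp
    hence I: "(i, j) \<in> inputs bs" by (auto simp: yss_def inputs_def simp del: upt_Suc)
    hence "pos bs i j \<in> {1..length (concat yss)}" using R length_concat_blocks[OF fit] by simp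
    hence "p = pos bs i j" using distinct_arg[OF dist p'] A[OF I] ij by metis
    thus "p \<in> (\<lambda>(i, j). pos bs i j) ` inputs bs" using I by force
  qed
  ultimately show ?thesis unfolding bij_betw_def using R by auto
qed

lemma pos_range: "i \<in> {1..length bs} \<Longrightarrow> j \<in> {1..fst (arg bs i)} \<Longrightarrow> pos bs i j \<in> {1..arity_sum bs}"
  using bij_betwE[OF pos_bij[of bs]] by (auto simp: inputs_def)

lemma pos_surj:
  assumes "p \<in> {1..arity_sum bs}"
  obtains i j where "i \<in> {1..length bs}" "j \<in> {1..fst (arg bs i)}" "p = pos bs i j"
proof -
  have "p \<in> (\<lambda>(i, j). pos bs i j) ` inputs bs" using pos_bij[of bs] assms by (simp add: bij_betw_def)
  thus ?thesis using that by (auto simp: inputs_def)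
qed

lemma list_pos_ext:
  assumes "length xs = arity_sum bs" "length ys = arity_sum bs"
    and "\<And>i j. i \<in> {1..length bs} \<Longrightarrow> j \<in> {1..fst (arg bs i)} \<Longrightarrow> arg xs (pos bs i j) = arg ys (pos bs i j)"
  shows "xs = ys"
proof (rule list_arg_ext)
  fix p assume "p \<in> {1..length xs}"
  then obtain i j where "i \<in> {1..length bs}" "j \<in> {1..fst (arg bs i)}" "p = pos bs i j"
    using pos_surj assms(1) by metis
  thus "arg xs p = arg ys p" using assms(3) by blast
qed (simp add: assms)

lemma reindex_permutation:
  assumes g: "bij_betw g (inputs bs') (inputs bs)"
  shows "\<exists>\<rho>. \<rho> permutes {1..arity_sum bs} \<and> arity_sum bs' = arity_sum bs \<and>
    (\<forall>(i, j) \<in> inputs bs'. \<rho> (pos bs' i j) = (case g (i, j) of (i', j') \<Rightarrow> pos bs i' j'))"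
proof -
  let ?p = "\<lambda>bs (i, j). pos bs i j"
  have S: "arity_sum bs' = arity_sum bs"
    using bij_betw_same_card[OF pos_bij[of bs]] bij_betw_same_card[OF pos_bij[of bs']]
      bij_betw_same_card[OF g] by simp
  define h where "h = ?p bs \<circ> g \<circ> inv_into (inputs bs') (?p bs')"
  have h: "bij_betw h {1..arity_sum bs} {1..arity_sum bs}" unfolding h_def
    using bij_betw_trans[OF bij_betw_inv_into[OF pos_bij[of bs']] bij_betw_trans[OF g pos_bij[of bs]]] S
    by (simp add: comp_assoc)
  define \<rho> where "\<rho> i = (if i \<in> {1..arity_sum bs} then h i else i)" for i
  have "\<rho> permutes {1..arity_sum bs}"
  proof (rule bij_imp_permutes)
    show "bij_betw \<rho> {1..arity_sum bs} {1..arity_sum bs}"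
      using h by (rule bij_betw_cong[THEN iffD1, rotated]) (simp add: \<rho>_def)
  qed (simp only: \<rho>_def if_False)
  moreover have "\<rho> (pos bs' i j) = ?p bs (g (i, j))" if "(i, j) \<in> inputs bs'" for i j
  proof -
    have "pos bs' i j \<in> {1..arity_sum bs}" using that pos_range[of i bs' j] S by (auto simp: inputs_def)
    moreover have "inv_into (inputs bs') (?p bs') (pos bs' i j) = (i, j)"
      using bij_betw_inv_into_left[OF pos_bij[of bs'] that] by simp
    ultimately show ?thesis by (simp add: \<rho>_def h_def)
  qed
  ultimately show ?thesis using S by auto
qed

lemma block_permutation:
  assumes s: "\<sigma> permutes {1..length bs}"
  obtains \<rho> where "\<rho> permutes {1..arity_sum bs}" "arity_sum (permute_args bs \<sigma>) = arity_sum bs"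
    "\<And>i j. i \<in> {1..length bs} \<Longrightarrow> j \<in> {1..fst (arg bs (\<sigma> i))} \<Longrightarrow>
       \<rho> (pos (permute_args bs \<sigma>) i j) = pos bs (\<sigma> i) j"
proof -
  have "bij_betw (\<lambda>(i, j). (\<sigma> i, j)) (inputs (permute_args bs \<sigma>)) (inputs bs)"
    by (rule bij_betw_byWitness[where f' = "\<lambda>(i, j). (inv \<sigma> i, j)"])
      (use permutes_in_image[OF s] permutes_in_image[OF permutes_inv[OF s]] permutes_inverses[OF s]
        in \<open>auto simp: inputs_def arg_permute_args\<close>)
  from reindex_permutation[OF this] obtain \<rho> where r: "\<rho> permutes {1..arity_sum bs}"
    "arity_sum (permute_args bs \<sigma>) = arity_sum bs"
    "\<forall>(i, j)\<in>inputs (permute_args bs \<sigma>). \<rho> (pos (permute_args bs \<sigma>) i j) = pos bs (\<sigma> i) j"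
    by auto
  show ?thesis
  proof (rule that[OF r(1,2)])
    fix i j assume "i \<in> {1..length bs}" "j \<in> {1..fst (arg bs (\<sigma> i))}"
    hence "(i, j) \<in> inputs (permute_args bs \<sigma>)" by (auto simp: inputs_def arg_permute_args)
    thus "\<rho> (pos (permute_args bs \<sigma>) i j) = pos bs (\<sigma> i) j" using r(3) by auto
  qed
qed

lemma juxtaposed_permutation:
  assumes t: "\<And>i. i \<in> {1..length bs} \<Longrightarrow> \<tau> i permutes {1..fst (arg bs i)}"
  obtains \<rho> where "\<rho> permutes {1..arity_sum bs}"
    "\<And>i j. i \<in> {1..length bs} \<Longrightarrow> j \<in> {1..fst (arg bs i)} \<Longrightarrow> \<rho> (pos bs i j) = pos bs i (\<tau> i j)"
proof -
  have P: "\<tau> i j \<in> {1..fst (arg bs i)} \<longleftrightarrow> j \<in> {1..fst (arg bs i)}"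
    "inv (\<tau> i) j \<in> {1..fst (arg bs i)} \<longleftrightarrow> j \<in> {1..fst (arg bs i)}"
    "\<tau> i (inv (\<tau> i) j) = j" "inv (\<tau> i) (\<tau> i j) = j" if "i \<in> {1..length bs}" for i j
    using permutes_in_image[OF t[OF that]] permutes_in_image[OF permutes_inv[OF t[OF that]]]
      permutes_inverses[OF t[OF that]] by blast+
  have "bij_betw (\<lambda>(i, j). (i, \<tau> i j)) (inputs bs) (inputs bs)"
    by (rule bij_betw_byWitness[where f' = "\<lambda>(i, j). (i, inv (\<tau> i) j)"])
      (use P in \<open>auto simp: inputs_def simp del: atLeastAtMost_iff\<close>)
  from reindex_permutation[OF this] obtain \<rho> where r: "\<rho> permutes {1..arity_sum bs}"
    "\<forall>(i, j)\<in>inputs bs. \<rho> (pos bs i j) = pos bs i (\<tau> i j)"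
    by auto
  show ?thesis
    by (rule that[OF r(1)]) (use r(2) in \<open>auto simp: inputs_def\<close>)
qed

lemma concat_permute_args:
  assumes fit: "map length yss = map fst bs" and s: "\<sigma> permutes {1..length bs}"
    and rs: "\<And>i j. i \<in> {1..length bs} \<Longrightarrow> j \<in> {1..fst (arg bs (\<sigma> i))} \<Longrightarrow>
       \<rho> (pos (permute_args bs \<sigma>) i j) = pos bs (\<sigma> i) j"
  shows "concat (permute_args yss \<sigma>) = permute_args (concat yss) \<rho>"
proof -
  have len: "length yss = length bs" using map_eq_imp_length_eq[OF fit] .
  have fit': "map length (permute_args yss \<sigma>) = map fst (permute_args bs \<sigma>)"
    using map_permute_args[of \<sigma> yss length] map_permute_args[of \<sigma> bs fst] s fit len by simp
  obtain \<rho>' where S: "arity_sum (permute_args bs \<sigma>) = arity_sum bs" using block_permutation[OF s] by metis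
  show ?thesis
  proof (rule list_pos_ext[of _ "permute_args bs \<sigma>"])
    show "length (concat (permute_args yss \<sigma>)) = arity_sum (permute_args bs \<sigma>)"
      by (rule length_concat_blocks[OF fit'])
    show "length (permute_args (concat yss) \<rho>) = arity_sum (permute_args bs \<sigma>)"
      using length_concat_blocks[OF fit] S by simp
  next
    fix i j assume "i \<in> {1..length (permute_args bs \<sigma>)}" and j: "j \<in> {1..fst (arg (permute_args bs \<sigma>) i)}"
    hence i: "i \<in> {1..length bs}" by simp
    have j': "j \<in> {1..fst (arg bs (\<sigma> i))}" using j i by (simp add: arg_permute_args)
    have si: "\<sigma> i \<in> {1..length bs}" using permutes_in_image[OF s] i by simp
    have "pos (permute_args bs \<sigma>) i j \<in> {1..arity_sum bs}"
      using pos_range[of i "permute_args bs \<sigma>" j] i j S by simp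
    hence "arg (permute_args (concat yss) \<rho>) (pos (permute_args bs \<sigma>) i j) = arg (arg yss (\<sigma> i)) j"
      using arg_concat_pos[OF fit si j'] rs[OF i j'] arg_permute_args[of "pos (permute_args bs \<sigma>) i j" "concat yss" \<rho>]
        length_concat_blocks[OF fit] by simp
    moreover have "arg (concat (permute_args yss \<sigma>)) (pos (permute_args bs \<sigma>) i j) = arg (arg yss (\<sigma> i)) j"
      using arg_concat_pos[OF fit', of i j] i j len by (simp add: arg_permute_args)
    ultimately show "arg (concat (permute_args yss \<sigma>)) (pos (permute_args bs \<sigma>) i j) =
       arg (permute_args (concat yss) \<rho>) (pos (permute_args bs \<sigma>) i j)" by simp
  qed
qed

lemma concat_map_permute_args:
  assumes fit: "map length yss = map fst bs"
    and t: "\<And>i. i \<in> {1..length bs} \<Longrightarrow> \<tau> i permutes {1..fst (arg bs i)}"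
    and rs: "\<And>i j. i \<in> {1..length bs} \<Longrightarrow> j \<in> {1..fst (arg bs i)} \<Longrightarrow> \<rho> (pos bs i j) = pos bs i (\<tau> i j)"
  shows "concat (map (\<lambda>i. permute_args (arg yss i) (\<tau> i)) [1..<Suc (length bs)]) = permute_args (concat yss) \<rho>"
proof -
  let ?y = "map (\<lambda>i. permute_args (arg yss i) (\<tau> i)) [1..<Suc (length bs)]"
  have len: "length yss = length bs" using map_eq_imp_length_eq[OF fit] .
  have li: "length (arg yss i) = fst (arg bs i)" if "i \<in> {1..length bs}" for i
    using arg_cong[OF fit, of "\<lambda>xs. arg xs i"] that len by (simp add: arg_map)
  have fit': "map length ?y = map fst bs"
    by (rule list_arg_ext) (auto simp: arg_map[of _ bs fst] arg_upt_simps li comp_def simp del: upt_Suc)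
  show ?thesis
  proof (rule list_pos_ext[of _ bs])
    show "length (concat ?y) = arity_sum bs" by (rule length_concat_blocks[OF fit'])
    show "length (permute_args (concat yss) \<rho>) = arity_sum bs" using length_concat_blocks[OF fit] by simp
  next
    fix i j assume i: "i \<in> {1..length bs}" and j: "j \<in> {1..fst (arg bs i)}"
    have tj: "\<tau> i j \<in> {1..fst (arg bs i)}" using permutes_in_image[OF t[OF i]] j by simp
    show "arg (concat ?y) (pos bs i j) = arg (permute_args (concat yss) \<rho>) (pos bs i j)"
      using arg_concat_pos[OF fit' i j] arg_concat_pos[OF fit i tj] rs[OF i j] pos_range[OF i j]
        arg_permute_args[of "pos bs i j" "concat yss" \<rho>] length_concat_blocks[OF fit] i j li[OF i]
      by (simp add: arg_upt_simps arg_permute_args del: upt_Suc)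
  qed
qed

lemma blocks_exist:
  assumes "length xs = arity_sum bs"
  obtains yss where "xs = concat yss" "map length yss = map fst bs"
  using assms
proof (induction bs arbitrary: xs thesis)
  case Nil
  thus ?case by (auto intro: Nil(1)[of "[]"])
next
  case (Cons b bs)
  have "length (drop (fst b) xs) = arity_sum bs" using Cons.prems(2) by simp
  then obtain zss where "drop (fst b) xs = concat zss" "map length zss = map fst bs" using Cons.IH by blast
  thus ?case using Cons.prems(2) append_take_drop_id[of "fst b" xs]
    by (intro Cons.prems(1)[of "take (fst b) xs # zss"]) auto
qed

lemma concat_eq_blocks:
  assumes "map length yss = map length zss" "concat yss = concat zss"
  shows "yss = zss"
proof -
  have "length yss = length zss" using map_eq_imp_length_eq[OF assms(1)] .
  moreover have "\<forall>(y, z) \<in> set (zip yss zss). length y = length z"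
    using assms(1) by (auto simp: set_zip list_eq_iff_nth_eq)
  ultimately show ?thesis using concat_injective assms(2) by blast
qed

section \<open>Presentations of analytic functors\<close>

definition pre :: "('v, 'z) sig_scheme \<Rightarrow> 'v fn \<Rightarrow> nat \<times> 'v \<Rightarrow> 'v list \<Rightarrow> bool" where
  "pre A x a xs \<longleftrightarrow> snd a \<in> ops A (fst a) \<and> length xs = fst a \<and>
     (\<forall>i \<in> {1..fst a}. arg xs i \<in> src x \<and> dat x (arg xs i) = bnd A a i)"

definition actp :: "('v, 'z) sig_scheme \<Rightarrow> nat \<times> 'v \<Rightarrow> (nat \<Rightarrow> nat) \<Rightarrow> nat \<times> 'v" where
  "actp A a \<sigma> = (fst a, act A a \<sigma>)"

lemma fst_actp [simp]: "fst (actp A a \<sigma>) = fst a" by (simp add: actp_def)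

lemma sig_act:
  assumes "is_sig A" "snd a \<in> ops A (fst a)"
  shows "actp A a id = a"
    and "\<sigma> permutes {1..fst a} \<Longrightarrow> snd (actp A a \<sigma>) \<in> ops A (fst a)"
    and "\<sigma> permutes {1..fst a} \<Longrightarrow> i \<in> {0..fst a} \<Longrightarrow> bnd A (actp A a \<sigma>) i = bnd A a (\<sigma> i)"
    and "\<sigma> permutes {1..fst a} \<Longrightarrow> \<tau> permutes {1..fst a} \<Longrightarrow>
      actp A (actp A a \<sigma>) \<tau> = actp A a (\<sigma> \<circ> \<tau>)"
    and "i \<in> {0..fst a} \<Longrightarrow> bnd A a i \<in> colours A"
  using assms by (cases a; auto simp: is_sig_def actp_def)+

lemma sig_act_0: "is_sig A \<Longrightarrow> snd a \<in> ops A (fst a) \<Longrightarrow> \<sigma> permutes {1..fst a} \<Longrightarrow> bnd A (actp A a \<sigma>) 0 = bnd A a 0"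
  using sig_act(3)[of A a \<sigma> 0] permutes_not_in[of \<sigma> "{1..fst a}" 0] by auto

lemma pre_act:
  assumes "is_sig A" "pre A x a xs" "\<sigma> permutes {1..fst a}"
  shows "pre A x (actp A a \<sigma>) (permute_args xs \<sigma>)"
proof -
  have "\<sigma> i \<in> {1..fst a}" if "i \<in> {1..fst a}" for i using permutes_in_image[OF assms(3)] that by blast
  thus ?thesis using assms sig_act(2,3)[of A a \<sigma>]
    by (auto simp: pre_def arg_permute_args)
qed

lemma pre_map: "pre A x a xs \<Longrightarrow> h \<in> Hom (Slice Q) x y \<Longrightarrow> pre A y a (map (elt_map h) xs)"
  unfolding pre_def using Slice_elt[of h Q x y] by (auto simp: arg_map)

text \<open>
  \<open>ev x a [e\<^sub>1, \<dots>, e\<^sub>n]\<close> is the element of \<open>P x\<close> named by the class of \<open>(a, e)\<close> in \<open>A \<star> x\<close>.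
\<close>

locale presentation = universe ty for ty :: "'v itself" +
  fixes A :: "('v, 'z) sig_scheme" and P :: "('v fn, 'v fn, 'v fn, 'v fn) func"
    and ev :: "'v fn \<Rightarrow> nat \<times> 'v \<Rightarrow> 'v list \<Rightarrow> 'v"
  assumes sig: "is_sig A"
    and P_functor: "is_functor (Slice (colours A)) (Slice (colours A)) P"
    and ev_mem: "\<And>x a xs. x \<in> Obj (Slice (colours A)) \<Longrightarrow> pre A x a xs \<Longrightarrow> ev x a xs \<in> src (omap P x)"
    and ev_ex: "\<And>x e. x \<in> Obj (Slice (colours A)) \<Longrightarrow> e \<in> src (omap P x) \<Longrightarrow>
      \<exists>a xs. pre A x a xs \<and> e = ev x a xs"
    and ev_eq: "\<And>x a xs b ys. x \<in> Obj (Slice (colours A)) \<Longrightarrow> pre A x a xs \<Longrightarrow> pre A x b ys \<Longrightarrow>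
      ev x a xs = ev x b ys \<longleftrightarrow>
      (\<exists>\<sigma>. \<sigma> permutes {1..fst a} \<and> b = actp A a \<sigma> \<and> ys = permute_args xs \<sigma>)"
    and ev_dat: "\<And>x a xs. x \<in> Obj (Slice (colours A)) \<Longrightarrow> pre A x a xs \<Longrightarrow>
      dat (omap P x) (ev x a xs) = bnd A a 0"
    and ev_nat: "\<And>h x y a xs. h \<in> Hom (Slice (colours A)) x y \<Longrightarrow> pre A x a xs \<Longrightarrow>
      elt_map (amap P h) (ev x a xs) = ev y a (map (elt_map h) xs)"
begin

lemma ev_act:
  "x \<in> Obj (Slice (colours A)) \<Longrightarrow> pre A x a xs \<Longrightarrow> \<sigma> permutes {1..fst a} \<Longrightarrow>
    ev x (actp A a \<sigma>) (permute_args xs \<sigma>) = ev x a xs"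
  using ev_eq[of x a xs "actp A a \<sigma>" "permute_args xs \<sigma>"] pre_act[OF sig] by metis

lemma ev_eqE:
  assumes "x \<in> Obj (Slice (colours A))" "pre A x a xs" "pre A x b ys" "ev x a xs = ev x b ys"
  obtains \<sigma> where "\<sigma> permutes {1..fst a}" "b = actp A a \<sigma>" "ys = permute_args xs \<sigma>"
  using ev_eq[OF assms(1-3)] assms(4) by blast

lemma ev_inject_distinct:
  assumes x: "x \<in> Obj (Slice (colours A))" and p: "pre A x a xs" "pre A x b xs" and d: "distinct xs"
    and e: "ev x a xs = ev x b xs"
  shows "a = b"
proof -
  obtain \<sigma> where s: "\<sigma> permutes {1..fst a}" "b = actp A a \<sigma>" "xs = permute_args xs \<sigma>"
    using ev_eqE[OF x p e] .
  have "length xs = fst a" using p by (simp add: pre_def)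
  hence "\<sigma> = id" using permute_args_inject[of \<sigma> xs id] s d by (simp add: permutes_id)
  thus ?thesis using s(2) sig_act(1)[OF sig, of a] p by (simp add: pre_def)
qed

definition rep :: "'v fn \<Rightarrow> 'v \<Rightarrow> (nat \<times> 'v) \<times> 'v list" where
  "rep x e = (SOME p. pre A x (fst p) (snd p) \<and> e = ev x (fst p) (snd p))"

lemma rep_lift:
  assumes x: "x \<in> Obj (Slice (colours A))" and p: "pre A x a xs"
    and inv: "\<And>\<sigma>. \<sigma> permutes {1..fst a} \<Longrightarrow> \<phi> (actp A a \<sigma>) (permute_args xs \<sigma>) = \<phi> a xs"
  shows "\<phi> (fst (rep x (ev x a xs))) (snd (rep x (ev x a xs))) = \<phi> a xs"
proof -
  let ?r = "rep x (ev x a xs)"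
  have "pre A x (fst ?r) (snd ?r) \<and> ev x a xs = ev x (fst ?r) (snd ?r)"
    unfolding rep_def by (rule someI[of _ "(a, xs)"]) (simp add: p)
  then obtain \<sigma> where "\<sigma> permutes {1..fst a}" "fst ?r = actp A a \<sigma>" "snd ?r = permute_args xs \<sigma>"
    using ev_eqE[OF x p] by metis
  thus ?thesis using inv by simp
qed

lemma P_obj: "x \<in> Obj (Slice (colours A)) \<Longrightarrow> omap P x \<in> Obj (Slice (colours A))"
  using func_obj[OF P_functor] .

lemma P_hom: "h \<in> Hom (Slice (colours A)) x y \<Longrightarrow> amap P h \<in> Hom (Slice (colours A)) (omap P x) (omap P y)"
  using func_hom[OF P_functor] .

lemma ev_lift_rep:
  assumes h: "h \<in> Hom (Slice (colours A)) y x" and e: "e \<in> src (omap P y)" and p: "pre A x a xs"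
    and eq: "elt_map (amap P h) e = ev x a xs"
  obtains ys where "pre A y a ys" "e = ev y a ys" "map (elt_map h) ys = xs"
proof -
  have O: "y \<in> Obj (Slice (colours A))" "x \<in> Obj (Slice (colours A))" using h by (auto simp: Slice_Hom)
  obtain b zs where b: "pre A y b zs" "e = ev y b zs" using ev_ex[OF O(1) e] by blast
  have "ev x b (map (elt_map h) zs) = ev x a xs" using ev_nat[OF h b(1)] b(2) eq by simp
  then obtain \<sigma> where s: "\<sigma> permutes {1..fst b}" "a = actp A b \<sigma>" "xs = permute_args (map (elt_map h) zs) \<sigma>"
    using ev_eqE[OF O(2) pre_map[OF b(1) h] p] by blast
  have l: "length zs = fst b" using b(1) by (simp add: pre_def)
  show ?thesis
  proof (rule that[of "permute_args zs \<sigma>"])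
    show "pre A y a (permute_args zs \<sigma>)" using pre_act[OF sig b(1) s(1)] s(2) by simp
    show "e = ev y a (permute_args zs \<sigma>)" using ev_act[OF O(1) b(1) s(1)] b(2) s(2) by simp
    show "map (elt_map h) (permute_args zs \<sigma>) = xs" using map_permute_args[of \<sigma> zs] s l by simp
  qed
qed

end

context universe
begin

text \<open>An object of \<open>n\<close> variables with prescribed colours, whose outgoing maps are lists of elements.\<close>

definition gen :: "nat \<Rightarrow> 'v list" where "gen n = map vnat [1..<Suc n]"

definition gobj :: "'v set \<Rightarrow> nat \<Rightarrow> (nat \<Rightarrow> 'v) \<Rightarrow> 'v fn" where
  "gobj Q n c = Arrow (vnat ` {1..n}) (\<lambda>e \<in> vnat ` {1..n}. c (inv vnat e)) Q"

lemma inv_vnat [simp]: "inv vnat (vnat n) = n"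
  by (rule inv_f_f) (simp add: inj_def)

lemma gen_simps [simp]: "length (gen n) = n" "distinct (gen n)" "set (gen n) = vnat ` {1..n}"
  by (auto simp: gen_def distinct_map inj_on_def simp del: upt_Suc)

lemma arg_gen [simp]: "i \<in> {1..n} \<Longrightarrow> arg (gen n) i = vnat i"
  unfolding gen_def by (rule arg_upt)

lemma gobj_src [simp]: "src (gobj Q n c) = vnat ` {1..n}" by (simp add: gobj_def)

lemma gobj_dat [simp]: "i \<in> {1..n} \<Longrightarrow> dat (gobj Q n c) (vnat i) = c i" by (simp add: gobj_def)

lemma gobj_Obj: "small Q \<Longrightarrow> (\<And>i. i \<in> {1..n} \<Longrightarrow> c i \<in> Q) \<Longrightarrow> gobj Q n c \<in> Obj (Slice Q)"
  by (auto simp: gobj_def Slice_Obj small_def intro!: less_finite)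

definition gmap :: "'v fn \<Rightarrow> 'v list \<Rightarrow> 'v fn \<Rightarrow> ('v fn, 'v fn) arrow" where
  "gmap g xs y = sarr g (\<lambda>e. arg xs (inv vnat e)) y"

lemma gmap_Hom:
  assumes "gobj Q n c \<in> Obj (Slice Q)" "y \<in> Obj (Slice Q)"
    and "\<And>i. i \<in> {1..n} \<Longrightarrow> arg xs i \<in> src y \<and> dat y (arg xs i) = c i"
  shows "gmap (gobj Q n c) xs y \<in> Hom (Slice Q) (gobj Q n c) y"
  unfolding gmap_def by (rule sarr_Hom[OF assms(1,2)]) (use assms(3) in \<open>auto simp: over_def\<close>)

lemma gmap_elt: "i \<in> {1..n} \<Longrightarrow> elt_map (gmap (gobj Q n c) xs y) (vnat i) = arg xs i"
  by (simp add: gmap_def)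

lemma gmap_gen: "length xs = n \<Longrightarrow> map (elt_map (gmap (gobj Q n c) xs y)) (gen n) = xs"
  by (rule list_arg_ext) (auto simp: arg_map gmap_elt)

end

context presentation
begin

text \<open>
  If every preimage of \<open>t \<in> P x\<close> along a map into \<open>x\<close> is itself the image of \<open>t\<close> under a section of that
  map, then \<open>t\<close> is given by an operation applied to the elements of \<open>x\<close>, each occurring exactly once.
\<close>

lemma generic_element:
  assumes x: "x \<in> Obj (Slice (colours A))" and t: "t \<in> src (omap P x)"
    and generic: "\<And>y h e. h \<in> Hom (Slice (colours A)) y x \<Longrightarrow> e \<in> src (omap P y) \<Longrightarrow>
      elt_map (amap P h) e = t \<Longrightarrow>
      \<exists>l \<in> Hom (Slice (colours A)) x y. (\<forall>d \<in> src x. elt_map h (elt_map l d) = d) \<and>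
        elt_map (amap P l) t = e"
    and g: "distinct gs" "set gs = src x"
  shows "\<exists>c. pre A x c gs \<and> t = ev x c gs"
proof -
  let ?S = "Slice (colours A)"
  obtain c xs where c: "pre A x c xs" "t = ev x c xs" using ev_ex[OF x t] by blast
  define n where "n = fst c"
  let ?y = "gobj (colours A) n (bnd A c)"
  have y: "?y \<in> Obj ?S"
    using c(1) sig sig_act(5)[OF sig, of c] by (intro gobj_Obj) (auto simp: pre_def n_def is_sig_def)
  have len: "length xs = n" using c(1) by (simp add: pre_def n_def)
  have h: "gmap ?y xs x \<in> Hom ?S ?y x"
    using c(1) by (intro gmap_Hom[OF y x]) (auto simp: pre_def n_def)
  have pg: "pre A ?y c (gen n)" using c(1) by (auto simp: pre_def n_def)
  have "elt_map (amap P (gmap ?y xs x)) (ev ?y c (gen n)) = t"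
    using ev_nat[OF h pg] gmap_gen[OF len] c(2) by simp
  then obtain l where l: "l \<in> Hom ?S x ?y" "\<And>d. d \<in> src x \<Longrightarrow> elt_map (gmap ?y xs x) (elt_map l d) = d"
    "elt_map (amap P l) t = ev ?y c (gen n)"
    using generic[OF h ev_mem[OF y pg]] by blast
  have "ev ?y c (map (elt_map l) xs) = ev ?y c (gen n)" using l(3) c ev_nat[OF l(1) c(1)] by simp
  then obtain \<sigma> where s: "\<sigma> permutes {1..n}" "gen n = permute_args (map (elt_map l) xs) \<sigma>"
    using ev_eqE[OF y pre_map[OF c(1) l(1)] pg] n_def by metis
  have "distinct (map (elt_map l) xs)"
    using distinct_permute_args[of "inv \<sigma>" "gen n"] permute_args_inv(1)[of \<sigma> "map (elt_map l) xs"] s len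
      gen_simps(2)[of n]
    by (simp add: permutes_inv)
  hence dx: "distinct xs" by (simp add: distinct_map)
  have xs: "set xs = src x"
  proof
    show "set xs \<subseteq> src x" using c(1) len by (auto simp: set_arg pre_def n_def)
    show "src x \<subseteq> set xs"
    proof
      fix d assume d: "d \<in> src x"
      then obtain i where i: "i \<in> {1..n}" "elt_map l d = vnat i" using Slice_elt[OF l(1) d] by auto
      thus "d \<in> set xs" using l(2)[OF d] gmap_elt[OF i(1)] arg_in_set[of i xs] len by metis
    qed
  qed
  have "length gs = length xs" using dx g xs by (metis distinct_card)
  then obtain \<tau> where tau: "\<tau> permutes {1..n}" "gs = permute_args xs \<tau>"
    using permute_args_exists[OF dx, of gs] g xs len by auto
  show ?thesis
    using pre_act[OF sig c(1), of \<tau>] ev_act[OF x c(1), of \<tau>] tau c(2) n_def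
    by (intro exI[of _ "actp A c \<tau>"]) auto
qed

end

subsection \<open>Morphisms\<close>

definition mapp :: "(nat \<Rightarrow> 'v \<Rightarrow> 'v) \<Rightarrow> nat \<times> 'v \<Rightarrow> nat \<times> 'v" where
  "mapp f a = (fst a, f (fst a) (snd a))"

lemma mapp_simps [simp]: "fst (mapp f a) = fst a" "mapp f (n, b) = (n, f n b)" "snd (mapp f a) = f (fst a) (snd a)"
  by (simp_all add: mapp_def)

lemma sig_mor:
  assumes "is_sig_mor A B (u, f)"
  shows "u \<in> Hom Sets (colours A) (colours B)"
    and "snd a \<in> ops A (fst a) \<Longrightarrow> f (fst a) (snd a) \<in> ops B (fst a)"
    and "snd a \<in> ops A (fst a) \<Longrightarrow> \<sigma> permutes {1..fst a} \<Longrightarrow> mapp f (actp A a \<sigma>) = actp B (mapp f a) \<sigma>"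
    and "snd a \<in> ops A (fst a) \<Longrightarrow> i \<in> {0..fst a} \<Longrightarrow> bnd B (mapp f a) i = dat u (bnd A a i)"
  using assms by (cases a; auto simp: is_sig_mor_def mapp_def actp_def)+

locale presentation_pair =
  universe ty + A: presentation ty A P ev + B: presentation ty B R ev'
  for ty :: "'v itself" and A :: "('v, 'z) sig_scheme" and P ev
    and B :: "('v, 'z) sig_scheme" and R ev'
begin

text \<open>The transformation \<open>P u\<^sup>* \<rightarrow> u\<^sup>* R\<close> that replaces \<open>a\<close> by \<open>f a\<close> in the name of an element.\<close>

definition component :: "'v fn \<Rightarrow> (nat \<Rightarrow> 'v \<Rightarrow> 'v) \<Rightarrow> 'v fn \<Rightarrow> ('v fn, 'v fn) arrow" where
  "component u f x = sarr (omap P (pb_obj u x))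
     (\<lambda>t. vpair (bnd A (fst (A.rep (pb_obj u x) t)) 0,
        ev' x (mapp f (fst (A.rep (pb_obj u x) t))) (map vsnd (snd (A.rep (pb_obj u x) t)))))
     (pb_obj u (omap R x))"

lemma pre_image:
  assumes m: "is_sig_mor A B (u, f)" and x: "x \<in> Obj (Slice (colours B))"
    and p: "pre A (pb_obj u x) a zs"
  shows "pre B x (mapp f a) (map vsnd zs)"
proof -
  have "vsnd (arg zs i) \<in> src x \<and> dat x (vsnd (arg zs i)) = dat u (bnd A a i)" if i: "i \<in> {1..fst a}" for i
  proof -
    have "arg zs i \<in> src (pb_obj u x)" "dat (pb_obj u x) (arg zs i) = bnd A a i"
      using p i unfolding pre_def by auto
    thus ?thesis by (auto elim!: pb_memE)
  qed
  thus ?thesis using p sig_mor(2,4)[OF m, of a] by (auto simp: pre_def arg_map)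
qed

context
  fixes u f x
  assumes m: "is_sig_mor A B (u, f)" and x: "x \<in> Obj (Slice (colours B))"
begin

private lemmas u = sig_mor(1)[OF m]
private lemmas ux = pb_obj_Obj[OF u x]

lemma component_value:
  assumes p: "pre A (pb_obj u x) a zs"
  shows "elt_map (component u f x) (ev (pb_obj u x) a zs) =
    vpair (bnd A a 0, ev' x (mapp f a) (map vsnd zs))"
proof -
  have sa: "snd a \<in> ops A (fst a)" and l: "length zs = fst a" using p by (auto simp: pre_def)
  show ?thesis
    unfolding component_def
    using A.rep_lift[OF ux p, of "\<lambda>a zs. vpair (bnd A a 0, ev' x (mapp f a) (map vsnd zs))"]
      A.ev_mem[OF ux p] sig_act_0[OF A.sig sa] sig_mor(3)[OF m sa] B.ev_act[OF x pre_image[OF m x p]]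
      map_permute_args[of _ zs vsnd] l
    by simp
qed

lemma component_Hom: "component u f x \<in> Hom (Slice (colours A)) (omap P (pb_obj u x)) (pb_obj u (omap R x))"
proof -
  have "over (omap P (pb_obj u x)) (elt_map (component u f x)) (pb_obj u (omap R x))"
    unfolding over_def
  proof
    fix t assume "t \<in> src (omap P (pb_obj u x))"
    then obtain a zs where a: "pre A (pb_obj u x) a zs" "t = ev (pb_obj u x) a zs" using A.ev_ex[OF ux] by blast
    have sa: "snd a \<in> ops A (fst a)" using a(1) by (auto simp: pre_def)
    have U: "src u = colours A" using u by (simp add: Sets_Hom)
    show "elt_map (component u f x) t \<in> src (pb_obj u (omap R x)) \<and>
        dat (pb_obj u (omap R x)) (elt_map (component u f x) t) = dat (omap P (pb_obj u x)) t"
      unfolding a(2) component_value[OF a(1)] A.ev_dat[OF ux a(1)]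
      using B.ev_mem[OF x pre_image[OF m x a(1)]] B.ev_dat[OF x pre_image[OF m x a(1)]]
        sig_mor(4)[OF m sa, of 0] sig_act(5)[OF A.sig sa, of 0]
      by (simp add: U)
  qed
  moreover have "component u f x = sarr (omap P (pb_obj u x)) (elt_map (component u f x)) (pb_obj u (omap R x))"
    unfolding component_def by (rule sarr_cong) simp
  ultimately show ?thesis
    using A.P_obj[OF ux] pb_obj_Obj[OF u B.P_obj[OF x]] by (simp add: Slice_Hom)
qed

end

lemma functors:
  assumes "u \<in> Hom Sets (colours A) (colours B)"
  shows "is_functor (Slice (colours B)) (Slice (colours A)) (P \<bullet> pb u)"
    "is_functor (Slice (colours B)) (Slice (colours A)) (pb u \<bullet> R)"
  using is_functor_comp[OF is_functor_pb[OF assms] A.P_functor]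
    is_functor_comp[OF B.P_functor is_functor_pb[OF assms]] by auto

lemma component_nat_trans:
  assumes m: "is_sig_mor A B (u, f)" and c: "\<And>x. x \<in> Obj (Slice (colours B)) \<Longrightarrow> \<phi> x = component u f x"
  shows "nat_trans (Slice (colours B)) (Slice (colours A)) (P \<bullet> pb u) (pb u \<bullet> R) \<phi>"
proof -
  note u = sig_mor(1)[OF m] and CA = is_category_Slice[of "colours A"]
  show ?thesis
  proof (rule nat_transI[OF functors[OF u]])
    fix x assume x: "x \<in> Obj (Slice (colours B))"
    show "\<phi> x \<in> Hom (Slice (colours A)) (omap (P \<bullet> pb u) x) (omap (pb u \<bullet> R) x)"
      using component_Hom[OF m x] by (simp add: c[OF x] comp_func_def)
  next
    fix h x y assume h: "h \<in> Hom (Slice (colours B)) x y"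
    hence x: "x \<in> Obj (Slice (colours B))" and y: "y \<in> Obj (Slice (colours B))" by (auto simp: Slice_Hom)
    note uh = pb_hom[OF u h] and Rh = B.P_hom[OF h]
    note cx = component_Hom[OF m x] and cy = component_Hom[OF m y]
    note ux = pb_obj_Obj[OF u x]
    have "Cmp (Slice (colours A)) (component u f y) (amap P (amap (pb u) h)) =
        Cmp (Slice (colours A)) (amap (pb u) (amap R h)) (component u f x)"
    proof (rule Slice_ext[OF cat_cmp[OF CA A.P_hom[OF uh] cy] cat_cmp[OF CA cx pb_hom[OF u Rh]]])
      fix t assume t: "t \<in> src (omap P (pb_obj u x))"
      then obtain a zs where a: "pre A (pb_obj u x) a zs" "t = ev (pb_obj u x) a zs" using A.ev_ex[OF ux] by blast
      note p' = pre_map[OF a(1) uh]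
      have "elt_map (Cmp (Slice (colours A)) (component u f y) (amap P (amap (pb u) h))) t =
          vpair (bnd A a 0, ev' y (mapp f a) (map vsnd (map (elt_map (amap (pb u) h)) zs)))"
        using Slice_Cmp[OF A.P_hom[OF uh] t] A.ev_nat[OF uh a(1)] component_value[OF m y p'] a(2) by simp
      also have "map vsnd (map (elt_map (amap (pb u) h)) zs) = map (elt_map h) (map vsnd zs)"
        using a(1) pb_elt[OF h] by (auto simp: pre_def set_arg)
      also have "vpair (bnd A a 0, ev' y (mapp f a) \<dots>) =
          elt_map (Cmp (Slice (colours A)) (amap (pb u) (amap R h)) (component u f x)) t"
        using Slice_Cmp[OF cx t] component_value[OF m x a(1)] a(2) Slice_elt[OF cx t]
          pb_elt[OF Rh, of "elt_map (component u f x) t" u] B.ev_nat[OF h pre_image[OF m x a(1)]] by simp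
      finally show "elt_map (Cmp (Slice (colours A)) (component u f y) (amap P (amap (pb u) h))) t =
        elt_map (Cmp (Slice (colours A)) (amap (pb u) (amap R h)) (component u f x)) t" .
    qed
    thus "Cmp (Slice (colours A)) (\<phi> y) (amap (P \<bullet> pb u) h) =
        Cmp (Slice (colours A)) (amap (pb u \<bullet> R) h) (\<phi> x)"
      by (simp add: c[OF x] c[OF y] comp_func_def)
  qed
qed

lemma weakly_cartesian_iff:
  assumes u: "u \<in> Hom Sets (colours A) (colours B)"
    and nt: "nat_trans (Slice (colours B)) (Slice (colours A)) (P \<bullet> pb u) (pb u \<bullet> R) \<phi>"
  shows "weakly_cartesian (Slice (colours B)) (Slice (colours A)) (P \<bullet> pb u) (pb u \<bullet> R) \<phi> \<longleftrightarrow>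
    (\<forall>x y h. h \<in> Hom (Slice (colours B)) x y \<longrightarrow> (\<forall>t \<in> src (omap P (pb_obj u y)). \<forall>s \<in> src (pb_obj u (omap R x)).
       elt_map (\<phi> y) t = elt_map (amap (pb u) (amap R h)) s \<longrightarrow>
       (\<exists>e \<in> src (omap P (pb_obj u x)). elt_map (amap P (amap (pb u) h)) e = t \<and> elt_map (\<phi> x) e = s)))"
proof -
  have *: "weak_pullback (Slice (colours A)) (amap (P \<bullet> pb u) h) (\<phi> x) (\<phi> y) (amap (pb u \<bullet> R) h) \<longleftrightarrow>
     (\<forall>t \<in> src (omap P (pb_obj u y)). \<forall>s \<in> src (pb_obj u (omap R x)).
       elt_map (\<phi> y) t = elt_map (amap (pb u) (amap R h)) s \<longrightarrow>
       (\<exists>e \<in> src (omap P (pb_obj u x)). elt_map (amap P (amap (pb u) h)) e = t \<and> elt_map (\<phi> x) e = s))"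
    if h: "h \<in> Hom (Slice (colours B)) x y" for h x y
  proof -
    have x: "x \<in> Obj (Slice (colours B))" and y: "y \<in> Obj (Slice (colours B))" using h by (auto simp: Slice_Hom)
    show ?thesis
      using weak_pullback_Slice[OF func_hom[OF functors(1)[OF u] h] nat_hom[OF nt x] nat_hom[OF nt y]
        func_hom[OF functors(2)[OF u] h] nat_nat[OF nt h]]
      by (simp add: comp_func_def)
  qed
  show ?thesis
    unfolding weakly_cartesian_def using nt * by (auto simp: Hom_Arr)
qed

lemma component_weakly_cartesian:
  assumes m: "is_sig_mor A B (u, f)" and c: "\<And>x. x \<in> Obj (Slice (colours B)) \<Longrightarrow> \<phi> x = component u f x"
  shows "weakly_cartesian (Slice (colours B)) (Slice (colours A)) (P \<bullet> pb u) (pb u \<bullet> R) \<phi>"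
proof -
  have nt: "nat_trans (Slice (colours B)) (Slice (colours A)) (P \<bullet> pb u) (pb u \<bullet> R) \<phi>"
    by (rule component_nat_trans[OF m c])
  show ?thesis
    unfolding weakly_cartesian_iff[OF sig_mor(1)[OF m] nt]
  proof (intro allI impI ballI)
    fix x y h t s
    assume h: "h \<in> Hom (Slice (colours B)) x y" and t: "t \<in> src (omap P (pb_obj u y))"
      and s: "s \<in> src (pb_obj u (omap R x))"
      and eq: "elt_map (\<phi> y) t = elt_map (amap (pb u) (amap R h)) s"
    note u = sig_mor(1)[OF m]
    have x: "x \<in> Obj (Slice (colours B))" and y: "y \<in> Obj (Slice (colours B))" using h by (auto simp: Slice_Hom)
    note ux = pb_obj_Obj[OF u x] and uy = pb_obj_Obj[OF u y] and uh = pb_hom[OF u h]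
    obtain a zs where a: "pre A (pb_obj u y) a zs" "t = ev (pb_obj u y) a zs" using A.ev_ex[OF uy t] by blast
    obtain b r where r: "s = vpair (b, r)" "r \<in> src (omap R x)" using s by (auto elim!: pb_memE)
    have "vpair (bnd A a 0, ev' y (mapp f a) (map vsnd zs)) = vpair (b, elt_map (amap R h) r)"
      using eq component_value[OF m y a(1)] pb_elt[OF B.P_hom[OF h] s] a(2) by (simp add: c[OF y] r(1))
    hence b: "b = bnd A a 0" and r2: "elt_map (amap R h) r = ev' y (mapp f a) (map vsnd zs)" by auto
    obtain xs where xs: "pre B x (mapp f a) xs" "r = ev' x (mapp f a) xs" "map (elt_map h) xs = map vsnd zs"
      using B.ev_lift_rep[OF h r(2) pre_image[OF m y a(1)] r2] by blast
    define ws where "ws = map (\<lambda>i. vpair (bnd A a i, arg xs i)) [1..<Suc (fst a)]"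
    have sa: "snd a \<in> ops A (fst a)" and lz: "length zs = fst a" and lx: "length xs = fst a"
      using a(1) xs(1) by (auto simp: pre_def)
    have lw: "length ws = fst a" by (simp add: ws_def del: upt_Suc)
    have aw: "arg ws i = vpair (bnd A a i, arg xs i)" if "i \<in> {1..fst a}" for i
      unfolding ws_def by (rule arg_upt[OF that])
    have U: "src u = colours A" using u by (simp add: Sets_Hom)
    have pw: "pre A (pb_obj u x) a ws"
      unfolding pre_def
    proof (intro conjI ballI sa lw)
      fix i assume i: "i \<in> {1..fst a}"
      have "arg xs i \<in> src x" "dat x (arg xs i) = dat u (bnd A a i)" "bnd A a i \<in> colours A"
        using xs(1) i sig_mor(4)[OF m sa, of i] sig_act(5)[OF A.sig sa, of i] by (auto simp: pre_def)
      thus "arg ws i \<in> src (pb_obj u x)" "dat (pb_obj u x) (arg ws i) = bnd A a i"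
        by (auto simp: aw[OF i] U)
    qed
    have 1: "map vsnd ws = xs"
      by (rule list_arg_ext) (auto simp: lw lx arg_map aw)
    have 2: "map (elt_map (amap (pb u) h)) ws = zs"
    proof (rule list_arg_ext)
      fix i assume "i \<in> {1..length (map (elt_map (amap (pb u) h)) ws)}"
      hence i: "i \<in> {1..fst a}" by (simp add: lw)
      have z: "arg zs i \<in> src (pb_obj u y)" "dat (pb_obj u y) (arg zs i) = bnd A a i"
        and w: "arg ws i \<in> src (pb_obj u x)"
        using a(1) pw i by (auto simp: pre_def)
      have "elt_map h (arg xs i) = vsnd (arg zs i)"
        using arg_cong[OF xs(3), of "\<lambda>l. arg l i"] i lx lz by (simp add: arg_map)
      hence "elt_map (amap (pb u) h) (arg ws i) = vpair (bnd A a i, vsnd (arg zs i))"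
        using pb_elt[OF h w] aw[OF i] by simp
      thus "arg (map (elt_map (amap (pb u) h)) ws) i = arg zs i"
        using z i lw by (auto simp: arg_map elim!: pb_memE)
    qed (simp add: lw lz)
    show "\<exists>e\<in>src (omap P (pb_obj u x)). elt_map (amap P (amap (pb u) h)) e = t \<and> elt_map (\<phi> x) e = s"
      using A.ev_mem[OF ux pw] A.ev_nat[OF uh pw] 2 a(2) component_value[OF m x pw] 1 xs(2) r(1) b c[OF x]
      by (intro bexI[of _ "ev (pb_obj u x) a ws"]) auto
  qed
qed

lemma component_inject:
  assumes m: "is_sig_mor A B (u, f)" "is_sig_mor A B (u, f')"
    and eq: "\<And>x. x \<in> Obj (Slice (colours B)) \<Longrightarrow> component u f x = component u f' x"
  shows "f = f'"
proof (intro ext)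
  fix n a show "f n a = f' n a"
  proof (cases "a \<in> ops A n")
    case False
    have "f n \<in> extensional (ops A n)" "f' n \<in> extensional (ops A n)"
      using m unfolding is_sig_mor_def by (auto simp: PiE_iff)
    thus ?thesis using False by (simp add: extensional_def)
  next
    case True
    note u = sig_mor(1)[OF m(1)]
    have U: "src u = colours A" "\<And>k. k \<in> colours A \<Longrightarrow> dat u k \<in> colours B" using u by (auto simp: Sets_Hom)
    let ?x = "gobj (colours B) n (\<lambda>i. dat u (bnd A (n, a) i))"
    have bA: "bnd A (n, a) i \<in> colours A" if "i \<in> {1..n}" for i
      using sig_act(5)[OF A.sig, of "(n, a)" i] True that by simp
    have x: "?x \<in> Obj (Slice (colours B))"
      using B.sig U(2)[OF bA] by (intro gobj_Obj) (auto simp: is_sig_def)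
    define zs where "zs = map (\<lambda>i. vpair (bnd A (n, a) i, vnat i)) [1..<Suc n]"
    have az: "arg zs i = vpair (bnd A (n, a) i, vnat i)" if "i \<in> {1..n}" for i
      unfolding zs_def by (rule arg_upt[OF that])
    have lz: "length zs = n" by (simp add: zs_def del: upt_Suc)
    have p: "pre A (pb_obj u ?x) (n, a) zs"
      using True bA by (auto simp: pre_def lz az U)
    have vz: "map vsnd zs = gen n" by (rule list_arg_ext) (auto simp: lz az arg_map)
    note pi = pre_image[OF m(1) x p] pre_image[OF m(2) x p]
    have "ev' ?x (n, f n a) (gen n) = ev' ?x (n, f' n a) (gen n)"
      using component_value[OF m(1) x p] component_value[OF m(2) x p] eq[OF x] vz by simp
    thus ?thesis using B.ev_inject_distinct[OF x pi[unfolded vz]] by simp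
  qed
qed

lemma weakly_cartesian_component:
  assumes u: "u \<in> Hom Sets (colours A) (colours B)"
    and wc: "weakly_cartesian (Slice (colours B)) (Slice (colours A)) (P \<bullet> pb u) (pb u \<bullet> R) \<phi>"
  shows "\<exists>f. is_sig_mor A B (u, f) \<and> (\<forall>x \<in> Obj (Slice (colours B)). \<phi> x = component u f x)"
proof -
  let ?SA = "Slice (colours A)" and ?SB = "Slice (colours B)"
  have nt: "nat_trans ?SB ?SA (P \<bullet> pb u) (pb u \<bullet> R) \<phi>" using wc by (simp add: weakly_cartesian_def)
  note wp = wc[unfolded weakly_cartesian_iff[OF u nt], rule_format]
  have ph: "\<phi> x \<in> Hom ?SA (omap P (pb_obj u x)) (pb_obj u (omap R x))" if "x \<in> Obj ?SB" for x
    using nat_hom[OF nt that] by (simp add: comp_func_def)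
  have U: "src u = colours A" "\<And>k. k \<in> colours A \<Longrightarrow> dat u k \<in> colours B" using u by (auto simp: Sets_Hom)
  have nat: "elt_map (\<phi> y) (elt_map (amap P (amap (pb u) h)) t) =
      vpair (vfst (elt_map (\<phi> x) t), elt_map (amap R h) (vsnd (elt_map (\<phi> x) t)))"
    if h: "h \<in> Hom ?SB x y" and t: "t \<in> src (omap P (pb_obj u x))" for h x y t
  proof -
    have x: "x \<in> Obj ?SB" using h by (auto simp: Slice_Hom)
    have "Cmp ?SA (\<phi> y) (amap P (amap (pb u) h)) = Cmp ?SA (amap (pb u) (amap R h)) (\<phi> x)"
      using nat_nat[OF nt h] by (simp add: comp_func_def)
    thus ?thesis
      using Slice_Cmp[OF A.P_hom[OF pb_hom[OF u h]] t, of "colours A" "\<phi> y"]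
        Slice_Cmp[OF ph[OF x] t, of "colours A"] pb_elt[OF B.P_hom[OF h]] Slice_elt[OF ph[OF x] t] by auto
  qed
  have val: "elt_map (\<phi> x) t = vpair (dat (omap P (pb_obj u x)) t, vsnd (elt_map (\<phi> x) t)) \<and>
      vsnd (elt_map (\<phi> x) t) \<in> src (omap R x) \<and>
      dat (omap R x) (vsnd (elt_map (\<phi> x) t)) = dat u (dat (omap P (pb_obj u x)) t)"
    if x: "x \<in> Obj ?SB" and t: "t \<in> src (omap P (pb_obj u x))" for x t
    using Slice_elt[OF ph[OF x] t] by (auto elim!: pb_memE)
  define X where "X a = gobj (colours B) (fst a) (\<lambda>i. dat u (bnd A a i))" for a
  define Z where "Z a = map (\<lambda>i. vpair (bnd A a i, vnat i)) [1..<Suc (fst a)]" for a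
  have lZ: "length (Z a) = fst a" for a by (simp add: Z_def del: upt_Suc)
  have aZ: "arg (Z a) i = vpair (bnd A a i, vnat i)" if "i \<in> {1..fst a}" for i a
    unfolding Z_def by (rule arg_upt[OF that])
  have vZ: "map vsnd (Z a) = gen (fst a)" for a by (rule list_arg_ext) (auto simp: lZ aZ arg_map)
  have bA: "bnd A a i \<in> colours A" if "snd a \<in> ops A (fst a)" "i \<in> {0..fst a}" for a i
    using sig_act(5)[OF A.sig] that by simp
  have XO: "X a \<in> Obj ?SB" if "snd a \<in> ops A (fst a)" for a
    unfolding X_def using B.sig bA[OF that] by (intro gobj_Obj U(2)) (auto simp: is_sig_def)
  have pZ: "pre A (pb_obj u (X a)) a (Z a)" if "snd a \<in> ops A (fst a)" for a
    using that bA[OF that] by (auto simp: pre_def lZ aZ U X_def)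
  have ex: "\<exists>c. pre B (X a) c (gen (fst a)) \<and>
      vsnd (elt_map (\<phi> (X a)) (ev (pb_obj u (X a)) a (Z a))) = ev' (X a) c (gen (fst a))"
    if sa: "snd a \<in> ops A (fst a)" for a
  proof (rule B.generic_element)
    note x = XO[OF sa] and p = pZ[OF sa]
    note ux = pb_obj_Obj[OF u x]
    let ?tz = "ev (pb_obj u (X a)) a (Z a)"
    let ?t = "vsnd (elt_map (\<phi> (X a)) ?tz)"
    note t0 = A.ev_mem[OF ux p]
    show "X a \<in> Obj ?SB" by (rule x)
    show "?t \<in> src (omap R (X a))" using val[OF x t0] by simp
    show "distinct (gen (fst a))" "set (gen (fst a)) = src (X a)" by (simp_all add: X_def)
    fix y h e assume h: "h \<in> Hom ?SB y (X a)" and e: "e \<in> src (omap R y)" and he: "elt_map (amap R h) e = ?t"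
    have y: "y \<in> Obj ?SB" using h by (simp add: Slice_Hom)
    note uh = pb_hom[OF u h]
    have d0: "dat (omap P (pb_obj u (X a))) ?tz = bnd A a 0" using A.ev_dat[OF ux p] .
    have b0: "bnd A a 0 \<in> colours A" using bA[OF sa] by simp
    have "dat (omap R y) e = dat u (bnd A a 0)"
      using Slice_elt[OF B.P_hom[OF h] e] he val[OF x t0] d0 by simp
    hence s: "vpair (bnd A a 0, e) \<in> src (pb_obj u (omap R y))" using e b0 by (simp add: U)
    have "elt_map (\<phi> (X a)) ?tz = elt_map (amap (pb u) (amap R h)) (vpair (bnd A a 0, e))"
      using val[OF x t0] pb_elt[OF B.P_hom[OF h] s] he d0 by simp
    then obtain e3 where e3: "e3 \<in> src (omap P (pb_obj u y))" "elt_map (amap P (amap (pb u) h)) e3 = ?tz"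
      "elt_map (\<phi> y) e3 = vpair (bnd A a 0, e)"
      using wp[OF h t0 s] by blast
    obtain ws where ws: "pre A (pb_obj u y) a ws" "e3 = ev (pb_obj u y) a ws"
       "map (elt_map (amap (pb u) h)) ws = Z a"
      using A.ev_lift_rep[OF uh e3(1) p e3(2)] by blast
    define ys where "ys = map vsnd ws"
    have lw: "length ws = fst a" using ws(1) by (simp add: pre_def)
    have w: "arg ws i = vpair (bnd A a i, arg ys i)" "arg ys i \<in> src y" "dat y (arg ys i) = dat u (bnd A a i)"
      "elt_map h (arg ys i) = vnat i"
      if i: "i \<in> {1..fst a}" for i
    proof -
      have wi: "arg ws i \<in> src (pb_obj u y)" "dat (pb_obj u y) (arg ws i) = bnd A a i"
        using ws(1) i by (auto simp: pre_def)
      have yi: "arg ys i = vsnd (arg ws i)" using i lw by (simp add: ys_def arg_map)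
      show "arg ws i = vpair (bnd A a i, arg ys i)" "arg ys i \<in> src y" "dat y (arg ys i) = dat u (bnd A a i)"
        using wi unfolding yi by (auto elim!: pb_memE)
      have "elt_map (amap (pb u) h) (arg ws i) = arg (Z a) i"
        using arg_cong[OF ws(3), of "\<lambda>l. arg l i"] i lw by (simp add: arg_map)
      thus "elt_map h (arg ys i) = vnat i" using pb_elt[OF h wi(1)] aZ[OF i] yi by simp
    qed
    let ?l = "gmap (X a) ys y"
    have l: "?l \<in> Hom ?SB (X a) y"
      unfolding X_def by (rule gmap_Hom[OF x[unfolded X_def] y]) (use w in blast)
    have li: "elt_map ?l (vnat i) = arg ys i" if "i \<in> {1..fst a}" for i
      using gmap_elt[OF that] by (simp add: X_def)
    note ul = pb_hom[OF u l]
    have "map (elt_map (amap (pb u) ?l)) (Z a) = ws"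
    proof (rule list_arg_ext)
      fix i assume "i \<in> {1..length (map (elt_map (amap (pb u) ?l)) (Z a))}"
      hence i: "i \<in> {1..fst a}" by (simp add: lZ)
      have "arg (Z a) i \<in> src (pb_obj u (X a))" using p i by (simp add: pre_def)
      hence "elt_map (amap (pb u) ?l) (arg (Z a) i) = arg ws i"
        using pb_elt[OF l] w(1)[OF i] li[OF i] aZ[OF i] by simp
      thus "arg (map (elt_map (amap (pb u) ?l)) (Z a)) i = arg ws i" using i by (simp add: arg_map lZ)
    qed (simp add: lZ lw)
    hence "elt_map (amap P (amap (pb u) ?l)) ?tz = e3" using A.ev_nat[OF ul p] ws(2) by simp
    hence "elt_map (amap R ?l) ?t = e" using nat[OF l t0] e3(3) by simp
    moreover have "elt_map h (elt_map ?l d) = d" if d: "d \<in> src (X a)" for d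
      using d w(4) li by (auto simp: X_def)
    ultimately show "\<exists>l\<in>Hom ?SB (X a) y. (\<forall>d\<in>src (X a). elt_map h (elt_map l d) = d) \<and>
        elt_map (amap R l) ?t = e" using l by blast
  qed
  then obtain F where F: "\<And>a. snd a \<in> ops A (fst a) \<Longrightarrow> pre B (X a) (F a) (gen (fst a)) \<and>
      vsnd (elt_map (\<phi> (X a)) (ev (pb_obj u (X a)) a (Z a))) = ev' (X a) (F a) (gen (fst a))"
    by metis
  define f where "f n = (\<lambda>a \<in> ops A n. snd (F (n, a)))" for n
  have Ff: "mapp f a = F a" if "snd a \<in> ops A (fst a)" for a
  proof -
    have "fst (F a) = fst a" using F[OF that] unfolding pre_def by simp
    moreover have "f (fst a) (snd a) = snd (F a)" using that by (simp add: f_def)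
    ultimately show ?thesis by (simp add: mapp_def prod_eq_iff)
  qed
  have formula: "elt_map (\<phi> x) (ev (pb_obj u x) a zs) = vpair (bnd A a 0, ev' x (F a) (map vsnd zs))"
    if x: "x \<in> Obj ?SB" and p: "pre A (pb_obj u x) a zs" for x a zs
  proof -
    have sa: "snd a \<in> ops A (fst a)" and lz: "length zs = fst a" using p by (auto simp: pre_def)
    note pF = conjunct1[OF F[OF sa]] and vF = conjunct2[OF F[OF sa]]
    let ?h = "gmap (X a) (map vsnd zs) x"
    have z: "arg zs i = vpair (bnd A a i, vsnd (arg zs i))" "vsnd (arg zs i) \<in> src x"
       "dat x (vsnd (arg zs i)) = dat u (bnd A a i)" if i: "i \<in> {1..fst a}" for i
    proof -
      have "arg zs i \<in> src (pb_obj u x)" "dat (pb_obj u x) (arg zs i) = bnd A a i"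
        using p i by (auto simp: pre_def)
      thus "arg zs i = vpair (bnd A a i, vsnd (arg zs i))" "vsnd (arg zs i) \<in> src x"
        "dat x (vsnd (arg zs i)) = dat u (bnd A a i)" by (auto elim!: pb_memE)
    qed
    have h: "?h \<in> Hom ?SB (X a) x"
      unfolding X_def by (rule gmap_Hom[OF XO[OF sa, unfolded X_def] x]) (use z lz in \<open>simp add: arg_map\<close>)
    have hi: "elt_map ?h (vnat i) = vsnd (arg zs i)" if "i \<in> {1..fst a}" for i
      using gmap_elt[OF that] that lz by (simp add: X_def arg_map)
    note uX = pb_obj_Obj[OF u XO[OF sa]] and uh = pb_hom[OF u h]
    have "map (elt_map (amap (pb u) ?h)) (Z a) = zs"
    proof (rule list_arg_ext)
      fix i assume "i \<in> {1..length (map (elt_map (amap (pb u) ?h)) (Z a))}"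
      hence i: "i \<in> {1..fst a}" by (simp add: lZ)
      have "arg (Z a) i \<in> src (pb_obj u (X a))" using pZ[OF sa] i by (simp add: pre_def)
      hence "elt_map (amap (pb u) ?h) (arg (Z a) i) = arg zs i"
        using pb_elt[OF h] z(1)[OF i] hi[OF i] aZ[OF i] by simp
      thus "arg (map (elt_map (amap (pb u) ?h)) (Z a)) i = arg zs i" using i by (simp add: arg_map lZ)
    qed (simp add: lZ lz)
    hence "elt_map (amap P (amap (pb u) ?h)) (ev (pb_obj u (X a)) a (Z a)) = ev (pb_obj u x) a zs"
      using A.ev_nat[OF uh pZ[OF sa]] by simp
    hence "elt_map (\<phi> x) (ev (pb_obj u x) a zs) =
        vpair (bnd A a 0, elt_map (amap R ?h) (ev' (X a) (F a) (gen (fst a))))"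
      using nat[OF h A.ev_mem[OF uX pZ[OF sa]]] val[OF XO[OF sa] A.ev_mem[OF uX pZ[OF sa]]] vF
        A.ev_dat[OF uX pZ[OF sa]] by (metis vpair_simps(1))
    also have "elt_map (amap R ?h) (ev' (X a) (F a) (gen (fst a))) = ev' x (F a) (map vsnd zs)"
      using B.ev_nat[OF h pF] gmap_gen[of "map vsnd zs" "fst a"] lz by (simp add: X_def)
    finally show ?thesis .
  qed
  have m: "is_sig_mor A B (u, f)"
    unfolding is_sig_mor_def
  proof (simp only: prod.case, intro conjI allI ballI impI u)
    fix n
    show "f n \<in> ops A n \<rightarrow>\<^sub>E ops B n"
    proof (rule PiE_I)
      fix a assume "a \<in> ops A n"
      thus "f n a \<in> ops B n" using F[of "(n, a)"] by (auto simp: f_def pre_def)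
    qed (simp add: f_def)
    fix a assume a: "a \<in> ops A n"
    have sa: "snd (n, a) \<in> ops A (fst (n, a))" using a by simp
    note x = XO[OF sa] and p = pZ[OF sa]
    note ux = pb_obj_Obj[OF u x]
    have Fa: "F (n, a) = (n, f n a)" using Ff[OF sa] by simp
    note pF = conjunct1[OF F[OF sa], unfolded Fa] and vF = conjunct2[OF F[OF sa], unfolded Fa]
    show "bnd B (n, f n a) i = dat u (bnd A (n, a) i)" if i: "i \<in> {0..n}" for i
    proof (cases "i = 0")
      case True
      have "dat (omap R (X (n, a))) (ev' (X (n, a)) (n, f n a) (gen n)) = dat u (bnd A (n, a) 0)"
        using val[OF x A.ev_mem[OF ux p]] vF A.ev_dat[OF ux p] by simp
      thus ?thesis using B.ev_dat[OF x pF] True by simp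
    next
      case False
      thus ?thesis using pF i by (auto simp: pre_def X_def)
    qed
    fix \<sigma> assume s: "\<sigma> permutes {1..n}"
    let ?b = "actp A (n, a) \<sigma>"
    have sb: "snd ?b \<in> ops A (fst ?b)" using sig_act(2)[OF A.sig sa] s by simp
    have Fb: "F ?b = (n, f n (act A (n, a) \<sigma>))" using Ff[OF sb] by (simp add: actp_def)
    have pb: "pre A (pb_obj u (X (n, a))) ?b (permute_args (Z (n, a)) \<sigma>)"
      using pre_act[OF A.sig p] s by simp
    have e: "ev (pb_obj u (X (n, a))) ?b (permute_args (Z (n, a)) \<sigma>) = ev (pb_obj u (X (n, a))) (n, a) (Z (n, a))"
      using A.ev_act[OF ux p] s by simp
    have mp: "map vsnd (permute_args (Z (n, a)) \<sigma>) = permute_args (gen n) \<sigma>"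
      using map_permute_args[of \<sigma> "Z (n, a)" vsnd] s lZ vZ by simp
    have "ev' (X (n, a)) (F ?b) (permute_args (gen n) \<sigma>) = ev' (X (n, a)) (F (n, a)) (gen n)"
      using formula[OF x pb] formula[OF x p] e mp vZ[of "(n, a)"] by simp
    also have "\<dots> = ev' (X (n, a)) (actp B (F (n, a)) \<sigma>) (permute_args (gen n) \<sigma>)"
      using B.ev_act[OF x pF, of \<sigma>] s by (simp add: Fa)
    finally have ee: "ev' (X (n, a)) (F ?b) (permute_args (gen n) \<sigma>) =
      ev' (X (n, a)) (actp B (F (n, a)) \<sigma>) (permute_args (gen n) \<sigma>)" .
    have p1: "pre B (X (n, a)) (actp B (F (n, a)) \<sigma>) (permute_args (gen n) \<sigma>)"
      using pre_act[OF B.sig pF, of \<sigma>] s by (simp add: Fa)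
    have p2: "pre B (X (n, a)) (F ?b) (permute_args (gen n) \<sigma>)"
    proof -
      have pFb: "pre B (X ?b) (F ?b) (gen n)" using F[OF sb] by simp
      have "arg (permute_args (gen n) \<sigma>) i \<in> src (X (n, a)) \<and>
          dat (X (n, a)) (arg (permute_args (gen n) \<sigma>) i) = bnd B (F ?b) i" if i: "i \<in> {1..n}" for i
      proof -
        have si: "\<sigma> i \<in> {1..n}" using permutes_in_image[OF s] i by blast
        have "dat (X ?b) (arg (gen n) i) = bnd B (F ?b) i"
          using pFb i Fb unfolding pre_def by (metis fst_conv)
        hence "bnd B (F ?b) i = dat u (bnd A ?b i)" using i by (simp add: X_def)
        also have "bnd A ?b i = bnd A (n, a) (\<sigma> i)" using sig_act(3)[OF A.sig sa, of \<sigma> i] s i by simp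
        finally show ?thesis using si i by (simp add: arg_permute_args X_def)
      qed
      thus ?thesis using pFb Fb by (simp add: pre_def)
    qed
    have "distinct (permute_args (gen n) \<sigma>)" using distinct_permute_args[of \<sigma> "gen n"] s by simp
    hence "F ?b = actp B (F (n, a)) \<sigma>" using B.ev_inject_distinct[OF x p2 p1 _ ee] by simp
    thus "f n (act A (n, a) \<sigma>) = act B (n, f n a) \<sigma>" using Fb by (simp add: Fa actp_def)
  qed
  have "\<phi> x = component u f x" if x: "x \<in> Obj ?SB" for x
  proof (rule Slice_ext[OF ph[OF x] component_Hom[OF m x]])
    fix t assume "t \<in> src (omap P (pb_obj u x))"
    then obtain a zs where a: "pre A (pb_obj u x) a zs" "t = ev (pb_obj u x) a zs"
      using A.ev_ex[OF pb_obj_Obj[OF u x]] by blast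
    have "snd a \<in> ops A (fst a)" using a(1) by (simp add: pre_def)
    thus "elt_map (\<phi> x) t = elt_map (component u f x) t"
      using formula[OF x a(1)] component_value[OF m x a(1)] a(2) Ff by simp
  qed
  thus ?thesis using m by blast
qed

end

section \<open>Signatures and analytic functors\<close>

definition orbit :: "('v, 'z) sig_scheme \<Rightarrow> nat \<times> 'v \<Rightarrow> 'v list \<Rightarrow> ((nat \<times> 'v) \<times> 'v list) set" where
  "orbit A a xs = {(actp A a \<sigma>, permute_args xs \<sigma>) | \<sigma>. \<sigma> permutes {1..fst a}}"

lemma orbit_self: "is_sig A \<Longrightarrow> pre A x a xs \<Longrightarrow> (a, xs) \<in> orbit A a xs"
  unfolding orbit_def using sig_act(1)[of A a] by (auto simp: pre_def permutes_id intro!: exI[of _ id])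

lemma orbit_act:
  assumes "is_sig A" "pre A x a xs" "\<sigma> permutes {1..fst a}"
  shows "orbit A (actp A a \<sigma>) (permute_args xs \<sigma>) = orbit A a xs"
proof -
  have sub: "orbit A (actp A a \<sigma>) (permute_args xs \<sigma>) \<subseteq> orbit A a xs"
    if p: "pre A x a xs" and s: "\<sigma> permutes {1..fst a}" for a xs \<sigma>
  proof
    fix z assume "z \<in> orbit A (actp A a \<sigma>) (permute_args xs \<sigma>)"
    then obtain \<tau> where t: "\<tau> permutes {1..fst a}"
      "z = (actp A (actp A a \<sigma>) \<tau>, permute_args (permute_args xs \<sigma>) \<tau>)"
      by (auto simp: orbit_def)
    have "z = (actp A a (\<sigma> \<circ> \<tau>), permute_args xs (\<sigma> \<circ> \<tau>))"
      using t p s sig_act(4)[OF assms(1), of a \<sigma> \<tau>] permute_args_comp[of \<tau> xs \<sigma>]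
      by (auto simp: pre_def)
    thus "z \<in> orbit A a xs" using permutes_compose[OF t(1) s] by (auto simp: orbit_def)
  qed
  have "orbit A a xs = orbit A (actp A (actp A a \<sigma>) (inv \<sigma>)) (permute_args (permute_args xs \<sigma>) (inv \<sigma>))"
    using assms sig_act(1)[OF assms(1), of a] sig_act(4)[OF assms(1), of a \<sigma> "inv \<sigma>"] permute_args_inv(1)[of \<sigma> xs]
    by (auto simp: pre_def permutes_inv permutes_inv_o)
  also have "\<dots> \<subseteq> orbit A (actp A a \<sigma>) (permute_args xs \<sigma>)"
    by (rule sub[OF pre_act[OF assms]]) (use assms in \<open>simp add: permutes_inv\<close>)
  finally show ?thesis using sub[OF assms(2,3)] by blast
qed

lemma orbit_eq:
  assumes "is_sig A" "pre A x a xs" "pre A x b ys"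
  shows "orbit A a xs = orbit A b ys \<longleftrightarrow>
    (\<exists>\<sigma>. \<sigma> permutes {1..fst a} \<and> b = actp A a \<sigma> \<and> ys = permute_args xs \<sigma>)"
proof
  assume "orbit A a xs = orbit A b ys"
  hence "(b, ys) \<in> orbit A a xs" using orbit_self[OF assms(1,3)] by simp
  thus "\<exists>\<sigma>. \<sigma> permutes {1..fst a} \<and> b = actp A a \<sigma> \<and> ys = permute_args xs \<sigma>"
    by (auto simp: orbit_def)
qed (use orbit_act[OF assms(1,2)] in auto)

definition as_fun :: "(nat \<times> 'v) \<times> 'v list \<Rightarrow> nat \<times> 'v \<times> (nat \<Rightarrow> 'v)" where
  "as_fun = (\<lambda>(a, xs). (fst a, snd a, \<lambda>i \<in> {1..fst a}. arg xs i))"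

lemma as_fun_star_pre: "pre A x a xs \<Longrightarrow> as_fun (a, xs) \<in> star_pre A x"
  by (auto simp: as_fun_def star_pre_def pre_def)

lemma star_pre_as_fun:
  assumes "z \<in> star_pre A x"
  shows "\<exists>a xs. pre A x a xs \<and> z = as_fun (a, xs)"
proof -
  obtain n a f where z: "z = (n, a, f)" "a \<in> ops A n" "f \<in> {1..n} \<rightarrow>\<^sub>E src x"
    "\<forall>i\<in>{1..n}. dat x (f i) = bnd A (n, a) i"
    using assms by (auto simp: star_pre_def)
  let ?xs = "map f [1..<Suc n]"
  have ax: "arg ?xs i = f i" if "i \<in> {1..n}" for i by (rule arg_upt[OF that])
  have "f = (\<lambda>i\<in>{1..n}. arg ?xs i)"
  proof
    fix i show "f i = (\<lambda>i\<in>{1..n}. arg ?xs i) i"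
      using z(3) ax[of i] by (cases "i \<in> {1..n}") (auto simp: PiE_def extensional_def simp del: upt_Suc)
  qed
  moreover have "pre A x (n, a) ?xs"
    unfolding pre_def using z ax by (auto simp del: upt_Suc)
  ultimately show ?thesis using z(1) by (intro exI[of _ "(n, a)"] exI[of _ ?xs]) (simp add: as_fun_def)
qed

lemma as_fun_inject:
  assumes "length xs = fst a" "length ys = fst b" "as_fun (a, xs) = as_fun (b, ys)"
  shows "a = b \<and> xs = ys"
proof -
  have ab: "a = b" using assms(3) by (auto simp: as_fun_def prod_eq_iff)
  have r: "restrict (arg xs) {1..fst a} = restrict (arg ys) {1..fst a}"
    using assms(3) ab by (simp add: as_fun_def)
  have "arg xs i = arg ys i" if "i \<in> {1..fst a}" for i
    using fun_cong[OF r, of i] that by simp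
  thus ?thesis using ab assms list_arg_ext[of xs ys] by auto
qed

lemma star_class:
  assumes "is_sig A" "pre A x a xs"
  shows "star_rel A x `` {as_fun (a, xs)} = as_fun ` orbit A a xs"
proof -
  have *: "as_fun (actp A a \<sigma>, permute_args xs \<sigma>) = (fst a, act A a \<sigma>, (\<lambda>i\<in>{1..fst a}. arg xs i) \<circ> \<sigma>)"
    if s: "\<sigma> permutes {1..fst a}" for \<sigma>
  proof -
    have "(\<lambda>i\<in>{1..fst a}. arg (permute_args xs \<sigma>) i) = (\<lambda>i\<in>{1..fst a}. arg xs i) \<circ> \<sigma>"
    proof
      fix i show "(\<lambda>i\<in>{1..fst a}. arg (permute_args xs \<sigma>) i) i = ((\<lambda>i\<in>{1..fst a}. arg xs i) \<circ> \<sigma>) i"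
        using permutes_in_image[OF s, of i] arg_permute_args[of i xs \<sigma>] assms(2)
        by (cases "i \<in> {1..fst a}") (auto simp: pre_def)
    qed
    thus ?thesis by (simp add: as_fun_def actp_def)
  qed
  have "star_rel A x `` {as_fun (a, xs)} =
      (\<lambda>\<sigma>. (fst a, act A a \<sigma>, (\<lambda>i\<in>{1..fst a}. arg xs i) \<circ> \<sigma>)) ` {\<sigma>. \<sigma> permutes {1..fst a}}"
    using as_fun_star_pre[OF assms(2)] unfolding star_rel_def as_fun_def by auto
  also have "\<dots> = (\<lambda>\<sigma>. as_fun (actp A a \<sigma>, permute_args xs \<sigma>)) ` {\<sigma>. \<sigma> permutes {1..fst a}}"
    by (rule image_cong[OF refl]) (simp add: *)
  also have "\<dots> = as_fun ` orbit A a xs" unfolding orbit_def by blast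
  finally show ?thesis .
qed

lemma star_classes: "is_sig A \<Longrightarrow> star A x = {as_fun ` orbit A a xs | a xs. pre A x a xs}"
  unfolding star_def quotient_def using star_class[of A x] star_pre_as_fun[of _ A x] as_fun_star_pre[of A x]
  by (auto, metis, metis)

lemma star_class_eq:
  assumes "is_sig A" "pre A x a xs" "pre A x b ys"
  shows "as_fun ` orbit A a xs = as_fun ` orbit A b ys \<longleftrightarrow> orbit A a xs = orbit A b ys"
proof -
  have l: "length (snd z) = fst (fst z)" if "z \<in> orbit A a xs \<or> z \<in> orbit A b ys" for z
    using that assms by (auto simp: orbit_def pre_def)
  have "inj_on as_fun (orbit A a xs \<union> orbit A b ys)"
    by (rule inj_onI) (metis UnE as_fun_inject l prod.collapse)
  thus ?thesis by (metis inj_on_Un_image_eq_iff)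
qed

lemma star_proj_class:
  assumes "is_sig A" "pre A x a xs"
  shows "star_proj A (as_fun ` orbit A a xs) = bnd A a 0"
proof -
  have "(\<lambda>(n, a, xs). bnd A (n, a) 0) ` as_fun ` orbit A a xs = {bnd A a 0}"
    using orbit_self[OF assms] sig_act_0[OF assms(1), of a] assms(2)
    by (force simp: orbit_def as_fun_def actp_def pre_def image_image)
  thus ?thesis by (simp add: star_proj_def)
qed

lemma star_map_class:
  assumes sig: "is_sig A" and p: "pre A x a xs" and h: "h \<in> Hom (Slice Q) x y"
  shows "star_map A h (as_fun ` orbit A a xs) = as_fun ` orbit A a (map (elt_map h) xs)"
proof -
  have th: "tgt h = y" using h by (simp add: Hom_Arr)
  have 1: "(\<lambda>(n, a, xs). (n, a, compose {1..n} (elt_map h) xs)) (as_fun (b, ys)) = as_fun (b, map (elt_map h) ys)"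
    if "length ys = fst b" for b ys
    using that by (auto simp: as_fun_def compose_def fun_eq_iff arg_map)
  have 2: "star_rel A y `` {as_fun (b, map (elt_map h) ys)} = as_fun ` orbit A a (map (elt_map h) xs)"
    and 3: "length ys = fst b"
    if b: "(b, ys) \<in> orbit A a xs" for b ys
  proof -
    obtain \<sigma> where s: "\<sigma> permutes {1..fst a}" "b = actp A a \<sigma>" "ys = permute_args xs \<sigma>"
      using b unfolding orbit_def by blast
    show "length ys = fst b" using s p by (simp add: pre_def)
    have m: "map (elt_map h) ys = permute_args (map (elt_map h) xs) \<sigma>"
      using map_permute_args[of \<sigma> xs] s p by (simp add: pre_def)
    show "star_rel A y `` {as_fun (b, map (elt_map h) ys)} = as_fun ` orbit A a (map (elt_map h) xs)"
      using star_class[OF sig pre_act[OF sig pre_map[OF p h] s(1)]] orbit_act[OF sig pre_map[OF p h] s(1)] s(2) m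
      by simp
  qed
  have "(\<lambda>(n, a, xs). (n, a, compose {1..n} (elt_map h) xs)) ` (as_fun ` orbit A a xs) =
      (\<lambda>(b, ys). as_fun (b, map (elt_map h) ys)) ` orbit A a xs"
    unfolding image_image by (rule image_cong[OF refl]) (use 1 3 in \<open>auto simp del: One_nat_def\<close>)
  hence "star_map A h (as_fun ` orbit A a xs) =
      star_rel A y `` ((\<lambda>(b, ys). as_fun (b, map (elt_map h) ys)) ` orbit A a xs)"
    unfolding star_map_def th by simp
  also have "\<dots> = (\<Union>z \<in> orbit A a xs. star_rel A y `` {(\<lambda>(b, ys). as_fun (b, map (elt_map h) ys)) z})" by blast
  also have "\<dots> = (\<Union>z \<in> orbit A a xs. as_fun ` orbit A a (map (elt_map h) xs))"
  proof (rule SUP_cong[OF refl])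
    fix z assume "z \<in> orbit A a xs"
    thus "star_rel A y `` {(\<lambda>(b, ys). as_fun (b, map (elt_map h) ys)) z} = as_fun ` orbit A a (map (elt_map h) xs)"
      using 2[of "fst z" "snd z"] by (simp add: case_prod_beta)
  qed
  also have "\<dots> = as_fun ` orbit A a (map (elt_map h) xs)"
    using orbit_self[OF sig p] by blast
  finally show ?thesis .
qed

context universe
begin

lemma analytic_of_presentation:
  assumes "presentation (A :: 'v sig) P ev"
  shows "analytic (colours A) P"
proof -
  interpret presentation ty A P ev by fact
  define \<theta> where "\<theta> x e = as_fun ` orbit A (fst (rep x e)) (snd (rep x e))" for x e
  have th: "\<theta> x (ev x a xs) = as_fun ` orbit A a xs" if "x \<in> Obj (Slice (colours A))" "pre A x a xs" for x a xs
    unfolding \<theta>_def using rep_lift[OF that, of "\<lambda>a xs. as_fun ` orbit A a xs"] orbit_act[OF sig that(2)] by simp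
  have bij: "bij_betw (\<theta> x) (src (omap P x)) (star A x)" if x: "x \<in> Obj (Slice (colours A))" for x
    unfolding bij_betw_def
  proof
    show "inj_on (\<theta> x) (src (omap P x))"
    proof (rule inj_onI)
      fix e e' assume e: "e \<in> src (omap P x)" "e' \<in> src (omap P x)" and eq: "\<theta> x e = \<theta> x e'"
      obtain a xs b ys where *: "pre A x a xs" "e = ev x a xs" "pre A x b ys" "e' = ev x b ys"
        using ev_ex[OF x e(1)] ev_ex[OF x e(2)] by blast
      show "e = e'"
        using eq th[OF x *(1)] th[OF x *(3)] star_class_eq[OF sig *(1,3)] orbit_eq[OF sig *(1,3)]
          ev_eq[OF x *(1,3)] * by simp
    qed
    show "\<theta> x ` src (omap P x) = star A x"
      unfolding star_classes[OF sig]
    proof (intro equalityI subsetI)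
      fix c assume "c \<in> \<theta> x ` src (omap P x)"
      then obtain e where "e \<in> src (omap P x)" "c = \<theta> x e" by blast
      thus "c \<in> {as_fun ` orbit A a xs |a xs. pre A x a xs}" using ev_ex[OF x] th[OF x] by blast
    next
      fix c assume "c \<in> {as_fun ` orbit A a xs |a xs. pre A x a xs}"
      thus "c \<in> \<theta> x ` src (omap P x)" using ev_mem[OF x] th[OF x] by (auto simp: image_iff) metis
    qed
  qed
  show ?thesis
    unfolding analytic_def
  proof (intro conjI P_functor exI[of _ A] exI[of _ \<theta>] sig refl ballI bij)
    fix x e assume x: "x \<in> Obj (Slice (colours A))" and e: "e \<in> src (omap P x)"
    show "star_proj A (\<theta> x e) = dat (omap P x) e"
      using ev_ex[OF x e] th[OF x] star_proj_class[OF sig] ev_dat[OF x] by force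
  next
    fix h e assume h: "h \<in> Arr (Slice (colours A))" and e: "e \<in> src (omap P (src h))"
    have h': "h \<in> Hom (Slice (colours A)) (src h) (tgt h)" using h by (simp add: Hom_Arr)
    hence O: "src h \<in> Obj (Slice (colours A))" "tgt h \<in> Obj (Slice (colours A))" by (auto simp: Slice_Hom)
    obtain a xs where a: "pre A (src h) a xs" "e = ev (src h) a xs" using ev_ex[OF O(1) e] by blast
    show "\<theta> (tgt h) (elt_map (amap P h) e) = star_map A h (\<theta> (src h) e)"
      using th[OF O(1) a(1)] th[OF O(2) pre_map[OF a(1) h']] star_map_class[OF sig a(1) h']
        ev_nat[OF h' a(1)] a(2) by simp
  qed
qed

lemma presentation_of_analytic:
  assumes an: "analytic Q P"
  shows "\<exists>(A :: 'v sig) ev. presentation A P ev \<and> colours A = Q"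
proof -
  obtain A :: "'v sig" and \<theta> where P: "is_functor (Slice Q) (Slice Q) P" and A: "is_sig A" "colours A = Q"
    and b: "\<And>x. x \<in> Obj (Slice Q) \<Longrightarrow> bij_betw (\<theta> x) (src (omap P x)) (star A x)"
    and d: "\<And>x e. x \<in> Obj (Slice Q) \<Longrightarrow> e \<in> src (omap P x) \<Longrightarrow> star_proj A (\<theta> x e) = dat (omap P x) e"
    and n: "\<And>h e. h \<in> Arr (Slice Q) \<Longrightarrow> e \<in> src (omap P (src h)) \<Longrightarrow>
       \<theta> (tgt h) (elt_map (amap P h) e) = star_map A h (\<theta> (src h) e)"
    using an unfolding analytic_def by blast
  define ev where "ev x a xs = inv_into (src (omap P x)) (\<theta> x) (as_fun ` orbit A a xs)" for x a xs
  have st: "as_fun ` orbit A a xs \<in> star A x" if "pre A x a xs" for x a xs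
    using star_classes[OF A(1)] that by blast
  have mem: "ev x a xs \<in> src (omap P x)" and th: "\<theta> x (ev x a xs) = as_fun ` orbit A a xs"
    if x: "x \<in> Obj (Slice Q)" and p: "pre A x a xs" for x a xs
    unfolding ev_def using st[OF p] b[OF x] bij_betw_inv_into_right[OF b[OF x] st[OF p]]
    by (auto simp: bij_betw_def inv_into_into)
  have inj: "e = e'" if "x \<in> Obj (Slice Q)" "e \<in> src (omap P x)" "e' \<in> src (omap P x)" "\<theta> x e = \<theta> x e'" for x e e'
    using b[OF that(1)] that by (auto simp: bij_betw_def dest: inj_onD)
  have "presentation A P ev"
  proof (unfold_locales, unfold A(2))
    show "is_sig A" by (rule A)
    show "is_functor (Slice Q) (Slice Q) P" by (rule P)
    fix x assume x: "x \<in> Obj (Slice Q)"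
    { fix e assume e: "e \<in> src (omap P x)"
      hence "\<theta> x e \<in> star A x" using b[OF x] bij_betwE by blast
      then obtain a xs where a: "pre A x a xs" "\<theta> x e = as_fun ` orbit A a xs"
        using star_classes[OF A(1)] by auto
      hence "e = ev x a xs" by (intro inj[OF x e mem[OF x a(1)]]) (simp add: th[OF x a(1)])
      thus "\<exists>a xs. pre A x a xs \<and> e = ev x a xs" using a by blast }
    fix a xs assume p: "pre A x a xs"
    show "ev x a xs \<in> src (omap P x)" by (rule mem[OF x p])
    show "dat (omap P x) (ev x a xs) = bnd A a 0"
      using d[OF x mem[OF x p]] th[OF x p] star_proj_class[OF A(1) p] by simp
    fix b ys assume p': "pre A x b ys"
    have "ev x a xs = ev x b ys \<longleftrightarrow> \<theta> x (ev x a xs) = \<theta> x (ev x b ys)"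
      using inj[OF x mem[OF x p] mem[OF x p']] by auto
    thus "ev x a xs = ev x b ys \<longleftrightarrow>
        (\<exists>\<sigma>. \<sigma> permutes {1..fst a} \<and> b = actp A a \<sigma> \<and> ys = permute_args xs \<sigma>)"
      unfolding th[OF x p] th[OF x p'] star_class_eq[OF A(1) p p'] orbit_eq[OF A(1) p p'] .
  next
    fix h x y a xs assume h: "h \<in> Hom (Slice Q) x y" and p: "pre A x a xs"
    have O: "x \<in> Obj (Slice Q)" "y \<in> Obj (Slice Q)" using h by (auto simp: Slice_Hom)
    note p' = pre_map[OF p h]
    have "\<theta> y (elt_map (amap P h) (ev x a xs)) = \<theta> y (ev y a (map (elt_map h) xs))"
      using n[of h "ev x a xs"] h mem[OF O(1) p] th[OF O(1) p] th[OF O(2) p'] star_map_class[OF A(1) p h]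
      by (simp add: Hom_Arr)
    thus "elt_map (amap P h) (ev x a xs) = ev y a (map (elt_map h) xs)"
      using inj[OF O(2) _ mem[OF O(2) p']] Slice_elt[OF func_hom[OF P h] mem[OF O(1) p]] by blast
  qed
  thus ?thesis using A(2) by blast
qed

lemma pre_small:
  assumes sig: "is_sig (A :: ('v, 'z) sig_scheme)" and x: "small (src x)"
  shows "|{p. pre A x (fst p) (snd p)}| <o |UNIV :: 'v set|"
proof -
  have "{p. pre A x (fst p) (snd p)} \<subseteq> (UNIV \<times> (\<Union>n\<in>UNIV. ops A n)) \<times> lists (src x)"
    by (auto simp: pre_def set_arg)
  moreover have "|\<Union>n\<in>UNIV. ops A n| <o |UNIV :: 'v set|"
  proof (intro less_UN less_nat)
    fix n
    have "small (ops A n)" using sig by (simp add: is_sig_def)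
    thus "|ops A n| <o |UNIV :: 'v set|" unfolding small_def .
  qed
  ultimately show ?thesis
    using less_subset less_Times[OF less_Times[OF less_nat] less_lists[of "src x"]] x
    unfolding small_def by blast
qed

lemma presentation_exists:
  assumes A: "is_sig (A :: ('v, 'z) sig_scheme)"
  shows "\<exists>P ev. presentation A P ev"
proof -
  let ?Q = "colours A" and ?S = "Slice (colours A)"
  define U where "U x = (\<lambda>p. orbit A (fst p) (snd p)) ` {p. pre A x (fst p) (snd p)}" for x
  have "\<exists>c :: _ \<Rightarrow> 'v. inj_on c (U x)" if "x \<in> Obj ?S" for x
    using that less_encode[OF less_image[OF pre_small[OF A]]] by (auto simp: U_def Slice_Obj)
  then obtain c :: "'v fn \<Rightarrow> _ \<Rightarrow> 'v" where c: "\<And>x. x \<in> Obj ?S \<Longrightarrow> inj_on (c x) (U x)" by metis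
  define ev where "ev x a xs = c x (orbit A a xs)" for x a xs
  have eq: "ev x a xs = ev x b ys \<longleftrightarrow>
      (\<exists>\<sigma>. \<sigma> permutes {1..fst a} \<and> b = actp A a \<sigma> \<and> ys = permute_args xs \<sigma>)"
    if "x \<in> Obj ?S" "pre A x a xs" "pre A x b ys" for x a xs b ys
  proof -
    have "orbit A a xs \<in> U x" "orbit A b ys \<in> U x" unfolding U_def
      by (rule image_eqI[of _ _ "(a, xs)"], use that in simp_all, rule image_eqI[of _ _ "(b, ys)"], simp_all)
    thus ?thesis using orbit_eq[OF A that(2,3)] c[OF that(1)] by (auto simp: ev_def dest: inj_onD)
  qed
  define Z where "Z x = (\<lambda>p. ev x (fst p) (snd p)) ` {p. pre A x (fst p) (snd p)}" for x
  have ZI: "ev x a xs \<in> Z x" if "pre A x a xs" for x a xs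
    unfolding Z_def by (rule image_eqI[of _ _ "(a, xs)"]) (use that in auto)
  define R where "R x e = (SOME p. pre A x (fst p) (snd p) \<and> e = ev x (fst p) (snd p))" for x e
  have R: "\<phi> (fst (R x (ev x a xs))) (snd (R x (ev x a xs))) = \<phi> a xs"
    if x: "x \<in> Obj ?S" and p: "pre A x a xs"
      and inv: "\<And>\<sigma>. \<sigma> permutes {1..fst a} \<Longrightarrow> \<phi> (actp A a \<sigma>) (permute_args xs \<sigma>) = \<phi> a xs"
    for x a xs and \<phi> :: "nat \<times> 'v \<Rightarrow> 'v list \<Rightarrow> 'v"
  proof -
    let ?r = "R x (ev x a xs)"
    have "pre A x (fst ?r) (snd ?r) \<and> ev x a xs = ev x (fst ?r) (snd ?r)"
      unfolding R_def by (rule someI[of _ "(a, xs)"]) (simp add: p)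
    then obtain \<sigma> where "\<sigma> permutes {1..fst a}" "fst ?r = actp A a \<sigma>" "snd ?r = permute_args xs \<sigma>"
      using eq[OF x p] by metis
    thus ?thesis using inv by simp
  qed
  define ob where "ob x = Arrow (Z x) (\<lambda>e \<in> Z x. bnd A (fst (R x e)) 0) ?Q" for x
  define P where "P = \<lparr>omap = ob, amap = (\<lambda>h. sarr (ob (src h))
     (\<lambda>e. ev (tgt h) (fst (R (src h) e)) (map (elt_map h) (snd (R (src h) e)))) (ob (tgt h)))\<rparr>"
  have sob [simp]: "src (ob x) = Z x" for x by (simp add: ob_def)
  have dob: "dat (ob x) (ev x a xs) = bnd A a 0" if "x \<in> Obj ?S" "pre A x a xs" for x a xs
  proof -
    have "ev x a xs \<in> Z x" using ZI that(2) by blast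
    thus ?thesis using R[OF that, of "\<lambda>a xs. bnd A a 0"] sig_act_0[OF A, of a] that(2)
      by (simp add: ob_def pre_def)
  qed
  have obO: "ob x \<in> Obj ?S" if x: "x \<in> Obj ?S" for x
  proof -
    have "small (Z x)" unfolding small_def Z_def using x less_image[OF pre_small[OF A]] by (auto simp: Slice_Obj)
    moreover have "dat (ob x) e \<in> ?Q" if "e \<in> Z x" for e
      using that dob[OF x] sig_act(5)[OF A, of _ 0] by (auto simp: Z_def pre_def)
    ultimately show ?thesis using A by (auto simp: Slice_Obj ob_def is_sig_def)
  qed
  have am: "elt_map (amap P h) (ev x a xs) = ev y a (map (elt_map h) xs)"
    if h: "h \<in> Hom ?S x y" and p: "pre A x a xs" for h x y a xs
  proof -
    have O: "x \<in> Obj ?S" "y \<in> Obj ?S" using h by (auto simp: Slice_Hom)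
    have st: "src h = x" "tgt h = y" using h by (auto simp: Hom_Arr)
    have e: "ev x a xs \<in> Z x" by (rule ZI[OF p])
    have "ev y (actp A a \<sigma>) (map (elt_map h) (permute_args xs \<sigma>)) = ev y a (map (elt_map h) xs)"
      if s: "\<sigma> permutes {1..fst a}" for \<sigma>
      using orbit_act[OF A pre_map[OF p h] s] map_permute_args[of \<sigma> xs "elt_map h"] s p
      by (simp add: ev_def pre_def)
    thus ?thesis using R[OF O(1) p, of "\<lambda>a xs. ev y a (map (elt_map h) xs)"] e
      by (simp add: P_def st)
  qed
  have hom: "amap P h \<in> Hom ?S (ob x) (ob y)" if h: "h \<in> Hom ?S x y" for h x y
  proof -
    have O: "x \<in> Obj ?S" "y \<in> Obj ?S" using h by (auto simp: Slice_Hom)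
    have st: "src h = x" "tgt h = y" using h by (auto simp: Hom_Arr)
    have "over (ob x) (elt_map (amap P h)) (ob y)"
      unfolding over_def
    proof
      fix e assume "e \<in> src (ob x)"
      then obtain a xs where a: "pre A x a xs" "e = ev x a xs" by (auto simp: Z_def)
      thus "elt_map (amap P h) e \<in> src (ob y) \<and> dat (ob y) (elt_map (amap P h) e) = dat (ob x) e"
        using am[OF h a(1)] dob[OF O(1) a(1)] dob[OF O(2) pre_map[OF a(1) h]] ZI[OF pre_map[OF a(1) h]]
        by simp
    qed
    moreover have "amap P h = sarr (ob x) (elt_map (amap P h)) (ob y)"
      unfolding P_def st[symmetric] func.simps by (rule sarr_cong) simp
    ultimately show ?thesis using obO O by (simp add: Slice_Hom)
  qed
  have oP: "omap P = ob" by (simp add: P_def)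
  note CS = is_category_Slice[of ?Q]
  have "presentation A P ev"
  proof (unfold_locales, unfold oP)
    show "is_sig A" by (rule A)
    show "is_functor ?S ?S P"
    proof (rule is_functorI[OF CS CS], unfold oP)
      fix x assume x: "x \<in> Obj ?S"
      show "ob x \<in> Obj ?S" by (rule obO[OF x])
      note i = cat_idn[OF CS x]
      show "amap P (Idn ?S x) = Idn ?S (ob x)"
      proof (rule Slice_ext[OF hom[OF i] cat_idn[OF CS obO[OF x]]])
        fix e assume e: "e \<in> src (ob x)"
        then obtain a xs where a: "pre A x a xs" "e = ev x a xs" by (auto simp: Z_def)
        have "map (elt_map (Idn ?S x)) xs = xs"
          using a(1) by (intro map_idI) (auto simp: pre_def set_arg)
        thus "elt_map (amap P (Idn ?S x)) e = elt_map (Idn ?S (ob x)) e" using am[OF i a(1)] a(2) e by simp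
      qed
    next
      fix f x y assume f: "f \<in> Hom ?S x y"
      show "amap P f \<in> Hom ?S (ob x) (ob y)" by (rule hom[OF f])
      fix g z assume g: "g \<in> Hom ?S y z"
      show "amap P (Cmp ?S g f) = Cmp ?S (amap P g) (amap P f)"
      proof (rule Slice_ext[OF hom[OF cat_cmp[OF CS f g]] cat_cmp[OF CS hom[OF f] hom[OF g]]])
        fix e assume e: "e \<in> src (ob x)"
        then obtain a xs where a: "pre A x a xs" "e = ev x a xs" by (auto simp: Z_def)
        have m: "map (elt_map (Cmp ?S g f)) xs = map (elt_map g) (map (elt_map f) xs)"
          using a(1) Slice_Cmp[OF f] by (auto simp: pre_def set_arg)
        show "elt_map (amap P (Cmp ?S g f)) e = elt_map (Cmp ?S (amap P g) (amap P f)) e"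
          using am[OF cat_cmp[OF CS f g] a(1)] am[OF f a(1)] am[OF g pre_map[OF a(1) f]] a(2)
            Slice_Cmp[OF hom[OF f] e] by (simp add: m)
      qed
    qed
  next
    fix x a xs assume "pre A x a xs"
    thus "ev x a xs \<in> src (ob x)" unfolding sob by (rule ZI)
  next
    fix x e assume "e \<in> src (ob x)"
    then obtain p where "pre A x (fst p) (snd p)" "e = ev x (fst p) (snd p)" by (auto simp: Z_def)
    thus "\<exists>a xs. pre A x a xs \<and> e = ev x a xs" by blast
  qed (simp_all add: eq dob am)
  thus ?thesis by blast
qed

end

subsection \<open>Identities and composites\<close>

lemma is_sig_mor_id: "is_sig A \<Longrightarrow> is_sig_mor A A (Idn Sets (colours A), \<lambda>n. \<lambda>a \<in> ops A n. a)"
  using cat_idn[OF is_category_Sets, of "colours A"]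
  by (auto simp: is_sig_mor_def is_sig_def Sets_def)

lemma is_sig_mor_comp:
  assumes f: "is_sig_mor A B (u, f)" and g: "is_sig_mor B C (v, g)" and A: "is_sig A"
  shows "is_sig_mor A C (Cmp Sets v u, \<lambda>n. compose (ops A n) (g n) (f n))"
proof -
  note u = sig_mor(1)[OF f] and v = sig_mor(1)[OF g]
  have vu: "dat (Cmp Sets v u) k = dat v (dat u k)" if "k \<in> colours A" for k
    using u that by (simp add: Sets_def Hom_Arr compose_def)
  show ?thesis
    unfolding is_sig_mor_def
  proof (simp only: prod.case, intro conjI allI ballI impI)
    show "Cmp Sets v u \<in> Hom Sets (colours A) (colours C)" by (rule cat_cmp[OF is_category_Sets u v])
    fix n
    show "compose (ops A n) (g n) (f n) \<in> ops A n \<rightarrow>\<^sub>E ops C n"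
      using f g by (auto simp: is_sig_mor_def compose_def PiE_iff)
    fix a assume a: "a \<in> ops A n"
    hence fa: "f n a \<in> ops B n" using f by (auto simp: is_sig_mor_def)
    show "bnd C (n, compose (ops A n) (g n) (f n) a) i = dat (Cmp Sets v u) (bnd A (n, a) i)" if "i \<in> {0..n}" for i
      using sig_mor(4)[OF f, of "(n, a)" i] sig_mor(4)[OF g, of "(n, f n a)" i] a fa that
        vu sig_act(5)[OF A, of "(n, a)" i] by (simp add: compose_def)
    fix \<sigma> assume s: "\<sigma> permutes {1..n}"
    have "act A (n, a) \<sigma> \<in> ops A n" using sig_act(2)[OF A, of "(n, a)" \<sigma>] a s by (simp add: actp_def)
    thus "compose (ops A n) (g n) (f n) (act A (n, a) \<sigma>) = act C (n, compose (ops A n) (g n) (f n) a) \<sigma>"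
      using sig_mor(3)[OF f, of "(n, a)" \<sigma>] sig_mor(3)[OF g, of "(n, f n a)" \<sigma>] a fa s
      by (simp add: compose_def actp_def)
  qed
qed

lemma sig_cmp_simp: "sig_cmp (Arrow B (v, g) C) (Arrow A (u, f) B') =
   Arrow A (Cmp Sets v u, \<lambda>n. compose (ops A n) (g n) (f n)) C"
  by (simp add: sig_cmp_def)

lemma sig_map_laws:
  assumes "is_sig_mor A B (u, f)"
  shows "sig_cmp (Arrow A (u, f) B) (sig_id A) = Arrow A (u, f) B"
    and "sig_cmp (sig_id B) (Arrow A (u, f) B) = Arrow A (u, f) B"
proof -
  note u = sig_mor(1)[OF assms]
  have f: "f n \<in> ops A n \<rightarrow>\<^sub>E ops B n" for n using assms by (simp add: is_sig_mor_def)
  have "compose (ops A n) (f n) (\<lambda>a\<in>ops A n. a) = f n" for n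
    using f[of n] by (auto simp: compose_def PiE_def extensional_def fun_eq_iff)
  moreover have "compose (ops A n) (\<lambda>a\<in>ops B n. a) (f n) = f n" for n
    using f[of n] by (auto simp: compose_def PiE_iff extensional_def fun_eq_iff)
  ultimately show "sig_cmp (Arrow A (u, f) B) (sig_id A) = Arrow A (u, f) B"
    "sig_cmp (sig_id B) (Arrow A (u, f) B) = Arrow A (u, f) B"
    using cat_idr[OF is_category_Sets u] cat_idl[OF is_category_Sets u]
    by (auto simp: sig_id_def sig_cmp_simp)
qed

lemma sig_map_assoc:
  assumes f: "is_sig_mor A B (u, f)" and g: "is_sig_mor B C (v, g)" and h: "is_sig_mor C D (w, h)"
  shows "sig_cmp (Arrow C (w, h) D) (sig_cmp (Arrow B (v, g) C) (Arrow A (u, f) B)) =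
    sig_cmp (sig_cmp (Arrow C (w, h) D) (Arrow B (v, g) C)) (Arrow A (u, f) B)"
proof -
  have "f n \<in> ops A n \<rightarrow>\<^sub>E ops B n" for n using f by (simp add: is_sig_mor_def)
  hence "compose (ops A n) (h n) (compose (ops A n) (g n) (f n)) =
      compose (ops A n) (compose (ops B n) (h n) (g n)) (f n)" for n
    by (auto simp: compose_def PiE_iff fun_eq_iff)
  thus ?thesis
    using cat_assoc[OF is_category_Sets sig_mor(1)[OF f] sig_mor(1)[OF g] sig_mor(1)[OF h]]
    by (simp add: sig_cmp_simp)
qed

lemma is_category_Sig: "is_category (Sig :: ('v sig, 'v sig_map) category)"
  unfolding is_category_def
proof (intro conjI ballI impI)
  fix f g :: "('v sig, 'v sig_map) arrow" assume "f \<in> Arr Sig" "g \<in> Arr Sig" "tgt f = src g"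
  thus "Cmp Sig g f \<in> Hom Sig (src f) (tgt g)"
    by (auto simp: Sig_def Hom_def sig_cmp_simp is_sig_mor_comp)
next
  fix f g h :: "('v sig, 'v sig_map) arrow"
  assume "f \<in> Arr Sig" "g \<in> Arr Sig" "h \<in> Arr Sig" "tgt f = src g" "tgt g = src h"
  thus "Cmp Sig h (Cmp Sig g f) = Cmp Sig (Cmp Sig h g) f"
    by (auto simp: Sig_def sig_map_assoc)
next
  fix a :: "'v sig" assume "a \<in> Obj Sig"
  thus "Idn Sig a \<in> Hom Sig a a" by (auto simp: Sig_def Hom_def sig_id_def is_sig_mor_id)
next
  fix f :: "('v sig, 'v sig_map) arrow" assume "f \<in> Arr Sig"
  thus "Cmp Sig f (Idn Sig (src f)) = f" "Cmp Sig (Idn Sig (tgt f)) f = f"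
    by (auto simp: Sig_def sig_map_laws)
qed (auto simp: Sig_def)

context universe
begin

abbreviation comp_arrow where "comp_arrow \<equiv> presentation_pair.component"

lemma presentation_pairI:
  "presentation (A :: ('v, 'z) sig_scheme) P ev \<Longrightarrow> presentation B R ev' \<Longrightarrow> presentation_pair A P ev B R ev'"
  by (simp add: presentation_pair_def universe_axioms)

lemma component_id:
  assumes p: "presentation (A :: ('v, 'z) sig_scheme) P ev" and x: "x \<in> Obj (Slice (colours A))"
  shows "Cmp (Slice (colours A)) (inv_arrow (Slice (colours A)) (pb_id (colours A) (omap P x)))
      (amap P (pb_id (colours A) x)) =
    comp_arrow A P ev P ev (Idn Sets (colours A)) (\<lambda>n. \<lambda>a \<in> ops A n. a) x" (is "Cmp ?S ?i ?j = ?c")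
proof -
  interpret presentation_pair ty A P ev A P ev by (rule presentation_pairI[OF p p])
  note m = is_sig_mor_id[OF A.sig]
  let ?u = "Idn Sets (colours A)"
  note u = sig_mor(1)[OF m]
  note ux = pb_obj_Obj[OF u x]
  note CS = is_category_Slice[of "colours A"]
  note iP = pb_id_Hom[OF A.P_obj[OF x]] and ix = pb_id_Hom[OF x]
  note jh = A.P_hom[OF ix(1)]
  note ih = Slice_inv(1)[OF iP(1,2)]
  show ?thesis
  proof (rule Slice_ext[OF cat_cmp[OF CS jh ih] component_Hom[OF m x]])
    fix t assume t: "t \<in> src (omap P (pb_obj ?u x))"
    then obtain a zs where a: "pre A (pb_obj ?u x) a zs" "t = ev (pb_obj ?u x) a zs" using A.ev_ex[OF ux] by blast
    have sa: "snd a \<in> ops A (fst a)" using a(1) by (simp add: pre_def)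
    have ma: "mapp (\<lambda>n. \<lambda>a \<in> ops A n. a) a = a" using sa by (simp add: mapp_def)
    have zs: "map (elt_map (pb_id (colours A) x)) zs = map vsnd zs"
      using a(1) ix(3) by (auto simp: pre_def set_arg)
    note p1 = pre_image[OF m x a(1), unfolded ma]
    have b0: "bnd A a 0 \<in> colours A" using sig_act(5)[OF A.sig sa] by simp
    let ?z = "vpair (bnd A a 0, ev x a (map vsnd zs))"
    have z: "?z \<in> src (pb_obj ?u (omap P x))"
      using b0 A.ev_mem[OF x p1] A.ev_dat[OF x p1] by (simp add: Sets_def)
    have "elt_map (Cmp ?S ?i ?j) t = elt_map ?i (elt_map (pb_id (colours A) (omap P x)) ?z)"
      using Slice_Cmp[OF jh t] a(2) A.ev_nat[OF ix(1) a(1)] zs iP(3)[OF z] by simp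
    also have "\<dots> = ?z" using Slice_inv(2)[OF iP(1,2) z] .
    finally show "elt_map (Cmp ?S ?i ?j) t = elt_map ?c t"
      using component_value[OF m x a(1)] a(2) ma by simp
  qed
qed

lemma component_comp:
  assumes pA: "presentation (A :: ('v, 'z) sig_scheme) P ev" and pB: "presentation B R ev'" and pC: "presentation C S ev''"
    and f: "is_sig_mor A B (u, f)" and g: "is_sig_mor B C (v, g)" and x: "x \<in> Obj (Slice (colours C))"
  shows "Cmp (Slice (colours A)) (inv_arrow (Slice (colours A)) (pb_cmp v u (omap S x)))
      (Cmp (Slice (colours A)) (amap (pb u) (comp_arrow B R ev' S ev'' v g x))
        (Cmp (Slice (colours A)) (comp_arrow A P ev R ev' u f (pb_obj v x)) (amap P (pb_cmp v u x)))) =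
    comp_arrow A P ev S ev'' (Cmp Sets v u) (\<lambda>n. compose (ops A n) (g n) (f n)) x"
    (is "Cmp ?S ?i (Cmp ?S ?g (Cmp ?S ?f ?j)) = ?c")
proof -
  interpret AB: presentation_pair ty A P ev B R ev' by (rule presentation_pairI[OF pA pB])
  interpret BC: presentation_pair ty B R ev' C S ev'' by (rule presentation_pairI[OF pB pC])
  interpret AC: presentation_pair ty A P ev C S ev'' by (rule presentation_pairI[OF pA pC])
  let ?h = "\<lambda>n. compose (ops A n) (g n) (f n)" and ?w = "Cmp Sets v u"
  note m = is_sig_mor_comp[OF f g AB.A.sig]
  note u = sig_mor(1)[OF f] and v = sig_mor(1)[OF g] and w = sig_mor(1)[OF m]
  note wx = pb_obj_Obj[OF w x] and vx = pb_obj_Obj[OF v x]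
  note CS = is_category_Slice[of "colours A"]
  note iS = pb_cmp_Hom[OF u v BC.B.P_obj[OF x]] and ix = pb_cmp_Hom[OF u v x]
  note jh = AB.A.P_hom[OF ix(1)]
  note ih = Slice_inv(1)[OF iS(1,2)]
  note fh = AB.component_Hom[OF f vx]
  note g0 = BC.component_Hom[OF g x]
  note gh = pb_hom[OF u g0]
  note fj = cat_cmp[OF CS jh fh]
  note gfj = cat_cmp[OF CS fj gh]
  show ?thesis
  proof (rule Slice_ext[OF cat_cmp[OF CS gfj ih] AC.component_Hom[OF m x]])
    fix t assume t: "t \<in> src (omap P (pb_obj ?w x))"
    then obtain a zs where a: "pre A (pb_obj ?w x) a zs" "t = ev (pb_obj ?w x) a zs" using AB.A.ev_ex[OF wx] by blast
    have sa: "snd a \<in> ops A (fst a)" using a(1) by (auto simp: pre_def)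
    have ma: "mapp ?h a = mapp g (mapp f a)" using sa by (simp add: mapp_def compose_def)
    let ?zs = "map (elt_map (pb_cmp v u x)) zs"
    note p1 = pre_map[OF a(1) ix(1)]
    note p2 = AB.pre_image[OF f vx p1]
    have zs: "map vsnd (map vsnd ?zs) = map vsnd zs"
      using a(1) ix(3) by (auto simp: pre_def set_arg)
    have fb0: "bnd B (mapp f a) 0 = dat u (bnd A a 0)" using sig_mor(4)[OF f sa, of 0] by simp
    let ?z = "vpair (bnd A a 0, ev'' x (mapp ?h a) (map vsnd zs))"
    have z: "?z \<in> src (pb_obj ?w (omap S x))"
      using Slice_elt[OF AC.component_Hom[OF m x] t] AC.component_value[OF m x a(1)] a(2) by simp
    have e1: "elt_map (Cmp ?S ?f ?j) t = vpair (bnd A a 0, ev' (pb_obj v x) (mapp f a) (map vsnd ?zs))"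
      using Slice_Cmp[OF jh t, of "colours A" ?f] a(2) AB.A.ev_nat[OF ix(1) a(1)] AB.component_value[OF f vx p1]
      by simp
    have "elt_map (Cmp ?S ?g (Cmp ?S ?f ?j)) t = vpair (bnd A a 0, vpair (bnd B (mapp f a) 0,
        ev'' x (mapp g (mapp f a)) (map vsnd (map vsnd ?zs))))"
      using Slice_Cmp[OF fj t, of "colours A" ?g] e1 pb_elt[OF g0, of "elt_map (Cmp ?S ?f ?j) t" u] Slice_elt[OF fj t]
        BC.component_value[OF g x p2] by simp
    also have "\<dots> = elt_map (pb_cmp v u (omap S x)) ?z" unfolding zs fb0 ma[symmetric] iS(3)[OF z] by simp
    finally have e2: "elt_map (Cmp ?S ?g (Cmp ?S ?f ?j)) t = elt_map (pb_cmp v u (omap S x)) ?z" .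
    have "elt_map (Cmp ?S ?i (Cmp ?S ?g (Cmp ?S ?f ?j))) t = ?z"
      using Slice_Cmp[OF gfj t, of "colours A" ?i] e2 Slice_inv(2)[OF iS(1,2) z] by simp
    thus "elt_map (Cmp ?S ?i (Cmp ?S ?g (Cmp ?S ?f ?j))) t = elt_map ?c t"
      using AC.component_value[OF m x a(1)] a(2) by simp
  qed
qed

type_synonym ('w, 'z, 'y) key =
  "('w, 'z) sig_scheme \<times> ('w, 'y) anfunc_scheme \<times> ('w fn \<Rightarrow> nat \<times> 'w \<Rightarrow> 'w list \<Rightarrow> 'w)"

definition presents :: "('v, 'z, 'y) key \<Rightarrow> bool" where
  "presents k \<longleftrightarrow> presentation (fst k) (fctr (fst (snd k))) (snd (snd k)) \<and>
     base (fst (snd k)) = colours (fst k)"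

definition an_arrow :: "('v, 'z, 'y) key \<Rightarrow> ('v, 'z, 'y) key \<Rightarrow>
    (('v, 'z) sig_scheme, 'v sig_map) arrow \<Rightarrow> (('v, 'y) anfunc_scheme, 'v an_map) arrow" where
  "an_arrow k k' F = Arrow (fst (snd k))
     (fst (dat F), \<lambda>x \<in> Obj (Slice (base (fst (snd k')))).
        comp_arrow (fst k) (fctr (fst (snd k))) (snd (snd k)) (fctr (fst (snd k'))) (snd (snd k'))
          (fst (dat F)) (snd (dat F)) x)
     (fst (snd k'))"

lemma an_arrow_simp: "an_arrow (A, P, ev) (B, R, ev') (Arrow A' (u, f) B') = Arrow P (u,
    \<lambda>x \<in> Obj (Slice (base R)). comp_arrow A (fctr P) ev (fctr R) ev' u f x) R"
  by (simp add: an_arrow_def)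

lemma is_an_mor_iff:
  assumes "presents (A, P, ev)" "presents (B, R, ev')"
  shows "is_an_mor P R (u, \<phi>) \<longleftrightarrow> (\<exists>f. is_sig_mor A B (u, f) \<and>
     \<phi> = (\<lambda>x \<in> Obj (Slice (base R)). comp_arrow A (fctr P) ev (fctr R) ev' u f x))"
proof -
  have b: "base P = colours A" "base R = colours B"
    and p: "presentation A (fctr P) ev" "presentation B (fctr R) ev'" using assms by (auto simp: presents_def)
  interpret presentation_pair ty A "fctr P" ev B "fctr R" ev' by (rule presentation_pairI[OF p])
  show ?thesis
  proof
    assume "is_an_mor P R (u, \<phi>)"
    hence u: "u \<in> Hom Sets (colours A) (colours B)" and e: "\<phi> \<in> extensional (Obj (Slice (colours B)))"
      and w: "weakly_cartesian (Slice (colours B)) (Slice (colours A)) (fctr P \<bullet> pb u) (pb u \<bullet> fctr R) \<phi>"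
      by (auto simp: is_an_mor_def b)
    from weakly_cartesian_component[OF u w]
    show "\<exists>f. is_sig_mor A B (u, f) \<and>
       \<phi> = (\<lambda>x \<in> Obj (Slice (base R)). comp_arrow A (fctr P) ev (fctr R) ev' u f x)"
      using e by (auto simp: b extensional_def fun_eq_iff)
  next
    assume "\<exists>f. is_sig_mor A B (u, f) \<and>
       \<phi> = (\<lambda>x \<in> Obj (Slice (base R)). comp_arrow A (fctr P) ev (fctr R) ev' u f x)"
    then obtain f where m: "is_sig_mor A B (u, f)"
      and phi: "\<phi> = (\<lambda>x \<in> Obj (Slice (base R)). comp_arrow A (fctr P) ev (fctr R) ev' u f x)" by blast
    show "is_an_mor P R (u, \<phi>)"
      using sig_mor(1)[OF m] component_weakly_cartesian[OF m, of \<phi>] phi by (simp add: is_an_mor_def b)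
  qed
qed

lemma an_arrow_inject:
  assumes "presents (A, P, ev)" "presents (B, R, ev')" "is_sig_mor A B (u, f)" "is_sig_mor A B (u', f')"
    "an_arrow (A, P, ev) (B, R, ev') (Arrow A (u, f) B) = an_arrow (A, P, ev) (B, R, ev') (Arrow A (u', f') B)"
  shows "u = u' \<and> f = f'"
proof -
  have b: "base R = colours B"
    and p: "presentation A (fctr P) ev" "presentation B (fctr R) ev'" using assms by (auto simp: presents_def)
  interpret presentation_pair ty A "fctr P" ev B "fctr R" ev' by (rule presentation_pairI[OF p])
  have u: "u' = u" and "\<And>x. x \<in> Obj (Slice (colours B)) \<Longrightarrow> comp_arrow A (fctr P) ev (fctr R) ev' u f x =
      comp_arrow A (fctr P) ev (fctr R) ev' u f' x"
    using assms(5) by (auto simp: an_arrow_simp b fun_eq_iff restrict_def split: if_splits)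
  thus ?thesis using component_inject[OF assms(3) assms(4)[unfolded u]] by simp
qed

lemma an_arrow_id: "presents (A, P, ev) \<Longrightarrow> an_arrow (A, P, ev) (A, P, ev) (sig_id A) = an_id P"
  using component_id[of A "fctr P" ev]
  by (auto simp: presents_def an_id_def an_arrow_def sig_id_def intro!: restrict_ext)

lemma an_arrow_cmp:
  assumes "presents (A, P, ev)" "presents (B, R, ev')" "presents (C, S, ev'')"
    and f: "is_sig_mor A B (u, f)" and g: "is_sig_mor B C (v, g)"
  shows "an_arrow (A, P, ev) (C, S, ev'') (sig_cmp (Arrow B (v, g) C) (Arrow A (u, f) B)) =
    an_cmp (an_arrow (B, R, ev') (C, S, ev'') (Arrow B (v, g) C)) (an_arrow (A, P, ev) (B, R, ev') (Arrow A (u, f) B))"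
proof -
  have b: "base P = colours A" "base R = colours B" "base S = colours C"
    and p: "presentation A (fctr P) ev" "presentation B (fctr R) ev'" "presentation C (fctr S) ev''"
    using assms by (auto simp: presents_def)
  have "pb_obj v x \<in> Obj (Slice (colours B))" if "x \<in> Obj (Slice (colours C))" for x
    using pb_obj_Obj[OF sig_mor(1)[OF g] that] .
  thus ?thesis
    using component_comp[OF p f g]
    by (auto simp: an_cmp_def Let_def an_arrow_simp sig_cmp_simp b intro!: restrict_ext)
qed

definition An_keys :: "('v, unit, unit) key set" where "An_keys = {k. presents k}"

lemma An_correspondence:
  "correspondence (Sig :: ('v sig, 'v sig_map) category) An An_keys fst (\<lambda>k. fst (snd k)) an_arrow"
proof
  show "is_category (Sig :: ('v sig, 'v sig_map) category)" by (rule is_category_Sig)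
  show "src f \<in> Obj An \<and> tgt f \<in> Obj An" if "f \<in> Arr An" for f :: "('v anfunc, 'v an_map) arrow"
    using that by (auto simp: An_def)
  have sig: "is_sig A" if "presents (A, P, ev)" for A :: "'v sig" and P :: "'v anfunc" and ev
    using that by (auto simp: presents_def presentation_def presentation_axioms_def)
  have anf: "is_anfunc P" if "presents (A, P, ev)" for A :: "'v sig" and P :: "'v anfunc" and ev
    using that sig[OF that] analytic_of_presentation[of A "fctr P" ev]
    by (auto simp: is_anfunc_def presents_def is_sig_def)
  show "fst k \<in> Obj Sig" if "k \<in> An_keys" for k
    using that sig[of "fst k" "fst (snd k)" "snd (snd k)"] by (auto simp: An_keys_def Sig_def)
  show "fst (snd k) \<in> Obj An" if "k \<in> An_keys" for k
    using that anf[of "fst k" "fst (snd k)" "snd (snd k)"] by (auto simp: An_keys_def An_def)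
  show "\<exists>k\<in>An_keys. fst k = A" if "A \<in> Obj Sig" for A
  proof -
    have "is_sig A" using that by (simp add: Sig_def)
    then obtain P ev where "presentation A P ev" using presentation_exists by blast
    hence "(A, \<lparr>base = colours A, fctr = P\<rparr>, ev) \<in> An_keys" by (simp add: An_keys_def presents_def)
    thus ?thesis by force
  qed
  show "\<exists>k\<in>An_keys. fst (snd k) = P" if "P \<in> Obj An" for P
  proof -
    have "analytic (base P) (fctr P)" using that by (simp add: An_def is_anfunc_def)
    then obtain A :: "'v sig" and ev where "presentation A (fctr P) ev" "colours A = base P"
      using presentation_of_analytic by blast
    hence "(A, P, ev) \<in> An_keys" by (simp add: An_keys_def presents_def)
    thus ?thesis by force
  qed
  show "bij_betw (an_arrow k k') (Hom Sig (fst k) (fst k')) (Hom An (fst (snd k)) (fst (snd k')))"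
    if kk: "k \<in> An_keys" "k' \<in> An_keys" for k k'
  proof -
    obtain A P ev B R ev' where k: "k = (A, P, ev)" "k' = (B, R, ev')" using prod_cases3 by metis
    have p: "presents (A, P, ev)" "presents (B, R, ev')" using kk k by (auto simp: An_keys_def)
    note s = sig[OF p(1)] sig[OF p(2)] and a = anf[OF p(1)] anf[OF p(2)]
    have H: "Hom Sig A B = {Arrow A (u, f) B | u f. is_sig_mor A B (u, f)}"
      using s by (auto simp: Hom_def Sig_def)
    have H': "Hom An P R = {Arrow P (u, \<phi>) R | u \<phi>. is_an_mor P R (u, \<phi>)}"
      using a by (auto simp: Hom_def An_def)
    show ?thesis
      unfolding bij_betw_def k fst_conv snd_conv
    proof
      show "inj_on (an_arrow (A, P, ev) (B, R, ev')) (Hom Sig A B)"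
        unfolding H inj_on_def using an_arrow_inject[OF p] by blast
      show "an_arrow (A, P, ev) (B, R, ev') ` Hom Sig A B = Hom An P R"
        unfolding H H' is_an_mor_iff[OF p] by (force simp: an_arrow_simp image_iff)
    qed
  qed
  show "an_arrow k k'' (Cmp Sig g f) = Cmp An (an_arrow k' k'' g) (an_arrow k k' f)"
    if "k \<in> An_keys" "k' \<in> An_keys" "k'' \<in> An_keys" "f \<in> Hom Sig (fst k) (fst k')"
      "g \<in> Hom Sig (fst k') (fst k'')" for k k' k'' f g
    using that an_arrow_cmp[of "fst k" "fst (snd k)" "snd (snd k)" "fst k'" "fst (snd k')" "snd (snd k')"
      "fst k''" "fst (snd k'')" "snd (snd k'')" "fst (dat f)" "snd (dat f)" "fst (dat g)" "snd (dat g)"]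
    by (auto simp: An_keys_def Hom_def Sig_def An_def)
  show "an_arrow k k (Idn Sig (fst k)) = Idn An (fst (snd k))" if "k \<in> An_keys" for k
    using that an_arrow_id[of "fst k" "fst (snd k)" "snd (snd k)"] by (auto simp: An_keys_def Sig_def An_def)
qed

end

section \<open>Multicategory structures and monad structures\<close>

declare split_paired_All [simp del] split_paired_Ex [simp del]

lemma arg_zip: "i \<in> {1..length xs} \<Longrightarrow> length ys = length xs \<Longrightarrow> arg (zip xs ys) i = (arg xs i, arg ys i)"
  by (auto simp: arg_def)

lemma arg_map2_eq: "i \<in> {1..length xs} \<Longrightarrow> length ys = length xs \<Longrightarrow> arg (map2 f xs ys) i = f (arg xs i) (arg ys i)"
  by (auto simp: arg_def)

lemmas arg_map2 = arg_map2_eq arg_zip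

lemma map2_arg_cong:
  assumes "length xs = length xs'" "length ys = length xs" "length ys' = length xs"
    "\<And>i. i \<in> {1..length xs} \<Longrightarrow> f (arg xs i) (arg ys i) = g (arg xs' i) (arg ys' i)"
  shows "map2 f xs ys = map2 g xs' ys'"
  by (rule list_arg_ext) (use assms in \<open>auto simp: arg_map2\<close>)

lemma concat_map2:
  assumes "length xss = length yss" "\<And>i. i \<in> {1..length xss} \<Longrightarrow> length (arg xss i) = length (arg yss i)"
  shows "concat (map2 (map2 f) xss yss) = map2 f (concat xss) (concat yss)"
  using assms
proof (induction xss yss rule: list_induct2)
  case (Cons xs xss ys yss)
  have "length xs = length ys" using Cons.prems[of 1] by (simp add: arg_def)
  moreover have "length (arg xss i) = length (arg yss i)" if "i \<in> {1..length xss}" for i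
    using Cons.prems[of "Suc i"] that by (cases i) (auto simp: arg_def)
  ultimately show ?case using Cons.IH by simp
qed simp

lemma concat_map_concat: "concat (map concat xsss) = concat (concat xsss)"
  by (induction xsss) auto

lemma all_arg_iff: "(\<forall>i < length xs. Q (xs ! i) (ys ! i)) \<longleftrightarrow> (\<forall>i \<in> {1..length xs}. Q (arg xs i) (arg ys i))"
proof
  assume "\<forall>i \<in> {1..length xs}. Q (arg xs i) (arg ys i)"
  hence "Q (xs ! i) (ys ! i)" if "i < length xs" for i
    using that by (auto simp: arg_def dest!: bspec[of _ _ "Suc i"])
  thus "\<forall>i < length xs. Q (xs ! i) (ys ! i)" by blast
qed (auto simp: arg_def)

definition nested :: "('v, 'z) sig_scheme \<Rightarrow> 'v fn \<Rightarrow> nat \<times> 'v \<Rightarrow> (nat \<times> 'v) list \<Rightarrow> 'v list list \<Rightarrow> bool" where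
  "nested A x a bs yss \<longleftrightarrow> snd a \<in> ops A (fst a) \<and> length bs = fst a \<and> length yss = fst a \<and>
     (\<forall>i \<in> {1..fst a}. bnd A (arg bs i) 0 = bnd A a i \<and> pre A x (arg bs i) (arg yss i))"

lemma nested_substitutable: "nested M x a bs yss \<Longrightarrow> substitutable M a bs"
  by (auto simp: nested_def substitutable_def pre_def)

lemma nestedI: "substitutable M a bs \<Longrightarrow> length yss = length bs \<Longrightarrow>
   (\<And>i. i \<in> {1..length bs} \<Longrightarrow> pre M x (arg bs i) (arg yss i)) \<Longrightarrow> nested M x a bs yss"
  by (auto simp: nested_def substitutable_def)

lemma nested_fit:
  assumes "nested A x a bs yss"
  shows "map length yss = map fst bs"
  by (rule list_arg_ext) (use assms in \<open>auto simp: nested_def pre_def arg_map\<close>)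

lemma nested_map:
  assumes n: "nested A x a bs yss" and h: "h \<in> Hom (Slice Q) x y"
  shows "nested A y a bs (map (map (elt_map h)) yss)"
  unfolding nested_def
proof (intro conjI ballI)
  fix i assume i: "i \<in> {1..fst a}"
  show "bnd A (arg bs i) 0 = bnd A a i" using n i by (simp add: nested_def)
  show "pre A y (arg bs i) (arg (map (map (elt_map h)) yss) i)"
    using pre_map[of A x "arg bs i" "arg yss i" h Q y] n i h by (simp add: nested_def arg_map)
qed (use n in \<open>simp_all add: nested_def\<close>)

text \<open>The axioms of a multicategory that only concern boundaries.\<close>

definition typed :: "('v, 'z) multicat_scheme \<Rightarrow> bool" where
  "typed M \<longleftrightarrow> is_sig M \<and>
    (\<forall>c \<in> colours M. ident M c \<in> ops M 1 \<and>
       bnd M (1, ident M c) 0 = c \<and> bnd M (1, ident M c) 1 = c) \<and>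
    (\<forall>a bs. substitutable M a bs \<longrightarrow>
       subst M a bs \<in> ops M (arity_sum bs) \<and>
       bnd M (msubst M a bs) 0 = bnd M a 0 \<and>
       (\<forall>i \<in> {1..fst a}. \<forall>j \<in> {1..fst (arg bs i)}.
          bnd M (msubst M a bs) (pos bs i j) = bnd M (arg bs i) j))"

lemma typed_multicat: "is_multicat M \<Longrightarrow> typed M"
  by (auto simp: is_multicat_def typed_def)

lemma fst_msubst [simp]: "fst (msubst M a bs) = arity_sum bs" by (simp add: msubst_def)

lemma typed_sig: "typed M \<Longrightarrow> is_sig M"
  by (simp add: typed_def)

lemma typed_ident:
  "typed M \<Longrightarrow> c \<in> colours M \<Longrightarrow> ident M c \<in> ops M 1 \<and> bnd M (1, ident M c) 0 = c \<and> bnd M (1, ident M c) 1 = c"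
  by (simp add: typed_def)

lemma typed_msubst:
  assumes "typed M" "substitutable M a bs"
  shows "snd (msubst M a bs) \<in> ops M (arity_sum bs)" "bnd M (msubst M a bs) 0 = bnd M a 0"
    "i \<in> {1..length bs} \<Longrightarrow> j \<in> {1..fst (arg bs i)} \<Longrightarrow> bnd M (msubst M a bs) (pos bs i j) = bnd M (arg bs i) j"
  using assms by (auto simp: typed_def msubst_def substitutable_def)

lemma substitutable_ident:
  assumes "typed M" and a: "snd a \<in> ops M (fst a)"
  shows "substitutable M (1, ident M (bnd M a 0)) [a]"
    "substitutable M a (map (\<lambda>i. (1, ident M (bnd M a i))) [1..<Suc (fst a)])"
proof -
  have "bnd M a i \<in> colours M" if "i \<le> fst a" for i
    using sig_act(5)[OF typed_sig[OF assms(1)] a] that by simp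
  note id = typed_ident[OF assms(1) this]
  show "substitutable M (1, ident M (bnd M a 0)) [a]"
    using id[of 0] a by (simp add: substitutable_def arg_def)
  show "substitutable M a (map (\<lambda>i. (1, ident M (bnd M a i))) [1..<Suc (fst a)])"
    using id a by (simp add: substitutable_def arg_upt_simps del: upt_Suc)
qed

lemma substitutable_assoc:
  assumes M: "typed M" and s: "substitutable M a bs" and l: "length css = length bs"
    and si: "\<And>i. i \<in> {1..length bs} \<Longrightarrow> substitutable M (arg bs i) (arg css i)"
  shows "map length css = map fst bs" "substitutable M a (map2 (msubst M) bs css)"
    "substitutable M (msubst M a bs) (concat css)"
proof -
  have la: "length bs = fst a" using s by (simp add: substitutable_def)
  show fit: "map length css = map fst bs"
    by (rule list_arg_ext) (use l si in \<open>auto simp: substitutable_def arg_map\<close>)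
  show "substitutable M a (map2 (msubst M) bs css)"
    using s l la typed_msubst(1,2)[OF M si] by (auto simp: substitutable_def[of M a] arg_map2)
  show "substitutable M (msubst M a bs) (concat css)"
    unfolding substitutable_def
  proof (intro conjI ballI)
    show "snd (msubst M a bs) \<in> ops M (fst (msubst M a bs))" using typed_msubst(1)[OF M s] by simp
    show "length (concat css) = fst (msubst M a bs)" using length_concat_blocks[OF fit] by simp
    fix p assume "p \<in> {1..fst (msubst M a bs)}"
    hence "p \<in> {1..arity_sum bs}" by simp
    then obtain i j where ij: "i \<in> {1..length bs}" "j \<in> {1..fst (arg bs i)}" "p = pos bs i j" by (rule pos_surj)
    thus "snd (arg (concat css) p) \<in> ops M (fst (arg (concat css) p))"
      "bnd M (arg (concat css) p) 0 = bnd M (msubst M a bs) p"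
      using arg_concat_pos[OF fit ij(1,2)] si[OF ij(1)] typed_msubst(3)[OF M s ij(1,2)]
      by (auto simp: substitutable_def)
  qed
qed

lemma substitutable_outer:
  assumes A: "is_sig M" and s: "substitutable M a bs" and sg: "\<sigma> permutes {1..fst a}"
  shows "substitutable M (actp M a \<sigma>) (permute_args bs \<sigma>)"
proof -
  have "\<sigma> i \<in> {1..fst a}" if "i \<in> {1..fst a}" for i using permutes_in_image[OF sg] that by blast
  thus ?thesis using s sig_act(2,3)[OF A _ sg] by (auto simp: substitutable_def arg_permute_args)
qed

lemma substitutable_inner:
  assumes A: "is_sig M" and s: "substitutable M a bs"
    and t: "\<And>i. i \<in> {1..fst a} \<Longrightarrow> \<tau> i permutes {1..fst (arg bs i)}"
  shows "substitutable M a (map (\<lambda>i. actp M (arg bs i) (\<tau> i)) [1..<Suc (fst a)])"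
    "arity_sum (map (\<lambda>i. actp M (arg bs i) (\<tau> i)) [1..<Suc (fst a)]) = arity_sum bs"
proof -
  let ?bs = "map (\<lambda>i. actp M (arg bs i) (\<tau> i)) [1..<Suc (fst a)]"
  have "snd (arg bs i) \<in> ops M (fst (arg bs i))" "bnd M (arg bs i) 0 = bnd M a i" if "i \<in> {1..fst a}" for i
    using s that by (auto simp: substitutable_def)
  thus "substitutable M a ?bs"
    using s t sig_act(2)[OF A] sig_act_0[OF A] by (simp add: substitutable_def arg_upt_simps del: upt_Suc)
  have "map fst ?bs = map fst bs"
    by (rule list_arg_ext) (use s in \<open>auto simp: substitutable_def arg_map[of _ bs fst] arg_upt_simps comp_def simp del: upt_Suc\<close>)
  thus "arity_sum ?bs = arity_sum bs" by (simp only: arity_sum_def)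
qed

lemma is_multicatI:
  assumes M: "typed M"
    and units: "\<And>a. snd a \<in> ops M (fst a) \<Longrightarrow> msubst M (1, ident M (bnd M a 0)) [a] = a"
      "\<And>a. snd a \<in> ops M (fst a) \<Longrightarrow> msubst M a (map (\<lambda>i. (1, ident M (bnd M a i))) [1..<Suc (fst a)]) = a"
    and assoc: "\<And>a bs css. substitutable M a bs \<Longrightarrow> length css = length bs \<Longrightarrow>
      (\<And>i. i \<in> {1..length bs} \<Longrightarrow> substitutable M (arg bs i) (arg css i)) \<Longrightarrow>
      msubst M a (map2 (msubst M) bs css) = msubst M (msubst M a bs) (concat css)"
    and outer: "\<And>a bs \<sigma> \<rho>. substitutable M a bs \<Longrightarrow> \<sigma> permutes {1..fst a} \<Longrightarrow> \<rho> permutes {1..arity_sum bs} \<Longrightarrow>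
      (\<And>i j. i \<in> {1..fst a} \<Longrightarrow> j \<in> {1..fst (arg bs (\<sigma> i))} \<Longrightarrow> \<rho> (pos (permute_args bs \<sigma>) i j) = pos bs (\<sigma> i) j) \<Longrightarrow>
      msubst M (actp M a \<sigma>) (permute_args bs \<sigma>) = actp M (msubst M a bs) \<rho>"
    and inner: "\<And>a bs \<tau> \<rho>. substitutable M a bs \<Longrightarrow> (\<And>i. i \<in> {1..fst a} \<Longrightarrow> \<tau> i permutes {1..fst (arg bs i)}) \<Longrightarrow>
      \<rho> permutes {1..arity_sum bs} \<Longrightarrow>
      (\<And>i j. i \<in> {1..fst a} \<Longrightarrow> j \<in> {1..fst (arg bs i)} \<Longrightarrow> \<rho> (pos bs i j) = pos bs i (\<tau> i j)) \<Longrightarrow>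
      msubst M a (map (\<lambda>i. actp M (arg bs i) (\<tau> i)) [1..<Suc (fst a)]) = actp M (msubst M a bs) \<rho>"
  shows "is_multicat M"
  unfolding is_multicat_def
proof (intro conjI)
  show "\<forall>n. \<forall>a \<in> ops M n. msubst M (1, ident M (bnd M (n, a) 0)) [(n, a)] = (n, a) \<and>
      msubst M (n, a) (map (\<lambda>i. (1, ident M (bnd M (n, a) i))) [1..<Suc n]) = (n, a)"
    using units[of "(n, a)" for n a] by (simp del: upt_Suc)
  show "\<forall>a bs css. substitutable M a bs \<longrightarrow> length css = length bs \<longrightarrow>
      (\<forall>i < length bs. substitutable M (bs ! i) (css ! i)) \<longrightarrow>
      msubst M a (map2 (msubst M) bs css) = msubst M (msubst M a bs) (concat css)"
    unfolding all_arg_iff using assoc by blast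
  show "\<forall>n a bs \<sigma> \<rho>. substitutable M (n, a) bs \<longrightarrow> \<sigma> permutes {1..n} \<longrightarrow> \<rho> permutes {1..arity_sum bs} \<longrightarrow>
      (\<forall>i \<in> {1..n}. \<forall>j \<in> {1..fst (arg bs (\<sigma> i))}. \<rho> (pos (permute_args bs \<sigma>) i j) = pos bs (\<sigma> i) j) \<longrightarrow>
      subst M (n, act M (n, a) \<sigma>) (permute_args bs \<sigma>) = act M (msubst M (n, a) bs) \<rho>"
    using outer[of "(n, a)" for n a] by (simp add: actp_def msubst_def)
  show "\<forall>n a bs \<tau> \<rho>. substitutable M (n, a) bs \<longrightarrow> (\<forall>i \<in> {1..n}. \<tau> i permutes {1..fst (arg bs i)}) \<longrightarrow>
      \<rho> permutes {1..arity_sum bs} \<longrightarrow>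
      (\<forall>i \<in> {1..n}. \<forall>j \<in> {1..fst (arg bs i)}. \<rho> (pos bs i j) = pos bs i (\<tau> i j)) \<longrightarrow>
      subst M (n, a) (map (\<lambda>i. (fst (arg bs i), act M (arg bs i) (\<tau> i))) [1..<Suc n]) = act M (msubst M (n, a) bs) \<rho>"
    using inner[of "(n, a)" for n a] by (simp add: actp_def msubst_def del: upt_Suc)
qed (use M in \<open>auto simp: typed_def\<close>)

lemma multicat_units:
  assumes "is_multicat M" "snd a \<in> ops M (fst a)"
  shows "msubst M (1, ident M (bnd M a 0)) [a] = a"
    "msubst M a (map (\<lambda>i. (1, ident M (bnd M a i))) [1..<Suc (fst a)]) = a"
proof -
  have "\<forall>n. \<forall>a \<in> ops M n. msubst M (1, ident M (bnd M (n, a) 0)) [(n, a)] = (n, a) \<and>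
       msubst M (n, a) (map (\<lambda>i. (1, ident M (bnd M (n, a) i))) [1..<Suc n]) = (n, a)"
    using assms(1) unfolding is_multicat_def by blast
  from this[rule_format, of "snd a" "fst a"] assms(2)
  show "msubst M (1, ident M (bnd M a 0)) [a] = a"
    "msubst M a (map (\<lambda>i. (1, ident M (bnd M a i))) [1..<Suc (fst a)]) = a"
    by (simp_all del: upt_Suc)
qed

lemma multicat_assoc:
  assumes "is_multicat M" "substitutable M a bs" "length css = length bs"
    "\<And>i. i \<in> {1..length bs} \<Longrightarrow> substitutable M (arg bs i) (arg css i)"
  shows "msubst M a (map2 (msubst M) bs css) = msubst M (msubst M a bs) (concat css)"
proof -
  have "\<forall>i < length bs. substitutable M (bs ! i) (css ! i)" unfolding all_arg_iff using assms(4) by blast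
  thus ?thesis using assms(1-3) unfolding is_multicat_def by blast
qed

lemma multicat_outer:
  assumes "is_multicat M" "substitutable M a bs" "\<sigma> permutes {1..fst a}" "\<rho> permutes {1..arity_sum bs}"
    "\<And>i j. i \<in> {1..fst a} \<Longrightarrow> j \<in> {1..fst (arg bs (\<sigma> i))} \<Longrightarrow> \<rho> (pos (permute_args bs \<sigma>) i j) = pos bs (\<sigma> i) j"
  shows "msubst M (actp M a \<sigma>) (permute_args bs \<sigma>) = actp M (msubst M a bs) \<rho>"
proof -
  have "subst M (fst a, act M (fst a, snd a) \<sigma>) (permute_args bs \<sigma>) = act M (msubst M (fst a, snd a) bs) \<rho>"
    by (rule is_multicat_def[THEN iffD1, OF assms(1), THEN conjunct2, THEN conjunct2, THEN conjunct2,
      THEN conjunct2, THEN conjunct2, THEN conjunct1, rule_format]) (use assms in simp_all)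
  moreover have "\<sigma> permutes {1..length bs}" using assms(2,3) by (simp add: substitutable_def)
  hence "arity_sum (permute_args bs \<sigma>) = arity_sum bs" using block_permutation[of \<sigma> bs] by metis
  ultimately show ?thesis by (simp add: actp_def msubst_def)
qed

lemma multicat_inner:
  assumes "is_multicat M" "substitutable M a bs" "\<And>i. i \<in> {1..fst a} \<Longrightarrow> \<tau> i permutes {1..fst (arg bs i)}"
    "\<rho> permutes {1..arity_sum bs}"
    "\<And>i j. i \<in> {1..fst a} \<Longrightarrow> j \<in> {1..fst (arg bs i)} \<Longrightarrow> \<rho> (pos bs i j) = pos bs i (\<tau> i j)"
  shows "msubst M a (map (\<lambda>i. actp M (arg bs i) (\<tau> i)) [1..<Suc (fst a)]) = actp M (msubst M a bs) \<rho>"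
proof -
  have "subst M (fst a, snd a) (map (\<lambda>i. (fst (arg bs i), act M (arg bs i) (\<tau> i))) [1..<Suc (fst a)]) =
      act M (msubst M (fst a, snd a) bs) \<rho>"
    by (rule is_multicat_def[THEN iffD1, OF assms(1), THEN conjunct2, THEN conjunct2, THEN conjunct2,
      THEN conjunct2, THEN conjunct2, THEN conjunct2, rule_format]) (use assms in simp_all)
  thus ?thesis
    using substitutable_inner(2)[OF typed_sig[OF typed_multicat[OF assms(1)]] assms(2,3)]
    by (simp add: actp_def msubst_def del: upt_Suc)
qed

lemma nested_concat:
  assumes M: "typed M" and n: "nested M x a bs yss"
  shows "pre M x (msubst M a bs) (concat yss)"
proof -
  note s = nested_substitutable[OF n] and fit = nested_fit[OF n]
  have T: "subst M a bs \<in> ops M (arity_sum bs)"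
    "\<And>i j. i \<in> {1..fst a} \<Longrightarrow> j \<in> {1..fst (arg bs i)} \<Longrightarrow> bnd M (msubst M a bs) (pos bs i j) = bnd M (arg bs i) j"
    using M s by (auto simp: typed_def)
  have len: "length bs = fst a" using n by (simp add: nested_def)
  show ?thesis
    unfolding pre_def
  proof (intro conjI ballI)
    show "snd (msubst M a bs) \<in> ops M (fst (msubst M a bs))" using T by (simp add: msubst_def)
    show "length (concat yss) = fst (msubst M a bs)" using length_concat_blocks[OF fit] by simp
    fix p assume "p \<in> {1..fst (msubst M a bs)}"
    hence "p \<in> {1..arity_sum bs}" by simp
    then obtain i j where ij: "i \<in> {1..length bs}" "j \<in> {1..fst (arg bs i)}" "p = pos bs i j"
      by (rule pos_surj)
    have "pre M x (arg bs i) (arg yss i)" using n ij(1) len by (simp add: nested_def)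
    thus "arg (concat yss) p \<in> src x" "dat x (arg (concat yss) p) = bnd M (msubst M a bs) p"
      using arg_concat_pos[OF fit ij(1,2)] T(2)[of i j] ij len by (auto simp: pre_def)
  qed
qed

lemma nested_split:
  assumes M: "typed M" and s: "substitutable M a bs" and p: "pre M x (msubst M a bs) xs"
  obtains yss where "nested M x a bs yss" "xs = concat yss"
proof -
  have "length xs = arity_sum bs" using p by (simp add: pre_def)
  then obtain yss where y: "xs = concat yss" "map length yss = map fst bs" by (rule blocks_exist)
  have la: "length bs = fst a" using s by (simp add: substitutable_def)
  have ly: "length yss = length bs" using map_eq_imp_length_eq[OF y(2)] .
  have "pre M x (arg bs i) (arg yss i)" if i: "i \<in> {1..length bs}" for i
    unfolding pre_def
  proof (intro conjI ballI)
    show "snd (arg bs i) \<in> ops M (fst (arg bs i))" using s i la by (simp add: substitutable_def)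
    show "length (arg yss i) = fst (arg bs i)"
      using arg_cong[OF y(2), of "\<lambda>l. arg l i"] i ly by (simp add: arg_map)
    fix j assume j: "j \<in> {1..fst (arg bs i)}"
    have "arg (arg yss i) j = arg xs (pos bs i j)" using arg_concat_pos[OF y(2) i j] y(1) by simp
    moreover have "bnd M (msubst M a bs) (pos bs i j) = bnd M (arg bs i) j"
      using M s i j la by (auto simp: typed_def)
    ultimately show "arg (arg yss i) j \<in> src x" "dat x (arg (arg yss i) j) = bnd M (arg bs i) j"
      using p pos_range[OF i j] by (auto simp: pre_def)
  qed
  hence "nested M x a bs yss" using nestedI[OF s ly] by blast
  thus ?thesis using that y(1) by simp
qed

lemma nested_permute:
  assumes A: "is_sig A" and n: "nested A x a bs yss" and s: "\<sigma> permutes {1..fst a}"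
  shows "nested A x (actp A a \<sigma>) (permute_args bs \<sigma>) (permute_args yss \<sigma>)"
    and "map2 f (permute_args bs \<sigma>) (permute_args yss \<sigma>) = permute_args (map2 f bs yss) \<sigma>"
proof -
  have l: "length bs = fst a" "length yss = fst a" and sa: "snd a \<in> ops A (fst a)" using n by (auto simp: nested_def)
  have si: "\<sigma> i \<in> {1..fst a}" if "i \<in> {1..fst a}" for i using permutes_in_image[OF s] that by blast
  show "nested A x (actp A a \<sigma>) (permute_args bs \<sigma>) (permute_args yss \<sigma>)"
    using n sig_act(2,3)[OF A sa s] l si by (auto simp: nested_def arg_permute_args)
  show "map2 f (permute_args bs \<sigma>) (permute_args yss \<sigma>) = permute_args (map2 f bs yss) \<sigma>"
    by (rule list_arg_ext) (use l si in \<open>auto simp: arg_map2 arg_permute_args\<close>)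
qed

context presentation
begin

lemma nested_ev:
  assumes x: "x \<in> Obj (Slice (colours A))" and n: "nested A x a bs yss"
  shows "pre A (omap P x) a (map2 (ev x) bs yss)"
  using n ev_mem[OF x] ev_dat[OF x] by (auto simp: nested_def pre_def[of A "omap P x"] arg_map2)

lemma nested_ex:
  assumes x: "x \<in> Obj (Slice (colours A))" and p: "pre A (omap P x) a es"
  obtains bs yss where "nested A x a bs yss" "es = map2 (ev x) bs yss"
proof -
  have "\<exists>b ys. pre A x b ys \<and> arg es i = ev x b ys" if "i \<in> {1..fst a}" for i
  proof -
    have "arg es i \<in> src (omap P x)" using p that unfolding pre_def by blast
    thus ?thesis by (rule ev_ex[OF x])
  qed
  then obtain b ys where b: "\<And>i. i \<in> {1..fst a} \<Longrightarrow> pre A x (b i) (ys i) \<and> arg es i = ev x (b i) (ys i)" by metis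
  let ?bs = "map b [1..<Suc (fst a)]" and ?yss = "map ys [1..<Suc (fst a)]"
  have l: "length ?bs = fst a" "length ?yss = fst a" by (simp_all del: upt_Suc)
  have g: "arg ?bs i = b i" "arg ?yss i = ys i" if "i \<in> {1..fst a}" for i by (rule arg_upt[OF that])+
  have d: "bnd A (b i) 0 = bnd A a i" if i: "i \<in> {1..fst a}" for i
  proof -
    have "dat (omap P x) (arg es i) = bnd A a i" using p i unfolding pre_def by blast
    thus ?thesis using b[OF i] ev_dat[OF x, of "b i" "ys i"] by simp
  qed
  have n: "nested A x a ?bs ?yss" using p l g b d by (simp add: nested_def pre_def[of A "omap P x"] del: upt_Suc)
  have "es = map2 (ev x) ?bs ?yss"
  proof (rule list_arg_ext)
    show "length es = length (map2 (ev x) ?bs ?yss)" using p l by (simp add: pre_def del: upt_Suc)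
    fix i assume "i \<in> {1..length es}"
    hence i: "i \<in> {1..fst a}" using p by (simp add: pre_def)
    show "arg es i = arg (map2 (ev x) ?bs ?yss) i"
      using arg_map2_eq[of i ?bs ?yss "ev x"] i l g[OF i] b[OF i] by (simp del: upt_Suc)
  qed
  with n show ?thesis by (rule that)
qed

lemma map_P_nested:
  assumes h: "h \<in> Hom (Slice (colours A)) x y" and n: "nested A x a bs yss"
  shows "map (elt_map (amap P h)) (map2 (ev x) bs yss) = map2 (ev y) bs (map (map (elt_map h)) yss)"
  by (rule list_arg_ext)
    (use n ev_nat[OF h] in \<open>auto simp: nested_def arg_map arg_map2\<close>)

end

locale induced = presentation ty M "fctr T" ev
  for ty :: "'v itself" and M :: "('v, 'z) multicat_scheme" and T :: "('v, 'y) anmonad_scheme" and ev +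
  assumes typed: "typed M" and base: "base T = colours M"
    and eta_Hom: "\<And>x. x \<in> Obj (Slice (colours M)) \<Longrightarrow> eta T x \<in> Hom (Slice (colours M)) x (omap (fctr T) x)"
    and mu_Hom: "\<And>x. x \<in> Obj (Slice (colours M)) \<Longrightarrow>
      mu T x \<in> Hom (Slice (colours M)) (omap (fctr T) (omap (fctr T) x)) (omap (fctr T) x)"
    and eta_value: "\<And>x e. x \<in> Obj (Slice (colours M)) \<Longrightarrow> e \<in> src x \<Longrightarrow>
      elt_map (eta T x) e = ev x (1, ident M (dat x e)) [e]"
    and mu_value: "\<And>x a bs yss. x \<in> Obj (Slice (colours M)) \<Longrightarrow> nested M x a bs yss \<Longrightarrow>
      elt_map (mu T x) (ev (omap (fctr T) x) a (map2 (ev x) bs yss)) = ev x (msubst M a bs) (concat yss)"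
begin

abbreviation "S \<equiv> Slice (colours M)"
abbreviation "P \<equiv> fctr T"

lemma S: "is_category S" by (rule is_category_Slice)

lemma sub_bnd: "substitutable M a bs \<Longrightarrow> bnd M (msubst M a bs) 0 = bnd M a 0"
  by (rule typed_msubst(2)[OF typed])

lemma sub_op: "substitutable M a bs \<Longrightarrow> snd (msubst M a bs) \<in> ops M (arity_sum bs)"
  by (rule typed_msubst(1)[OF typed])

lemma ident_op: "c \<in> colours M \<Longrightarrow> ident M c \<in> ops M 1 \<and> bnd M (1, ident M c) 0 = c \<and> bnd M (1, ident M c) 1 = c"
  by (rule typed_ident[OF typed])

lemma x_dat: "x \<in> Obj S \<Longrightarrow> e \<in> src x \<Longrightarrow> dat x e \<in> colours M"
  by (auto simp: Slice_Obj)

lemma pre_ident: "x \<in> Obj S \<Longrightarrow> e \<in> src x \<Longrightarrow> pre M x (1, ident M (dat x e)) [e]"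
  using ident_op[OF x_dat[of x e]] by (auto simp: pre_def arg_def)

lemma nested_ident_outer:
  assumes p: "pre M x a xs"
  shows "nested M x (1, ident M (bnd M a 0)) [a] [xs]"
proof -
  have "bnd M a 0 \<in> colours M" using p sig_act(5)[OF sig, of a 0] by (simp add: pre_def)
  thus ?thesis using ident_op[of "bnd M a 0"] p by (auto simp: nested_def arg_def)
qed

lemma nested_ident_inner:
  assumes x: "x \<in> Obj S" and p: "pre M x a xs"
  shows "nested M x a (map (\<lambda>i. (1, ident M (bnd M a i))) [1..<Suc (fst a)]) (map (\<lambda>e. [e]) xs)"
    and "map (elt_map (eta T x)) xs =
       map2 (ev x) (map (\<lambda>i. (1, ident M (bnd M a i))) [1..<Suc (fst a)]) (map (\<lambda>e. [e]) xs)"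
proof -
  let ?bs = "map (\<lambda>i. (1 :: nat, ident M (bnd M a i))) [1..<Suc (fst a)]"
  have lb: "length ?bs = fst a" and lx: "length xs = fst a" using p by (auto simp: pre_def simp del: upt_Suc)
  have ab: "arg ?bs i = (1, ident M (bnd M a i))" if "i \<in> {1..fst a}" for i by (rule arg_upt[OF that])
  have xi: "arg xs i \<in> src x" "dat x (arg xs i) = bnd M a i" if "i \<in> {1..fst a}" for i
    using p that by (auto simp: pre_def)
  have pi: "pre M x (1, ident M (bnd M a i)) [arg xs i]" "bnd M (1, ident M (bnd M a i)) 0 = bnd M a i"
    if i: "i \<in> {1..fst a}" for i
    using pre_ident[OF x xi(1)[OF i]] xi(2)[OF i] ident_op[OF x_dat[OF x xi(1)[OF i]]] by auto
  show "nested M x a ?bs (map (\<lambda>e. [e]) xs)"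
    unfolding nested_def using p lb lx ab pi by (auto simp: pre_def[of M x a] arg_map simp del: upt_Suc)
  show "map (elt_map (eta T x)) xs = map2 (ev x) ?bs (map (\<lambda>e. [e]) xs)"
  proof (rule list_arg_ext)
    show "length (map (elt_map (eta T x)) xs) = length (map2 (ev x) ?bs (map (\<lambda>e. [e]) xs))"
      using lb lx by (simp del: upt_Suc)
    fix i assume "i \<in> {1..length (map (elt_map (eta T x)) xs)}"
    hence i: "i \<in> {1..fst a}" using lx by simp
    have i': "i \<in> {1..length xs}" and i'': "i \<in> {1..length ?bs}" using i lx lb by (auto simp del: upt_Suc)
    show "arg (map (elt_map (eta T x)) xs) i = arg (map2 (ev x) ?bs (map (\<lambda>e. [e]) xs)) i"
      unfolding arg_map[OF i'] using arg_map2_eq[OF i'', of "map (\<lambda>e. [e]) xs" "ev x"] lb lx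
        eta_value[OF x xi(1)[OF i]] xi(2)[OF i] ab[OF i] arg_map[OF i', of "\<lambda>e. [e]"]
      by (simp del: upt_Suc)
  qed
qed

lemma nested_triple:
  assumes x: "x \<in> Obj S" and s: "substitutable M a bs" and l: "length css = length bs" "length zsss = length bs"
    and n: "\<And>i. i \<in> {1..length bs} \<Longrightarrow> nested M x (arg bs i) (arg css i) (arg zsss i)"
  shows "nested M (omap P x) a bs (map2 (map2 (ev x)) css zsss)"
    and "nested M x a (map2 (msubst M) bs css) (map concat zsss)"
    and "nested M x (msubst M a bs) (concat css) (concat zsss)"
    and "concat (map2 (map2 (ev x)) css zsss) = map2 (ev x) (concat css) (concat zsss)"
proof -
  have la: "length bs = fst a" using s by (simp add: substitutable_def)
  show 1: "nested M (omap P x) a bs (map2 (map2 (ev x)) css zsss)"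
    by (rule nestedI[OF s]) (use l nested_ev[OF x n] in \<open>auto simp: arg_map2\<close>)
  show "concat (map2 (map2 (ev x)) css zsss) = map2 (ev x) (concat css) (concat zsss)"
    by (rule concat_map2) (use l n in \<open>auto simp: nested_def\<close>)
  have si: "substitutable M (arg bs i) (arg css i)" if "i \<in> {1..length bs}" for i
    using nested_substitutable[OF n[OF that]] .
  show "nested M x a (map2 (msubst M) bs css) (map concat zsss)"
  proof (rule nestedI)
    show "substitutable M a (map2 (msubst M) bs css)"
      using s l la sub_op[OF si] sub_bnd[OF si] by (auto simp: substitutable_def[of M a] arg_map2)
    show "length (map concat zsss) = length (map2 (msubst M) bs css)" using l by simp
    fix i assume "i \<in> {1..length (map2 (msubst M) bs css)}"
    hence i: "i \<in> {1..length bs}" using l by simp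
    thus "pre M x (arg (map2 (msubst M) bs css) i) (arg (map concat zsss) i)"
      using nested_concat[OF typed n[OF i]] l by (simp add: arg_map2 arg_map)
  qed
  have fit: "map length css = map fst bs"
    by (rule list_arg_ext) (use l n in \<open>auto simp: nested_def arg_map\<close>)
  have fit': "map length zsss = map fst bs"
    by (rule list_arg_ext) (use l n in \<open>auto simp: nested_def arg_map\<close>)
  have B: "bnd M (msubst M a bs) (pos bs i j) = bnd M (arg bs i) j"
    if "i \<in> {1..fst a}" "j \<in> {1..fst (arg bs i)}" for i j
    using typed s that by (auto simp: typed_def)
  show "nested M x (msubst M a bs) (concat css) (concat zsss)"
    unfolding nested_def
  proof (intro conjI ballI)
    show "snd (msubst M a bs) \<in> ops M (fst (msubst M a bs))" using sub_op[OF s] by simp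
    show "length (concat css) = fst (msubst M a bs)" "length (concat zsss) = fst (msubst M a bs)"
      using length_concat_blocks[OF fit] length_concat_blocks[OF fit'] by auto
    fix p assume "p \<in> {1..fst (msubst M a bs)}"
    hence "p \<in> {1..arity_sum bs}" by simp
    then obtain i j where ij: "i \<in> {1..length bs}" "j \<in> {1..fst (arg bs i)}" "p = pos bs i j"
      by (rule pos_surj)
    show "bnd M (arg (concat css) p) 0 = bnd M (msubst M a bs) p"
      "pre M x (arg (concat css) p) (arg (concat zsss) p)"
      using arg_concat_pos[OF fit ij(1,2)] arg_concat_pos[OF fit' ij(1,2)] B[of i j] n[OF ij(1)] ij la
      by (auto simp: nested_def)
  qed
qed

lemma triple_value:
  assumes x: "x \<in> Obj S" and s: "substitutable M a bs" and l: "length css = length bs" "length zsss = length bs"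
    and n: "\<And>i. i \<in> {1..length bs} \<Longrightarrow> nested M x (arg bs i) (arg css i) (arg zsss i)"
  defines "t \<equiv> ev (omap P (omap P x)) a (map2 (ev (omap P x)) bs (map2 (map2 (ev x)) css zsss))"
  shows "t \<in> src (omap P (omap P (omap P x)))"
    and "elt_map (mu T x) (elt_map (mu T (omap P x)) t) =
      ev x (msubst M (msubst M a bs) (concat css)) (concat (concat zsss))"
    and "elt_map (mu T x) (elt_map (amap P (mu T x)) t) =
      ev x (msubst M a (map2 (msubst M) bs css)) (concat (concat zsss))"
proof -
  note N = nested_triple[OF x s l n]
  note Px = P_obj[OF x]
  note PPx = P_obj[OF Px]
  show "t \<in> src (omap P (omap P (omap P x)))"
    unfolding t_def by (rule ev_mem[OF PPx nested_ev[OF Px N(1)]])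
  show "elt_map (mu T x) (elt_map (mu T (omap P x)) t) =
      ev x (msubst M (msubst M a bs) (concat css)) (concat (concat zsss))"
    using mu_value[OF Px N(1)] mu_value[OF x N(3)] N(4) by (simp add: t_def)
  have "map (elt_map (mu T x)) (map2 (ev (omap P x)) bs (map2 (map2 (ev x)) css zsss)) =
      map2 (ev x) (map2 (msubst M) bs css) (map concat zsss)"
    by (rule list_arg_ext) (use l mu_value[OF x n] in \<open>auto simp: arg_map arg_map2\<close>)
  hence "elt_map (amap P (mu T x)) t = ev (omap P x) a (map2 (ev x) (map2 (msubst M) bs css) (map concat zsss))"
    unfolding t_def using ev_nat[OF mu_Hom[OF x] nested_ev[OF Px N(1)]] by simp
  thus "elt_map (mu T x) (elt_map (amap P (mu T x)) t) =
      ev x (msubst M a (map2 (msubst M) bs css)) (concat (concat zsss))"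
    using mu_value[OF x N(2)] by (simp add: concat_map_concat)
qed

lemma nested_choice:
  assumes x: "x \<in> Obj S" and s: "substitutable M a bs" "length ess = length bs"
    and p: "\<And>i. i \<in> {1..length bs} \<Longrightarrow> pre M (omap P x) (arg bs i) (arg ess i)"
  obtains css zsss where "length css = length bs" "length zsss = length bs"
    "\<And>i. i \<in> {1..length bs} \<Longrightarrow> nested M x (arg bs i) (arg css i) (arg zsss i)"
    "ess = map2 (map2 (ev x)) css zsss"
proof -
  have "\<exists>cs zss. nested M x (arg bs i) cs zss \<and> arg ess i = map2 (ev x) cs zss" if "i \<in> {1..length bs}" for i
    using nested_ex[OF x p[OF that]] by blast
  then obtain c z where cz: "\<And>i. i \<in> {1..length bs} \<Longrightarrow> nested M x (arg bs i) (c i) (z i) \<and>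
      arg ess i = map2 (ev x) (c i) (z i)" by metis
  let ?c = "map c [1..<Suc (length bs)]" and ?z = "map z [1..<Suc (length bs)]"
  have l: "length ?c = length bs" "length ?z = length bs" by (simp_all del: upt_Suc)
  have g: "arg ?c i = c i" "arg ?z i = z i" if "i \<in> {1..length bs}" for i by (rule arg_upt[OF that])+
  show ?thesis
  proof (rule that[OF l])
    fix i assume i: "i \<in> {1..length bs}"
    show "nested M x (arg bs i) (arg ?c i) (arg ?z i)" unfolding g[OF i] using cz[OF i] by blast
  next
    show "ess = map2 (map2 (ev x)) ?c ?z"
    proof (rule list_arg_ext)
      show "length ess = length (map2 (map2 (ev x)) ?c ?z)" using s(2) l by (simp del: upt_Suc)
      fix i assume "i \<in> {1..length ess}"
      hence i: "i \<in> {1..length bs}" using s(2) by simp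
      show "arg ess i = arg (map2 (map2 (ev x)) ?c ?z) i"
        using arg_map2_eq[of i ?c ?z "map2 (ev x)"] i l g[OF i] cz[OF i] by (simp del: upt_Suc)
    qed
  qed
qed

lemma eta_nat: "h \<in> Hom S x y \<Longrightarrow> Cmp S (eta T y) h = Cmp S (amap P h) (eta T x)"
proof -
  assume h: "h \<in> Hom S x y"
  hence x: "x \<in> Obj S" and y: "y \<in> Obj S" by (auto simp: Slice_Hom)
  show ?thesis
  proof (rule Slice_ext[OF cat_cmp[OF S h eta_Hom[OF y]] cat_cmp[OF S eta_Hom[OF x] P_hom[OF h]]])
    fix e assume e: "e \<in> src x"
    thus "elt_map (Cmp S (eta T y) h) e = elt_map (Cmp S (amap P h) (eta T x)) e"
      using Slice_elt[OF h e] eta_value[OF x e] eta_value[OF y, of "elt_map h e"] ev_nat[OF h pre_ident[OF x e]]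
        Slice_Cmp[OF h e] Slice_Cmp[OF eta_Hom[OF x] e] by simp
  qed
qed

lemma mu_nat: "h \<in> Hom S x y \<Longrightarrow> Cmp S (mu T y) (amap P (amap P h)) = Cmp S (amap P h) (mu T x)"
proof -
  assume h: "h \<in> Hom S x y"
  hence x: "x \<in> Obj S" and y: "y \<in> Obj S" by (auto simp: Slice_Hom)
  note Ph = P_hom[OF h] and Px = P_obj[OF x]
  note PPh = P_hom[OF Ph]
  show ?thesis
  proof (rule Slice_ext[OF cat_cmp[OF S PPh mu_Hom[OF y]] cat_cmp[OF S mu_Hom[OF x] Ph]])
    fix t assume t: "t \<in> src (omap P (omap P x))"
    then obtain a es where a: "pre M (omap P x) a es" "t = ev (omap P x) a es" using ev_ex[OF Px] by blast
    obtain bs yss where n: "nested M x a bs yss" "es = map2 (ev x) bs yss" using nested_ex[OF x a(1)] .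
    have "elt_map (amap P (amap P h)) t = ev (omap P y) a (map2 (ev y) bs (map (map (elt_map h)) yss))"
      using ev_nat[OF Ph a(1)] map_P_nested[OF h n(1)] a(2) n(2) by simp
    hence "elt_map (mu T y) (elt_map (amap P (amap P h)) t) = ev y (msubst M a bs) (concat (map (map (elt_map h)) yss))"
      using mu_value[OF y nested_map[OF n(1) h]] by simp
    also have "\<dots> = elt_map (amap P h) (elt_map (mu T x) t)"
      using mu_value[OF x n(1)] ev_nat[OF h nested_concat[OF typed n(1)]] a(2) n(2) by (simp add: map_concat)
    finally show "elt_map (Cmp S (mu T y) (amap P (amap P h))) t = elt_map (Cmp S (amap P h) (mu T x)) t"
      using Slice_Cmp[OF PPh t] Slice_Cmp[OF mu_Hom[OF x] t] by simp
  qed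
qed

lemma eta_nat_trans: "nat_trans S S id_func P (eta T)"
  by (rule nat_transI[OF is_functor_id[OF S] P_functor])
    (auto simp: id_func_def eta_Hom eta_nat)

lemma mu_nat_trans: "nat_trans S S (P \<bullet> P) P (mu T)"
  by (rule nat_transI[OF is_functor_comp[OF P_functor P_functor] P_functor])
    (auto simp: comp_func_def mu_Hom mu_nat)

lemma eta_weakly_cartesian: "weakly_cartesian S S id_func P (eta T)"
  unfolding weakly_cartesian_def
proof (intro conjI ballI eta_nat_trans)
  fix h assume "h \<in> Arr S"
  then obtain x y where h: "h \<in> Hom S x y" and st: "src h = x" "tgt h = y" by (auto simp: Hom_Arr)
  hence x: "x \<in> Obj S" and y: "y \<in> Obj S" by (auto simp: Slice_Hom)
  show "weak_pullback S (amap id_func h) (eta T (src h)) (eta T (tgt h)) (amap P h)"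
    unfolding st id_func_def func.simps
      weak_pullback_Slice[OF h eta_Hom[OF x] eta_Hom[OF y] P_hom[OF h] eta_nat[OF h]]
  proof (intro ballI impI)
    fix e t assume e: "e \<in> src y" and t: "t \<in> src (omap P x)" and eq: "elt_map (eta T y) e = elt_map (amap P h) t"
    obtain xs where xs: "pre M x (1, ident M (dat y e)) xs" "t = ev x (1, ident M (dat y e)) xs" "map (elt_map h) xs = [e]"
      using ev_lift_rep[OF h t pre_ident[OF y e]] eq eta_value[OF y e] by metis
    then obtain d where d: "xs = [d]" "elt_map h d = e" by auto
    hence ds: "d \<in> src x" using xs(1) by (auto simp: pre_def arg_def)
    show "\<exists>d\<in>src x. elt_map h d = e \<and> elt_map (eta T x) d = t"
      using ds d xs(2) eta_value[OF x ds] Slice_elt[OF h ds] by (intro bexI[of _ d]) auto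
  qed
qed

lemma mu_weakly_cartesian: "weakly_cartesian S S (P \<bullet> P) P (mu T)"
  unfolding weakly_cartesian_def
proof (intro conjI ballI mu_nat_trans)
  fix h assume "h \<in> Arr S"
  then obtain x y where h: "h \<in> Hom S x y" and st: "src h = x" "tgt h = y" by (auto simp: Hom_Arr)
  hence x: "x \<in> Obj S" and y: "y \<in> Obj S" by (auto simp: Slice_Hom)
  note Ph = P_hom[OF h] and Px = P_obj[OF x] and Py = P_obj[OF y]
  note PPh = P_hom[OF Ph]
  show "weak_pullback S (amap (P \<bullet> P) h) (mu T (src h)) (mu T (tgt h)) (amap P h)"
    unfolding st comp_func_def func.simps
      weak_pullback_Slice[OF PPh mu_Hom[OF x] mu_Hom[OF y] Ph mu_nat[OF h]]
  proof (intro ballI impI)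
    fix s t assume s: "s \<in> src (omap P (omap P y))" and t: "t \<in> src (omap P x)"
      and eq: "elt_map (mu T y) s = elt_map (amap P h) t"
    obtain a es where a: "pre M (omap P y) a es" "s = ev (omap P y) a es" using ev_ex[OF Py s] by blast
    obtain bs yss where n: "nested M y a bs yss" "es = map2 (ev y) bs yss" using nested_ex[OF y a(1)] .
    note fit = nested_fit[OF n(1)]
    obtain xs where xs: "pre M x (msubst M a bs) xs" "t = ev x (msubst M a bs) xs" "map (elt_map h) xs = concat yss"
      using ev_lift_rep[OF h t nested_concat[OF typed n(1)]] eq mu_value[OF y n(1)] a(2) n(2) by metis
    obtain xss where nx: "nested M x a bs xss" and xss: "xs = concat xss"
      using nested_split[OF typed nested_substitutable[OF n(1)] xs(1)] .
    have hy: "map (map (elt_map h)) xss = yss"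
      using xs(3) xss fit nested_fit[OF nx] by (intro concat_eq_blocks) (auto simp: map_concat comp_def)
    show "\<exists>e\<in>src (omap P (omap P x)). elt_map (amap P (amap P h)) e = s \<and> elt_map (mu T x) e = t"
      using ev_mem[OF Px nested_ev[OF x nx]] ev_nat[OF Ph nested_ev[OF x nx]] map_P_nested[OF h nx] hy
        mu_value[OF x nx] a(2) n(2) xs(2) xss
      by (intro bexI[of _ "ev (omap P x) a (map2 (ev x) bs xss)"]) auto
  qed
qed

text \<open>
  \<open>G a\<close> has one variable for each input of \<open>a\<close>.  Since the variables are distinct, two operations naming the
  same element of \<open>P (G a)\<close> are equal.
\<close>

definition G :: "nat \<times> 'v \<Rightarrow> 'v fn" where "G a = gobj (colours M) (fst a) (bnd M a)"

lemma G_Obj: "snd a \<in> ops M (fst a) \<Longrightarrow> G a \<in> Obj S"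
  unfolding G_def using sig sig_act(5)[OF sig, of a] by (intro gobj_Obj) (auto simp: is_sig_def)

lemma G_pre: "snd a \<in> ops M (fst a) \<Longrightarrow> pre M (G a) a (gen (fst a))"
  by (auto simp: pre_def G_def)

lemma nested_G:
  assumes s: "substitutable M a bs"
  obtains yss where "nested M (G (msubst M a bs)) a bs yss" "concat yss = gen (arity_sum bs)"
proof -
  have "snd (msubst M a bs) \<in> ops M (fst (msubst M a bs))" using sub_op[OF s] by simp
  from nested_split[OF typed s G_pre[OF this]] show ?thesis using that by (metis fst_msubst)
qed

lemma monad_unit_laws:
  assumes "is_multicat M" and x: "x \<in> Obj S"
  shows "Cmp S (mu T x) (eta T (omap P x)) = Idn S (omap P x)"
    and "Cmp S (mu T x) (amap P (eta T x)) = Idn S (omap P x)"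
proof -
  note U = multicat_units[OF assms(1)]
  note Px = P_obj[OF x]
  have "elt_map (Cmp S (mu T x) (eta T (omap P x))) t = t \<and> elt_map (Cmp S (mu T x) (amap P (eta T x))) t = t"
    if t: "t \<in> src (omap P x)" for t
  proof -
    obtain a xs where a: "pre M x a xs" "t = ev x a xs" using ev_ex[OF x t] by blast
    have sa: "snd a \<in> ops M (fst a)" using a(1) by (simp add: pre_def)
    have "elt_map (eta T (omap P x)) t = ev (omap P x) (1, ident M (bnd M a 0)) (map2 (ev x) [a] [xs])"
      using eta_value[OF Px t] ev_dat[OF x a(1)] a(2) by simp
    hence 1: "elt_map (mu T x) (elt_map (eta T (omap P x)) t) = t"
      using mu_value[OF x nested_ident_outer[OF a(1)]] U(1)[OF sa] a(2) by simp
    have "elt_map (mu T x) (elt_map (amap P (eta T x)) t) = t"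
      unfolding a(2) ev_nat[OF eta_Hom[OF x] a(1)] nested_ident_inner(2)[OF x a(1)]
        mu_value[OF x nested_ident_inner(1)[OF x a(1)]] U(2)[OF sa] by simp
    thus ?thesis using 1 Slice_Cmp[OF eta_Hom[OF Px] t] Slice_Cmp[OF P_hom[OF eta_Hom[OF x]] t] by simp
  qed
  thus "Cmp S (mu T x) (eta T (omap P x)) = Idn S (omap P x)"
    "Cmp S (mu T x) (amap P (eta T x)) = Idn S (omap P x)"
    using Slice_ext[OF cat_cmp[OF S eta_Hom[OF Px] mu_Hom[OF x]] cat_idn[OF S Px]]
      Slice_ext[OF cat_cmp[OF S P_hom[OF eta_Hom[OF x]] mu_Hom[OF x]] cat_idn[OF S Px]] by auto
qed

lemma monad_assoc_law:
  assumes "is_multicat M" and x: "x \<in> Obj S"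
  shows "Cmp S (mu T x) (mu T (omap P x)) = Cmp S (mu T x) (amap P (mu T x))"
proof (rule Slice_ext[OF cat_cmp[OF S mu_Hom[OF P_obj[OF x]] mu_Hom[OF x]]
    cat_cmp[OF S P_hom[OF mu_Hom[OF x]] mu_Hom[OF x]]])
  note Px = P_obj[OF x]
  note PPx = P_obj[OF Px]
  fix t assume t: "t \<in> src (omap P (omap P (omap P x)))"
  then obtain a ds where a: "pre M (omap P (omap P x)) a ds" "t = ev (omap P (omap P x)) a ds" using ev_ex[OF PPx] by blast
  obtain bs ess where b: "nested M (omap P x) a bs ess" "ds = map2 (ev (omap P x)) bs ess" using nested_ex[OF Px a(1)] .
  note s = nested_substitutable[OF b(1)]
  have le: "length ess = length bs" and pe: "\<And>i. i \<in> {1..length bs} \<Longrightarrow> pre M (omap P x) (arg bs i) (arg ess i)"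
    using b(1) by (auto simp: nested_def)
  obtain css zsss where c: "length css = length bs" "length zsss = length bs"
    "\<And>i. i \<in> {1..length bs} \<Longrightarrow> nested M x (arg bs i) (arg css i) (arg zsss i)"
    "ess = map2 (map2 (ev x)) css zsss" using nested_choice[OF x s le pe] by blast
  have "msubst M a (map2 (msubst M) bs css) = msubst M (msubst M a bs) (concat css)"
    by (rule multicat_assoc[OF assms(1) s c(1) nested_substitutable[OF c(3)]])
  thus "elt_map (Cmp S (mu T x) (mu T (omap P x))) t = elt_map (Cmp S (mu T x) (amap P (mu T x))) t"
    using triple_value[OF x s c(1-3)] Slice_Cmp[OF mu_Hom[OF Px] t] Slice_Cmp[OF P_hom[OF mu_Hom[OF x]] t]
      a(2) b(2) c(4) by simp
qed

lemma is_monad: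
  assumes "is_multicat M"
  shows "is_monad S P (eta T) (mu T)"
  unfolding is_monad_def
  using P_functor eta_nat_trans mu_nat_trans monad_unit_laws[OF assms] monad_assoc_law[OF assms] by blast

lemma is_multicat:
  assumes "is_monad S P (eta T) (mu T)"
  shows "is_multicat M"
proof (rule is_multicatI[OF typed])
  have law: "Cmp S (mu T x) (eta T (omap P x)) = Idn S (omap P x)" "Cmp S (mu T x) (amap P (eta T x)) = Idn S (omap P x)"
    "Cmp S (mu T x) (mu T (omap P x)) = Cmp S (mu T x) (amap P (mu T x))" if "x \<in> Obj S" for x
    using assms that unfolding is_monad_def by auto
  note eqI = ev_inject_distinct
  fix a
  {
    assume sa: "snd a \<in> ops M (fst a)"
    let ?x = "G a"
    note x = G_Obj[OF sa] and p = G_pre[OF sa]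
    note Px = P_obj[OF x] and t = ev_mem[OF x p]
    let ?t = "ev ?x a (gen (fst a))"
    note n1 = nested_ident_outer[OF p] and n2 = nested_ident_inner[OF x p]
    have "elt_map (eta T (omap P ?x)) ?t = ev (omap P ?x) (1, ident M (bnd M a 0)) (map2 (ev ?x) [a] [gen (fst a)])"
      using eta_value[OF Px t] ev_dat[OF x p] by simp
    hence "ev ?x (msubst M (1, ident M (bnd M a 0)) [a]) (concat [gen (fst a)]) =
        elt_map (Cmp S (mu T ?x) (eta T (omap P ?x))) ?t"
      using mu_value[OF x n1] Slice_Cmp[OF eta_Hom[OF Px] t, of "colours M" "mu T ?x"] by simp
    also have "\<dots> = ?t" using law(1)[OF x] t by simp
    finally show "msubst M (1, ident M (bnd M a 0)) [a] = a"
      using eqI[OF x] nested_concat[OF typed n1] p by simp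
    have "ev ?x (msubst M a (map (\<lambda>i. (1, ident M (bnd M a i))) [1..<Suc (fst a)]))
        (concat (map (\<lambda>e. [e]) (gen (fst a)))) = elt_map (Cmp S (mu T ?x) (amap P (eta T ?x))) ?t"
      unfolding Slice_Cmp[OF P_hom[OF eta_Hom[OF x]] t] ev_nat[OF eta_Hom[OF x] p] n2(2) mu_value[OF x n2(1)] ..
    hence "ev ?x (msubst M a (map (\<lambda>i. (1, ident M (bnd M a i))) [1..<Suc (fst a)])) (gen (fst a)) = ?t"
      using law(2)[OF x] t by (simp del: upt_Suc)
    thus "msubst M a (map (\<lambda>i. (1, ident M (bnd M a i))) [1..<Suc (fst a)]) = a"
      using eqI[OF x _ p] nested_concat[OF typed n2(1)] by (simp del: upt_Suc)
  }
  fix bs assume s: "substitutable M a bs"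
  have la: "length bs = fst a" using s by (simp add: substitutable_def)
  {
    fix css assume l: "length css = length bs"
      and si: "\<And>i. i \<in> {1..length bs} \<Longrightarrow> substitutable M (arg bs i) (arg css i)"
    note fit = substitutable_assoc(1)[OF typed s l si] and s2 = substitutable_assoc(3)[OF typed s l si]
    let ?d = "msubst M (msubst M a bs) (concat css)"
    have sd: "snd ?d \<in> ops M (fst ?d)" using sub_op[OF s2] by simp
    obtain ws where ws: "nested M (G ?d) (msubst M a bs) (concat css) ws" "concat ws = gen (arity_sum (concat css))"
      using nested_G[OF s2] .
    note x = G_Obj[OF sd]
    have "length ws = arity_sum bs" using ws(1) by (simp add: nested_def)
    then obtain zsss where z: "ws = concat zsss" "map length zsss = map fst bs" using blocks_exist by blast
    have lz: "length zsss = length bs" using map_eq_imp_length_eq[OF z(2)] .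
    have n: "nested M (G ?d) (arg bs i) (arg css i) (arg zsss i)" if i: "i \<in> {1..length bs}" for i
    proof (rule nestedI[OF si[OF i]])
      have lc: "length (arg css i) = fst (arg bs i)" using si[OF i] by (simp add: substitutable_def)
      show "length (arg zsss i) = length (arg css i)"
        using arg_cong[OF z(2), of "\<lambda>l. arg l i"] i lz lc by (simp add: arg_map)
      fix j assume "j \<in> {1..length (arg css i)}"
      hence j: "j \<in> {1..fst (arg bs i)}" using lc by simp
      have "pre M (G ?d) (arg (concat css) (pos bs i j)) (arg ws (pos bs i j))"
        using ws(1) pos_range[OF i j] unfolding nested_def fst_msubst by blast
      thus "pre M (G ?d) (arg (arg css i) j) (arg (arg zsss i) j)"
        using arg_concat_pos[OF fit i j] arg_concat_pos[OF z(2) i j] z(1) by simp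
    qed
    note tv = triple_value[OF x s l lz n] and Px = P_obj[OF x] and nt = nested_triple[OF x s l lz n]
    have "ev (G ?d) (msubst M a (map2 (msubst M) bs css)) (concat (concat zsss)) =
        ev (G ?d) ?d (concat (concat zsss))"
      using tv(2,3) Slice_Cmp[OF mu_Hom[OF Px] tv(1), of "colours M" "mu T (G ?d)"]
        Slice_Cmp[OF P_hom[OF mu_Hom[OF x]] tv(1), of "colours M" "mu T (G ?d)"] law(3)[OF x] by simp
    thus "msubst M a (map2 (msubst M) bs css) = ?d"
      using eqI[OF x nested_concat[OF typed nt(2)]] nested_concat[OF typed nt(3)] ws(2) z(1)
      by (simp add: concat_map_concat)
  }
  let ?d = "msubst M a bs"
  have sd: "snd ?d \<in> ops M (fst ?d)" using sub_op[OF s] by simp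
  note x = G_Obj[OF sd]
  obtain yss where y: "nested M (G ?d) a bs yss" "concat yss = gen (arity_sum bs)" using nested_G[OF s] .
  have ly: "length yss = fst a" using y(1) by (simp add: nested_def)
  note np = nested_ev[OF x y(1)] and nc = nested_concat[OF typed y(1)] and fit = nested_fit[OF y(1)]
  fix \<rho> assume r: "\<rho> permutes {1..arity_sum bs}"
  let ?ws = "permute_args (concat yss) \<rho>"
  have eqd: "b = actp M ?d \<rho>" if "pre M (G ?d) b ?ws" "ev (G ?d) b ?ws = ev (G ?d) ?d (concat yss)" for b
  proof (rule eqI[OF x that(1)])
    show "pre M (G ?d) (actp M ?d \<rho>) ?ws" using pre_act[OF sig nc] r by simp
    show "distinct ?ws" using distinct_permute_args[of \<rho> "concat yss"] r y(2) by simp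
    show "ev (G ?d) b ?ws = ev (G ?d) (actp M ?d \<rho>) ?ws" using ev_act[OF x nc, of \<rho>] r that(2) by simp
  qed
  {
    fix \<sigma> assume sg: "\<sigma> permutes {1..fst a}"
      and rs: "\<And>i j. i \<in> {1..fst a} \<Longrightarrow> j \<in> {1..fst (arg bs (\<sigma> i))} \<Longrightarrow> \<rho> (pos (permute_args bs \<sigma>) i j) = pos bs (\<sigma> i) j"
    note n' = nested_permute(1)[OF sig y(1) sg] and m = nested_permute(2)[OF sig y(1) sg, of "ev (G ?d)"]
    have c: "concat (permute_args yss \<sigma>) = ?ws"
      by (rule concat_permute_args[OF fit]) (use sg r rs la in auto)
    show "msubst M (actp M a \<sigma>) (permute_args bs \<sigma>) = actp M ?d \<rho>"
      by (rule eqd) (use nested_concat[OF typed n'] c mu_value[OF x n'] mu_value[OF x y(1)]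
        ev_act[OF P_obj[OF x] np sg] m in simp_all)
  }
  fix \<tau> assume t: "\<And>i. i \<in> {1..fst a} \<Longrightarrow> \<tau> i permutes {1..fst (arg bs i)}"
    and rs: "\<And>i j. i \<in> {1..fst a} \<Longrightarrow> j \<in> {1..fst (arg bs i)} \<Longrightarrow> \<rho> (pos bs i j) = pos bs i (\<tau> i j)"
  let ?bs = "map (\<lambda>i. actp M (arg bs i) (\<tau> i)) [1..<Suc (fst a)]"
  let ?yss = "map (\<lambda>i. permute_args (arg yss i) (\<tau> i)) [1..<Suc (fst a)]"
  have l: "length ?bs = fst a" "length ?yss = fst a" by (simp_all del: upt_Suc)
  have ab: "arg ?bs i = actp M (arg bs i) (\<tau> i)" "arg ?yss i = permute_args (arg yss i) (\<tau> i)"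
    if "i \<in> {1..fst a}" for i by (rule arg_upt[OF that])+
  have pi: "pre M (G ?d) (arg bs i) (arg yss i)" if "i \<in> {1..fst a}" for i
    using y(1) that by (auto simp: nested_def)
  have n': "nested M (G ?d) a ?bs ?yss"
  proof (rule nestedI[OF substitutable_inner(1)[OF sig s t]])
    fix i assume "i \<in> {1..length ?bs}"
    hence i: "i \<in> {1..fst a}" using l by simp
    show "pre M (G ?d) (arg ?bs i) (arg ?yss i)"
      unfolding ab[OF i] by (rule pre_act[OF sig pi[OF i] t[OF i]])
  qed (use l in simp_all)
  have m: "map2 (ev (G ?d)) ?bs ?yss = map2 (ev (G ?d)) bs yss"
  proof (rule map2_arg_cong)
    fix i assume "i \<in> {1..length ?bs}"
    hence i: "i \<in> {1..fst a}" using l by simp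
    show "ev (G ?d) (arg ?bs i) (arg ?yss i) = ev (G ?d) (arg bs i) (arg yss i)"
      unfolding ab[OF i] using ev_act[OF x pi[OF i] t[OF i]] .
  qed (use l la ly in auto)
  have c: "concat ?yss = ?ws"
    using concat_map_permute_args[OF fit, of \<tau> \<rho>] r rs t la by simp
  show "msubst M a ?bs = actp M ?d \<rho>"
    by (rule eqd) (use nested_concat[OF typed n'] mu_value[OF x n', unfolded m] mu_value[OF x y(1)] in \<open>simp_all only: c\<close>)
qed

end

lemma sig_cong:
  assumes "colours A = colours B" "ops A = ops B" "act A = act B" "bnd A = bnd B"
  shows "is_sig A \<longleftrightarrow> is_sig B" "pre A = pre B" "actp A = actp B" "nested A = nested B"
    "presentation A P ev \<longleftrightarrow> presentation B P ev"
proof -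
  show 1: "is_sig A \<longleftrightarrow> is_sig B" using assms by (simp add: is_sig_def)
  show 2: "pre A = pre B" using assms by (simp add: pre_def fun_eq_iff)
  show 3: "actp A = actp B" using assms by (simp add: actp_def fun_eq_iff)
  show "nested A = nested B" using assms 2 by (simp add: nested_def fun_eq_iff)
  show "presentation A P ev \<longleftrightarrow> presentation B P ev"
    unfolding presentation_def presentation_axioms_def 1 2 3 assms ..
qed

lemma substitutable_cong: "ops M = ops N \<Longrightarrow> bnd M = bnd N \<Longrightarrow> substitutable M = substitutable N"
  by (simp add: substitutable_def fun_eq_iff)

lemma (in presentation) rep_spec:
  assumes "x \<in> Obj (Slice (colours A))" "e \<in> src (omap P x)"
  shows "pre A x (fst (rep x e)) (snd (rep x e)) \<and> ev x (fst (rep x e)) (snd (rep x e)) = e"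
proof -
  obtain a xs where "pre A x a xs" "e = ev x a xs" using ev_ex[OF assms] by blast
  hence "pre A x (fst (a, xs)) (snd (a, xs)) \<and> e = ev x (fst (a, xs)) (snd (a, xs))" by simp
  hence "pre A x (fst (rep x e)) (snd (rep x e)) \<and> e = ev x (fst (rep x e)) (snd (rep x e))"
    unfolding rep_def by (rule someI)
  thus ?thesis by simp
qed

context universe
begin

subsection \<open>The monad of a multicategory\<close>

lemma induced_exists:
  assumes M: "is_multicat (M :: ('v, 'z) multicat_scheme)"
  shows "\<exists>(T :: 'v anmonad) ev. induced M T ev"
proof -
  note typed = typed_multicat[OF M]
  have "is_sig M" using typed by (simp add: typed_def)
  then obtain P ev where "presentation M P ev" using presentation_exists by blast
  then interpret presentation ty M P ev .
  let ?S = "Slice (colours M)"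
  have inner: "ev x (msubst M a bs) (concat yss) = ev x (msubst M a bs') (concat yss')"
    if x: "x \<in> Obj ?S" and n: "nested M x a bs yss" "nested M x a bs' yss'"
      and eq: "map2 (ev x) bs yss = map2 (ev x) bs' yss'" for x a bs yss bs' yss'
  proof -
    have l: "length bs = fst a" "length yss = fst a" "length bs' = fst a" "length yss' = fst a"
      and p: "\<And>i. i \<in> {1..fst a} \<Longrightarrow> pre M x (arg bs i) (arg yss i)" "\<And>i. i \<in> {1..fst a} \<Longrightarrow> pre M x (arg bs' i) (arg yss' i)"
      using n by (auto simp: nested_def)
    have "\<exists>\<tau>. \<tau> permutes {1..fst (arg bs i)} \<and> arg bs' i = actp M (arg bs i) \<tau> \<and> arg yss' i = permute_args (arg yss i) \<tau>"
      if i: "i \<in> {1..fst a}" for i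
    proof -
      have "ev x (arg bs i) (arg yss i) = ev x (arg bs' i) (arg yss' i)"
        using arg_cong[OF eq, of "\<lambda>l. arg l i"] i l by (simp add: arg_map2_eq del: One_nat_def)
      thus ?thesis using ev_eq[OF x p(1)[OF i] p(2)[OF i]] by simp
    qed
    then obtain \<tau> where t: "\<And>i. i \<in> {1..fst a} \<Longrightarrow> \<tau> i permutes {1..fst (arg bs i)} \<and>
       arg bs' i = actp M (arg bs i) (\<tau> i) \<and> arg yss' i = permute_args (arg yss i) (\<tau> i)" by metis
    have b: "bs' = map (\<lambda>i. actp M (arg bs i) (\<tau> i)) [1..<Suc (fst a)]"
      by (rule list_arg_ext) (use l t in \<open>auto simp: arg_upt_simps simp del: upt_Suc\<close>)
    have y: "yss' = map (\<lambda>i. permute_args (arg yss i) (\<tau> i)) [1..<Suc (length bs)]"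
      by (rule list_arg_ext) (use l t in \<open>auto simp: arg_upt_simps simp del: upt_Suc\<close>)
    have t': "\<tau> i permutes {1..fst (arg bs i)}" if "i \<in> {1..length bs}" for i using t that l by simp
    obtain \<rho> where r: "\<rho> permutes {1..arity_sum bs}"
       "\<And>i j. i \<in> {1..length bs} \<Longrightarrow> j \<in> {1..fst (arg bs i)} \<Longrightarrow> \<rho> (pos bs i j) = pos bs i (\<tau> i j)"
      using juxtaposed_permutation[OF t'] by blast
    have "msubst M a bs' = actp M (msubst M a bs) \<rho>"
      unfolding b by (rule multicat_inner[OF M nested_substitutable[OF n(1)]]) (use t r l in auto)
    moreover have "concat yss' = permute_args (concat yss) \<rho>"
      unfolding y by (rule concat_map_permute_args[OF nested_fit[OF n(1)] t' r(2)])
    ultimately show ?thesis using ev_act[OF x nested_concat[OF typed n(1)], of \<rho>] r(1) by simp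
  qed
  define eta0 where "eta0 x = sarr x (\<lambda>e. ev x (1, ident M (dat x e)) [e]) (omap P x)" for x
  define val where "val x a es = ev x (msubst M a (map (\<lambda>e. fst (rep x e)) es)) (concat (map (\<lambda>e. snd (rep x e)) es))" for x a es
  define mu0 where "mu0 x = sarr (omap P (omap P x))
     (\<lambda>t. val x (fst (rep (omap P x) t)) (snd (rep (omap P x) t))) (omap P x)" for x
  have val: "val x a (map2 (ev x) bs yss) = ev x (msubst M a bs) (concat yss)"
    if x: "x \<in> Obj ?S" and n: "nested M x a bs yss" for x a bs yss
  proof -
    let ?es = "map2 (ev x) bs yss"
    have l: "length bs = fst a" "length yss = fst a" using n by (auto simp: nested_def)
    have r: "pre M x (fst (rep x (arg ?es i))) (snd (rep x (arg ?es i))) \<and>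
        ev x (fst (rep x (arg ?es i))) (snd (rep x (arg ?es i))) = arg ?es i" if i: "i \<in> {1..fst a}" for i
      using nested_ev[OF x n] i by (intro rep_spec[OF x]) (auto simp: pre_def)
    have d: "bnd M (fst (rep x (arg ?es i))) 0 = bnd M a i" if i: "i \<in> {1..fst a}" for i
    proof -
      have "dat (omap P x) (arg ?es i) = bnd M a i" using nested_ev[OF x n] i unfolding pre_def by blast
      thus ?thesis using r[OF i] ev_dat[OF x, of "fst (rep x (arg ?es i))" "snd (rep x (arg ?es i))"] by simp
    qed
    have n': "nested M x a (map (\<lambda>e. fst (rep x e)) ?es) (map (\<lambda>e. snd (rep x e)) ?es)"
      unfolding nested_def
    proof (intro conjI ballI)
      show "snd a \<in> ops M (fst a)" using n by (simp add: nested_def)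
      fix i assume i: "i \<in> {1..fst a}"
      hence i': "i \<in> {1..length ?es}" using l by simp
      show "bnd M (arg (map (\<lambda>e. fst (rep x e)) ?es) i) 0 = bnd M a i"
        "pre M x (arg (map (\<lambda>e. fst (rep x e)) ?es) i) (arg (map (\<lambda>e. snd (rep x e)) ?es) i)"
        unfolding arg_map[OF i'] using r[OF i] d[OF i] by auto
    qed (use l in simp_all)
    have "map2 (ev x) (map (\<lambda>e. fst (rep x e)) ?es) (map (\<lambda>e. snd (rep x e)) ?es) = ?es"
    proof (rule list_arg_ext)
      fix i assume "i \<in> {1..length (map2 (ev x) (map (\<lambda>e. fst (rep x e)) ?es) (map (\<lambda>e. snd (rep x e)) ?es))}"
      hence i: "i \<in> {1..fst a}" and i': "i \<in> {1..length ?es}" and i'': "i \<in> {1..length (map (\<lambda>e. fst (rep x e)) ?es)}"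
        using l by simp_all
      have "arg (map2 (ev x) (map (\<lambda>e. fst (rep x e)) ?es) (map (\<lambda>e. snd (rep x e)) ?es)) i =
          ev x (arg (map (\<lambda>e. fst (rep x e)) ?es) i) (arg (map (\<lambda>e. snd (rep x e)) ?es) i)"
        by (rule arg_map2_eq[OF i'']) simp
      also have "\<dots> = arg ?es i" unfolding arg_map[OF i'] using r[OF i] by blast
      finally show "arg (map2 (ev x) (map (\<lambda>e. fst (rep x e)) ?es) (map (\<lambda>e. snd (rep x e)) ?es)) i = arg ?es i" .
    qed simp
    from inner[OF x n' n this] show ?thesis by (simp add: val_def)
  qed
  have pi: "pre M x (1, ident M (dat x e)) [e]" if "x \<in> Obj ?S" "e \<in> src x" for x e
  proof -
    have "dat x e \<in> colours M" using that by (auto simp: Slice_Obj)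
    thus ?thesis using typed that by (auto simp: typed_def pre_def arg_def)
  qed
  have mv: "elt_map (mu0 x) (ev (omap P x) a (map2 (ev x) bs yss)) = ev x (msubst M a bs) (concat yss)"
    if x: "x \<in> Obj ?S" and n: "nested M x a bs yss" for x a bs yss
  proof -
    note Px = P_obj[OF x] and p = nested_ev[OF x n]
    have "val x (actp M a \<sigma>) (permute_args (map2 (ev x) bs yss) \<sigma>) = val x a (map2 (ev x) bs yss)"
      if s: "\<sigma> permutes {1..fst a}" for \<sigma>
    proof -
      have la: "length bs = fst a" using n by (simp add: nested_def)
      note np = nested_permute[OF sig n s]
      have s': "\<sigma> permutes {1..length bs}" using s la by simp
      obtain \<rho> where r: "\<rho> permutes {1..arity_sum bs}" "arity_sum (permute_args bs \<sigma>) = arity_sum bs"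
        "\<And>i j. i \<in> {1..length bs} \<Longrightarrow> j \<in> {1..fst (arg bs (\<sigma> i))} \<Longrightarrow> \<rho> (pos (permute_args bs \<sigma>) i j) = pos bs (\<sigma> i) j"
        using block_permutation[OF s'] by blast
      have "msubst M (actp M a \<sigma>) (permute_args bs \<sigma>) = actp M (msubst M a bs) \<rho>"
        by (rule multicat_outer[OF M nested_substitutable[OF n] s r(1)]) (use r la in auto)
      moreover have "concat (permute_args yss \<sigma>) = permute_args (concat yss) \<rho>"
        by (rule concat_permute_args[OF nested_fit[OF n] s' r(3)])
      moreover have "ev x (actp M (msubst M a bs) \<rho>) (permute_args (concat yss) \<rho>) = ev x (msubst M a bs) (concat yss)"
        using ev_act[OF x nested_concat[OF typed n], of \<rho>] r(1) by simp
      ultimately show ?thesis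
        unfolding np(2)[of "ev x", symmetric] using val[OF x np(1)] val[OF x n] by simp
    qed
    from rep_lift[OF Px p, of "val x", OF this] show ?thesis
      unfolding mu0_def using ev_mem[OF Px p] val[OF x n] by simp
  qed
  define T where "T = \<lparr>base = colours M, fctr = P, eta = eta0, mu = mu0\<rparr>"
  have "induced M T ev"
  proof (intro induced.intro induced_axioms.intro)
    show "presentation M (fctr T) ev" unfolding T_def by (simp add: presentation_axioms)
    show "typed M" by (rule typed)
    show "base T = colours M" by (simp add: T_def)
    fix x assume x: "x \<in> Obj ?S"
    note Px = P_obj[OF x]
    have "over x (\<lambda>e. ev x (1, ident M (dat x e)) [e]) (omap P x)"
      unfolding over_def
    proof
      fix e assume e: "e \<in> src x"
      have "dat x e \<in> colours M" using x e by (auto simp: Slice_Obj)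
      thus "ev x (1, ident M (dat x e)) [e] \<in> src (omap P x) \<and> dat (omap P x) (ev x (1, ident M (dat x e)) [e]) = dat x e"
        using ev_mem[OF x pi[OF x e]] ev_dat[OF x pi[OF x e]] typed by (simp add: typed_def)
    qed
    thus "eta T x \<in> Hom ?S x (omap (fctr T) x)" unfolding T_def eta0_def using sarr_Hom[OF x Px] by simp
    have "over (omap P (omap P x)) (elt_map (mu0 x)) (omap P x)"
      unfolding over_def
    proof
      fix t assume t: "t \<in> src (omap P (omap P x))"
      obtain a es where a: "pre M (omap P x) a es" "t = ev (omap P x) a es" using ev_ex[OF Px t] by blast
      obtain bs yss where n: "nested M x a bs yss" "es = map2 (ev x) bs yss" using nested_ex[OF x a(1)] .
      note nc = nested_concat[OF typed n(1)]
      show "elt_map (mu0 x) t \<in> src (omap P x) \<and> dat (omap P x) (elt_map (mu0 x) t) = dat (omap P (omap P x)) t"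
        unfolding a(2) ev_dat[OF Px a(1)] unfolding n(2) mv[OF x n(1)] ev_dat[OF x nc]
        using ev_mem[OF x nc] typed nested_substitutable[OF n(1)] by (auto simp: typed_def)
    qed
    moreover have "mu0 x = sarr (omap P (omap P x)) (elt_map (mu0 x)) (omap P x)"
      unfolding mu0_def by (rule sarr_cong) simp
    ultimately show "mu T x \<in> Hom ?S (omap (fctr T) (omap (fctr T) x)) (omap (fctr T) x)"
      unfolding T_def using P_obj[OF Px] Px by (simp add: Slice_Hom)
    show "elt_map (eta T x) e = ev x (1, ident M (dat x e)) [e]" if "e \<in> src x" for e
      using that by (simp add: T_def eta0_def)
    show "elt_map (mu T x) (ev (omap (fctr T) x) a (map2 (ev x) bs yss)) = ev x (msubst M a bs) (concat yss)"
      if "nested M x a bs yss" for a bs yss using mv[OF x that] by (simp add: T_def)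
  qed
  thus ?thesis by blast
qed

subsection \<open>The multicategory of a monad\<close>

lemma inducing_exists:
  assumes T: "is_anmonad (T :: ('v, 'y) anmonad_scheme)"
  shows "\<exists>(M :: 'v multicat) ev. induced M T ev"
proof -
  define P where "P = fctr T"
  have we: "weakly_cartesian (Slice (base T)) (Slice (base T)) id_func P (eta T)"
    and wm: "weakly_cartesian (Slice (base T)) (Slice (base T)) (P \<bullet> P) P (mu T)"
    and an: "analytic (base T) P"
    using T by (auto simp: is_anmonad_def Let_def is_anfunc_def P_def)
  obtain A :: "'v sig" and ev where A: "presentation A P ev" "colours A = base T"
    using presentation_of_analytic[OF an] by blast
  define M0 :: "'v multicat" where "M0 = \<lparr>colours = colours A, ops = ops A, act = act A, bnd = bnd A, ident = \<lambda>_. undefined, subst = \<lambda>_ _. undefined\<rparr>"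
  have "presentation M0 P ev" using A sig_cong(5)[of M0 A P ev] by (simp add: M0_def)
  then interpret presentation ty M0 P ev .
  let ?Q = "colours M0" and ?S = "Slice (colours M0)"
  have Q: "base T = ?Q" using A by (simp add: M0_def)
  note we = we[unfolded Q] and wm = wm[unfolded Q]
  have ne: "nat_trans ?S ?S id_func P (eta T)" and nm: "nat_trans ?S ?S (P \<bullet> P) P (mu T)"
    using we wm by (auto simp: weakly_cartesian_def)
  have eH: "eta T x \<in> Hom ?S x (omap P x)" and mH: "mu T x \<in> Hom ?S (omap P (omap P x)) (omap P x)"
    if "x \<in> Obj ?S" for x using nat_hom[OF ne that] nat_hom[OF nm that] by (auto simp: id_func_def comp_func_def)
  have en: "elt_map (eta T y) (elt_map h e) = elt_map (amap P h) (elt_map (eta T x) e)"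
    if h: "h \<in> Hom ?S x y" and e: "e \<in> src x" for h x y e
  proof -
    have x: "x \<in> Obj ?S" using h by (simp add: Slice_Hom)
    have "Cmp ?S (eta T y) h = Cmp ?S (amap P h) (eta T x)" using nat_nat[OF ne h] by (simp add: id_func_def)
    thus ?thesis using Slice_Cmp[OF h e, of ?Q "eta T y"] Slice_Cmp[OF eH[OF x] e, of ?Q "amap P h"] by simp
  qed
  have mn: "elt_map (mu T y) (elt_map (amap P (amap P h)) t) = elt_map (amap P h) (elt_map (mu T x) t)"
    if h: "h \<in> Hom ?S x y" and t: "t \<in> src (omap P (omap P x))" for h x y t
  proof -
    have x: "x \<in> Obj ?S" using h by (simp add: Slice_Hom)
    have "Cmp ?S (mu T y) (amap P (amap P h)) = Cmp ?S (amap P h) (mu T x)"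
      using nat_nat[OF nm h] by (simp add: comp_func_def)
    thus ?thesis using Slice_Cmp[OF P_hom[OF P_hom[OF h]] t, of ?Q "mu T y"] Slice_Cmp[OF mH[OF x] t, of ?Q "amap P h"] by simp
  qed
  have ew: "\<exists>d\<in>src x. elt_map h d = e \<and> elt_map (eta T x) d = t"
    if h: "h \<in> Hom ?S x y" and e: "e \<in> src y" and t: "t \<in> src (omap P x)"
      and eq: "elt_map (eta T y) e = elt_map (amap P h) t" for h x y e t
  proof -
    have x: "x \<in> Obj ?S" and y: "y \<in> Obj ?S" using h by (auto simp: Slice_Hom)
    have "weak_pullback ?S (amap id_func h) (eta T x) (eta T y) (amap P h)"
      using we h unfolding weakly_cartesian_def by (auto simp: Hom_Arr)
    moreover have "Cmp ?S (eta T y) h = Cmp ?S (amap P h) (eta T x)" using nat_nat[OF ne h] by (simp add: id_func_def)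
    ultimately show ?thesis
      using weak_pullback_Slice[OF h eH[OF x] eH[OF y] P_hom[OF h]] e t eq by (simp add: id_func_def)
  qed
  have mw: "\<exists>s'\<in>src (omap P (omap P x)). elt_map (amap P (amap P h)) s' = s \<and> elt_map (mu T x) s' = t"
    if h: "h \<in> Hom ?S x y" and s: "s \<in> src (omap P (omap P y))" and t: "t \<in> src (omap P x)"
      and eq: "elt_map (mu T y) s = elt_map (amap P h) t" for h x y s t
  proof -
    have x: "x \<in> Obj ?S" and y: "y \<in> Obj ?S" using h by (auto simp: Slice_Hom)
    have "weak_pullback ?S (amap (P \<bullet> P) h) (mu T x) (mu T y) (amap P h)"
      using wm h unfolding weakly_cartesian_def by (auto simp: Hom_Arr)
    moreover have "Cmp ?S (mu T y) (amap P (amap P h)) = Cmp ?S (amap P h) (mu T x)"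
      using nat_nat[OF nm h] by (simp add: comp_func_def)
    ultimately show ?thesis
      using weak_pullback_Slice[OF P_hom[OF P_hom[OF h]] mH[OF x] mH[OF y] P_hom[OF h]] s t eq
      by (simp add: comp_func_def)
  qed
  have small_Q: "small ?Q" using sig by (simp add: is_sig_def)
  have ptO: "pt ?Q c \<in> Obj ?S" if "c \<in> ?Q" for c using pt_Obj[OF small_Q that] .
  have pts: "src (pt ?Q c) = {vnat 0}" "dat (pt ?Q c) (vnat 0) = c" for c by (auto simp: pt_def)
  have "\<exists>k. pre M0 (pt ?Q c) k [vnat 0] \<and> elt_map (eta T (pt ?Q c)) (vnat 0) = ev (pt ?Q c) k [vnat 0]"
    if c: "c \<in> ?Q" for c
  proof (rule generic_element[OF ptO[OF c]])
    note x = ptO[OF c]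
    have v: "vnat 0 \<in> src (pt ?Q c)" by (simp add: pts)
    show "elt_map (eta T (pt ?Q c)) (vnat 0) \<in> src (omap P (pt ?Q c))" using Slice_elt[OF eH[OF x] v] by simp
    fix y h e assume h: "h \<in> Hom ?S y (pt ?Q c)" and e: "e \<in> src (omap P y)"
      and eq: "elt_map (amap P h) e = elt_map (eta T (pt ?Q c)) (vnat 0)"
    obtain d where d: "d \<in> src y" "elt_map h d = vnat 0" "elt_map (eta T y) d = e" using ew[OF h v e eq[symmetric]] by blast
    have y: "y \<in> Obj ?S" using h by (simp add: Slice_Hom)
    have "over (pt ?Q c) (\<lambda>_. d) y" using d Slice_elt[OF h d(1)] by (simp add: over_def pts)
    note l = sarr_Hom[OF x y this]
    have "elt_map (amap P (sarr (pt ?Q c) (\<lambda>_. d) y)) (elt_map (eta T (pt ?Q c)) (vnat 0)) = e"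
      using en[OF l v] d(3) v by simp
    thus "\<exists>l\<in>Hom ?S (pt ?Q c) y. (\<forall>d\<in>src (pt ?Q c). elt_map h (elt_map l d) = d) \<and>
        elt_map (amap P l) (elt_map (eta T (pt ?Q c)) (vnat 0)) = e"
      using l d(2) by (intro bexI[OF _ l]) (auto simp: pts)
  qed (simp_all add: pts)
  then obtain k where k: "\<And>c. c \<in> ?Q \<Longrightarrow> pre M0 (pt ?Q c) (k c) [vnat 0] \<and>
      elt_map (eta T (pt ?Q c)) (vnat 0) = ev (pt ?Q c) (k c) [vnat 0]" by metis
  have k1: "k c = (1, snd (k c))" if "c \<in> ?Q" for c using k[OF that] by (simp add: pre_def prod_eq_iff)
  define ctx where "ctx bs = arg (concat (map (\<lambda>b. map (bnd M0 b) [1..<Suc (fst b)]) bs))" for bs :: "(nat \<times> 'v) list"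
  have ctx: "ctx bs (pos bs i j) = bnd M0 (arg bs i) j" if i: "i \<in> {1..length bs}" and j: "j \<in> {1..fst (arg bs i)}" for bs i j
  proof -
    have "map length (map (\<lambda>b. map (bnd M0 b) [1..<Suc (fst b)]) bs) = map fst bs" by (simp add: comp_def del: upt_Suc)
    from arg_concat_pos[OF this i j] show ?thesis unfolding arg_map[OF i] arg_upt[OF j] ctx_def .
  qed
  define X where "X bs = gobj ?Q (arity_sum bs) (ctx bs)" for bs
  have XO: "X bs \<in> Obj ?S" if s: "substitutable M0 a bs" for a bs
    unfolding X_def
  proof (rule gobj_Obj[OF small_Q])
    fix p assume "p \<in> {1..arity_sum bs}"
    then obtain i j where ij: "i \<in> {1..length bs}" "j \<in> {1..fst (arg bs i)}" "p = pos bs i j" by (rule pos_surj)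
    have "snd (arg bs i) \<in> ops M0 (fst (arg bs i))" using s ij by (simp add: substitutable_def)
    thus "ctx bs p \<in> ?Q" using ctx[OF ij(1,2)] ij(2,3) sig_act(5)[OF sig, of "arg bs i" j] by simp
  qed
  have "\<exists>yss c. nested M0 (X bs) a bs yss \<and> concat yss = gen (arity_sum bs) \<and> pre M0 (X bs) c (gen (arity_sum bs)) \<and>
      elt_map (mu T (X bs)) (ev (omap P (X bs)) a (map2 (ev (X bs)) bs yss)) = ev (X bs) c (gen (arity_sum bs))"
    if s: "substitutable M0 a bs" for a bs
  proof -
    let ?x = "X bs" and ?n = "arity_sum bs"
    note x = XO[OF s] and Px = P_obj[OF XO[OF s]]
    have "length (gen ?n) = ?n" by simp
    then obtain yss where y: "gen ?n = concat yss" "map length yss = map fst bs" by (rule blocks_exist)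
    have la: "length bs = fst a" using s by (simp add: substitutable_def)
    have ly: "length yss = length bs" using map_eq_imp_length_eq[OF y(2)] .
    have n: "nested M0 ?x a bs yss"
    proof (rule nestedI[OF s ly])
      fix i assume i: "i \<in> {1..length bs}"
      have li: "length (arg yss i) = fst (arg bs i)"
        using arg_cong[OF y(2), of "\<lambda>l. arg l i"] i ly by (simp add: arg_map)
      have "arg (arg yss i) j = vnat (pos bs i j)" "pos bs i j \<in> {1..?n}" if j: "j \<in> {1..fst (arg bs i)}" for j
        using arg_concat_pos[OF y(2) i j] arg_gen[OF pos_range[OF i j]] y(1) pos_range[OF i j] by auto
      thus "pre M0 ?x (arg bs i) (arg yss i)"
        using s i la li ctx[OF i] by (simp add: pre_def substitutable_def X_def)
    qed
    note p = nested_ev[OF x n]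
    note s0 = ev_mem[OF Px p]
    let ?s = "ev (omap P ?x) a (map2 (ev ?x) bs yss)"
    have "\<exists>c. pre M0 ?x c (gen ?n) \<and> elt_map (mu T ?x) ?s = ev ?x c (gen ?n)"
    proof (rule generic_element[OF x])
      show "elt_map (mu T ?x) ?s \<in> src (omap P ?x)" using Slice_elt[OF mH[OF x] s0] by simp
      fix z h e assume h: "h \<in> Hom ?S z ?x" and e: "e \<in> src (omap P z)"
        and eq: "elt_map (amap P h) e = elt_map (mu T ?x) ?s"
      have z: "z \<in> Obj ?S" using h by (simp add: Slice_Hom)
      note Ph = P_hom[OF h]
      obtain s' where s': "s' \<in> src (omap P (omap P z))" "elt_map (amap P (amap P h)) s' = ?s" "elt_map (mu T z) s' = e"
        using mw[OF h s0 e eq[symmetric]] by blast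
      obtain es where es: "pre M0 (omap P z) a es" "s' = ev (omap P z) a es" "map (elt_map (amap P h)) es = map2 (ev ?x) bs yss"
        using ev_lift_rep[OF Ph s'(1) p s'(2)] by blast
      have le: "length es = fst a" using es(1) by (simp add: pre_def)
      have "\<exists>ws. pre M0 z (arg bs i) ws \<and> arg es i = ev z (arg bs i) ws \<and> map (elt_map h) ws = arg yss i"
        if i: "i \<in> {1..length bs}" for i
      proof -
        have "elt_map (amap P h) (arg es i) = ev ?x (arg bs i) (arg yss i)"
        proof -
          have ie: "i \<in> {1..length es}" using i le la by simp
          have "arg (map (elt_map (amap P h)) es) i = arg (map2 (ev ?x) bs yss) i" unfolding es(3) ..
          thus ?thesis unfolding arg_map[OF ie] arg_map2_eq[OF i ly] .
        qed
        moreover have "arg es i \<in> src (omap P z)" using es(1) i la unfolding pre_def by simp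
        moreover have "pre M0 ?x (arg bs i) (arg yss i)" using n i la by (simp add: nested_def)
        ultimately show ?thesis using ev_lift_rep[OF h] by metis
      qed
      then obtain w where w: "\<And>i. i \<in> {1..length bs} \<Longrightarrow> pre M0 z (arg bs i) (w i) \<and> arg es i = ev z (arg bs i) (w i) \<and>
          map (elt_map h) (w i) = arg yss i" by metis
      let ?w = "map w [1..<Suc (length bs)]"
      have aw: "arg ?w i = w i" if "i \<in> {1..length bs}" for i by (rule arg_upt[OF that])
      have lw: "length ?w = length bs" by (simp del: upt_Suc)
      have nw: "nested M0 z a bs ?w"
        by (rule nestedI[OF s lw]) (use w aw in \<open>simp del: upt_Suc\<close>)
      note fit = nested_fit[OF nw]
      have hw: "map (map (elt_map h)) ?w = yss"
        by (rule list_arg_ext) (use lw ly w aw in \<open>auto simp: arg_map simp del: upt_Suc map_map\<close>)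
      let ?l = "gmap ?x (concat ?w) z"
      have lc: "length (concat ?w) = ?n" using length_concat_blocks[OF fit] .
      have cw: "arg (concat ?w) p \<in> src z \<and> dat z (arg (concat ?w) p) = ctx bs p" if p: "p \<in> {1..?n}" for p
      proof -
        obtain i j where ij: "i \<in> {1..length bs}" "j \<in> {1..fst (arg bs i)}" "p = pos bs i j" using p by (rule pos_surj)
        have "pre M0 z (arg bs i) (arg ?w i)" using w[OF ij(1)] aw[OF ij(1)] by simp
        thus ?thesis using arg_concat_pos[OF fit ij(1,2)] ctx[OF ij(1,2)] ij(2,3) by (simp add: pre_def)
      qed
      have l: "?l \<in> Hom ?S ?x z" unfolding X_def by (rule gmap_Hom[OF x[unfolded X_def] z cw])
      have lg: "map (elt_map ?l) (gen ?n) = concat ?w" unfolding X_def by (rule gmap_gen[OF lc])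
      have ly': "map (map (elt_map ?l)) yss = ?w"
        using lg y fit by (intro concat_eq_blocks) (auto simp: map_concat comp_def simp del: upt_Suc)
      have "es = map2 (ev z) bs ?w"
      proof (rule list_arg_ext)
        show "length es = length (map2 (ev z) bs ?w)" using le la lw by (simp del: upt_Suc)
        fix i assume "i \<in> {1..length es}"
        hence i: "i \<in> {1..length bs}" using le la by simp
        show "arg es i = arg (map2 (ev z) bs ?w) i" unfolding arg_map2_eq[OF i lw] aw[OF i] using w[OF i] by blast
      qed
      hence "elt_map (amap P (amap P ?l)) ?s = s'"
        using ev_nat[OF P_hom[OF l] p] map_P_nested[OF l n] ly' es(2) by simp
      hence "elt_map (amap P ?l) (elt_map (mu T ?x) ?s) = e" using mn[OF l s0] s'(3) by simp
      moreover have "elt_map h (elt_map ?l d) = d" if d: "d \<in> src ?x" for d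
      proof -
        have "map (elt_map h) (map (elt_map ?l) (gen ?n)) = gen ?n" unfolding y(1) map_concat ly' hw ..
        hence "map (\<lambda>d. elt_map h (elt_map ?l d)) (gen ?n) = map (\<lambda>d. d) (gen ?n)"
          unfolding map_map comp_def map_ident .
        moreover have "d \<in> set (gen ?n)" using d by (simp add: X_def)
        ultimately show ?thesis unfolding map_eq_conv by blast
      qed
      ultimately show "\<exists>l\<in>Hom ?S ?x z. (\<forall>d\<in>src ?x. elt_map h (elt_map l d) = d) \<and>
          elt_map (amap P l) (elt_map (mu T ?x) ?s) = e" using l by blast
    qed (simp_all add: X_def)
    thus ?thesis using n y(1) by metis
  qed
  then obtain Y c where Yc: "\<And>a bs. substitutable M0 a bs \<Longrightarrow> nested M0 (X bs) a bs (Y a bs) \<and> concat (Y a bs) = gen (arity_sum bs) \<and>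
      pre M0 (X bs) (c a bs) (gen (arity_sum bs)) \<and>
      elt_map (mu T (X bs)) (ev (omap P (X bs)) a (map2 (ev (X bs)) bs (Y a bs))) = ev (X bs) (c a bs) (gen (arity_sum bs))"
    by metis
  define M :: "'v multicat" where "M = \<lparr>colours = colours A, ops = ops A, act = act A, bnd = bnd A, ident = \<lambda>c. snd (k c), subst = \<lambda>a bs. snd (c a bs)\<rparr>"
  have MM: "colours M = colours M0" "ops M = ops M0" "act M = act M0" "bnd M = bnd M0" by (simp_all add: M_def M0_def)
  note MC = sig_cong[OF MM] substitutable_cong[OF MM(2,4)]
  have ms: "msubst M a bs = c a bs" if "substitutable M0 a bs" for a bs
    using Yc[OF that] by (simp add: msubst_def M_def pre_def prod_eq_iff)
  have mi: "(1, ident M d) = k d" if "d \<in> ?Q" for d using k1[OF that] by (simp add: M_def prod_eq_iff)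
  have typed: "typed M"
    unfolding typed_def MC(1,6) MM
  proof (intro conjI ballI allI impI sig)
    fix d assume d: "d \<in> ?Q"
    note x = ptO[OF d]
    have v: "vnat 0 \<in> src (pt ?Q d)" by (simp add: pts)
    have p: "pre M0 (pt ?Q d) (1, ident M d) [vnat 0]" using k[OF d] mi[OF d] by simp
    show "ident M d \<in> ops M0 1" using p by (simp add: pre_def)
    show "bnd M0 (1, ident M d) 1 = d" using p by (simp add: pre_def arg_def pts)
    show "bnd M0 (1, ident M d) 0 = d"
      using ev_dat[OF x p] k[OF d] mi[OF d] Slice_elt[OF eH[OF x] v] by (simp add: pts)
  next
    fix a bs assume s: "substitutable M0 a bs"
    note Y = Yc[OF s]
    have la: "length bs = fst a" using s by (simp add: substitutable_def)
    have p: "pre M0 (X bs) (msubst M a bs) (gen (arity_sum bs))" using Y ms[OF s] by simp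
    show "subst M a bs \<in> ops M0 (arity_sum bs)" using p by (simp add: pre_def msubst_def)
    note Px = P_obj[OF XO[OF s]]
    have n: "nested M0 (X bs) a bs (Y a bs)" using Y by blast
    show "bnd M0 (msubst M a bs) 0 = bnd M0 a 0"
      using ev_dat[OF XO[OF s] p] Y ms[OF s] ev_dat[OF Px nested_ev[OF XO[OF s] n]]
        Slice_elt[OF mH[OF XO[OF s]] ev_mem[OF Px nested_ev[OF XO[OF s] n]]] by simp
    show "bnd M0 (msubst M a bs) (pos bs i j) = bnd M0 (arg bs i) j"
      if i: "i \<in> {1..fst a}" and j: "j \<in> {1..fst (arg bs i)}" for i j
    proof -
      have i': "i \<in> {1..length bs}" using i la by simp
      note r = pos_range[OF i' j]
      have "bnd M0 (msubst M a bs) (pos bs i j) = dat (X bs) (arg (gen (arity_sum bs)) (pos bs i j))"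
        using p r by (simp add: pre_def)
      thus ?thesis using r ctx[OF i' j] by (simp add: X_def)
    qed
  qed
  have "induced M T ev"
  proof (intro induced.intro induced_axioms.intro, unfold MM MC P_def[symmetric])
    show "presentation M0 P ev" by (rule presentation_axioms)
    show "typed M" by (rule typed)
    show "base T = ?Q" by (rule Q)
    fix x assume x: "x \<in> Obj ?S"
    show "eta T x \<in> Hom ?S x (omap P x)" by (rule eH[OF x])
    show "mu T x \<in> Hom ?S (omap P (omap P x)) (omap P x)" by (rule mH[OF x])
    show "elt_map (eta T x) e = ev x (1, ident M (dat x e)) [e]" if e: "e \<in> src x" for e
    proof -
      have d: "dat x e \<in> ?Q" using x e by (auto simp: Slice_Obj)
      let ?p = "pt ?Q (dat x e)"
      have "over ?p (\<lambda>_. e) x" using e by (simp add: over_def pts)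
      note h = sarr_Hom[OF ptO[OF d] x this]
      have v: "vnat 0 \<in> src ?p" by (simp add: pts)
      show ?thesis using en[OF h v] k[OF d] ev_nat[OF h, of "k (dat x e)" "[vnat 0]"] mi[OF d] v by simp
    qed
    show "elt_map (mu T x) (ev (omap P x) a (map2 (ev x) bs yss)) = ev x (msubst M a bs) (concat yss)"
      if n: "nested M0 x a bs yss" for a bs yss
    proof -
      note s = nested_substitutable[OF n] and fit = nested_fit[OF n]
      note Y = Yc[OF s]
      have lc: "length (concat yss) = arity_sum bs" using length_concat_blocks[OF fit] .
      have nM: "nested M x a bs yss" using n MC(4) by simp
      have pc: "pre M0 x (msubst M a bs) (concat yss)" using nested_concat[OF typed nM] MC(2) by simp
      have pg: "pre M0 (X bs) (msubst M a bs) (gen (arity_sum bs))" using Y ms[OF s] by simp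
      let ?h = "gmap (X bs) (concat yss) x"
      have h: "?h \<in> Hom ?S (X bs) x" unfolding X_def
      proof (rule gmap_Hom[OF XO[OF s, unfolded X_def] x])
        fix p assume p: "p \<in> {1..arity_sum bs}"
        have "bnd M0 (msubst M a bs) p = ctx bs p" using pg p by (simp add: pre_def X_def)
        thus "arg (concat yss) p \<in> src x \<and> dat x (arg (concat yss) p) = ctx bs p" using pc p by (simp add: pre_def)
      qed
      have hg: "map (elt_map ?h) (gen (arity_sum bs)) = concat yss" unfolding X_def by (rule gmap_gen[OF lc])
      have nY: "nested M0 (X bs) a bs (Y a bs)" using Y by blast
      have hY: "map (map (elt_map ?h)) (Y a bs) = yss"
        using hg Y fit nested_fit[OF nY] by (intro concat_eq_blocks) (simp_all add: map_concat[symmetric] comp_def)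
      note Px = P_obj[OF XO[OF s]] and p = nested_ev[OF XO[OF s] nY]
      have "ev (omap P x) a (map2 (ev x) bs yss) = elt_map (amap P (amap P ?h)) (ev (omap P (X bs)) a (map2 (ev (X bs)) bs (Y a bs)))"
        using ev_nat[OF P_hom[OF h] p] map_P_nested[OF h nY] hY by simp
      thus ?thesis using mn[OF h ev_mem[OF Px p]] Y ms[OF s] ev_nat[OF h pg] hg by simp
    qed
  qed
  thus ?thesis by blast
qed

lemma is_anmonad_iff:
  assumes "induced (M :: ('v, 'z) multicat_scheme) (T :: ('v, 'y) anmonad_scheme) ev"
  shows "is_anmonad T \<longleftrightarrow> is_multicat M"
proof -
  interpret induced ty M T ev by fact
  have t: "colours M = colours (sig.truncate M)" "ops M = ops (sig.truncate M)"
    "act M = act (sig.truncate M)" "bnd M = bnd (sig.truncate M)" by (simp_all add: sig.truncate_def)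
  have "presentation (sig.truncate M) (fctr T) ev"
    by (rule sig_cong(5)[OF t, THEN iffD1, OF presentation_axioms])
  from analytic_of_presentation[OF this] have "analytic (colours M) (fctr T)" unfolding t(1)[symmetric] .
  moreover have "small (colours M)" using sig by (simp add: is_sig_def)
  ultimately have "is_anfunc T" by (simp add: is_anfunc_def base)
  thus ?thesis
    unfolding is_anmonad_def Let_def base
    using is_monad is_multicat eta_weakly_cartesian mu_weakly_cartesian by blast
qed

end

subsection \<open>Multifunctors and monad morphisms\<close>

lemma is_multifunctor_iff:
  "is_multifunctor M N (u, f) \<longleftrightarrow> is_sig_mor M N (u, f) \<and>
    (\<forall>c \<in> colours M. f 1 (ident M c) = ident N (dat u c)) \<and>
    (\<forall>a bs. substitutable M a bs \<longrightarrow> mapp f (msubst M a bs) = msubst N (mapp f a) (map (mapp f) bs))"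
proof -
  have 1: "arity_sum (map (mapp f) bs) = arity_sum bs" for bs by (simp add: arity_sum_def comp_def)
  have 2: "map (\<lambda>(k, b). (k, f k b)) bs = map (mapp f) bs" for bs by (simp add: mapp_def case_prod_beta)
  have key: "(f (arity_sum bs) (subst M (n, a) bs) = subst N (n, f n a) (map (\<lambda>(k, b). (k, f k b)) bs)) \<longleftrightarrow>
     mapp f (msubst M (n, a) bs) = msubst N (mapp f (n, a)) (map (mapp f) bs)" for n a bs
    unfolding 2 msubst_def 1 by simp
  show ?thesis unfolding is_multifunctor_def prod.case by (simp only: split_paired_All key)
qed

context universe
begin

lemma presents_induced: "induced (M :: ('v, 'z) multicat_scheme) (T :: ('v, 'y) anmonad_scheme) ev \<Longrightarrow> presents (M, T, ev)"
  unfolding presents_def induced_def induced_axioms_def by simp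

lemma multifunctor_iff_monad_morphism:
  assumes M: "induced (M :: ('v, 'z) multicat_scheme) (T :: ('v, 'y) anmonad_scheme) ev"
    and N: "induced (N :: ('v, 'z) multicat_scheme) (T' :: ('v, 'y) anmonad_scheme) ev'"
    and m: "is_sig_mor M N (u, f)"
  shows "is_multifunctor M N (u, f) \<longleftrightarrow> is_anmonad_mor T T'
    (u, \<lambda>x \<in> Obj (Slice (base T')). comp_arrow M (fctr T) ev (fctr T') ev' u f x)"
proof -
  interpret M: induced ty M T ev by fact
  interpret N: induced ty N T' ev' by fact
  interpret presentation_pair ty M "fctr T" ev N "fctr T'" ev'
    by (rule presentation_pairI[OF M.presentation_axioms N.presentation_axioms])
  let ?S = "Slice (colours M)" and ?S' = "Slice (colours N)" and ?P = "fctr T" and ?R = "fctr T'"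
  let ?c = "component u f"
  note u = sig_mor(1)[OF m]
  have U: "src u = colours M" "\<And>k. k \<in> colours M \<Longrightarrow> dat u k \<in> colours N" using u by (auto simp: Sets_Hom)
  have an: "is_an_mor T T' (u, \<lambda>x \<in> Obj (Slice (base T')). ?c x)"
    using is_an_mor_iff[OF presents_induced[OF M] presents_induced[OF N]] m by blast
  have sf: "substitutable N (mapp f a) (map (mapp f) bs)" if "substitutable M a bs" for a bs
    using that sig_mor(2,4)[OF m] by (auto simp: substitutable_def arg_map)
  have V1: "elt_map (?c x) (elt_map (eta T (pb_obj u x)) z) = vpair (o', ev' x (1, f 1 (ident M o')) [e]) \<and>
      elt_map (amap (pb u) (eta T' x)) z = vpair (o', ev' x (1, ident N (dat u o')) [e]) \<and>
      pre N x (1, f 1 (ident M o')) [e] \<and> pre N x (1, ident N (dat u o')) [e]"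
    if x: "x \<in> Obj ?S'" and z: "z \<in> src (pb_obj u x)" "z = vpair (o', e)" for x z o' e
  proof -
    note ux = pb_obj_Obj[OF u x]
    have o: "o' \<in> colours M" "e \<in> src x" "dat x e = dat u o'" "dat (pb_obj u x) z = o'" using z U by auto
    note p = M.pre_ident[OF ux z(1), unfolded o(4)]
    have "snd (1, ident M o') \<in> ops M (fst (1, ident M o'))" using M.ident_op[OF o(1)] by simp
    hence b: "bnd M (1, ident M o') 0 = o'" using M.ident_op[OF o(1)] by simp
    show ?thesis
      using component_value[OF m x p] M.eta_value[OF ux z(1)] o(3,4) b z(2) pb_elt[OF N.eta_Hom[OF x] z(1)]
        N.eta_value[OF x o(2)] pre_image[OF m x p] N.pre_ident[OF x o(2)] by simp
  qed
  have V2: "elt_map (?c x) (elt_map (mu T (pb_obj u x)) t) = vpair (bnd M a 0, ev' x (mapp f (msubst M a bs)) (map vsnd (concat zss))) \<and>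
      elt_map (amap (pb u) (mu T' x)) (elt_map (?c (omap ?R x)) (elt_map (amap ?P (?c x)) t)) =
        vpair (bnd M a 0, ev' x (msubst N (mapp f a) (map (mapp f) bs)) (map vsnd (concat zss))) \<and>
      pre N x (mapp f (msubst M a bs)) (map vsnd (concat zss)) \<and>
      pre N x (msubst N (mapp f a) (map (mapp f) bs)) (map vsnd (concat zss))"
    if x: "x \<in> Obj ?S'" and n: "nested M (pb_obj u x) a bs zss"
      and t: "t = ev (omap ?P (pb_obj u x)) a (map2 (ev (pb_obj u x)) bs zss)" for x a bs zss t
  proof -
    note ux = pb_obj_Obj[OF u x]
    note Rx = N.P_obj[OF x] and Pux = M.P_obj[OF ux]
    note s = nested_substitutable[OF n]
    have l: "length bs = fst a" "length zss = fst a"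
      and pi: "\<And>i. i \<in> {1..fst a} \<Longrightarrow> pre M (pb_obj u x) (arg bs i) (arg zss i)" using n by (auto simp: nested_def)
    note nc = nested_concat[OF M.typed n]
    have 1: "elt_map (?c x) (elt_map (mu T (pb_obj u x)) t) = vpair (bnd M a 0, ev' x (mapp f (msubst M a bs)) (map vsnd (concat zss)))"
      unfolding t M.mu_value[OF ux n] component_value[OF m x nc] using M.sub_bnd[OF s] by simp
    have nN: "nested N x (mapp f a) (map (mapp f) bs) (map (map vsnd) zss)"
      by (rule nestedI[OF sf[OF s]]) (use l pre_image[OF m x pi] in \<open>simp_all add: arg_map\<close>)
    note pe = M.nested_ev[OF ux n]
    have t1: "elt_map (amap ?P (?c x)) t = ev (pb_obj u (omap ?R x)) a (map (elt_map (?c x)) (map2 (ev (pb_obj u x)) bs zss))"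
      unfolding t by (rule M.ev_nat[OF component_Hom[OF m x] pe])
    note pe' = pre_map[OF pe component_Hom[OF m x]]
    have ev: "map vsnd (map (elt_map (?c x)) (map2 (ev (pb_obj u x)) bs zss)) = map2 (ev' x) (map (mapp f) bs) (map (map vsnd) zss)"
      by (rule list_arg_ext) (use l component_value[OF m x pi] in \<open>simp_all add: arg_map arg_map2\<close>)
    have tm: "t \<in> src (omap ?P (omap ?P (pb_obj u x)))" unfolding t by (rule M.ev_mem[OF Pux pe])
    have t2: "elt_map (?c (omap ?R x)) (elt_map (amap ?P (?c x)) t) =
        vpair (bnd M a 0, ev' (omap ?R x) (mapp f a) (map2 (ev' x) (map (mapp f) bs) (map (map vsnd) zss)))"
      unfolding t1 component_value[OF m Rx pe'] ev ..
    have "elt_map (?c (omap ?R x)) (elt_map (amap ?P (?c x)) t) \<in> src (pb_obj u (omap ?R (omap ?R x)))"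
      using Slice_elt[OF component_Hom[OF m Rx]] Slice_elt[OF M.P_hom[OF component_Hom[OF m x]] tm] by blast
    from pb_elt[OF N.mu_Hom[OF x] this]
    have "elt_map (amap (pb u) (mu T' x)) (elt_map (?c (omap ?R x)) (elt_map (amap ?P (?c x)) t)) =
        vpair (bnd M a 0, ev' x (msubst N (mapp f a) (map (mapp f) bs)) (concat (map (map vsnd) zss)))"
      unfolding t2 using N.mu_value[OF x nN] by simp
    thus ?thesis using 1 pre_image[OF m x nc] nested_concat[OF N.typed nN] by (simp add: map_concat)
  qed
  have main: "is_anmonad_mor T T' (u, \<lambda>x \<in> Obj (Slice (base T')). ?c x) \<longleftrightarrow>
    (\<forall>x \<in> Obj ?S'. (\<forall>z \<in> src (pb_obj u x). elt_map (?c x) (elt_map (eta T (pb_obj u x)) z) = elt_map (amap (pb u) (eta T' x)) z) \<and>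
      (\<forall>t \<in> src (omap ?P (omap ?P (pb_obj u x))). elt_map (?c x) (elt_map (mu T (pb_obj u x)) t) =
         elt_map (amap (pb u) (mu T' x)) (elt_map (?c (omap ?R x)) (elt_map (amap ?P (?c x)) t))))"
  proof -
    have "(Cmp ?S (?c x) (eta T (pb_obj u x)) = amap (pb u) (eta T' x) \<longleftrightarrow>
        (\<forall>z \<in> src (pb_obj u x). elt_map (?c x) (elt_map (eta T (pb_obj u x)) z) = elt_map (amap (pb u) (eta T' x)) z)) \<and>
      (Cmp ?S (?c x) (mu T (pb_obj u x)) = Cmp ?S (amap (pb u) (mu T' x)) (Cmp ?S (?c (omap ?R x)) (amap ?P (?c x))) \<longleftrightarrow>
        (\<forall>t \<in> src (omap ?P (omap ?P (pb_obj u x))). elt_map (?c x) (elt_map (mu T (pb_obj u x)) t) =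
         elt_map (amap (pb u) (mu T' x)) (elt_map (?c (omap ?R x)) (elt_map (amap ?P (?c x)) t))))" if x: "x \<in> Obj ?S'" for x
    proof (intro conjI)
      note ux = pb_obj_Obj[OF u x] and Rx = N.P_obj[OF x]
      note ch = component_Hom[OF m x] and cR = component_Hom[OF m Rx]
      note e1 = M.eta_Hom[OF ux] and e2 = pb_hom[OF u N.eta_Hom[OF x]]
      note m1 = M.mu_Hom[OF ux] and m2 = pb_hom[OF u N.mu_Hom[OF x]]
      note Pc = M.P_hom[OF ch]
      note cc = cat_cmp[OF M.S Pc cR]
      show "Cmp ?S (?c x) (eta T (pb_obj u x)) = amap (pb u) (eta T' x) \<longleftrightarrow>
        (\<forall>z \<in> src (pb_obj u x). elt_map (?c x) (elt_map (eta T (pb_obj u x)) z) = elt_map (amap (pb u) (eta T' x)) z)"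
        using Slice_ext[OF cat_cmp[OF M.S e1 ch] e2] Slice_Cmp[OF e1] by metis
      have "elt_map (Cmp ?S (amap (pb u) (mu T' x)) (Cmp ?S (?c (omap ?R x)) (amap ?P (?c x)))) t =
          elt_map (amap (pb u) (mu T' x)) (elt_map (?c (omap ?R x)) (elt_map (amap ?P (?c x)) t))"
        if "t \<in> src (omap ?P (omap ?P (pb_obj u x)))" for t
        using Slice_Cmp[OF cc that] Slice_Cmp[OF Pc that] by simp
      thus "Cmp ?S (?c x) (mu T (pb_obj u x)) = Cmp ?S (amap (pb u) (mu T' x)) (Cmp ?S (?c (omap ?R x)) (amap ?P (?c x))) \<longleftrightarrow>
        (\<forall>t \<in> src (omap ?P (omap ?P (pb_obj u x))). elt_map (?c x) (elt_map (mu T (pb_obj u x)) t) =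
         elt_map (amap (pb u) (mu T' x)) (elt_map (?c (omap ?R x)) (elt_map (amap ?P (?c x)) t)))"
        using Slice_ext[OF cat_cmp[OF M.S m1 ch] cat_cmp[OF M.S cc m2]] Slice_Cmp[OF m1] by metis
    qed
    thus ?thesis
      unfolding is_anmonad_mor_def Let_def using an N.P_obj by (simp add: M.base N.base)
  qed
  show ?thesis
  proof
    assume "is_multifunctor M N (u, f)"
    hence fi: "\<And>c. c \<in> colours M \<Longrightarrow> f 1 (ident M c) = ident N (dat u c)"
      and fs: "\<And>a bs. substitutable M a bs \<Longrightarrow> mapp f (msubst M a bs) = msubst N (mapp f a) (map (mapp f) bs)"
      by (auto simp: is_multifunctor_iff)
    show "is_anmonad_mor T T' (u, \<lambda>x \<in> Obj (Slice (base T')). ?c x)"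
      unfolding main
    proof (intro ballI conjI)
      fix x z assume x: "x \<in> Obj ?S'" and z: "z \<in> src (pb_obj u x)"
      obtain o' e where oe: "z = vpair (o', e)" "o' \<in> src u" using z by (auto elim!: pb_memE)
      thus "elt_map (?c x) (elt_map (eta T (pb_obj u x)) z) = elt_map (amap (pb u) (eta T' x)) z"
        using V1[OF x z oe(1)] fi U by simp
    next
      fix x t assume x: "x \<in> Obj ?S'" and t: "t \<in> src (omap ?P (omap ?P (pb_obj u x)))"
      note ux = pb_obj_Obj[OF u x]
      obtain a es where a: "pre M (omap ?P (pb_obj u x)) a es" "t = ev (omap ?P (pb_obj u x)) a es"
        using M.ev_ex[OF M.P_obj[OF ux] t] by blast
      obtain bs zss where n: "nested M (pb_obj u x) a bs zss" "es = map2 (ev (pb_obj u x)) bs zss"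
        using M.nested_ex[OF ux a(1)] .
      show "elt_map (?c x) (elt_map (mu T (pb_obj u x)) t) =
         elt_map (amap (pb u) (mu T' x)) (elt_map (?c (omap ?R x)) (elt_map (amap ?P (?c x)) t))"
        using V2[OF x n(1)] fs[OF nested_substitutable[OF n(1)]] a(2) n(2) by simp
    qed
  next
    assume "is_anmonad_mor T T' (u, \<lambda>x \<in> Obj (Slice (base T')). ?c x)"
    hence E1: "\<And>x z. x \<in> Obj ?S' \<Longrightarrow> z \<in> src (pb_obj u x) \<Longrightarrow>
        elt_map (?c x) (elt_map (eta T (pb_obj u x)) z) = elt_map (amap (pb u) (eta T' x)) z"
      and E2: "\<And>x t. x \<in> Obj ?S' \<Longrightarrow> t \<in> src (omap ?P (omap ?P (pb_obj u x))) \<Longrightarrow>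
        elt_map (?c x) (elt_map (mu T (pb_obj u x)) t) =
         elt_map (amap (pb u) (mu T' x)) (elt_map (?c (omap ?R x)) (elt_map (amap ?P (?c x)) t))"
      unfolding main by blast+
    have small_N: "small (colours N)" using N.sig by (simp add: is_sig_def)
    show "is_multifunctor M N (u, f)"
      unfolding is_multifunctor_iff
    proof (intro conjI m ballI allI impI)
      fix c assume c: "c \<in> colours M"
      let ?x = "pt (colours N) (dat u c)"
      have x: "?x \<in> Obj ?S'" by (rule pt_Obj[OF small_N U(2)[OF c]])
      have z: "vpair (c, vnat 0) \<in> src (pb_obj u ?x)" using c U by (simp add: pt_def)
      note V = V1[OF x z refl]
      have e: "ev' ?x (1, f 1 (ident M c)) [vnat 0] = ev' ?x (1, ident N (dat u c)) [vnat 0]"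
        using E1[OF x z] V by simp
      have "(1 :: nat, f 1 (ident M c)) = (1, ident N (dat u c))"
        by (rule N.ev_inject_distinct[OF x _ _ _ e]) (use V in auto)
      thus "f 1 (ident M c) = ident N (dat u c)" by simp
    next
      fix a bs assume s: "substitutable M a bs"
      let ?d = "msubst M a bs" and ?n = "arity_sum bs"
      let ?x = "gobj (colours N) ?n (\<lambda>p. dat u (bnd M ?d p))"
      have sd: "snd ?d \<in> ops M (fst ?d)" using M.sub_op[OF s] by simp
      have bd: "bnd M ?d p \<in> colours M" if "p \<in> {1..?n}" for p using sig_act(5)[OF M.sig sd, of p] that by simp
      have x: "?x \<in> Obj ?S'" using bd by (intro gobj_Obj[OF small_N] U(2)) auto
      define zs where "zs = map (\<lambda>p. vpair (bnd M ?d p, vnat p)) [1..<Suc ?n]"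
      have az: "arg zs p = vpair (bnd M ?d p, vnat p)" if "p \<in> {1..?n}" for p unfolding zs_def by (rule arg_upt[OF that])
      have lz: "length zs = ?n" by (simp add: zs_def del: upt_Suc)
      have vz: "map vsnd zs = gen ?n" by (rule list_arg_ext) (auto simp: lz az arg_map)
      have "pre M (pb_obj u ?x) ?d zs" unfolding pre_def using sd lz az bd U by simp
      from nested_split[OF M.typed s this]
      obtain zss where n: "nested M (pb_obj u ?x) a bs zss" "zs = concat zss" .
      note ux = pb_obj_Obj[OF u x]
      note V = V2[OF x n(1) refl]
      note t = M.ev_mem[OF M.P_obj[OF ux] M.nested_ev[OF ux n(1)]]
      have e: "ev' ?x (mapp f ?d) (gen ?n) = ev' ?x (msubst N (mapp f a) (map (mapp f) bs)) (gen ?n)"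
        using E2[OF x t] V n(2) vz by simp
      show "mapp f ?d = msubst N (mapp f a) (map (mapp f) bs)"
        by (rule N.ev_inject_distinct[OF x _ _ _ e]) (use V n(2) vz in auto)
    qed
  qed
qed

definition AnMonad_keys :: "('v multicat \<times> 'v anmonad \<times> ('v fn \<Rightarrow> nat \<times> 'v \<Rightarrow> 'v list \<Rightarrow> 'v)) set" where
  "AnMonad_keys = {k. is_multicat (fst k) \<and> induced (fst k) (fst (snd k)) (snd (snd k))}"

lemma is_multifunctor_id: "is_multicat M \<Longrightarrow> is_multifunctor M M (Idn Sets (colours M), \<lambda>n. \<lambda>a \<in> ops M n. a)"
proof -
  assume M: "is_multicat M"
  hence t: "typed M" by (rule typed_multicat)
  let ?i = "\<lambda>n. \<lambda>a \<in> ops M n. a"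
  have i: "mapp ?i a = a" if "snd a \<in> ops M (fst a)" for a using that by (simp add: mapp_def)
  have l: "map (mapp ?i) bs = bs" if s: "substitutable M a bs" for a bs
  proof (rule list_arg_ext)
    fix j assume "j \<in> {1..length (map (mapp ?i) bs)}"
    thus "arg (map (mapp ?i) bs) j = arg bs j"
      using s i[of "arg bs j"] by (simp add: arg_map substitutable_def)
  qed simp
  show ?thesis
    unfolding is_multifunctor_iff
  proof (intro conjI ballI allI impI)
    show "is_sig_mor M M (Idn Sets (colours M), ?i)" using t by (intro is_sig_mor_id) (simp add: typed_def)
    show "?i 1 (ident M c) = ident M (dat (Idn Sets (colours M)) c)" if "c \<in> colours M" for c
      using t that by (simp add: typed_def Sets_def)
    fix a bs assume s: "substitutable M a bs"
    have "snd (msubst M a bs) \<in> ops M (fst (msubst M a bs))" "snd a \<in> ops M (fst a)"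
      using t s by (auto simp: typed_def msubst_def substitutable_def)
    thus "mapp ?i (msubst M a bs) = msubst M (mapp ?i a) (map (mapp ?i) bs)"
      unfolding l[OF s] using i[of a] i[of "msubst M a bs"] by simp
  qed
qed

lemma is_multifunctor_comp:
  assumes f: "is_multifunctor M N (u, f)" and g: "is_multifunctor N O' (v, g)" and M: "is_multicat M"
  shows "is_multifunctor M O' (Cmp Sets v u, \<lambda>n. compose (ops M n) (g n) (f n))"
proof -
  note t = typed_multicat[OF M]
  have mf: "is_sig_mor M N (u, f)" and mg: "is_sig_mor N O' (v, g)" using f g by (auto simp: is_multifunctor_iff)
  note u = sig_mor(1)[OF mf]
  have U: "dat u c \<in> colours N" if "c \<in> colours M" for c using u that by (auto simp: Sets_Hom)
  have vu: "dat (Cmp Sets v u) k = dat v (dat u k)" if "k \<in> colours M" for k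
    using u that by (simp add: Sets_def Hom_Arr compose_def)
  let ?h = "\<lambda>n. compose (ops M n) (g n) (f n)"
  have mh: "mapp ?h a = mapp g (mapp f a)" if "snd a \<in> ops M (fst a)" for a using that by (simp add: mapp_def compose_def)
  have "is_sig M" using t by (simp add: typed_def)
  note sm = is_sig_mor_comp[OF mf mg this]
  have sf: "substitutable N (mapp f a) (map (mapp f) bs)" if "substitutable M a bs" for a bs
    using that sig_mor(2,4)[OF mf] by (auto simp: substitutable_def arg_map)
  show ?thesis
    unfolding is_multifunctor_iff
  proof (intro conjI sm ballI allI impI)
    fix c assume c: "c \<in> colours M"
    show "?h 1 (ident M c) = ident O' (dat (Cmp Sets v u) c)"
      using f g c U[OF c] vu[OF c] t by (simp add: is_multifunctor_iff typed_def compose_def)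
  next
    fix a bs assume s: "substitutable M a bs"
    have 1: "map (mapp ?h) bs = map (mapp g) (map (mapp f) bs)"
    proof (rule list_arg_ext)
      fix i assume "i \<in> {1..length (map (mapp ?h) bs)}"
      hence i: "i \<in> {1..length bs}" by simp
      have "snd (arg bs i) \<in> ops M (fst (arg bs i))" using s i by (simp add: substitutable_def)
      thus "arg (map (mapp ?h) bs) i = arg (map (mapp g) (map (mapp f) bs)) i" using i mh by (simp add: arg_map)
    qed simp
    have 2: "snd (msubst M a bs) \<in> ops M (fst (msubst M a bs))" using t s by (simp add: typed_def msubst_def)
    have 3: "snd a \<in> ops M (fst a)" using s by (simp add: substitutable_def)
    show "mapp ?h (msubst M a bs) = msubst O' (mapp ?h a) (map (mapp ?h) bs)"
      unfolding mh[OF 2] mh[OF 3] 1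
      using f g s sf[OF s] unfolding is_multifunctor_iff by simp
  qed
qed

lemma is_category_Multicat: "is_category (Multicat :: ('v multicat, 'v sig_map) category)"
  unfolding is_category_def
proof (intro conjI ballI impI)
  fix f g :: "('v multicat, 'v sig_map) arrow" assume "f \<in> Arr Multicat" "g \<in> Arr Multicat" "tgt f = src g"
  thus "Cmp Multicat g f \<in> Hom Multicat (src f) (tgt g)"
    by (auto simp: Multicat_def Hom_def sig_cmp_simp is_multifunctor_comp)
next
  fix f g h :: "('v multicat, 'v sig_map) arrow"
  assume "f \<in> Arr Multicat" "g \<in> Arr Multicat" "h \<in> Arr Multicat" "tgt f = src g" "tgt g = src h"
  thus "Cmp Multicat h (Cmp Multicat g f) = Cmp Multicat (Cmp Multicat h g) f"
    by (auto simp: Multicat_def sig_map_assoc is_multifunctor_iff)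
next
  fix a :: "'v multicat" assume "a \<in> Obj Multicat"
  thus "Idn Multicat a \<in> Hom Multicat a a" by (auto simp: Multicat_def Hom_def sig_id_def is_multifunctor_id)
next
  fix f :: "('v multicat, 'v sig_map) arrow" assume "f \<in> Arr Multicat"
  thus "Cmp Multicat f (Idn Multicat (src f)) = f" "Cmp Multicat (Idn Multicat (tgt f)) f = f"
    by (auto simp: Multicat_def sig_map_laws is_multifunctor_iff)
qed (auto simp: Multicat_def)

lemma AnMonad_correspondence:
  "correspondence (Multicat :: ('v multicat, 'v sig_map) category) AnMonad AnMonad_keys fst (\<lambda>k. fst (snd k)) an_arrow"
proof
  show "is_category (Multicat :: ('v multicat, 'v sig_map) category)" by (rule is_category_Multicat)
  show "src f \<in> Obj AnMonad \<and> tgt f \<in> Obj AnMonad" if "f \<in> Arr AnMonad" for f :: "('v anmonad, 'v an_map) arrow"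
    using that by (auto simp: AnMonad_def)
  show "fst k \<in> Obj Multicat" if "k \<in> AnMonad_keys" for k
    using that by (simp add: AnMonad_keys_def Multicat_def)
  show "fst (snd k) \<in> Obj AnMonad" if "k \<in> AnMonad_keys" for k
    using that is_anmonad_iff by (auto simp: AnMonad_keys_def AnMonad_def)
  show "\<exists>k\<in>AnMonad_keys. fst k = M" if "M \<in> Obj Multicat" for M :: "'v multicat"
  proof -
    have M: "is_multicat M" using that by (simp add: Multicat_def)
    then obtain T :: "'v anmonad" and ev where "induced M T ev" using induced_exists by blast
    thus ?thesis using M by (intro bexI[of _ "(M, T, ev)"]) (simp_all add: AnMonad_keys_def)
  qed
  show "\<exists>k\<in>AnMonad_keys. fst (snd k) = T" if "T \<in> Obj AnMonad" for T :: "'v anmonad"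
  proof -
    have T: "is_anmonad T" using that by (simp add: AnMonad_def)
    then obtain M :: "'v multicat" and ev where i: "induced M T ev" using inducing_exists by blast
    thus ?thesis using T is_anmonad_iff[OF i] by (intro bexI[of _ "(M, T, ev)"]) (simp_all add: AnMonad_keys_def)
  qed
  show "bij_betw (an_arrow k k') (Hom Multicat (fst k) (fst k')) (Hom AnMonad (fst (snd k)) (fst (snd k')))"
    if kk: "k \<in> AnMonad_keys" "k' \<in> AnMonad_keys" for k k'
  proof -
    obtain A P ev B R ev' where k: "k = (A, P, ev)" "k' = (B, R, ev')" using prod_cases3 by metis
    have i: "induced A P ev" "induced B R ev'" and mc: "is_multicat A" "is_multicat B"
      using kk k by (auto simp: AnMonad_keys_def)
    note p = presents_induced[OF i(1)] presents_induced[OF i(2)]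
    have a: "is_anmonad P" "is_anmonad R" using is_anmonad_iff[OF i(1)] is_anmonad_iff[OF i(2)] mc by auto
    have H: "Hom Multicat A B = {Arrow A (u, f) B | u f. is_multifunctor A B (u, f)}"
      using mc by (auto simp: Hom_def Multicat_def)
    have H': "Hom AnMonad P R = {Arrow P (u, \<phi>) R | u \<phi>. is_anmonad_mor P R (u, \<phi>)}"
      using a by (auto simp: Hom_def AnMonad_def)
    show ?thesis
      unfolding bij_betw_def k fst_conv snd_conv
    proof
      show "inj_on (an_arrow (A, P, ev) (B, R, ev')) (Hom Multicat A B)"
        unfolding H inj_on_def using an_arrow_inject[OF p] is_multifunctor_iff[of A B] by blast
      show "an_arrow (A, P, ev) (B, R, ev') ` Hom Multicat A B = Hom AnMonad P R"
      proof (intro equalityI subsetI)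
        fix F assume "F \<in> an_arrow (A, P, ev) (B, R, ev') ` Hom Multicat A B"
        then obtain u f where F: "F = an_arrow (A, P, ev) (B, R, ev') (Arrow A (u, f) B)" "is_multifunctor A B (u, f)"
          unfolding H by blast
        have m: "is_sig_mor A B (u, f)" using F(2) by (simp add: is_multifunctor_iff)
        show "F \<in> Hom AnMonad P R"
          using multifunctor_iff_monad_morphism[OF i m] F unfolding H' by (auto simp: an_arrow_simp)
      next
        fix F assume "F \<in> Hom AnMonad P R"
        then obtain u \<phi> where F: "F = Arrow P (u, \<phi>) R" "is_anmonad_mor P R (u, \<phi>)" unfolding H' by blast
        have "is_an_mor P R (u, \<phi>)" using F(2) by (simp add: is_anmonad_mor_def)
        then obtain f where f: "is_sig_mor A B (u, f)"
          "\<phi> = (\<lambda>x \<in> Obj (Slice (base R)). comp_arrow A (fctr P) ev (fctr R) ev' u f x)"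
          unfolding is_an_mor_iff[OF p] by blast
        hence "is_multifunctor A B (u, f)" using multifunctor_iff_monad_morphism[OF i f(1)] F(2) by simp
        thus "F \<in> an_arrow (A, P, ev) (B, R, ev') ` Hom Multicat A B"
          unfolding H F(1) by (intro image_eqI[of _ _ "Arrow A (u, f) B"]) (auto simp: an_arrow_simp f(2))
      qed
    qed
  qed
  show "an_arrow k k'' (Cmp Multicat g f) = Cmp AnMonad (an_arrow k' k'' g) (an_arrow k k' f)"
    if "k \<in> AnMonad_keys" "k' \<in> AnMonad_keys" "k'' \<in> AnMonad_keys" "f \<in> Hom Multicat (fst k) (fst k')"
      "g \<in> Hom Multicat (fst k') (fst k'')" for k k' k'' f g
    using that an_arrow_cmp[of "fst k" "fst (snd k)" "snd (snd k)" "fst k'" "fst (snd k')" "snd (snd k')"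
      "fst k''" "fst (snd k'')" "snd (snd k'')" "fst (dat f)" "snd (dat f)" "fst (dat g)" "snd (dat g)"]
      presents_induced[of "fst k" "fst (snd k)" "snd (snd k)"] presents_induced[of "fst k'" "fst (snd k')" "snd (snd k')"]
      presents_induced[of "fst k''" "fst (snd k'')" "snd (snd k'')"]
    by (auto simp: AnMonad_keys_def Hom_def Multicat_def AnMonad_def is_multifunctor_iff)
  show "an_arrow k k (Idn Multicat (fst k)) = Idn AnMonad (fst (snd k))" if "k \<in> AnMonad_keys" for k
    using that an_arrow_id[of "fst k" "fst (snd k)" "snd (snd k)"]
      presents_induced[of "fst k" "fst (snd k)" "snd (snd k)"]
    by (auto simp: AnMonad_keys_def Multicat_def AnMonad_def)
qed

end

section \<open>Constructions of multicategories\<close>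

lemma substitutable_image:
  assumes "is_sig_mor F N (u, f)" "substitutable F a bs"
  shows "substitutable N (mapp f a) (map (mapp f) bs)"
  using assms(2) sig_mor(2,4)[OF assms(1)] by (auto simp: substitutable_def arg_map)

lemma multifunctor_sub:
  "is_multifunctor F N (u, f) \<Longrightarrow> substitutable F a bs \<Longrightarrow> mapp f (msubst F a bs) = msubst N (mapp f a) (map (mapp f) bs)"
  by (simp add: is_multifunctor_iff)

text \<open>
  The axioms of a multicategory are equations between operations, so they can be checked after
  applying a jointly injective family of structure-preserving maps to multicategories.
\<close>

lemma is_multicat_joint_embedding:
  fixes F :: "('v, 'z) multicat_scheme"
    and K :: "(('v, 'z) multicat_scheme \<times> 'v fn \<times> (nat \<Rightarrow> 'v \<Rightarrow> 'v)) set"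
  assumes small: "small (colours F)" "\<And>n. small (ops F n)"
    and bnd: "\<And>n a i. a \<in> ops F n \<Longrightarrow> i \<in> {0..n} \<Longrightarrow> bnd F (n, a) i \<in> colours F"
    and act: "\<And>n a \<sigma>. a \<in> ops F n \<Longrightarrow> \<sigma> permutes {1..n} \<Longrightarrow> act F (n, a) \<sigma> \<in> ops F n"
    and ident: "\<And>c. c \<in> colours F \<Longrightarrow> ident F c \<in> ops F 1"
    and sub: "\<And>a bs. substitutable F a bs \<Longrightarrow> subst F a bs \<in> ops F (arity_sum bs)"
    and K: "\<And>N u f. (N, u, f) \<in> K \<Longrightarrow> is_multicat N \<and> is_multifunctor F N (u, f)" "K \<noteq> {}"
    and inj_ops: "\<And>n a b. a \<in> ops F n \<Longrightarrow> b \<in> ops F n \<Longrightarrow> (\<And>N u f. (N, u, f) \<in> K \<Longrightarrow> f n a = f n b) \<Longrightarrow> a = b"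
    and inj_colours: "\<And>c d. c \<in> colours F \<Longrightarrow> d \<in> colours F \<Longrightarrow> (\<And>N u f. (N, u, f) \<in> K \<Longrightarrow> dat u c = dat u d) \<Longrightarrow> c = d"
  shows "is_multicat F"
proof -
  have KN: "is_multicat N" "is_multifunctor F N (u, f)" "is_sig_mor F N (u, f)" "typed N" "is_sig N"
    if "(N, u, f) \<in> K" for N u f
    using K(1)[OF that] typed_multicat by (auto simp: is_multifunctor_iff typed_def)
  have eq: "p = p'" if "snd p \<in> ops F (fst p)" "snd p' \<in> ops F (fst p')"
    "\<And>N u f. (N, u, f) \<in> K \<Longrightarrow> mapp f p = mapp f p'" for p p'
  proof -
    obtain N u f where "(N, u, f) \<in> K" using K(2) by (metis ex_in_conv prod_cases3)
    hence 1: "fst p = fst p'" using that(3) by (metis fst_conv mapp_def)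
    moreover have "snd p = snd p'"
      by (rule inj_ops[of _ "fst p"]) (use that 1 in \<open>auto simp: mapp_def\<close>)
    ultimately show ?thesis by (simp add: prod_eq_iff)
  qed
  have fop: "f n a \<in> ops N n" if "(N, u, f) \<in> K" "a \<in> ops F n" for N u f n a
    using sig_mor(2)[OF KN(3)[OF that(1)], of "(n, a)"] that(2) by simp
  have fact: "f n (act F (n, a) \<sigma>) = act N (n, f n a) \<sigma>"
    if "(N, u, f) \<in> K" "a \<in> ops F n" "\<sigma> permutes {1..n}" for N u f n a \<sigma>
    using sig_mor(3)[OF KN(3)[OF that(1)], of "(n, a)" \<sigma>] that(2,3) by (simp add: actp_def)
  have fbnd: "bnd N (mapp f a) i = dat u (bnd F a i)"
    if "(N, u, f) \<in> K" "snd a \<in> ops F (fst a)" "i \<in> {0..fst a}" for N u f a i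
    using sig_mor(4)[OF KN(3)[OF that(1)] that(2,3)] .
  have sig: "is_sig F"
    unfolding is_sig_def
  proof (intro conjI allI ballI impI small)
    fix n a assume a: "a \<in> ops F n"
    show "bnd F (n, a) i \<in> colours F" if "i \<in> {0..n}" for i by (rule bnd[OF a that])
    have "act F (n, a) id \<in> ops F n" by (rule act[OF a permutes_id])
    thus "act F (n, a) id = a"
    proof (rule inj_ops[OF _ a])
      fix N u f assume k: "(N, u, f) \<in> K"
      show "f n (act F (n, a) id) = f n a"
        using fact[OF k a permutes_id] sig_act(1)[OF KN(5)[OF k], of "(n, f n a)"] fop[OF k a] by (simp add: actp_def)
    qed
    fix \<sigma> assume s: "\<sigma> permutes {1..n}"
    show sa: "act F (n, a) \<sigma> \<in> ops F n" by (rule act[OF a s])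
    show "bnd F (n, act F (n, a) \<sigma>) i = bnd F (n, a) (\<sigma> i)" if i: "i \<in> {0..n}" for i
    proof (rule inj_colours)
      have si: "\<sigma> i \<in> {0..n}" using i permutes_in_image[OF s, of i] permutes_not_in[OF s, of i] by (cases "i \<in> {1..n}") auto
      show "bnd F (n, act F (n, a) \<sigma>) i \<in> colours F" by (rule bnd[OF sa i])
      show "bnd F (n, a) (\<sigma> i) \<in> colours F" by (rule bnd[OF a si])
      fix N u f assume k: "(N, u, f) \<in> K"
      show "dat u (bnd F (n, act F (n, a) \<sigma>) i) = dat u (bnd F (n, a) (\<sigma> i))"
        using fbnd[OF k, of "(n, act F (n, a) \<sigma>)" i] fbnd[OF k, of "(n, a)" "\<sigma> i"] sa a i si fact[OF k a s]
          sig_act(3)[OF KN(5)[OF k], of "(n, f n a)" \<sigma> i] fop[OF k a] s by (simp add: actp_def)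
    qed
    fix \<tau> assume t: "\<tau> permutes {1..n}"
    note st = permutes_compose[OF t s]
    show "act F (n, act F (n, a) \<sigma>) \<tau> = act F (n, a) (\<sigma> \<circ> \<tau>)"
    proof (rule inj_ops[OF act[OF sa t] act[OF a st]])
      fix N u f assume k: "(N, u, f) \<in> K"
      show "f n (act F (n, act F (n, a) \<sigma>) \<tau>) = f n (act F (n, a) (\<sigma> \<circ> \<tau>))"
        using fact[OF k sa t] fact[OF k a s] fact[OF k a st] fop[OF k a] s t
          sig_act(4)[OF KN(5)[OF k], of "(n, f n a)" \<sigma> \<tau>] by (simp add: actp_def)
    qed
  qed
  have fsub: "mapp f (msubst F a bs) = msubst N (mapp f a) (map (mapp f) bs)"
    and fsubs: "substitutable N (mapp f a) (map (mapp f) bs)"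
    if "(N, u, f) \<in> K" "substitutable F a bs" for N u f a bs
    using multifunctor_sub[OF KN(2)[OF that(1)] that(2)] substitutable_image[OF KN(3)[OF that(1)] that(2)] by auto
  have fid: "f 1 (ident F c) = ident N (dat u c)" if "(N, u, f) \<in> K" "c \<in> colours F" for N u f c
    using KN(2)[OF that(1)] that(2) by (simp add: is_multifunctor_iff)
  have uc: "dat u c \<in> colours N" if "(N, u, f) \<in> K" "c \<in> colours F" for N u f c
    using sig_mor(1)[OF KN(3)[OF that(1)]] that(2) by (auto simp: Sets_Hom)
  have sop: "snd (msubst F a bs) \<in> ops F (fst (msubst F a bs))" if "substitutable F a bs" for a bs
    using sub[OF that] by (simp add: msubst_def)
  have typed: "typed F"
    unfolding typed_def
  proof (intro conjI sig ballI allI impI)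
    fix c assume c: "c \<in> colours F"
    show i: "ident F c \<in> ops F 1" by (rule ident[OF c])
    have "bnd F (1, ident F c) i = c" if ii: "i = 0 \<or> i = 1" for i
    proof (rule inj_colours[OF bnd[OF i] c])
      show "i \<in> {0..1}" using ii by auto
      fix N u f assume k: "(N, u, f) \<in> K"
      show "dat u (bnd F (1, ident F c) i) = dat u c"
        using fbnd[OF k, of "(1, ident F c)" i] i ii fid[OF k c] KN(4)[OF k] uc[OF k c] by (auto simp: typed_def)
    qed
    thus "bnd F (1, ident F c) 0 = c" "bnd F (1, ident F c) 1 = c" by auto
  next
    fix a bs assume s: "substitutable F a bs"
    show "subst F a bs \<in> ops F (arity_sum bs)" by (rule sub[OF s])
    have sa: "snd a \<in> ops F (fst a)" and la: "length bs = fst a"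
      and sb: "\<And>i. i \<in> {1..fst a} \<Longrightarrow> snd (arg bs i) \<in> ops F (fst (arg bs i))"
      using s by (auto simp: substitutable_def)
    have ps: "pos (map (mapp f) bs) i j = pos bs i j" for f :: "nat \<Rightarrow> 'v \<Rightarrow> 'v" and i j
      by (simp add: pos_def arity_sum_def take_map comp_def)
    have T: "bnd N (mapp f (msubst F a bs)) 0 = bnd N (mapp f a) 0"
      "\<And>i j. i \<in> {1..fst a} \<Longrightarrow> j \<in> {1..fst (arg bs i)} \<Longrightarrow>
        bnd N (mapp f (msubst F a bs)) (pos bs i j) = bnd N (mapp f (arg bs i)) j" if k: "(N, u, f) \<in> K" for N u f
    proof -
      have t: "bnd N (msubst N (mapp f a) (map (mapp f) bs)) 0 = bnd N (mapp f a) 0"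
        "\<And>i j. i \<in> {1..fst a} \<Longrightarrow> j \<in> {1..fst (arg (map (mapp f) bs) i)} \<Longrightarrow>
          bnd N (msubst N (mapp f a) (map (mapp f) bs)) (pos (map (mapp f) bs) i j) = bnd N (arg (map (mapp f) bs) i) j"
        using KN(4)[OF k] fsubs[OF k s] by (auto simp: typed_def)
      show "bnd N (mapp f (msubst F a bs)) 0 = bnd N (mapp f a) 0" unfolding fsub[OF k s] by (rule t(1))
      fix i j assume ij: "i \<in> {1..fst a}" "j \<in> {1..fst (arg bs i)}"
      hence i': "i \<in> {1..length bs}" using la by simp
      show "bnd N (mapp f (msubst F a bs)) (pos bs i j) = bnd N (mapp f (arg bs i)) j"
        unfolding fsub[OF k s] using t(2)[OF ij(1), of j] ij(2) unfolding arg_map[OF i'] ps by simp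
    qed
    have bs0: "bnd F (msubst F a bs) p \<in> colours F" if "p \<in> {0..arity_sum bs}" for p
      using bnd[OF sub[OF s] that] by (simp add: msubst_def)
    show "bnd F (msubst F a bs) 0 = bnd F a 0"
    proof (rule inj_colours)
      show "bnd F (msubst F a bs) 0 \<in> colours F" by (rule bs0) simp
      show "bnd F a 0 \<in> colours F" using bnd[of "snd a" "fst a" 0] sa by simp
      fix N u f assume k: "(N, u, f) \<in> K"
      show "dat u (bnd F (msubst F a bs) 0) = dat u (bnd F a 0)"
        using T(1)[OF k] fbnd[OF k sop[OF s], of 0] fbnd[OF k sa, of 0] by simp
    qed
    fix i j assume ij: "i \<in> {1..fst a}" "j \<in> {1..fst (arg bs i)}"
    have pr: "pos bs i j \<in> {1..arity_sum bs}" using pos_range[of i bs j] ij la by simp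
    show "bnd F (msubst F a bs) (pos bs i j) = bnd F (arg bs i) j"
    proof (rule inj_colours)
      show "bnd F (msubst F a bs) (pos bs i j) \<in> colours F" by (rule bs0) (use pr in simp)
      show "bnd F (arg bs i) j \<in> colours F" using bnd[OF sb[OF ij(1)], of j] ij(2) by simp
      fix N u f assume k: "(N, u, f) \<in> K"
      show "dat u (bnd F (msubst F a bs) (pos bs i j)) = dat u (bnd F (arg bs i) j)"
        using T(2)[OF k ij] fbnd[OF k sop[OF s], of "pos bs i j"] fbnd[OF k sb[OF ij(1)], of j] pr ij(2) by simp
    qed
  qed
  have eqs: "msubst F a bs = p" if "substitutable F a bs" "snd p \<in> ops F (fst p)"
    "\<And>N u f. (N, u, f) \<in> K \<Longrightarrow> msubst N (mapp f a) (map (mapp f) bs) = mapp f p" for a bs p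
    by (rule eq[OF sop[OF that(1)] that(2)]) (use fsub that in auto)
  have fact': "mapp f (actp F a \<sigma>) = actp N (mapp f a) \<sigma>"
    if "(N, u, f) \<in> K" "snd a \<in> ops F (fst a)" "\<sigma> permutes {1..fst a}" for N u f a \<sigma>
    using sig_mor(3)[OF KN(3)[OF that(1)] that(2,3)] .
  show ?thesis
  proof (rule is_multicatI[OF typed])
    fix a
    {
      assume op: "snd a \<in> ops F (fst a)"
      have ba: "bnd F a i \<in> colours F" if "i \<in> {0..fst a}" for i by (rule sig_act(5)[OF sig op that])
      show "msubst F (1, ident F (bnd F a 0)) [a] = a"
      proof (rule eqs[OF substitutable_ident(1)[OF typed op] op])
        fix N u f assume k: "(N, u, f) \<in> K"
        show "msubst N (mapp f (1, ident F (bnd F a 0))) (map (mapp f) [a]) = mapp f a"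
          using multicat_units(1)[OF KN(1)[OF k], of "mapp f a"] fbnd[OF k op, of 0] fop[OF k op] fid[OF k ba, of 0] by simp
      qed
      let ?ids = "map (\<lambda>i. (1, ident F (bnd F a i))) [1..<Suc (fst a)]"
      show "msubst F a ?ids = a"
      proof (rule eqs[OF substitutable_ident(2)[OF typed op] op])
        fix N u f assume k: "(N, u, f) \<in> K"
        have m: "map (mapp f) ?ids = map (\<lambda>i. (1, ident N (bnd N (mapp f a) i))) [1..<Suc (fst (mapp f a))]"
          using fid[OF k ba] fbnd[OF k op] by (simp add: comp_def del: upt_Suc)
        show "msubst N (mapp f a) (map (mapp f) ?ids) = mapp f a"
          unfolding m by (rule multicat_units(2)[OF KN(1)[OF k]]) (use fop[OF k op] in simp)
      qed
    }
    fix bs assume s: "substitutable F a bs"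
    have la: "length bs = fst a" and op: "snd a \<in> ops F (fst a)"
      and sb: "\<And>i. i \<in> {1..fst a} \<Longrightarrow> snd (arg bs i) \<in> ops F (fst (arg bs i))"
      using s by (auto simp: substitutable_def)
    {
      fix css assume l: "length css = length bs"
        and si: "\<And>i. i \<in> {1..length bs} \<Longrightarrow> substitutable F (arg bs i) (arg css i)"
      note S = substitutable_assoc[OF typed s l si]
      have S3: "substitutable F (msubst F a bs) (concat css)" by (rule S(3))
      show "msubst F a (map2 (msubst F) bs css) = msubst F (msubst F a bs) (concat css)"
      proof (rule eqs[OF S(2) sop[OF S3]])
        fix N u f assume k: "(N, u, f) \<in> K"
        let ?bs = "map (mapp f) bs" and ?css = "map (map (mapp f)) css"
        have m: "map (mapp f) (map2 (msubst F) bs css) = map2 (msubst N) ?bs ?css"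
          by (rule list_arg_ext) (use l fsub[OF k] si in \<open>simp_all add: arg_map arg_map2\<close>)
        have "msubst N (mapp f a) (map2 (msubst N) ?bs ?css) = msubst N (msubst N (mapp f a) ?bs) (concat ?css)"
          by (rule multicat_assoc[OF KN(1)[OF k] fsubs[OF k s]]) (use l fsubs[OF k] si in \<open>simp_all add: arg_map\<close>)
        thus "msubst N (mapp f a) (map (mapp f) (map2 (msubst F) bs css)) = mapp f (msubst F (msubst F a bs) (concat css))"
          unfolding fsub[OF k S3] fsub[OF k s] m map_concat .
      qed
    }
    fix \<rho> assume r: "\<rho> permutes {1..arity_sum bs}"
    have o2: "snd (actp F (msubst F a bs) \<rho>) \<in> ops F (fst (actp F (msubst F a bs) \<rho>))"
      using sig_act(2)[OF sig sop[OF s], of \<rho>] r by simp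
    have f2: "mapp f (actp F (msubst F a bs) \<rho>) = actp N (msubst N (mapp f a) (map (mapp f) bs)) \<rho>"
      if k: "(N, u, f) \<in> K" for N u f
      using fact'[OF k sop[OF s], of \<rho>] r fsub[OF k s] by simp
    have ps: "pos (map (mapp f) cs) i j = pos cs i j" "arity_sum (map (mapp f) cs) = arity_sum cs"
      for f :: "nat \<Rightarrow> 'v \<Rightarrow> 'v" and cs i j by (simp_all add: pos_def arity_sum_def take_map comp_def)
    have am: "arg (map (mapp f) bs) i = mapp f (arg bs i)" if "i \<in> {1..fst a}" for f :: "nat \<Rightarrow> 'v \<Rightarrow> 'v" and i
      by (rule arg_map) (use that la in simp)
    {
      fix \<sigma> assume sg: "\<sigma> permutes {1..fst a}"
        and rs: "\<And>i j. i \<in> {1..fst a} \<Longrightarrow> j \<in> {1..fst (arg bs (\<sigma> i))} \<Longrightarrow> \<rho> (pos (permute_args bs \<sigma>) i j) = pos bs (\<sigma> i) j"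
      have si: "\<sigma> i \<in> {1..fst a}" if "i \<in> {1..fst a}" for i using permutes_in_image[OF sg] that by blast
      show "msubst F (actp F a \<sigma>) (permute_args bs \<sigma>) = actp F (msubst F a bs) \<rho>"
      proof (rule eqs[OF substitutable_outer[OF sig s sg] o2])
        fix N u f assume k: "(N, u, f) \<in> K"
        have m: "map (mapp f) (permute_args bs \<sigma>) = permute_args (map (mapp f) bs) \<sigma>"
          by (rule map_permute_args) (use sg la in simp)
        show "msubst N (mapp f (actp F a \<sigma>)) (map (mapp f) (permute_args bs \<sigma>)) = mapp f (actp F (msubst F a bs) \<rho>)"
          unfolding f2[OF k] fact'[OF k op sg] m
        proof (rule multicat_outer[OF KN(1)[OF k] fsubs[OF k s]])
          fix i j assume i: "i \<in> {1..fst (mapp f a)}" and j: "j \<in> {1..fst (arg (map (mapp f) bs) (\<sigma> i))}"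
          hence i': "i \<in> {1..fst a}" by simp
          from j have "j \<in> {1..fst (arg bs (\<sigma> i))}" unfolding am[OF si[OF i']] by simp
          from rs[OF i' this] show "\<rho> (pos (permute_args (map (mapp f) bs) \<sigma>) i j) = pos (map (mapp f) bs) (\<sigma> i) j"
            unfolding m[symmetric] ps .
        qed (use sg r ps in simp_all)
      qed
    }
    fix \<tau> assume t: "\<And>i. i \<in> {1..fst a} \<Longrightarrow> \<tau> i permutes {1..fst (arg bs i)}"
      and rs: "\<And>i j. i \<in> {1..fst a} \<Longrightarrow> j \<in> {1..fst (arg bs i)} \<Longrightarrow> \<rho> (pos bs i j) = pos bs i (\<tau> i j)"
    let ?bs = "map (\<lambda>i. actp F (arg bs i) (\<tau> i)) [1..<Suc (fst a)]"
    show "msubst F a ?bs = actp F (msubst F a bs) \<rho>"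
    proof (rule eqs[OF substitutable_inner(1)[OF sig s t] o2])
      fix N u f assume k: "(N, u, f) \<in> K"
      have m: "map (mapp f) ?bs = map (\<lambda>i. actp N (arg (map (mapp f) bs) i) (\<tau> i)) [1..<Suc (fst (mapp f a))]"
        unfolding map_map comp_def mapp_simps fst_conv
      proof (rule map_cong[OF refl])
        fix i assume "i \<in> set [1..<Suc (fst a)]"
        hence i: "i \<in> {1..fst a}" by auto
        show "mapp f (actp F (arg bs i) (\<tau> i)) = actp N (arg (map (mapp f) bs) i) (\<tau> i)"
          unfolding am[OF i] by (rule fact'[OF k sb[OF i] t[OF i]])
      qed
      show "msubst N (mapp f a) (map (mapp f) ?bs) = mapp f (actp F (msubst F a bs) \<rho>)"
        unfolding f2[OF k] m
        by (rule multicat_inner[OF KN(1)[OF k] fsubs[OF k s]]) (use t r rs am in \<open>simp_all add: ps\<close>)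
    qed
  qed
qed

subsection \<open>Indiscrete multicategories\<close>

definition input_colours :: "('v, 'z) sig_scheme \<Rightarrow> nat \<times> 'v \<Rightarrow> 'v list" where
  "input_colours A a = map (bnd A a) [1..<Suc (fst a)]"

lemma length_input_colours [simp]: "length (input_colours A a) = fst a"
  by (simp add: input_colours_def del: upt_Suc)

lemma arg_input_colours: "i \<in> {1..fst a} \<Longrightarrow> arg (input_colours A a) i = bnd A a i"
  unfolding input_colours_def by (rule arg_upt)

lemma input_colours_msubst:
  assumes t: "typed M" and s: "substitutable M a bs"
  shows "input_colours M (msubst M a bs) = concat (map (input_colours M) bs)"
proof -
  have fit: "map length (map (input_colours M) bs) = map fst bs" by simp
  show ?thesis
  proof (rule list_pos_ext[of _ bs])
    show "length (input_colours M (msubst M a bs)) = arity_sum bs" by simp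
    show "length (concat (map (input_colours M) bs)) = arity_sum bs" by (rule length_concat_blocks[OF fit])
    fix i j assume i: "i \<in> {1..length bs}" and j: "j \<in> {1..fst (arg bs i)}"
    from typed_msubst(3)[OF t s i j] show "arg (input_colours M (msubst M a bs)) (pos bs i j) = arg (concat (map (input_colours M) bs)) (pos bs i j)"
      using arg_concat_pos[OF fit i j] pos_range[OF i j] i j by (simp add: arg_input_colours arg_map)
  qed
qed

lemma input_colours_act:
  assumes "is_sig A" "snd a \<in> ops A (fst a)" "\<sigma> permutes {1..fst a}"
  shows "input_colours A (actp A a \<sigma>) = permute_args (input_colours A a) \<sigma>"
proof (rule list_arg_ext)
  fix i assume "i \<in> {1..length (input_colours A (actp A a \<sigma>))}"
  hence i: "i \<in> {1..fst a}" by simp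
  have "\<sigma> i \<in> {1..fst a}" using permutes_in_image[OF assms(3)] i by blast
  thus "arg (input_colours A (actp A a \<sigma>)) i = arg (permute_args (input_colours A a) \<sigma>) i"
    using sig_act(3)[OF assms, of i] i by (simp add: arg_permute_args arg_input_colours)
qed simp

lemma is_multicat_thin:
  assumes t: "typed M"
    and thin: "\<And>a b. snd a \<in> ops M (fst a) \<Longrightarrow> snd b \<in> ops M (fst b) \<Longrightarrow> bnd M a 0 = bnd M b 0 \<Longrightarrow>
       input_colours M a = input_colours M b \<Longrightarrow> a = b"
  shows "is_multicat M"
proof -
  note sig = typed_sig[OF t] and ic = input_colours_msubst[OF t]
  have eq: "msubst M a bs = b" if s: "substitutable M a bs" and "snd b \<in> ops M (fst b)" "bnd M b 0 = bnd M a 0"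
    "concat (map (input_colours M) bs) = input_colours M b" for a bs b
    by (rule thin) (use that typed_msubst(1,2)[OF t s] ic[OF s] in simp_all)
  show ?thesis
  proof (rule is_multicatI[OF t])
    fix a
    {
      assume op: "snd a \<in> ops M (fst a)"
      have id: "bnd M (1, ident M (bnd M a i)) 0 = bnd M a i" "input_colours M (1, ident M (bnd M a i)) = [bnd M a i]"
        if "i \<in> {0..fst a}" for i
        using typed_ident[OF t sig_act(5)[OF sig op that]] by (auto simp: input_colours_def)
      show "msubst M (1, ident M (bnd M a 0)) [a] = a"
        by (rule eq[OF substitutable_ident(1)[OF t op] op]) (use id[of 0] in simp_all)
      have "map (input_colours M) (map (\<lambda>i. (1, ident M (bnd M a i))) [1..<Suc (fst a)]) = map (\<lambda>i. [bnd M a i]) [1..<Suc (fst a)]"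
        using id(2) by (simp add: comp_def del: upt_Suc)
      thus "msubst M a (map (\<lambda>i. (1, ident M (bnd M a i))) [1..<Suc (fst a)]) = a"
        by (intro eq[OF substitutable_ident(2)[OF t op] op]) (simp_all add: input_colours_def[of M a] del: upt_Suc map_map)
    }
    fix bs assume s: "substitutable M a bs"
    note T = typed_msubst(1,2)[OF t s]
    have la: "length bs = fst a" using s by (simp add: substitutable_def)
    {
      fix css assume l: "length css = length bs"
        and si: "\<And>i. i \<in> {1..length bs} \<Longrightarrow> substitutable M (arg bs i) (arg css i)"
      note S = substitutable_assoc[OF t s l si]
      have S3: "substitutable M (msubst M a bs) (concat css)" by (rule S(3))
      have m: "map (input_colours M) (map2 (msubst M) bs css) = map concat (map (map (input_colours M)) css)"
        by (rule list_arg_ext) (use l ic si in \<open>simp_all add: arg_map arg_map2\<close>)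
      have "concat (map (input_colours M) (map2 (msubst M) bs css)) = input_colours M (msubst M (msubst M a bs) (concat css))"
        unfolding ic[OF S3] m concat_map_concat map_concat ..
      thus "msubst M a (map2 (msubst M) bs css) = msubst M (msubst M a bs) (concat css)"
        by (intro eq[OF S(2)]) (use typed_msubst(1,2)[OF t S3] T in simp_all)
    }
    have fit: "map length (map (input_colours M) bs) = map fst bs" by simp
    fix \<rho> assume r: "\<rho> permutes {1..arity_sum bs}"
    hence r': "\<rho> permutes {1..fst (msubst M a bs)}" by simp
    have op: "snd (msubst M a bs) \<in> ops M (fst (msubst M a bs))" using T by simp
    note d = sig_act(2)[OF sig op r'] sig_act_0[OF sig op r'] input_colours_act[OF sig op r', unfolded ic[OF s]]
    {
      fix \<sigma> assume sg: "\<sigma> permutes {1..fst a}"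
        and rs: "\<And>i j. i \<in> {1..fst a} \<Longrightarrow> j \<in> {1..fst (arg bs (\<sigma> i))} \<Longrightarrow> \<rho> (pos (permute_args bs \<sigma>) i j) = pos bs (\<sigma> i) j"
      have sg': "\<sigma> permutes {1..length bs}" using sg la by simp
      have "snd a \<in> ops M (fst a)" using s by (simp add: substitutable_def)
      note a0 = sig_act_0[OF sig this sg]
      show "msubst M (actp M a \<sigma>) (permute_args bs \<sigma>) = actp M (msubst M a bs) \<rho>"
      proof (rule eq[OF substitutable_outer[OF sig s sg]])
        show "concat (map (input_colours M) (permute_args bs \<sigma>)) = input_colours M (actp M (msubst M a bs) \<rho>)"
          unfolding d map_permute_args[OF sg'] by (rule concat_permute_args[OF fit sg']) (use rs la in auto)
      qed (use d a0 T in simp_all)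
    }
    fix \<tau> assume tt: "\<And>i. i \<in> {1..fst a} \<Longrightarrow> \<tau> i permutes {1..fst (arg bs i)}"
      and rs: "\<And>i j. i \<in> {1..fst a} \<Longrightarrow> j \<in> {1..fst (arg bs i)} \<Longrightarrow> \<rho> (pos bs i j) = pos bs i (\<tau> i j)"
    let ?bs = "map (\<lambda>i. actp M (arg bs i) (\<tau> i)) [1..<Suc (fst a)]"
    have m: "map (input_colours M) ?bs = map (\<lambda>i. permute_args (arg (map (input_colours M) bs) i) (\<tau> i)) [1..<Suc (length bs)]"
      unfolding map_map comp_def la
    proof (rule map_cong[OF refl])
      fix i assume "i \<in> set [1..<Suc (fst a)]"
      hence i: "i \<in> {1..fst a}" and i': "i \<in> {1..length bs}" using la by auto
      have "snd (arg bs i) \<in> ops M (fst (arg bs i))" using s i by (simp add: substitutable_def)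
      thus "input_colours M (actp M (arg bs i) (\<tau> i)) = permute_args (arg (map (input_colours M) bs) i) (\<tau> i)"
        unfolding arg_map[OF i'] by (rule input_colours_act[OF sig _ tt[OF i]])
    qed
    show "msubst M a ?bs = actp M (msubst M a bs) \<rho>"
    proof (rule eq[OF substitutable_inner(1)[OF sig s tt]])
      show "concat (map (input_colours M) ?bs) = input_colours M (actp M (msubst M a bs) \<rho>)"
        unfolding d m by (rule concat_map_permute_args[OF fit]) (use tt rs la in auto)
    qed (use d T in simp_all)
  qed
qed

lemma permutes_le: "\<sigma> permutes {1..n} \<Longrightarrow> i \<le> n \<Longrightarrow> \<sigma> i \<le> n" for n i :: nat
  using permutes_in_image[of \<sigma> "{1..n}" i] permutes_not_in[of \<sigma> "{1..n}" i] by (cases "i \<in> {1..n}") auto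

context universe
begin

declare vlist.simps [simp del]

definition unlist :: "nat \<Rightarrow> 'v \<Rightarrow> 'v list" where
  "unlist n v = (SOME xs. length xs = n \<and> v = vlist xs)"

lemma unlist_vlist [simp]: "length xs = n \<Longrightarrow> unlist n (vlist xs) = xs"
proof -
  assume l: "length xs = n"
  have "length (unlist n (vlist xs)) = n \<and> vlist xs = vlist (unlist n (vlist xs))"
    unfolding unlist_def by (rule someI[of _ xs]) (simp add: l)
  thus ?thesis using vlist_inj[of xs "unlist n (vlist xs)"] l by simp
qed

text \<open>There is one operation for each boundary, encoded as the list of its colours with the output first.\<close>

definition indiscrete :: "'v set \<Rightarrow> 'v multicat" where
  "indiscrete O' = \<lparr>colours = O',
     ops = (\<lambda>n. vlist ` {xs. length xs = Suc n \<and> set xs \<subseteq> O'}),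
     act = (\<lambda>a \<sigma>. vlist (map (\<lambda>i. unlist (Suc (fst a)) (snd a) ! \<sigma> i) [0..<Suc (fst a)])),
     bnd = (\<lambda>a i. unlist (Suc (fst a)) (snd a) ! i),
     ident = (\<lambda>c. vlist [c, c]),
     subst = (\<lambda>a bs. vlist (unlist (Suc (fst a)) (snd a) ! 0 #
        concat (map (\<lambda>b. tl (unlist (Suc (fst b)) (snd b))) bs)))\<rparr>"

lemma indiscrete_colours [simp]: "colours (indiscrete O') = O'" by (simp add: indiscrete_def)

lemma indiscrete_opE:
  assumes "snd a \<in> ops (indiscrete O') (fst a)"
  obtains xs where "snd a = vlist xs" "length xs = Suc (fst a)" "set xs \<subseteq> O'" "\<And>i. bnd (indiscrete O') a i = xs ! i"
    "input_colours (indiscrete O') a = tl xs" "unlist (Suc (fst a)) (snd a) = xs"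
proof -
  obtain xs where xs: "snd a = vlist xs" "length xs = Suc (fst a)" "set xs \<subseteq> O'"
    using assms by (auto simp: indiscrete_def)
  have b: "bnd (indiscrete O') a i = xs ! i" for i using xs by (simp add: indiscrete_def)
  moreover have "input_colours (indiscrete O') a = tl xs"
  proof (rule list_arg_ext)
    fix i assume "i \<in> {1..length (input_colours (indiscrete O') a)}"
    hence i: "i \<in> {1..fst a}" by simp
    have "arg (tl xs) i = xs ! i" using i xs(2) by (cases xs; cases i) (auto simp: arg_def)
    thus "arg (input_colours (indiscrete O') a) i = arg (tl xs) i"
      unfolding arg_input_colours[OF i] b ..
  qed (use xs in simp)
  ultimately show ?thesis using that xs by simp
qed

lemma indiscrete_ext:
  assumes "snd a \<in> ops (indiscrete O') (fst a)" "snd b \<in> ops (indiscrete O') (fst b)"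
    "bnd (indiscrete O') a 0 = bnd (indiscrete O') b 0"
    "input_colours (indiscrete O') a = input_colours (indiscrete O') b"
  shows "a = b"
proof -
  obtain xs where xs: "snd a = vlist xs" "length xs = Suc (fst a)" "\<And>i. bnd (indiscrete O') a i = xs ! i"
    "input_colours (indiscrete O') a = tl xs" using indiscrete_opE[OF assms(1)] by metis
  obtain ys where ys: "snd b = vlist ys" "length ys = Suc (fst b)" "\<And>i. bnd (indiscrete O') b i = ys ! i"
    "input_colours (indiscrete O') b = tl ys" using indiscrete_opE[OF assms(2)] by metis
  have "xs = ys" using assms(3,4) xs ys by (cases xs; cases ys) auto
  thus ?thesis using xs ys by (simp add: prod_eq_iff)
qed

lemma indiscrete_ext':
  assumes "a \<in> ops (indiscrete O') n" "b \<in> ops (indiscrete O') n"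
    "\<And>i. i \<in> {0..n} \<Longrightarrow> bnd (indiscrete O') (n, a) i = bnd (indiscrete O') (n, b) i"
  shows "a = b"
proof -
  have "input_colours (indiscrete O') (n, a) = input_colours (indiscrete O') (n, b)"
    by (rule list_arg_ext) (use assms(3) in \<open>auto simp: arg_input_colours\<close>)
  thus ?thesis using indiscrete_ext[of "(n, a)" O' "(n, b)"] assms by simp
qed

lemma indiscrete_opI:
  "length xs = Suc n \<Longrightarrow> set xs \<subseteq> O' \<Longrightarrow> vlist xs \<in> ops (indiscrete O') n"
  by (auto simp: indiscrete_def)

lemma indiscrete_bnd: "length xs = Suc n \<Longrightarrow> bnd (indiscrete O') (n, vlist xs) i = xs ! i"
  by (simp add: indiscrete_def)

lemma typed_indiscrete:
  assumes O': "small O'"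
  shows "typed (indiscrete O')"
proof -
  let ?I = "indiscrete O'"
  have sig: "is_sig ?I"
    unfolding is_sig_def
  proof (intro conjI allI ballI impI)
    show "small (colours ?I)" using O' by simp
    fix n
    have "ops ?I n \<subseteq> vlist ` lists O'" by (auto simp: indiscrete_def)
    thus "small (ops ?I n)" unfolding small_def
      using less_subset less_image[OF less_lists[OF O'[unfolded small_def]]] by blast
    fix a assume a: "a \<in> ops ?I n"
    then obtain xs where xs: "a = vlist xs" "length xs = Suc n" "set xs \<subseteq> O'" by (auto simp: indiscrete_def)
    have b: "bnd ?I (n, a) i = xs ! i" for i using xs by (simp add: indiscrete_def)
    have at: "act ?I (n, a) \<sigma> = vlist (map (\<lambda>i. xs ! \<sigma> i) [0..<Suc n])" for \<sigma> using xs by (simp add: indiscrete_def del: upt_Suc)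
    show "bnd ?I (n, a) i \<in> colours ?I" if "i \<in> {0..n}" for i using that xs b by auto
    show "act ?I (n, a) id = a" unfolding at using xs map_nth[of xs] by (simp del: upt_Suc)
    fix \<sigma> assume s: "\<sigma> permutes {1..n}"
    have ss: "set (map (\<lambda>i. xs ! \<sigma> i) [0..<Suc n]) \<subseteq> O'"
      using xs permutes_le[OF s] by (auto simp: less_Suc_eq_le simp del: upt_Suc intro!: subsetD[OF xs(3)] nth_mem)
    show "act ?I (n, a) \<sigma> \<in> ops ?I n" unfolding at by (rule indiscrete_opI[OF _ ss]) simp
    show "bnd ?I (n, act ?I (n, a) \<sigma>) i = bnd ?I (n, a) (\<sigma> i)" if "i \<in> {0..n}" for i
      using that unfolding at b by (simp add: indiscrete_bnd del: upt_Suc)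
    fix \<tau> assume t: "\<tau> permutes {1..n}"
    have "act ?I (n, vlist (map (\<lambda>i. xs ! \<sigma> i) [0..<Suc n])) \<tau> =
        vlist (map (\<lambda>i. map (\<lambda>i. xs ! \<sigma> i) [0..<Suc n] ! \<tau> i) [0..<Suc n])"
      by (simp add: indiscrete_def del: upt_Suc)
    also have "map (\<lambda>i. map (\<lambda>i. xs ! \<sigma> i) [0..<Suc n] ! \<tau> i) [0..<Suc n] = map (\<lambda>i. xs ! (\<sigma> \<circ> \<tau>) i) [0..<Suc n]"
    proof (rule map_cong[OF refl])
      fix i assume "i \<in> set [0..<Suc n]"
      hence "\<tau> i < length [0..<Suc n]" "[0..<Suc n] ! \<tau> i = \<tau> i" using permutes_le[OF t, of i] by (auto simp del: upt_Suc)
      thus "map (\<lambda>i. xs ! \<sigma> i) [0..<Suc n] ! \<tau> i = xs ! (\<sigma> \<circ> \<tau>) i" by (simp del: upt_Suc)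
    qed
    finally show "act ?I (n, act ?I (n, a) \<sigma>) \<tau> = act ?I (n, a) (\<sigma> \<circ> \<tau>)" unfolding at .
  qed
  show ?thesis
    unfolding typed_def
  proof (intro conjI sig ballI allI impI)
    fix c assume c: "c \<in> colours ?I"
    have i: "ident ?I c = vlist [c, c]" by (simp add: indiscrete_def)
    show "ident ?I c \<in> ops ?I 1" unfolding i by (rule indiscrete_opI) (use c in auto)
    show "bnd ?I (1, ident ?I c) 0 = c" "bnd ?I (1, ident ?I c) 1 = c"
      unfolding i using indiscrete_bnd[of "[c, c]" 1 O'] by auto
  next
    fix a bs assume s: "substitutable ?I a bs"
    have la: "length bs = fst a" and sa: "snd a \<in> ops ?I (fst a)"
      and sb: "\<And>i. i \<in> {1..fst a} \<Longrightarrow> snd (arg bs i) \<in> ops ?I (fst (arg bs i))"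
      using s by (auto simp: substitutable_def)
    define r where "r = (\<lambda>b. tl (unlist (Suc (fst b)) (snd b)))"
    have r: "length (r (arg bs i)) = fst (arg bs i) \<and> set (r (arg bs i)) \<subseteq> O' \<and> r (arg bs i) = input_colours ?I (arg bs i)"
      if i: "i \<in> {1..fst a}" for i
    proof -
      obtain xs where "length xs = Suc (fst (arg bs i))" "set xs \<subseteq> O'" "input_colours ?I (arg bs i) = tl xs"
        "unlist (Suc (fst (arg bs i))) (snd (arg bs i)) = xs" using indiscrete_opE[OF sb[OF i]] by metis
      thus ?thesis by (cases xs) (auto simp: r_def)
    qed
    have fit: "map length (map r bs) = map fst bs"
      by (rule list_arg_ext) (use r la in \<open>auto simp: arg_map\<close>)
    have b0: "bnd ?I a 0 \<in> O'" using sig_act(5)[OF sig sa, of 0] by simp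
    let ?ys = "bnd ?I a 0 # concat (map r bs)"
    have sub: "subst ?I a bs = vlist ?ys" by (simp add: indiscrete_def r_def)
    have ly: "length ?ys = Suc (arity_sum bs)" using length_concat_blocks[OF fit] by simp
    have "set ?ys \<subseteq> O'"
    proof -
      have "set (r b) \<subseteq> O'" if b: "b \<in> set bs" for b
      proof -
        obtain i where "i \<in> {1..fst a}" "b = arg bs i" using b la set_arg[of bs] by auto
        thus ?thesis using r by blast
      qed
      thus ?thesis using b0 by auto
    qed
    thus "subst ?I a bs \<in> ops ?I (arity_sum bs)" unfolding sub by (rule indiscrete_opI[OF ly])
    have B: "bnd ?I (msubst ?I a bs) i = ?ys ! i" for i unfolding msubst_def sub by (rule indiscrete_bnd[OF ly])
    show "bnd ?I (msubst ?I a bs) 0 = bnd ?I a 0" by (simp add: B)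
    fix i j assume i: "i \<in> {1..fst a}" and j: "j \<in> {1..fst (arg bs i)}"
    have i': "i \<in> {1..length bs}" using i la by simp
    have "bnd ?I (msubst ?I a bs) (pos bs i j) = arg (concat (map r bs)) (pos bs i j)"
      using pos_range[OF i' j] by (simp add: B arg_def nth_Cons')
    also have "\<dots> = bnd ?I (arg bs i) j"
      using arg_concat_pos[OF fit i' j] r[OF i] j i' by (simp add: arg_map arg_input_colours)
    finally show "bnd ?I (msubst ?I a bs) (pos bs i j) = bnd ?I (arg bs i) j" .
  qed
qed

lemma is_multicat_indiscrete: "small O' \<Longrightarrow> is_multicat (indiscrete O')"
  by (rule is_multicat_thin[OF typed_indiscrete indiscrete_ext])

definition trace :: "('v, 'z) sig_scheme \<Rightarrow> 'v fn \<Rightarrow> nat \<Rightarrow> 'v \<Rightarrow> 'v" where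
  "trace A w n = (\<lambda>a \<in> ops A n. vlist (map (\<lambda>i. dat w (bnd A (n, a) i)) [0..<Suc n]))"

lemma trace_bnd: "a \<in> ops A n \<Longrightarrow> i \<in> {0..n} \<Longrightarrow> bnd (indiscrete O') (n, trace A w n a) i = dat w (bnd A (n, a) i)"
  by (simp add: trace_def indiscrete_bnd nth_append)

lemma trace_sig_mor:
  fixes A :: "'v multicat"
  assumes A: "is_sig A" and w: "w \<in> Hom Sets (colours A) O'"
  shows "is_sig_mor A (indiscrete O') (w, trace A w)"
proof -
  have O': "small O'" using w by (simp add: Sets_Hom)
  note I = typed_indiscrete[OF O', unfolded typed_def, THEN conjunct1]
  have wc: "dat w k \<in> O'" if "k \<in> colours A" for k using w that by (auto simp: Sets_Hom)
  have op: "trace A w n a \<in> ops (indiscrete O') n" if a: "a \<in> ops A n" for n a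
    using sig_act(5)[OF A, of "(n, a)"] a wc by (auto simp: trace_def simp del: upt_Suc intro!: indiscrete_opI)
  show ?thesis
    unfolding is_sig_mor_def prod.case
  proof (intro conjI allI ballI impI)
    show "w \<in> Hom Sets (colours A) (colours (indiscrete O'))" using w by simp
    fix n
    show "trace A w n \<in> ops A n \<rightarrow>\<^sub>E ops (indiscrete O') n"
      using op by (auto simp: trace_def)
    fix a assume a: "a \<in> ops A n"
    show "bnd (indiscrete O') (n, trace A w n a) i = dat w (bnd A (n, a) i)" if "i \<in> {0..n}" for i
      by (rule trace_bnd[OF a that])
    fix \<sigma> assume s: "\<sigma> permutes {1..n}"
    have as: "act A (n, a) \<sigma> \<in> ops A n" using sig_act(2)[OF A, of "(n, a)" \<sigma>] a s by (simp add: actp_def)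
    have ia: "act (indiscrete O') (n, trace A w n a) \<sigma> \<in> ops (indiscrete O') n"
      using sig_act(2)[OF I, of "(n, trace A w n a)" \<sigma>] op[OF a] s by (simp add: actp_def)
    show "trace A w n (act A (n, a) \<sigma>) = act (indiscrete O') (n, trace A w n a) \<sigma>"
    proof (rule indiscrete_ext'[OF op[OF as] ia])
      fix i assume i: "i \<in> {0..n}"
      have si: "\<sigma> i \<in> {0..n}" using permutes_le[OF s, of i] i by simp
      show "bnd (indiscrete O') (n, trace A w n (act A (n, a) \<sigma>)) i = bnd (indiscrete O') (n, act (indiscrete O') (n, trace A w n a) \<sigma>) i"
        using trace_bnd[OF as i, of O' w] trace_bnd[OF a si, of O' w] sig_act(3)[OF A, of "(n, a)" \<sigma> i] a s i
          sig_act(3)[OF I, of "(n, trace A w n a)" \<sigma> i] op[OF a] by (simp add: actp_def)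
    qed
  qed
qed

lemma trace_multifunctor:
  fixes M :: "'v multicat"
  assumes M: "typed M" and w: "w \<in> Hom Sets (colours M) O'"
  shows "is_multifunctor M (indiscrete O') (w, trace M w)"
proof -
  have O': "small O'" using w by (simp add: Sets_Hom)
  note I = typed_indiscrete[OF O']
  have sig: "is_sig M" using M by (simp add: typed_def)
  note m = trace_sig_mor[OF sig w]
  have ic: "input_colours (indiscrete O') (mapp (trace M w) a) = map (dat w) (input_colours M a)"
    if "snd a \<in> ops M (fst a)" for a
    by (rule list_arg_ext) (use sig_mor(4)[OF m that] in \<open>simp_all add: arg_input_colours arg_map\<close>)
  show ?thesis
    unfolding is_multifunctor_iff
  proof (intro conjI m ballI allI impI)
    fix c assume "c \<in> colours M"
    thus "trace M w 1 (ident M c) = ident (indiscrete O') (dat w c)"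
      using M by (simp add: trace_def typed_def indiscrete_def)
  next
    fix a bs assume s: "substitutable M a bs"
    have sa: "snd a \<in> ops M (fst a)" and sb: "\<And>b. b \<in> set bs \<Longrightarrow> snd b \<in> ops M (fst b)"
      using s by (auto simp: substitutable_def set_arg)
    have sop: "snd (msubst M a bs) \<in> ops M (fst (msubst M a bs))" "bnd M (msubst M a bs) 0 = bnd M a 0"
      using M s by (auto simp: typed_def msubst_def)
    note s' = substitutable_image[OF m s]
    have sop': "snd (msubst (indiscrete O') (mapp (trace M w) a) (map (mapp (trace M w)) bs)) \<in>
        ops (indiscrete O') (fst (msubst (indiscrete O') (mapp (trace M w) a) (map (mapp (trace M w)) bs)))"
      "bnd (indiscrete O') (msubst (indiscrete O') (mapp (trace M w) a) (map (mapp (trace M w)) bs)) 0 =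
         bnd (indiscrete O') (mapp (trace M w) a) 0"
      using I s' by (auto simp: typed_def msubst_def)
    have mm: "map (input_colours (indiscrete O') \<circ> mapp (trace M w)) bs = map (map (dat w) \<circ> input_colours M) bs"
      using ic[OF sb] by simp
    show "mapp (trace M w) (msubst M a bs) = msubst (indiscrete O') (mapp (trace M w) a) (map (mapp (trace M w)) bs)"
      using sig_mor(2)[OF m sop(1)] sop(2) sop' sig_mor(4)[OF m sop(1), of 0] sig_mor(4)[OF m sa, of 0]
        ic[OF sop(1)] input_colours_msubst[OF M s] input_colours_msubst[OF I s']
      by (intro indiscrete_ext[where O' = O']) (simp_all add: map_concat mm)
  qed
qed

subsection \<open>Reindexing\<close>

text \<open>
  The pullback of \<open>N\<close> along the map between the indiscrete multicategories on the source and the target of \<open>u\<close>.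
\<close>

definition reindex :: "'v fn \<Rightarrow> 'v multicat \<Rightarrow> 'v multicat" where
  "reindex u N = (let I = indiscrete (src u) in
    \<lparr>colours = src u,
     ops = (\<lambda>n. {vpair (b, w) | b w. b \<in> ops N n \<and> w \<in> ops I n \<and>
        (\<forall>i \<in> {0..n}. bnd N (n, b) i = dat u (bnd I (n, w) i))}),
     act = (\<lambda>a \<sigma>. vpair (act N (fst a, vfst (snd a)) \<sigma>, act I (fst a, vsnd (snd a)) \<sigma>)),
     bnd = (\<lambda>a i. bnd I (fst a, vsnd (snd a)) i),
     ident = (\<lambda>c. vpair (ident N (dat u c), ident I c)),
     subst = (\<lambda>a bs. vpair (subst N (mapp (\<lambda>_. vfst) a) (map (mapp (\<lambda>_. vfst)) bs),
        subst I (mapp (\<lambda>_. vsnd) a) (map (mapp (\<lambda>_. vsnd)) bs)))\<rparr>)"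

context
  fixes u :: "'v fn" and N :: "'v multicat" and O'
  assumes N: "is_multicat N" and u: "u \<in> Hom Sets O' (colours N)"
begin

private abbreviation "I \<equiv> indiscrete O'"
private abbreviation "F \<equiv> reindex u N"

private lemma O: "src u = O'" "small O'" "\<And>c. c \<in> O' \<Longrightarrow> dat u c \<in> colours N" using u by (auto simp: Sets_Hom)
private lemma IM: "is_multicat I" "typed I" "is_sig I"
  using is_multicat_indiscrete[OF O(2)] typed_multicat by (auto simp: typed_def)
private lemma NM: "typed N" "is_sig N" using typed_multicat[OF N] by (auto simp: typed_def)

private lemma F_simps: "colours F = O'" "bnd F a i = bnd I (fst a, vsnd (snd a)) i"
  "act F a \<sigma> = vpair (act N (fst a, vfst (snd a)) \<sigma>, act I (fst a, vsnd (snd a)) \<sigma>)"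
  "ident F c = vpair (ident N (dat u c), ident I c)"
  "subst F a bs = vpair (subst N (mapp (\<lambda>_. vfst) a) (map (mapp (\<lambda>_. vfst)) bs),
        subst I (mapp (\<lambda>_. vsnd) a) (map (mapp (\<lambda>_. vsnd)) bs))"
  by (simp_all add: reindex_def Let_def O)

lemma reindex_op: "z \<in> ops (reindex u N) n \<longleftrightarrow> z = vpair (vfst z, vsnd z) \<and> vfst z \<in> ops N n \<and> vsnd z \<in> ops (indiscrete O') n \<and>
    (\<forall>i \<in> {0..n}. bnd N (n, vfst z) i = dat u (bnd (indiscrete O') (n, vsnd z) i))"
proof -
  have "z \<in> ops F n \<longleftrightarrow> (\<exists>b w. z = vpair (b, w) \<and> b \<in> ops N n \<and> w \<in> ops I n \<and>
      (\<forall>i \<in> {0..n}. bnd N (n, b) i = dat u (bnd I (n, w) i)))"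
    by (simp add: reindex_def Let_def O)
  thus ?thesis by (metis vpair_simps(1,2))
qed

private lemma F_proj:
  assumes s: "substitutable F a bs"
  shows "substitutable N (mapp (\<lambda>_. vfst) a) (map (mapp (\<lambda>_. vfst)) bs)"
    and "substitutable I (mapp (\<lambda>_. vsnd) a) (map (mapp (\<lambda>_. vsnd)) bs)"
proof -
  have sa: "snd a \<in> ops F (fst a)" and la: "length bs = fst a"
    and sb: "\<And>i. i \<in> {1..fst a} \<Longrightarrow> snd (arg bs i) \<in> ops F (fst (arg bs i)) \<and> bnd F (arg bs i) 0 = bnd F a i"
    using s by (auto simp: substitutable_def)
  show "substitutable N (mapp (\<lambda>_. vfst) a) (map (mapp (\<lambda>_. vfst)) bs)"
    unfolding substitutable_def
  proof (intro conjI ballI)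
    fix i assume "i \<in> {1..fst (mapp (\<lambda>_. vfst) a)}"
    hence i: "i \<in> {1..fst a}" and i': "i \<in> {1..length bs}" using la by auto
    have 1: "bnd N (fst a, vfst (snd a)) i = dat u (bnd I (fst a, vsnd (snd a)) i)"
      using sa i unfolding reindex_op by simp
    have 2: "bnd N (fst (arg bs i), vfst (snd (arg bs i))) 0 = dat u (bnd I (fst (arg bs i), vsnd (snd (arg bs i))) 0)"
      using sb[OF i] unfolding reindex_op by simp
    show "bnd N (arg (map (mapp (\<lambda>_. vfst)) bs) i) 0 = bnd N (mapp (\<lambda>_. vfst) a) i"
      unfolding arg_map[OF i'] using 1 2 sb[OF i] by (simp add: mapp_def F_simps)
    show "snd (arg (map (mapp (\<lambda>_. vfst)) bs) i) \<in> ops N (fst (arg (map (mapp (\<lambda>_. vfst)) bs) i))"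
      unfolding arg_map[OF i'] using sb[OF i] by (simp add: reindex_op)
  qed (use sa la in \<open>simp_all add: reindex_op\<close>)
  show "substitutable I (mapp (\<lambda>_. vsnd) a) (map (mapp (\<lambda>_. vsnd)) bs)"
    unfolding substitutable_def
  proof (intro conjI ballI)
    fix i assume "i \<in> {1..fst (mapp (\<lambda>_. vsnd) a)}"
    hence i: "i \<in> {1..fst a}" and i': "i \<in> {1..length bs}" using la by auto
    show "bnd I (arg (map (mapp (\<lambda>_. vsnd)) bs) i) 0 = bnd I (mapp (\<lambda>_. vsnd) a) i"
      unfolding arg_map[OF i'] using sb[OF i] by (simp add: mapp_def F_simps)
    show "snd (arg (map (mapp (\<lambda>_. vsnd)) bs) i) \<in> ops I (fst (arg (map (mapp (\<lambda>_. vsnd)) bs) i))"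
      unfolding arg_map[OF i'] using sb[OF i] by (simp add: reindex_op)
  qed (use sa la in \<open>simp_all add: reindex_op\<close>)
qed

private lemma F_act:
  assumes a: "a \<in> ops F n" and s: "\<sigma> permutes {1..n}"
  shows "act F (n, a) \<sigma> \<in> ops F n"
proof -
  have o: "vfst a \<in> ops N n" "vsnd a \<in> ops I n" "\<And>i. i \<in> {0..n} \<Longrightarrow> bnd N (n, vfst a) i = dat u (bnd I (n, vsnd a) i)"
    using a by (auto simp: reindex_op)
  have "\<sigma> i \<in> {0..n}" if "i \<in> {0..n}" for i using permutes_le[OF s, of i] that by simp
  thus ?thesis
    using o(3) sig_act(2,3)[OF NM(2), of "(n, vfst a)" \<sigma>] sig_act(2,3)[OF IM(3), of "(n, vsnd a)" \<sigma>] o(1,2) s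
    unfolding reindex_op by (simp add: F_simps actp_def)
qed

private lemma F_sub:
  assumes s: "substitutable F a bs"
  shows "subst F a bs \<in> ops F (arity_sum bs)"
proof -
  let ?p = "mapp (\<lambda>_. vfst)" and ?q = "mapp (\<lambda>_. vsnd)"
  note P = F_proj[OF s]
  have la: "length bs = fst a" and sa: "snd a \<in> ops F (fst a)"
    and sb: "\<And>i. i \<in> {1..fst a} \<Longrightarrow> snd (arg bs i) \<in> ops F (fst (arg bs i))" using s by (auto simp: substitutable_def)
  have ar: "arity_sum (map ?p bs) = arity_sum bs" "arity_sum (map ?q bs) = arity_sum bs" by (simp_all add: arity_sum_def comp_def)
  have ps: "pos (map ?p bs) i j = pos bs i j" "pos (map ?q bs) i j = pos bs i j" for i j
    by (simp_all add: pos_def arity_sum_def take_map comp_def)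
  have "subst N (?p a) (map ?p bs) \<in> ops N (arity_sum (map ?p bs))" "subst I (?q a) (map ?q bs) \<in> ops I (arity_sum (map ?q bs))"
    "bnd N (msubst N (?p a) (map ?p bs)) 0 = bnd N (?p a) 0" "bnd I (msubst I (?q a) (map ?q bs)) 0 = bnd I (?q a) 0"
    using NM(1) IM(2) P by (auto simp: typed_def)
  note T = this[unfolded ar]
  have T2: "bnd N (msubst N (?p a) (map ?p bs)) (pos bs i j) = bnd N (?p (arg bs i)) j"
    "bnd I (msubst I (?q a) (map ?q bs)) (pos bs i j) = bnd I (?q (arg bs i)) j"
    if i: "i \<in> {1..length bs}" and j: "j \<in> {1..fst (arg bs i)}" for i j
  proof -
    have i': "i \<in> {1..fst (?p a)}" "i \<in> {1..fst (?q a)}" "j \<in> {1..fst (arg (map ?p bs) i)}" "j \<in> {1..fst (arg (map ?q bs) i)}"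
      using i j la by (simp_all add: arg_map)
    show "bnd N (msubst N (?p a) (map ?p bs)) (pos bs i j) = bnd N (?p (arg bs i)) j"
      using NM(1)[unfolded typed_def] P(1) i'(1,3) unfolding ps(1)[symmetric] arg_map[OF i, symmetric] by blast
    show "bnd I (msubst I (?q a) (map ?q bs)) (pos bs i j) = bnd I (?q (arg bs i)) j"
      using IM(2)[unfolded typed_def] P(2) i'(2,4) unfolding ps(2)[symmetric] arg_map[OF i, symmetric] by blast
  qed
  have "bnd N (msubst N (?p a) (map ?p bs)) p = dat u (bnd I (msubst I (?q a) (map ?q bs)) p)" if p: "p \<in> {0..arity_sum bs}" for p
  proof (cases "p = 0")
    case True
    thus ?thesis using T(3,4) sa by (simp add: reindex_op mapp_def)
  next
    case False
    hence "p \<in> {1..arity_sum bs}" using p by simp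
    then obtain i j where ij: "i \<in> {1..length bs}" "j \<in> {1..fst (arg bs i)}" "p = pos bs i j" by (rule pos_surj)
    have "snd (arg bs i) \<in> ops F (fst (arg bs i))" using sb ij la by simp
    thus ?thesis unfolding ij(3) T2[OF ij(1,2)] using ij(2) by (simp add: reindex_op mapp_def)
  qed
  thus ?thesis unfolding reindex_op F_simps using T(1,2) by (simp add: msubst_def ar)
qed

private lemma F_restrict:
  assumes "substitutable F a bs"
  shows "mapp (\<lambda>n. restrict f (ops F n)) a = mapp (\<lambda>_. f) a"
    "map (mapp (\<lambda>n. restrict f (ops F n))) bs = map (mapp (\<lambda>_. f)) bs"
proof -
  show "mapp (\<lambda>n. restrict f (ops F n)) a = mapp (\<lambda>_. f) a" using assms by (simp add: mapp_def substitutable_def)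
  show "map (mapp (\<lambda>n. restrict f (ops F n))) bs = map (mapp (\<lambda>_. f)) bs"
    by (rule list_arg_ext) (use assms in \<open>auto simp: mapp_def substitutable_def arg_map\<close>)
qed

private lemma F_ident: "c \<in> O' \<Longrightarrow> ident F c \<in> ops F 1"
proof -
  assume c: "c \<in> O'"
  have "bnd N (1, ident N (dat u c)) i = dat u (bnd I (1, ident I c) i)" if "i \<in> {0..1}" for i
  proof -
    have "i = 0 \<or> i = 1" using that by auto
    thus ?thesis using NM(1) IM(2) c O(3)[OF c] by (auto simp: typed_def)
  qed
  moreover have "ident N (dat u c) \<in> ops N 1" "ident I c \<in> ops I 1" using NM(1) IM(2) c O(3)[OF c] by (auto simp: typed_def)
  ultimately show ?thesis unfolding reindex_op F_simps by simp
qed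

lemma reindex_proj: "is_multifunctor (reindex u N) N (u, \<lambda>n. restrict vfst (ops (reindex u N) n))"
  and reindex_trace: "is_multifunctor (reindex u N) (indiscrete O') (Idn Sets O', \<lambda>n. restrict vsnd (ops (reindex u N) n))"
proof -
  let ?p = "\<lambda>n. restrict vfst (ops F n)" and ?q = "\<lambda>n. restrict vsnd (ops F n)"
  have id: "Idn Sets O' \<in> Hom Sets O' O'" "\<And>c. c \<in> O' \<Longrightarrow> dat (Idn Sets O') c = c" using O(2) by (auto simp: Sets_def Hom_def)
  have bI: "bnd I (n, vsnd z) i \<in> O'" if "z \<in> ops F n" "i \<in> {0..n}" for n z i
    using sig_act(5)[OF IM(3), of "(n, vsnd z)" i] that by (simp add: reindex_op)
  have sp: "is_sig_mor F N (u, ?p)"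
    unfolding is_sig_mor_def prod.case using u F_act
    by (auto simp: F_simps reindex_op)
  have sq: "is_sig_mor F I (Idn Sets O', ?q)"
    unfolding is_sig_mor_def prod.case using id F_act bI
    by (auto simp: F_simps reindex_op)
  have sub: "snd (msubst F a bs) \<in> ops F (fst (msubst F a bs))" if "substitutable F a bs" for a bs
    using F_sub[OF that] by (simp add: msubst_def)
  have ar: "arity_sum (map (mapp f) bs) = arity_sum bs" for f :: "nat \<Rightarrow> 'v \<Rightarrow> 'v" and bs
    by (simp add: arity_sum_def comp_def)
  show "is_multifunctor F N (u, ?p)"
    unfolding is_multifunctor_iff
  proof (intro conjI sp ballI allI impI)
    show "?p 1 (ident F c) = ident N (dat u c)" if "c \<in> colours F" for c
      using F_ident[of c] that by (simp add: F_simps)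
    show "mapp ?p (msubst F a bs) = msubst N (mapp ?p a) (map (mapp ?p) bs)" if s: "substitutable F a bs" for a bs
      unfolding F_restrict[OF s] msubst_def ar using F_sub[OF s] by (simp add: F_simps)
  qed
  show "is_multifunctor F I (Idn Sets O', ?q)"
    unfolding is_multifunctor_iff
  proof (intro conjI sq ballI allI impI)
    show "?q 1 (ident F c) = ident I (dat (Idn Sets O') c)" if "c \<in> colours F" for c
      using F_ident[of c] that id by (simp add: F_simps)
    show "mapp ?q (msubst F a bs) = msubst I (mapp ?q a) (map (mapp ?q) bs)" if s: "substitutable F a bs" for a bs
      unfolding F_restrict[OF s] msubst_def ar using F_sub[OF s] by (simp add: F_simps)
  qed
qed

lemma is_multicat_reindex: "is_multicat (reindex u N)"
proof (rule is_multicat_joint_embedding[where K = "{(N, u, \<lambda>n. restrict vfst (ops F n)), (I, Idn Sets O', \<lambda>n. restrict vsnd (ops F n))}"])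
  show "small (colours F)" using O by (simp add: F_simps)
  show "small (ops F n)" for n
  proof -
    have "ops F n \<subseteq> vpair ` (ops N n \<times> ops I n)"
    proof
      fix z assume "z \<in> ops F n"
      thus "z \<in> vpair ` (ops N n \<times> ops I n)" unfolding reindex_op by blast
    qed
    moreover have "small (ops N n)" "small (ops I n)" using NM(2) IM(3) by (auto simp: is_sig_def)
    hence "|vpair ` (ops N n \<times> ops I n)| <o |UNIV :: 'v set|"
      unfolding small_def by (intro less_image less_Times)
    ultimately show ?thesis unfolding small_def using less_subset by blast
  qed
  show "bnd F (n, a) i \<in> colours F" if "a \<in> ops F n" "i \<in> {0..n}" for n a i
    using sig_act(5)[OF IM(3), of "(n, vsnd a)" i] that by (simp add: F_simps reindex_op)
  show "ident F c \<in> ops F 1" if "c \<in> colours F" for c using F_ident that by (simp add: F_simps)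
  show "is_multicat N' \<and> is_multifunctor F N' (u', f)"
    if "(N', u', f) \<in> {(N, u, \<lambda>n. restrict vfst (ops F n)), (I, Idn Sets O', \<lambda>n. restrict vsnd (ops F n))}" for N' u' f
    using that N IM(1) reindex_proj reindex_trace by auto
  show "a = b" if ab: "a \<in> ops F n" "b \<in> ops F n"
    and eq: "\<And>N' u' f. (N', u', f) \<in> {(N, u, \<lambda>n. restrict vfst (ops F n)), (I, Idn Sets O', \<lambda>n. restrict vsnd (ops F n))} \<Longrightarrow> f n a = f n b"
    for n a b
  proof -
    have "vfst a = vfst b" using eq[of N u "\<lambda>n. restrict vfst (ops F n)"] ab by simp
    moreover have "vsnd a = vsnd b" using eq[of I "Idn Sets O'" "\<lambda>n. restrict vsnd (ops F n)"] ab by simp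
    ultimately show ?thesis using ab by (metis reindex_op)
  qed
  show "c = d" if cd: "c \<in> colours F" "d \<in> colours F"
    and eq: "\<And>N' u' f. (N', u', f) \<in> {(N, u, \<lambda>n. restrict vfst (ops F n)), (I, Idn Sets O', \<lambda>n. restrict vsnd (ops F n))} \<Longrightarrow> dat u' c = dat u' d"
    for c d
    using eq[of I "Idn Sets O'" "\<lambda>n. restrict vsnd (ops F n)"] cd by (simp add: F_simps Sets_def)
qed (use F_act F_sub in auto)

lemma reindex_cartesian:
  "cartesian_arrow Multicat Sets colours_func (Arrow (reindex u N) (u, \<lambda>n. restrict vfst (ops (reindex u N) n)) N)"
  (is "cartesian_arrow _ _ _ ?\<phi>")
  unfolding cartesian_arrow_def
proof (intro conjI ballI impI)
  show "?\<phi> \<in> Arr Multicat" using is_multicat_reindex N reindex_proj by (simp add: Multicat_def)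
  fix \<psi> w assume psi: "\<psi> \<in> Arr Multicat" and w: "w \<in> Hom Sets (omap colours_func (src \<psi>)) (omap colours_func (src ?\<phi>))"
    and t: "tgt \<psi> = tgt ?\<phi>" and eq: "amap colours_func \<psi> = Cmp Sets (amap colours_func ?\<phi>) w"
  obtain M f where M: "is_multicat M" and f: "is_multifunctor M N (Cmp Sets u w, f)" and p: "\<psi> = Arrow M (Cmp Sets u w, f) N"
    using psi t eq by (auto simp: Multicat_def colours_func_def)
  note TM = typed_multicat[OF M]
  have sM: "is_sig M" using TM by (simp add: typed_def)
  have w': "w \<in> Hom Sets (colours M) O'" using w p by (simp add: colours_func_def F_simps)
  have uw: "dat (Cmp Sets u w) k = dat u (dat w k)" if "k \<in> colours M" for k
    using w' that by (simp add: Sets_def Hom_Arr compose_def)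
  note mf = f[unfolded is_multifunctor_iff, THEN conjunct1]
  note tr = trace_multifunctor[OF TM w']
  note mt = tr[unfolded is_multifunctor_iff, THEN conjunct1]
  define h where "h n = (\<lambda>a \<in> ops M n. vpair (f n a, trace M w n a))" for n
  have hop: "h n a \<in> ops F n" if a: "a \<in> ops M n" for n a
  proof -
    have "bnd N (n, f n a) i = dat u (bnd I (n, trace M w n a) i)" if i: "i \<in> {0..n}" for i
      using sig_mor(4)[OF mf, of "(n, a)" i] sig_mor(4)[OF mt, of "(n, a)" i] a i uw sig_act(5)[OF sM, of "(n, a)" i] by simp
    thus ?thesis unfolding reindex_op h_def
      using sig_mor(2)[OF mf, of "(n, a)"] sig_mor(2)[OF mt, of "(n, a)"] a by simp
  qed
  have hs: "is_sig_mor M F (w, h)"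
    unfolding is_sig_mor_def prod.case
  proof (intro conjI allI ballI impI)
    show "w \<in> Hom Sets (colours M) (colours F)" using w' by (simp add: F_simps)
    fix n
    show "h n \<in> ops M n \<rightarrow>\<^sub>E ops F n" using hop by (auto simp: h_def)
    fix a assume a: "a \<in> ops M n"
    show "bnd F (n, h n a) i = dat w (bnd M (n, a) i)" if i: "i \<in> {0..n}" for i
      using sig_mor(4)[OF mt, of "(n, a)" i] a i by (simp add: F_simps h_def)
    fix \<sigma> assume s: "\<sigma> permutes {1..n}"
    have "act M (n, a) \<sigma> \<in> ops M n" using sig_act(2)[OF sM, of "(n, a)" \<sigma>] a s by (simp add: actp_def)
    thus "h n (act M (n, a) \<sigma>) = act F (n, h n a) \<sigma>"
      using sig_mor(3)[OF mf, of "(n, a)" \<sigma>] sig_mor(3)[OF mt, of "(n, a)" \<sigma>] a s by (simp add: F_simps h_def actp_def)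
  qed
  have pq: "mapp (\<lambda>_. vfst) (mapp h a) = mapp f a" "mapp (\<lambda>_. vsnd) (mapp h a) = mapp (trace M w) a"
    if "snd a \<in> ops M (fst a)" for a using that by (simp_all add: mapp_def h_def)
  have hm: "is_multifunctor M F (w, h)"
    unfolding is_multifunctor_iff
  proof (intro conjI hs ballI allI impI)
    fix c assume c: "c \<in> colours M"
    have "ident M c \<in> ops M 1" using TM c by (simp add: typed_def)
    thus "h 1 (ident M c) = ident F (dat w c)"
      using f tr c uw[OF c] by (simp add: is_multifunctor_iff h_def F_simps)
  next
    fix a bs assume s: "substitutable M a bs"
    have sa: "snd a \<in> ops M (fst a)" using s by (simp add: substitutable_def)
    have mb: "map (mapp (\<lambda>_. vfst)) (map (mapp h) bs) = map (mapp f) bs"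
      "map (mapp (\<lambda>_. vsnd)) (map (mapp h) bs) = map (mapp (trace M w)) bs"
      using s pq by (auto simp: substitutable_def set_arg)
    have ar: "arity_sum (map (mapp k) bs) = arity_sum bs" for k :: "nat \<Rightarrow> 'v \<Rightarrow> 'v" by (simp add: arity_sum_def comp_def)
    have so: "subst M a bs \<in> ops M (arity_sum bs)" using TM s by (simp add: typed_def)
    have 1: "f (arity_sum bs) (subst M a bs) = subst N (mapp f a) (map (mapp f) bs)"
      using multifunctor_sub[OF f s] by (simp add: msubst_def ar)
    have 2: "trace M w (arity_sum bs) (subst M a bs) = subst I (mapp (trace M w) a) (map (mapp (trace M w)) bs)"
      using multifunctor_sub[OF tr s] by (simp add: msubst_def ar)
    show "mapp h (msubst M a bs) = msubst F (mapp h a) (map (mapp h) bs)"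
      unfolding msubst_def ar F_simps mb pq[OF sa] using so 1 2 by (simp add: h_def)
  qed
  show "\<exists>!\<chi>. \<chi> \<in> Hom Multicat (src \<psi>) (src ?\<phi>) \<and> amap colours_func \<chi> = w \<and> Cmp Multicat ?\<phi> \<chi> = \<psi>"
  proof (rule ex1I[of _ "Arrow M (w, h) F"])
    have fe: "f n \<in> extensional (ops M n)" for n using mf by (simp add: is_sig_mor_def PiE_iff)
    have "compose (ops M n) (restrict vfst (ops F n)) (h n) = f n" for n
    proof
      fix a show "compose (ops M n) (restrict vfst (ops F n)) (h n) a = f n a"
        using fe[of n] hop[of a n] by (cases "a \<in> ops M n") (auto simp: compose_def h_def extensional_def)
    qed
    thus "Arrow M (w, h) F \<in> Hom Multicat (src \<psi>) (src ?\<phi>) \<and> amap colours_func (Arrow M (w, h) F) = w \<and>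
        Cmp Multicat ?\<phi> (Arrow M (w, h) F) = \<psi>"
      using M hm is_multicat_reindex by (simp add: p Hom_def Multicat_def colours_func_def sig_cmp_simp)
  next
    fix \<chi> assume c: "\<chi> \<in> Hom Multicat (src \<psi>) (src ?\<phi>) \<and> amap colours_func \<chi> = w \<and> Cmp Multicat ?\<phi> \<chi> = \<psi>"
    then obtain k where k: "\<chi> = Arrow M (w, k) F" and km: "is_multifunctor M F (w, k)"
      by (auto simp: p Hom_def Multicat_def colours_func_def)
    note ks = km[unfolded is_multifunctor_iff, THEN conjunct1]
    have ke: "k n \<in> extensional (ops M n)" and kop: "\<And>a. a \<in> ops M n \<Longrightarrow> k n a \<in> ops F n" for n
      using ks by (auto simp: is_sig_mor_def PiE_iff)
    have cf: "compose (ops M n) (restrict vfst (ops F n)) (k n) = f n" for n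
      using c by (simp add: p k Multicat_def sig_cmp_simp fun_eq_iff)
    have "k n a = h n a" for n a
    proof (cases "a \<in> ops M n")
      case True
      have "vfst (k n a) = f n a" using fun_cong[OF cf, of n a] True kop[OF True] by (simp add: compose_def)
      moreover have "vsnd (k n a) = trace M w n a"
      proof (rule indiscrete_ext'[of _ O' n])
        show "vsnd (k n a) \<in> ops I n" using kop[OF True] by (simp add: reindex_op)
        show "trace M w n a \<in> ops I n" using sig_mor(2)[OF mt, of "(n, a)"] True by simp
        fix i assume i: "i \<in> {0..n}"
        show "bnd I (n, vsnd (k n a)) i = bnd I (n, trace M w n a) i"
          using sig_mor(4)[OF ks, of "(n, a)" i] sig_mor(4)[OF mt, of "(n, a)" i] True i by (simp add: F_simps)
      qed
      moreover have "k n a = vpair (vfst (k n a), vsnd (k n a))" using kop[OF True] reindex_op by blast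
      ultimately show ?thesis using True by (simp add: h_def)
    next
      case False
      thus ?thesis using ke[of n] by (simp add: h_def extensional_def)
    qed
    hence "k = h" by blast
    thus "\<chi> = Arrow M (w, h) F" using k by simp
  qed
qed

end

lemma colours_functor: "is_functor (Multicat :: ('v multicat, 'v sig_map) category) Sets colours_func"
proof (rule is_functorI[OF is_category_Multicat is_category_Sets])
  show "omap colours_func M \<in> Obj Sets" if "M \<in> Obj Multicat" for M :: "'v multicat"
    using that typed_multicat[of M] by (auto simp: Multicat_def colours_func_def Sets_def typed_def is_sig_def)
  show "amap colours_func f \<in> Hom Sets (omap colours_func M) (omap colours_func N)"
    if f: "f \<in> Hom Multicat M N" for f and M N :: "'v multicat"
  proof -
    obtain u k where "f = Arrow M (u, k) N" "is_multifunctor M N (u, k)"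
      using f by (auto simp: Multicat_def Hom_def)
    thus ?thesis using sig_mor(1)[of M N u k] by (simp add: colours_func_def is_multifunctor_iff)
  qed
qed (auto simp: Multicat_def colours_func_def sig_id_def sig_cmp_def)

lemma fibration_Multicat: "fibration (Multicat :: ('v multicat, 'v sig_map) category) Sets colours_func"
  unfolding fibration_def
proof (intro conjI ballI impI colours_functor)
  fix N :: "'v multicat" and u assume N: "N \<in> Obj Multicat" and u: "u \<in> Arr Sets" "tgt u = omap colours_func N"
  have N': "is_multicat N" using N by (simp add: Multicat_def)
  have u': "u \<in> Hom Sets (src u) (colours N)" using u by (simp add: Hom_Arr colours_func_def)
  show "\<exists>\<phi>. cartesian_arrow Multicat Sets colours_func \<phi> \<and> tgt \<phi> = N \<and> amap colours_func \<phi> = u"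
    using reindex_cartesian[OF N' u']
    by (intro exI[of _ "Arrow (reindex u N) (u, \<lambda>n. restrict vfst (ops (reindex u N) n)) N"]) (simp add: colours_func_def)
qed

end

subsection \<open>Free multicategories\<close>

text \<open>
  Formal terms are identified when they agree under every interpretation in a multicategory.  Since the
  axioms of a multicategory hold in each interpretation, they hold for the quotient.
\<close>

datatype 'w trm = Gen nat 'w | Idt 'w | Act "'w trm" "nat \<Rightarrow> nat" | Sub "'w trm" "'w trm list"

primrec eval_trm :: "'v multicat \<Rightarrow> 'v fn \<Rightarrow> (nat \<Rightarrow> 'v \<Rightarrow> 'v) \<Rightarrow> 'v trm \<Rightarrow> nat \<times> 'v" where
  "eval_trm N u f (Gen n a) = (n, f n a)"
| "eval_trm N u f (Idt c) = (1, ident N (dat u c))"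
| "eval_trm N u f (Act t \<sigma>) = actp N (eval_trm N u f t) \<sigma>"
| "eval_trm N u f (Sub t ts) = msubst N (eval_trm N u f t) (map (eval_trm N u f) ts)"

lemma pos_cong: "map fst bs = map fst cs \<Longrightarrow> pos bs = pos cs"
  unfolding pos_def fun_eq_iff arity_sum_def by (metis take_map)

lemma arity_sum_cong: "map fst bs = map fst cs \<Longrightarrow> arity_sum bs = arity_sum cs"
  by (simp add: arity_sum_def)

text \<open>
  The signature \<open>A\<close> has the type of a multicategory so that it can be the source of maps to multicategories;
  its fields \<open>ident\<close> and \<open>subst\<close> are never used.
\<close>

locale signature = universe ty for ty :: "'v itself" +
  fixes A :: "'v multicat"
  assumes sig: "is_sig A"
begin

abbreviation "O' \<equiv> colours A"
abbreviation "J \<equiv> indiscrete O'"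
abbreviation "one \<equiv> Idn Sets O'"

lemma small_O: "small O'" using sig by (simp add: is_sig_def)

lemma one: "one \<in> Hom Sets O' O'" "c \<in> O' \<Longrightarrow> dat one c = c"
  using small_O by (auto simp: Sets_def Hom_def)

lemma J_multicat: "is_multicat J" "typed J" "is_sig J"
  using is_multicat_indiscrete[OF small_O] typed_multicat by (auto simp: typed_def)

lemma trace_one: "is_sig_mor A J (one, trace A one)" by (rule trace_sig_mor[OF sig one(1)])

text \<open>Evaluation in the indiscrete multicategory computes the boundary of a term.\<close>

definition tp :: "'v trm \<Rightarrow> nat \<times> 'v" where "tp = eval_trm J one (trace A one)"

lemma tp_simps:
  "tp (Gen n a) = (n, trace A one n a)" "tp (Idt c) = (1, ident J (dat one c))"
  "tp (Act t \<sigma>) = actp J (tp t) \<sigma>" "tp (Sub t ts) = msubst J (tp t) (map tp ts)"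
  by (simp_all add: tp_def)

fun ok :: "'v trm \<Rightarrow> bool" where
  "ok (Gen n a) \<longleftrightarrow> a \<in> ops A n"
| "ok (Idt c) \<longleftrightarrow> c \<in> O'"
| "ok (Act t \<sigma>) \<longleftrightarrow> ok t \<and> \<sigma> permutes {1..fst (tp t)}"
| "ok (Sub t ts) \<longleftrightarrow> ok t \<and> (\<forall>s \<in> set ts. ok s) \<and> substitutable J (tp t) (map tp ts)"

lemma tp_op: "ok t \<Longrightarrow> snd (tp t) \<in> ops J (fst (tp t))"
proof (induction t)
  case (Gen n a)
  thus ?case using sig_mor(2)[OF trace_one, of "(n, a)"] by (simp add: tp_simps)
next
  case (Idt c)
  thus ?case using J_multicat(2) one by (simp add: tp_simps typed_def)
next
  case (Act t \<sigma>)
  thus ?case using sig_act(2)[OF J_multicat(3), of "tp t" \<sigma>] by (simp add: tp_simps)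
next
  case (Sub t ts)
  thus ?case using J_multicat(2) by (simp add: tp_simps typed_def msubst_def)
qed

lemma eval_typed:
  assumes N: "is_multicat N" and m: "is_sig_mor A N (u, f)"
  shows "ok t \<Longrightarrow> fst (eval_trm N u f t) = fst (tp t) \<and> snd (eval_trm N u f t) \<in> ops N (fst (tp t)) \<and>
    (\<forall>i \<in> {0..fst (tp t)}. bnd N (eval_trm N u f t) i = dat u (bnd J (tp t) i))"
proof (induction t)
  case (Gen n a)
  have "bnd J (n, trace A one n a) i = bnd A (n, a) i" if "i \<in> {0..n}" for i
    using sig_mor(4)[OF trace_one, of "(n, a)" i] Gen that one(2) sig_act(5)[OF sig, of "(n, a)" i] by simp
  thus ?case using Gen sig_mor(2)[OF m, of "(n, a)"] sig_mor(4)[OF m, of "(n, a)"] by (simp add: tp_simps)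
next
  case (Idt c)
  have c: "c \<in> O'" using Idt by simp
  have uc: "dat u c \<in> colours N" using sig_mor(1)[OF m] c by (auto simp: Sets_Hom)
  have "bnd N (1, ident N (dat u c)) i = dat u (bnd J (1, ident J c) i)" if "i \<in> {0..1}" for i
  proof -
    have "i = 0 \<or> i = 1" using that by auto
    thus ?thesis using typed_multicat[OF N] J_multicat(2) uc c by (auto simp: typed_def)
  qed
  thus ?case using typed_multicat[OF N] uc c one(2) by (simp add: tp_simps typed_def)
next
  case (Act t \<sigma>)
  have t: "ok t" and s: "\<sigma> permutes {1..fst (tp t)}" using Act.prems by auto
  note IH = Act.IH[OF t]
  have sN: "is_sig N" using typed_multicat[OF N] by (simp add: typed_def)
  have "bnd N (actp N (eval_trm N u f t) \<sigma>) i = dat u (bnd J (actp J (tp t) \<sigma>) i)" if i: "i \<in> {0..fst (tp t)}" for i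
  proof -
    have "\<sigma> i \<in> {0..fst (tp t)}" using permutes_le[OF s, of i] i by simp
    thus ?thesis using sig_act(3)[OF sN, of "eval_trm N u f t" \<sigma> i] sig_act(3)[OF J_multicat(3) tp_op[OF t] s i] IH s i by simp
  qed
  thus ?case using sig_act(2)[OF sN, of "eval_trm N u f t" \<sigma>] IH s by (simp add: tp_simps)
next
  case (Sub t ts)
  let ?e = "eval_trm N u f"
  have t: "ok t" and ts: "\<And>s. s \<in> set ts \<Longrightarrow> ok s" and si: "substitutable J (tp t) (map tp ts)"
    using Sub.prems by auto
  note IHt = Sub.IH(1)[OF t] and IHs = Sub.IH(2)[OF _ ts]
  have mf: "map fst (map ?e ts) = map fst (map tp ts)" using IHs by simp
  have lt: "length ts = fst (tp t)" using si by (simp add: substitutable_def)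
  have ti: "arg ts i \<in> set ts" if "i \<in> {1..fst (tp t)}" for i using that lt arg_in_set[of i ts] by simp
  have sn: "substitutable N (?e t) (map ?e ts)"
    unfolding substitutable_def
  proof (intro conjI ballI)
    show "snd (?e t) \<in> ops N (fst (?e t))" "length (map ?e ts) = fst (?e t)" using IHt lt by auto
    fix i assume "i \<in> {1..fst (?e t)}"
    hence i: "i \<in> {1..fst (tp t)}" and i': "i \<in> {1..length ts}" using IHt lt by auto
    have "bnd J (tp (arg ts i)) 0 = bnd J (tp t) i" using si i unfolding substitutable_def arg_map[OF i', symmetric] by blast
    thus "snd (arg (map ?e ts) i) \<in> ops N (fst (arg (map ?e ts) i))" "bnd N (arg (map ?e ts) i) 0 = bnd N (?e t) i"
      unfolding arg_map[OF i'] using IHs[OF ti[OF i] ti[OF i]] IHt i by auto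
  qed
  have TN: "snd (msubst N (?e t) (map ?e ts)) \<in> ops N (arity_sum (map ?e ts))"
     "bnd N (msubst N (?e t) (map ?e ts)) 0 = bnd N (?e t) 0"
     "\<And>i j. i \<in> {1..fst (?e t)} \<Longrightarrow> j \<in> {1..fst (arg (map ?e ts) i)} \<Longrightarrow>
        bnd N (msubst N (?e t) (map ?e ts)) (pos (map ?e ts) i j) = bnd N (arg (map ?e ts) i) j"
    using typed_multicat[OF N] sn by (auto simp: typed_def msubst_def)
  have TI: "bnd J (msubst J (tp t) (map tp ts)) 0 = bnd J (tp t) 0"
     "\<And>i j. i \<in> {1..fst (tp t)} \<Longrightarrow> j \<in> {1..fst (arg (map tp ts) i)} \<Longrightarrow>
        bnd J (msubst J (tp t) (map tp ts)) (pos (map tp ts) i j) = bnd J (arg (map tp ts) i) j"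
    using J_multicat(2) si by (auto simp: typed_def)
  have "bnd N (msubst N (?e t) (map ?e ts)) p = dat u (bnd J (msubst J (tp t) (map tp ts)) p)"
    if p: "p \<in> {0..arity_sum (map tp ts)}" for p
  proof (cases "p = 0")
    case True
    thus ?thesis using TN(2) TI(1) IHt by simp
  next
    case False
    hence "p \<in> {1..arity_sum (map tp ts)}" using p by simp
    then obtain i j where ij: "i \<in> {1..length (map tp ts)}" "j \<in> {1..fst (arg (map tp ts) i)}" "p = pos (map tp ts) i j"
      by (rule pos_surj)
    have i: "i \<in> {1..fst (tp t)}" "i \<in> {1..fst (?e t)}" and i': "i \<in> {1..length ts}" using ij(1) lt IHt by auto
    note IH = IHs[OF ti[OF i(1)] ti[OF i(1)]]
    have j: "j \<in> {1..fst (tp (arg ts i))}" using ij(2) unfolding arg_map[OF i'] .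
    have "j \<in> {1..fst (arg (map ?e ts) i)}" unfolding arg_map[OF i'] using IH j by simp
    from TN(3)[OF i(2) this] TI(2)[OF i(1) ij(2)] show ?thesis
      unfolding ij(3) pos_cong[OF mf] arg_map[OF i'] using IH j by simp
  qed
  thus ?case using TN(1) arity_sum_cong[OF mf] by (simp add: tp_simps del: map_map)
qed

definition rel :: "'v trm \<Rightarrow> 'v trm \<Rightarrow> bool" where
  "rel t s \<longleftrightarrow> (\<forall>N u f. is_multicat N \<longrightarrow> is_sig_mor A N (u, f) \<longrightarrow> eval_trm N u f t = eval_trm N u f s)"

lemma rel_eval: "rel t s \<Longrightarrow> is_multicat N \<Longrightarrow> is_sig_mor A N (u, f) \<Longrightarrow> eval_trm N u f t = eval_trm N u f s"
  by (simp add: rel_def)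

lemma rel_tp: "rel t s \<Longrightarrow> tp t = tp s"
  unfolding tp_def by (rule rel_eval[OF _ J_multicat(1) trace_one])

lemma small_terms: "|{t. ok t}| <o |UNIV :: 'v set|"
proof -
  define W where "W n = {t. ok t \<and> size t < n}" for n
  define Perm where "Perm = (\<Union>n. {\<sigma>. \<sigma> permutes {1..n :: nat}})"
  have P: "|Perm| <o |UNIV :: 'v set|"
    unfolding Perm_def by (rule less_countable, rule countable_UN) (simp_all add: countable_finite finite_permutations)
  have G: "|\<Union>n. ops A n| <o |UNIV :: 'v set|"
  proof (intro less_UN less_nat)
    fix n
    have "small (ops A n)" using sig by (simp add: is_sig_def)
    thus "|ops A n| <o |UNIV :: 'v set|" unfolding small_def .
  qed
  have "|W n| <o |UNIV :: 'v set|" for n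
  proof (induction n)
    case 0
    have "W 0 = {}" by (simp add: W_def)
    thus ?case using less_finite[of "{} :: 'v trm set"] by simp
  next
    case (Suc n)
    have *: "W (Suc n) \<subseteq> (\<lambda>(n, a). Gen n a) ` (UNIV \<times> (\<Union>n. ops A n)) \<union> (Idt ` O' \<union>
        ((\<lambda>(t, \<sigma>). Act t \<sigma>) ` (W n \<times> Perm) \<union> (\<lambda>(t, ts). Sub t ts) ` (W n \<times> lists (W n))))"
    proof
      fix t assume t: "t \<in> W (Suc n)"
      show "t \<in> (\<lambda>(n, a). Gen n a) ` (UNIV \<times> (\<Union>n. ops A n)) \<union> (Idt ` O' \<union>
        ((\<lambda>(t, \<sigma>). Act t \<sigma>) ` (W n \<times> Perm) \<union> (\<lambda>(t, ts). Sub t ts) ` (W n \<times> lists (W n))))"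
      proof (cases t)
        case (Gen m a)
        thus ?thesis using t by (auto simp: W_def)
      next
        case (Idt c)
        thus ?thesis using t by (auto simp: W_def)
      next
        case (Act s \<sigma>)
        thus ?thesis using t by (auto simp: W_def Perm_def)
      next
        case (Sub s ts)
        have "size r < n" if "r \<in> set ts" for r
          using t size_list_estimation'[OF that, of "size r" size] by (simp add: W_def Sub)
        thus ?thesis using t by (auto simp: W_def Sub)
      qed
    qed
    have U: "|X \<union> Y| <o |UNIV :: 'v set|" if "|X| <o |UNIV :: 'v set|" "|Y| <o |UNIV :: 'v set|" for X Y :: "'v trm set"
      by (rule card_of_Un_ordLess_infinite[OF infinite_UNIV that])
    show ?case
      by (rule less_subset[OF U[OF less_image[OF less_Times[OF less_nat G]] U[OF less_image[OF small_O[unfolded small_def]]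
      U[OF less_image[OF less_Times[OF Suc P]] less_image[OF less_Times[OF Suc less_lists[OF Suc]]]]]] *])
  qed
  moreover have "{t. ok t} \<subseteq> (\<Union>n. W n)" by (auto simp: W_def)
  ultimately show ?thesis using less_subset[OF less_UN[OF less_nat, of W]] by blast
qed

definition code :: "'v trm \<Rightarrow> 'v" where "code = (SOME c. inj_on c {t. ok t})"

lemma code_inj: "inj_on code {t. ok t}"
  unfolding code_def using less_encode[OF small_terms] by (rule someI_ex)

definition nf :: "'v trm \<Rightarrow> 'v trm" where "nf t = (SOME s. ok s \<and> rel t s)"

definition cls :: "'v trm \<Rightarrow> 'v" where "cls t = code (nf t)"

definition trm_of :: "'v \<Rightarrow> 'v trm" where "trm_of v = inv_into {t. ok t} code v"

lemma nf: "ok t \<Longrightarrow> ok (nf t) \<and> rel t (nf t)"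
  unfolding nf_def by (rule someI[of _ t]) (simp add: rel_def)

lemma trm_of_cls: "ok t \<Longrightarrow> trm_of (cls t) = nf t"
  unfolding trm_of_def cls_def using nf by (intro inv_into_f_f[OF code_inj]) simp

lemma cls_eq: "ok t \<Longrightarrow> ok s \<Longrightarrow> cls t = cls s \<longleftrightarrow> rel t s"
proof
  assume *: "ok t" "ok s" "cls t = cls s"
  hence "nf t = nf s" using trm_of_cls by metis
  thus "rel t s" using nf[OF *(1)] nf[OF *(2)] by (simp add: rel_def)
next
  assume "rel t s"
  hence "rel t = rel s" by (auto simp: rel_def fun_eq_iff)
  thus "cls t = cls s" by (simp add: cls_def nf_def)
qed

definition free :: "'v multicat" where
  "free = \<lparr>colours = O', ops = (\<lambda>n. cls ` {t. ok t \<and> fst (tp t) = n}),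
     act = (\<lambda>a \<sigma>. cls (Act (trm_of (snd a)) \<sigma>)), bnd = (\<lambda>a i. bnd J (tp (trm_of (snd a))) i),
     ident = (\<lambda>c. cls (Idt c)), subst = (\<lambda>a bs. cls (Sub (trm_of (snd a)) (map (\<lambda>b. trm_of (snd b)) bs)))\<rparr>"

lemma free_simps:
  "colours free = O'" "act free a \<sigma> = cls (Act (trm_of (snd a)) \<sigma>)" "bnd free a i = bnd J (tp (trm_of (snd a))) i"
  "ident free c = cls (Idt c)" "subst free a bs = cls (Sub (trm_of (snd a)) (map (\<lambda>b. trm_of (snd b)) bs))"
  by (simp_all add: free_def)

lemma cls_op: "ok t \<Longrightarrow> fst (tp t) = n \<Longrightarrow> cls t \<in> ops free n"
  by (auto simp: free_def)

lemma trm_of: "ok t \<Longrightarrow> ok (trm_of (cls t)) \<and> rel (trm_of (cls t)) t \<and> tp (trm_of (cls t)) = tp t"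
  using nf[of t] rel_tp[of t "nf t"] by (auto simp: trm_of_cls rel_def)

lemma free_op:
  assumes "v \<in> ops free n"
  shows "ok (trm_of v)" "fst (tp (trm_of v)) = n" "cls (trm_of v) = v"
proof -
  obtain t where t: "ok t" "fst (tp t) = n" "v = cls t" using assms by (auto simp: free_def)
  show "ok (trm_of v)" "fst (tp (trm_of v)) = n" "cls (trm_of v) = v"
    using trm_of[OF t(1)] t cls_eq[of "trm_of (cls t)" t] by auto
qed

lemma free_act:
  assumes "a \<in> ops free n" "\<sigma> permutes {1..n}"
  shows "ok (Act (trm_of a) \<sigma>)" "act free (n, a) \<sigma> \<in> ops free n"
proof -
  show k: "ok (Act (trm_of a) \<sigma>)" using free_op[OF assms(1)] assms(2) by simp
  show "act free (n, a) \<sigma> \<in> ops free n" unfolding free_simps snd_conv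
    by (rule cls_op[OF k]) (use free_op[OF assms(1)] in \<open>simp add: tp_simps\<close>)
qed

lemma free_sub:
  assumes s: "substitutable free a bs"
  shows "ok (Sub (trm_of (snd a)) (map (\<lambda>b. trm_of (snd b)) bs))" "subst free a bs \<in> ops free (arity_sum bs)"
    "map fst (map tp (map (\<lambda>b. trm_of (snd b)) bs)) = map fst bs"
proof -
  have sa: "snd a \<in> ops free (fst a)" and la: "length bs = fst a"
    and sb: "\<And>i. i \<in> {1..fst a} \<Longrightarrow> snd (arg bs i) \<in> ops free (fst (arg bs i)) \<and> bnd free (arg bs i) 0 = bnd free a i"
    using s by (auto simp: substitutable_def)
  have sb': "snd b \<in> ops free (fst b)" if "b \<in> set bs" for b
    using that sb la by (auto simp: set_arg)
  let ?ts = "map (\<lambda>b. trm_of (snd b)) bs"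
  note A = free_op[OF sa]
  have si: "substitutable J (tp (trm_of (snd a))) (map tp ?ts)"
    unfolding substitutable_def A(2)
  proof (intro conjI ballI)
    show "snd (tp (trm_of (snd a))) \<in> ops J (fst a)" using tp_op[OF A(1)] A(2) by simp
    show "length (map tp ?ts) = fst a" using la by simp
    fix i assume i: "i \<in> {1..fst a}"
    hence i': "i \<in> {1..length bs}" and i'': "i \<in> {1..length ?ts}" using la by auto
    have oi: "ok (trm_of (snd (arg bs i)))" using free_op(1) sb[OF i] by blast
    show "snd (arg (map tp ?ts) i) \<in> ops J (fst (arg (map tp ?ts) i))"
      unfolding arg_map[OF i''] arg_map[OF i'] by (rule tp_op[OF oi])
    show "bnd J (arg (map tp ?ts) i) 0 = bnd J (tp (trm_of (snd a))) i"
      unfolding arg_map[OF i''] arg_map[OF i'] using sb[OF i] by (simp add: free_simps)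
  qed
  show k: "ok (Sub (trm_of (snd a)) ?ts)" using A(1) free_op(1)[OF sb'] si by auto
  show m: "map fst (map tp ?ts) = map fst bs" using free_op(2)[OF sb'] by simp
  show "subst free a bs \<in> ops free (arity_sum bs)" unfolding free_simps
    by (rule cls_op[OF k]) (use arity_sum_cong[OF m] in \<open>simp add: tp_simps del: map_map\<close>)
qed

definition ext :: "'v multicat \<Rightarrow> 'v fn \<Rightarrow> (nat \<Rightarrow> 'v \<Rightarrow> 'v) \<Rightarrow> nat \<Rightarrow> 'v \<Rightarrow> 'v" where
  "ext N u f n = (\<lambda>v \<in> ops free n. snd (eval_trm N u f (trm_of v)))"

lemma ext_eval:
  assumes "is_multicat N" "is_sig_mor A N (u, f)" "snd a \<in> ops free (fst a)"
  shows "mapp (ext N u f) a = eval_trm N u f (trm_of (snd a))"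
  using eval_typed[OF assms(1,2) free_op(1)[OF assms(3)]] free_op(2)[OF assms(3)] assms(3)
  by (simp add: mapp_def ext_def prod_eq_iff)

lemma ext_cls:
  assumes "is_multicat N" "is_sig_mor A N (u, f)" "ok t"
  shows "ext N u f (fst (tp t)) (cls t) = snd (eval_trm N u f t)"
  using rel_eval[OF _ assms(1,2), of "trm_of (cls t)" t] trm_of[OF assms(3)] cls_op[OF assms(3)] by (simp add: ext_def)

lemma ext_multifunctor:
  assumes N: "is_multicat N" and m: "is_sig_mor A N (u, f)"
  shows "is_multifunctor free N (u, ext N u f)"
proof -
  have s: "is_sig_mor free N (u, ext N u f)"
    unfolding is_sig_mor_def prod.case
  proof (intro conjI allI ballI impI)
    show "u \<in> Hom Sets (colours free) (colours N)" using sig_mor(1)[OF m] by (simp add: free_simps)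
    fix n
    show "ext N u f n \<in> ops free n \<rightarrow>\<^sub>E ops N n"
      using eval_typed[OF N m free_op(1)] free_op(2) by (auto simp: ext_def)
    fix a assume a: "a \<in> ops free n"
    note e = ext_eval[OF N m, of "(n, a)"] and E = eval_typed[OF N m free_op(1)[OF a]]
    show "bnd N (n, ext N u f n a) i = dat u (bnd free (n, a) i)" if "i \<in> {0..n}" for i
      using e a E that free_op(2)[OF a] by (simp add: free_simps)
    fix \<sigma> assume s: "\<sigma> permutes {1..n}"
    note F = free_act[OF a s]
    have "ext N u f n (act free (n, a) \<sigma>) = snd (eval_trm N u f (Act (trm_of a) \<sigma>))"
      using ext_cls[OF N m F(1)] free_op(2)[OF a] by (simp add: free_simps tp_simps)
    thus "ext N u f n (act free (n, a) \<sigma>) = act N (n, ext N u f n a) \<sigma>"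
      using e a by (simp add: actp_def)
  qed
  show ?thesis
    unfolding is_multifunctor_iff
  proof (intro conjI s ballI allI impI)
    show "ext N u f 1 (ident free c) = ident N (dat u c)" if "c \<in> colours free" for c
      using ext_cls[OF N m, of "Idt c"] that by (simp add: free_simps tp_simps)
    fix a bs assume sub: "substitutable free a bs"
    note F = free_sub[OF sub]
    have sa: "snd a \<in> ops free (fst a)" and sb: "\<And>b. b \<in> set bs \<Longrightarrow> snd b \<in> ops free (fst b)"
      using sub by (auto simp: substitutable_def set_arg)
    let ?t = "Sub (trm_of (snd a)) (map (\<lambda>b. trm_of (snd b)) bs)"
    have ty: "fst (tp ?t) = arity_sum bs" using arity_sum_cong[OF F(3)] by (simp add: tp_simps del: map_map)
    have "mapp (ext N u f) (msubst free a bs) = eval_trm N u f ?t"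
      using ext_cls[OF N m F(1)] eval_typed[OF N m F(1)] ty by (simp add: mapp_def msubst_def free_simps prod_eq_iff)
    also have "\<dots> = msubst N (mapp (ext N u f) a) (map (mapp (ext N u f)) bs)"
      using ext_eval[OF N m sa] ext_eval[OF N m sb] by (simp add: comp_def cong: map_cong)
    finally show "mapp (ext N u f) (msubst free a bs) = msubst N (mapp (ext N u f) a) (map (mapp (ext N u f)) bs)" .
  qed
qed

lemma is_multicat_free: "is_multicat free"
proof (rule is_multicat_joint_embedding[where K = "{(N, u, ext N u f) | N u f. is_multicat N \<and> is_sig_mor A N (u, f)}"])
  show "small (colours free)" using small_O by (simp add: free_simps)
  show "small (ops free n)" for n
  proof -
    have "ops free n \<subseteq> cls ` {t. ok t}" by (auto simp: free_def)
    thus ?thesis unfolding small_def using less_subset[OF less_image[OF small_terms]] by blast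
  qed
  show "bnd free (n, a) i \<in> colours free" if a: "a \<in> ops free n" and i: "i \<in> {0..n}" for n a i
    using sig_act(5)[OF J_multicat(3) tp_op[OF free_op(1)[OF a]], of i] free_op(2)[OF a] i by (simp add: free_simps)
  show "act free (n, a) \<sigma> \<in> ops free n" if "a \<in> ops free n" "\<sigma> permutes {1..n}" for n a \<sigma>
    using free_act[OF that] by blast
  show "ident free c \<in> ops free 1" if "c \<in> colours free" for c
    unfolding free_simps by (rule cls_op) (use that in \<open>simp_all add: free_simps tp_simps\<close>)
  show "subst free a bs \<in> ops free (arity_sum bs)" if "substitutable free a bs" for a bs using free_sub[OF that] by blast
  show "is_multicat N \<and> is_multifunctor free N (u, f)"
    if "(N, u, f) \<in> {(N, u, ext N u f) | N u f. is_multicat N \<and> is_sig_mor A N (u, f)}" for N u f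
    using that ext_multifunctor by auto
  show "{(N, u, ext N u f) | N u f. is_multicat N \<and> is_sig_mor A N (u, f)} \<noteq> {}" using J_multicat(1) trace_one by blast
  show "a = b" if ab: "a \<in> ops free n" "b \<in> ops free n"
    and eq: "\<And>N u f. (N, u, f) \<in> {(N, u, ext N u f) | N u f. is_multicat N \<and> is_sig_mor A N (u, f)} \<Longrightarrow> f n a = f n b" for n a b
  proof -
    have "eval_trm N u f (trm_of a) = eval_trm N u f (trm_of b)" if m: "is_multicat N" "is_sig_mor A N (u, f)" for N u f
    proof -
      have "ext N u f n a = ext N u f n b" using eq[of N u "ext N u f"] m by blast
      thus ?thesis using ext_eval[OF m, of "(n, a)"] ext_eval[OF m, of "(n, b)"] ab by simp
    qed
    hence "rel (trm_of a) (trm_of b)" by (simp add: rel_def)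
    thus ?thesis using cls_eq[of "trm_of a" "trm_of b"] free_op[OF ab(1)] free_op[OF ab(2)] by simp
  qed
  show "c = d" if cd: "c \<in> colours free" "d \<in> colours free"
    and eq: "\<And>N u f. (N, u, f) \<in> {(N, u, ext N u f) | N u f. is_multicat N \<and> is_sig_mor A N (u, f)} \<Longrightarrow> dat u c = dat u d" for c d
  proof -
    have "dat one c = dat one d" using eq[of J one "ext J one (trace A one)"] J_multicat(1) trace_one by blast
    thus ?thesis using cd one(2) by (simp add: free_simps)
  qed
qed

definition gen_map :: "nat \<Rightarrow> 'v \<Rightarrow> 'v" where "gen_map n = (\<lambda>a \<in> ops A n. cls (Gen n a))"

lemma cls_Act: "ok (Act t \<sigma>) \<Longrightarrow> act free (n, cls t) \<sigma> = cls (Act t \<sigma>)"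
proof -
  assume o: "ok (Act t \<sigma>)"
  note T = trm_of[of t]
  have "ok (Act (trm_of (cls t)) \<sigma>)" "rel (Act (trm_of (cls t)) \<sigma>) (Act t \<sigma>)"
    using o T by (auto simp: rel_def)
  thus ?thesis using cls_eq[OF _ o] by (simp add: free_simps)
qed

lemma gen_map: "is_sig_mor A free (one, gen_map)"
  unfolding is_sig_mor_def prod.case
proof (intro conjI allI ballI impI)
  show "one \<in> Hom Sets O' (colours free)" using one(1) by (simp add: free_simps)
  fix n
  have op: "cls (Gen n a) \<in> ops free n" if "a \<in> ops A n" for a by (rule cls_op) (use that in \<open>simp_all add: tp_simps\<close>)
  show "gen_map n \<in> ops A n \<rightarrow>\<^sub>E ops free n" using op by (auto simp: gen_map_def)
  fix a assume a: "a \<in> ops A n"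
  show "bnd free (n, gen_map n a) i = dat one (bnd A (n, a) i)" if "i \<in> {0..n}" for i
    using trm_of[of "Gen n a"] a sig_mor(4)[OF trace_one, of "(n, a)" i] that
    by (simp add: gen_map_def free_simps tp_simps)
  fix \<sigma> assume s: "\<sigma> permutes {1..n}"
  have aa: "act A (n, a) \<sigma> \<in> ops A n" using sig_act(2)[OF sig, of "(n, a)" \<sigma>] a s by (simp add: actp_def)
  have o: "ok (Act (Gen n a) \<sigma>)" "ok (Gen n (act A (n, a) \<sigma>))" using a aa s by (auto simp: tp_simps)
  have "rel (Gen n (act A (n, a) \<sigma>)) (Act (Gen n a) \<sigma>)"
    unfolding rel_def
  proof (intro allI impI)
    fix N u f assume "is_multicat N" "is_sig_mor A N (u, f)"
    thus "eval_trm N u f (Gen n (act A (n, a) \<sigma>)) = eval_trm N u f (Act (Gen n a) \<sigma>)"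
      using sig_mor(3)[of A N u f "(n, a)" \<sigma>] a s by (simp add: actp_def)
  qed
  thus "gen_map n (act A (n, a) \<sigma>) = act free (n, gen_map n a) \<sigma>"
    using cls_eq[OF o(2,1)] cls_Act[OF o(1), of n] a aa by (simp add: gen_map_def)
qed

lemma multifunctor_on_terms:
  assumes N: "is_multicat N" and m: "is_sig_mor A N (u, f)" and k: "is_multifunctor free N (u, k)"
    and kf: "\<And>n a. a \<in> ops A n \<Longrightarrow> k n (cls (Gen n a)) = f n a"
  shows "ok t \<Longrightarrow> mapp k (fst (tp t), cls t) = eval_trm N u f t"
proof (induction t)
  case (Gen n a)
  thus ?case using kf by (simp add: tp_simps)
next
  case (Idt c)
  have "k 1 (ident free c) = ident N (dat u c)" using k Idt by (simp add: is_multifunctor_iff free_simps)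
  thus ?case by (simp add: tp_simps free_simps)
next
  case (Act t \<sigma>)
  have t: "ok t" "\<sigma> permutes {1..fst (tp t)}" using Act.prems by auto
  have ks: "is_sig_mor free N (u, k)" using k by (simp add: is_multifunctor_iff)
  have "mapp k (actp free (fst (tp t), cls t) \<sigma>) = actp N (mapp k (fst (tp t), cls t)) \<sigma>"
    by (rule sig_mor(3)[OF ks]) (use cls_op[OF t(1)] t(2) in simp_all)
  moreover have "actp free (fst (tp t), cls t) \<sigma> = (fst (tp (Act t \<sigma>)), cls (Act t \<sigma>))"
    using cls_Act[OF Act.prems, of "fst (tp t)"] by (simp add: actp_def tp_simps)
  ultimately show ?case using Act.IH[OF t(1)] by simp
next
  case (Sub t ts)
  have t: "ok t" and ts: "\<And>s. s \<in> set ts \<Longrightarrow> ok s" and si: "substitutable J (tp t) (map tp ts)"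
    using Sub.prems by auto
  let ?a = "(fst (tp t), cls t)" and ?b = "\<lambda>s. (fst (tp s), cls s)"
  have lt: "length ts = fst (tp t)" using si by (simp add: substitutable_def)
  have ti: "arg ts i \<in> set ts" if "i \<in> {1..fst (tp t)}" for i using that lt arg_in_set[of i ts] by simp
  have s: "substitutable free ?a (map ?b ts)"
    unfolding substitutable_def fst_conv
  proof (intro conjI ballI)
    show "snd ?a \<in> ops free (fst (tp t))" using cls_op[OF t] by simp
    show "length (map ?b ts) = fst (tp t)" using lt by simp
    fix i assume i: "i \<in> {1..fst (tp t)}"
    hence i': "i \<in> {1..length ts}" using lt by simp
    note oi = ts[OF ti[OF i]]
    have "bnd J (tp (arg ts i)) 0 = bnd J (tp t) i" using si i unfolding substitutable_def arg_map[OF i', symmetric] by blast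
    thus "snd (arg (map ?b ts) i) \<in> ops free (fst (arg (map ?b ts) i))" "bnd free (arg (map ?b ts) i) 0 = bnd free ?a i"
      unfolding arg_map[OF i'] using cls_op[OF oi] trm_of[OF oi] trm_of[OF t] by (auto simp: free_simps)
  qed
  have e: "msubst free ?a (map ?b ts) = (fst (tp (Sub t ts)), cls (Sub t ts))"
  proof -
    let ?s = "Sub (trm_of (cls t)) (map (\<lambda>s. trm_of (cls s)) ts)"
    have o: "ok ?s" using free_sub(1)[OF s] by (simp add: comp_def)
    have "rel ?s (Sub t ts)"
      unfolding rel_def
    proof (intro allI impI)
      fix N u f assume m: "is_multicat N" "is_sig_mor A N (u, f)"
      have "eval_trm N u f (trm_of (cls s)) = eval_trm N u f s" if "ok s" for s
        using rel_eval[OF _ m] trm_of[OF that] by blast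
      thus "eval_trm N u f ?s = eval_trm N u f (Sub t ts)" using t ts by (simp add: comp_def cong: map_cong)
    qed
    hence "cls ?s = cls (Sub t ts)" using cls_eq[OF o Sub.prems] by simp
    moreover have "arity_sum (map ?b ts) = arity_sum (map tp ts)" by (rule arity_sum_cong) simp
    ultimately show ?thesis by (simp add: msubst_def free_simps tp_simps comp_def)
  qed
  have "map (mapp k) (map ?b ts) = map (eval_trm N u f) ts" using Sub.IH(2)[OF _ ts] by simp
  thus ?case using multifunctor_sub[OF k s] e Sub.IH(1)[OF t] by (simp del: map_map)
qed

lemma free_universal:
  "universal_arrow Sig Multicat multicat_forget (sig.truncate A) free
     (Arrow (sig.truncate A) (one, gen_map) (sig.truncate free))"
  unfolding universal_arrow_def
proof (intro conjI ballI)
  have tr: "is_sig (sig.truncate M) \<longleftrightarrow> is_sig M" for M :: "'v multicat" by (simp add: is_sig_def sig.truncate_def)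
  have trm: "is_sig_mor (sig.truncate M) (sig.truncate N) = is_sig_mor M N" for M N :: "'v multicat"
    by (simp add: is_sig_mor_def sig.truncate_def fun_eq_iff)
  show "free \<in> Obj Multicat" using is_multicat_free by (simp add: Multicat_def)
  have sf: "is_sig free" using typed_multicat[OF is_multicat_free] by (simp add: typed_def)
  show "Arrow (sig.truncate A) (one, gen_map) (sig.truncate free) \<in> Hom Sig (sig.truncate A) (omap multicat_forget free)"
    using sig sf gen_map by (simp add: Hom_def Sig_def multicat_forget_def tr trm)
  fix N g assume "N \<in> Obj Multicat" and g: "g \<in> Hom Sig (sig.truncate A) (omap multicat_forget N)"
  hence N: "is_multicat N" by (simp add: Multicat_def)
  obtain u f where uf: "g = Arrow (sig.truncate A) (u, f) (sig.truncate N)" and m: "is_sig_mor A N (u, f)"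
    using g by (auto simp: Hom_def Sig_def multicat_forget_def trm)
  have u: "Cmp Sets v one = v" if "v \<in> Hom Sets O' (colours N)" for v using cat_idr[OF is_category_Sets that] .
  have fe: "f n \<in> extensional (ops A n)" for n using m by (simp add: is_sig_mor_def PiE_iff)
  have go: "gen_map n a = cls (Gen n a)" "cls (Gen n a) \<in> ops free n" if "a \<in> ops A n" for n a
    using that cls_op[of "Gen n a" n] by (simp_all add: gen_map_def tp_simps)
  show "\<exists>!h. h \<in> Hom Multicat free N \<and>
      Cmp Sig (amap multicat_forget h) (Arrow (sig.truncate A) (one, gen_map) (sig.truncate free)) = g"
  proof (rule ex1I[of _ "Arrow free (u, ext N u f) N"])
    have "compose (ops A n) (ext N u f n) (gen_map n) = f n" for n
    proof
      fix a show "compose (ops A n) (ext N u f n) (gen_map n) a = f n a"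
        using fe[of n] go[of a n] ext_cls[OF N m, of "Gen n a"]
        by (cases "a \<in> ops A n") (auto simp: compose_def extensional_def tp_simps)
    qed
    moreover have "ops (sig.truncate A) = ops A" by (simp add: sig.truncate_def)
    ultimately show "Arrow free (u, ext N u f) N \<in> Hom Multicat free N \<and>
        Cmp Sig (amap multicat_forget (Arrow free (u, ext N u f) N)) (Arrow (sig.truncate A) (one, gen_map) (sig.truncate free)) = g"
      using ext_multifunctor[OF N m] is_multicat_free N u[OF sig_mor(1)[OF m]]
      by (simp add: Hom_def Multicat_def Sig_def multicat_forget_def sig_cmp_simp uf)
  next
    fix h assume h: "h \<in> Hom Multicat free N \<and>
      Cmp Sig (amap multicat_forget h) (Arrow (sig.truncate A) (one, gen_map) (sig.truncate free)) = g"
    then obtain v k where vk: "h = Arrow free (v, k) N" "is_multifunctor free N (v, k)"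
      by (auto simp: Hom_def Multicat_def)
    have ks: "is_sig_mor free N (v, k)" using vk by (simp add: is_multifunctor_iff)
    have e: "Cmp Sets v one = u" "\<And>n. compose (ops A n) (k n) (gen_map n) = f n"
      using h by (auto simp: vk Sig_def multicat_forget_def sig_cmp_simp uf sig.truncate_def fun_eq_iff)
    have v: "v = u" using e(1) u[of v] sig_mor(1)[OF ks] by (simp add: free_simps)
    have kf: "k n (cls (Gen n a)) = f n a" if "a \<in> ops A n" for n a
      using fun_cong[OF e(2), of n a] that go by (simp add: compose_def)
    have "k n a = ext N u f n a" for n a
    proof (cases "a \<in> ops free n")
      case True
      have "mapp k (n, a) = eval_trm N u f (trm_of a)"
        using multifunctor_on_terms[OF N m vk(2)[unfolded v] kf free_op(1)[OF True]] free_op[OF True] by simp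
      also have "\<dots> = mapp (ext N u f) (n, a)" using ext_eval[OF N m, of "(n, a)"] True by simp
      finally show ?thesis by simp
    next
      case False
      have "k n \<in> extensional (ops free n)" using ks by (simp add: is_sig_mor_def PiE_iff)
      thus ?thesis using False by (simp add: extensional_def ext_def)
    qed
    hence "k = ext N u f" by blast
    thus "h = Arrow free (u, ext N u f) N" using vk(1) v by simp
  qed
qed

end

section \<open>The correspondence of free objects\<close>

context universe
begin

lemma multicat_forget_functor: "is_functor (Multicat :: ('v multicat, 'v sig_map) category) Sig multicat_forget"
proof (rule is_functorI[OF is_category_Multicat is_category_Sig])
  have tr: "is_sig (sig.truncate M) \<longleftrightarrow> is_sig M" for M :: "'v multicat" by (simp add: is_sig_def sig.truncate_def)
  have trm: "is_sig_mor (sig.truncate M) (sig.truncate N) = is_sig_mor M N" for M N :: "'v multicat"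
    by (simp add: is_sig_mor_def sig.truncate_def fun_eq_iff)
  have sig: "is_sig M" if "is_multicat M" for M :: "'v multicat" using typed_multicat[OF that] by (simp add: typed_def)
  show "omap multicat_forget M \<in> Obj Sig" if "M \<in> Obj Multicat" for M :: "'v multicat"
    using that sig by (simp add: Multicat_def Sig_def multicat_forget_def tr)
  show "amap multicat_forget f \<in> Hom Sig (omap multicat_forget M) (omap multicat_forget N)"
    if f: "f \<in> Hom Multicat M N" for f and M N :: "'v multicat"
  proof -
    obtain u k where "f = Arrow M (u, k) N" "is_multifunctor M N (u, k)" "is_multicat M" "is_multicat N"
      using f by (auto simp: Multicat_def Hom_def)
    thus ?thesis using sig by (simp add: Sig_def Hom_def multicat_forget_def tr trm is_multifunctor_iff)
  qed
  show "amap multicat_forget (Idn Multicat M) = Idn Sig (omap multicat_forget M)" for M :: "'v multicat"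
    by (simp add: multicat_forget_def Multicat_def Sig_def sig_id_def sig.truncate_def)
  show "amap multicat_forget (Cmp Multicat g f) = Cmp Sig (amap multicat_forget g) (amap multicat_forget f)" for g f
    by (simp add: multicat_forget_def Multicat_def Sig_def sig_cmp_def sig.truncate_def)
qed

lemma anmonad_forget_functor: "is_functor (AnMonad :: ('v anmonad, 'v an_map) category) An anmonad_forget"
proof (rule is_functorI[OF correspondence.D[OF AnMonad_correspondence] correspondence.D[OF An_correspondence]])
  have tr: "is_anfunc (anfunc.truncate M) \<longleftrightarrow> is_anfunc M" for M :: "'v anmonad"
    by (simp add: is_anfunc_def anfunc.truncate_def)
  have trm: "is_an_mor (anfunc.truncate M) (anfunc.truncate N) = is_an_mor M N" for M N :: "'v anmonad"
    by (simp add: is_an_mor_def anfunc.truncate_def fun_eq_iff)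
  show "omap anmonad_forget M \<in> Obj An" if "M \<in> Obj AnMonad" for M :: "'v anmonad"
    using that by (simp add: AnMonad_def An_def anmonad_forget_def tr is_anmonad_def)
  show "amap anmonad_forget f \<in> Hom An (omap anmonad_forget M) (omap anmonad_forget N)"
    if f: "f \<in> Hom AnMonad M N" for f and M N :: "'v anmonad"
  proof -
    obtain u k where "f = Arrow M (u, k) N" "is_anmonad_mor M N (u, k)" "is_anmonad M" "is_anmonad N"
      using f by (auto simp: AnMonad_def Hom_def)
    thus ?thesis by (simp add: An_def Hom_def anmonad_forget_def tr trm is_anmonad_mor_def is_anmonad_def)
  qed
  show "amap anmonad_forget (Idn AnMonad M) = Idn An (omap anmonad_forget M)" for M :: "'v anmonad"
    by (simp add: anmonad_forget_def AnMonad_def An_def an_id_def anfunc.truncate_def)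
  show "amap anmonad_forget (Cmp AnMonad g f) = Cmp An (amap anmonad_forget g) (amap anmonad_forget f)" for g f
    by (simp add: anmonad_forget_def AnMonad_def An_def an_cmp_def Let_def anfunc.truncate_def)
qed

lemma free_multicat_exists:
  assumes "A \<in> Obj (Sig :: ('v sig, 'v sig_map) category)"
  shows "\<exists>M e. universal_arrow Sig Multicat multicat_forget A M e"
proof -
  define A0 :: "'v multicat" where
    "A0 = \<lparr>colours = colours A, ops = ops A, act = act A, bnd = bnd A, ident = \<lambda>_. undefined, subst = \<lambda>_ _. undefined\<rparr>"
  have t: "sig.truncate A0 = A" by (simp add: A0_def sig.truncate_def)
  have "is_sig A0" using assms by (simp add: Sig_def A0_def is_sig_def)
  then interpret signature ty A0 by unfold_locales
  show ?thesis using free_universal unfolding t by blast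
qed

definition forget_key :: "'v multicat \<times> 'v anmonad \<times> ('v fn \<Rightarrow> nat \<times> 'v \<Rightarrow> 'v list \<Rightarrow> 'v) \<Rightarrow>
    'v sig \<times> 'v anfunc \<times> ('v fn \<Rightarrow> nat \<times> 'v \<Rightarrow> 'v list \<Rightarrow> 'v)" where
  "forget_key k = (sig.truncate (fst k), anfunc.truncate (fst (snd k)), snd (snd k))"

lemma truncate_fields:
  "colours M = colours (sig.truncate M)" "ops M = ops (sig.truncate M)"
  "act M = act (sig.truncate M)" "bnd M = bnd (sig.truncate M)" for M :: "'v multicat"
  by (simp_all add: sig.truncate_def)

lemma forget_key:
  assumes "k \<in> AnMonad_keys"
  shows "forget_key k \<in> An_keys \<and> fst (forget_key k) = omap multicat_forget (fst k) \<and>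
    fst (snd (forget_key k)) = omap anmonad_forget (fst (snd k))"
proof -
  have "presents k" using assms presents_induced[of "fst k" "fst (snd k)" "snd (snd k)"] by (simp add: AnMonad_keys_def)
  thus ?thesis
    using sig_cong(5)[OF truncate_fields, of "fst k" "fctr (fst (snd k))" "snd (snd k)"]
    by (simp add: forget_key_def An_keys_def presents_def multicat_forget_def anmonad_forget_def anfunc.truncate_def
        sig.truncate_def)
qed

lemma forget_an_arrow:
  assumes k: "k \<in> AnMonad_keys" "k' \<in> AnMonad_keys"
  shows "amap anmonad_forget (an_arrow k k' f) = an_arrow (forget_key k) (forget_key k') (amap multicat_forget f)"
proof -
  obtain M T ev where K: "k = (M, T, ev)" by (cases k)
  obtain N R ev' where K': "k' = (N, R, ev')" by (cases k')
  have p: "presentation M (fctr T) ev" "presentation N (fctr R) ev'"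
    using k K K' by (auto simp: AnMonad_keys_def induced_def)
  note p' = sig_cong(5)[OF truncate_fields, THEN iffD1, OF p(1)] sig_cong(5)[OF truncate_fields, THEN iffD1, OF p(2)]
  have r: "presentation.rep (sig.truncate M) ev = presentation.rep M ev"
    unfolding fun_eq_iff presentation.rep_def[OF p(1)] presentation.rep_def[OF p'(1)]
      sig_cong(2)[OF truncate_fields, of M] by simp
  have "comp_arrow (sig.truncate M) (fctr T) ev (fctr R) ev' = comp_arrow M (fctr T) ev (fctr R) ev'"
    unfolding fun_eq_iff presentation_pair.component_def[OF presentation_pairI[OF p]]
      presentation_pair.component_def[OF presentation_pairI[OF p']] r by (simp add: sig.truncate_def)
  thus ?thesis
    by (simp add: an_arrow_def forget_key_def multicat_forget_def anmonad_forget_def anfunc.truncate_def K K')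
qed

lemma forget_inverse:
  assumes k: "k \<in> AnMonad_keys" "k' \<in> AnMonad_keys" and g: "g \<in> Hom AnMonad (fst (snd k)) (fst (snd k'))"
  shows "amap multicat_forget (correspondence.\<Psi> Multicat fst an_arrow k k' g) =
    correspondence.\<Psi> Sig fst an_arrow (forget_key k) (forget_key k') (amap anmonad_forget g)"
proof -
  interpret X: correspondence Sig An An_keys fst "\<lambda>k. fst (snd k)" an_arrow by (rule An_correspondence)
  interpret Y: correspondence Multicat AnMonad AnMonad_keys fst "\<lambda>k. fst (snd k)" an_arrow by (rule AnMonad_correspondence)
  note f = Y.\<Psi>_hom[OF k g]
  note j = forget_key[OF k(1)] and j' = forget_key[OF k(2)]
  have "amap multicat_forget (Y.\<Psi> k k' g) \<in> Hom Sig (fst (forget_key k)) (fst (forget_key k'))"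
    using func_hom[OF multicat_forget_functor f] j j' by simp
  hence "X.\<Psi> (forget_key k) (forget_key k') (an_arrow (forget_key k) (forget_key k') (amap multicat_forget (Y.\<Psi> k k' g))) =
     amap multicat_forget (Y.\<Psi> k k' g)"
    using X.\<Psi>\<Phi> j j' by blast
  thus ?thesis using forget_an_arrow[OF k, of "Y.\<Psi> k k' g"] Y.\<Phi>\<Psi>[OF k g] by simp
qed

end

theorem corollary7p6:
  assumes uncountable: "natLeq <o |UNIV :: 'v set|"
    and regular: "regularCard |UNIV :: 'v set|"
  shows "(\<exists>L. left_adjoint (Sig :: ('v sig, 'v sig_map) category) Multicat L multicat_forget) \<and>
    (\<exists>L. left_adjoint (An :: ('v anfunc, 'v an_map) category) AnMonad L anmonad_forget) \<and>
    (\<exists>E :: ('v multicat, 'v sig_map, 'v anmonad, 'v an_map) func.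
       fibration_equivalence Sets Multicat colours_func AnMonad base_func E \<and>
       (\<forall>M \<in> Obj Multicat.
          free_object Sig Multicat multicat_forget M \<longleftrightarrow>
          free_object An AnMonad anmonad_forget (omap E M)))"
proof -
  interpret universe "TYPE('v)" by unfold_locales (rule uncountable, rule regular)
  note X = An_correspondence and Y = AnMonad_correspondence
  interpret X: correspondence "Sig :: ('v sig, 'v sig_map) category" An An_keys fst "\<lambda>k. fst (snd k)" an_arrow by (rule X)
  interpret Y: fibred_correspondence "Multicat :: ('v multicat, 'v sig_map) category" AnMonad AnMonad_keys fst
    "\<lambda>k. fst (snd k)" an_arrow Sets colours_func base_func
  proof (intro fibred_correspondence.intro fibred_correspondence_axioms.intro Y colours_functor)
    fix k :: "'v multicat \<times> 'v anmonad \<times> ('v fn \<Rightarrow> nat \<times> 'v \<Rightarrow> 'v list \<Rightarrow> 'v)" assume "k \<in> AnMonad_keys"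
    thus "omap base_func (fst (snd k)) = omap colours_func (fst k)"
      using presents_induced[of "fst k" "fst (snd k)" "snd (snd k)"]
      by (simp add: AnMonad_keys_def presents_def base_func_def colours_func_def)
  qed (simp add: an_arrow_def base_func_def colours_func_def)
  note U = multicat_forget_functor and V = anmonad_forget_functor
  have transport: "universal_arrow An AnMonad anmonad_forget (fst (snd k)) (fst (snd k')) (an_arrow k (forget_key k') e)"
    if "k \<in> An_keys" "k' \<in> AnMonad_keys" "universal_arrow Sig Multicat multicat_forget (fst k) (fst k') e" for k k' e
    by (rule universal_arrow_transport[OF X Y U forget_key forget_an_arrow that])
  have transport': "\<exists>e. universal_arrow Sig Multicat multicat_forget (fst k) (fst k') e"
    if "k \<in> An_keys" "k' \<in> AnMonad_keys" "universal_arrow An AnMonad anmonad_forget (fst (snd k)) (fst (snd k')) e" for k k' e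
    using universal_arrow_transport[OF X.flip Y.flip V _ forget_inverse that] forget_key by blast
  have exM: "\<exists>M e. universal_arrow Sig Multicat multicat_forget A M e" if "A \<in> Obj Sig" for A :: "'v sig"
    by (rule free_multicat_exists[OF that])
  have exT: "\<exists>T e. universal_arrow An AnMonad anmonad_forget P T e" if P: "P \<in> Obj An" for P :: "'v anfunc"
  proof -
    obtain k where k: "k \<in> An_keys" "fst (snd k) = P" using X.r_ex[OF P] by blast
    obtain M e where M: "universal_arrow Sig Multicat multicat_forget (fst k) M e" using exM[OF X.l_obj[OF k(1)]] by blast
    hence "M \<in> Obj Multicat" by (simp add: universal_arrow_def)
    then obtain k' where "k' \<in> AnMonad_keys" "fst k' = M" using Y.l_ex by blast
    thus ?thesis using transport[OF k(1), of k' e] M k(2) by blast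
  qed
  obtain s where s: "\<And>M. M \<in> Obj Multicat \<Longrightarrow> s M \<in> AnMonad_keys \<and> fst (s M) = M" using Y.l_ex by metis
  have free: "free_object Sig Multicat multicat_forget M \<longleftrightarrow> free_object An AnMonad anmonad_forget (omap (Y.E s) M)"
    if M: "M \<in> Obj Multicat" for M
  proof -
    have sM: "s M \<in> AnMonad_keys" "fst (s M) = M" "omap (Y.E s) M = fst (snd (s M))" using s[OF M] by (auto simp: Y.E_def)
    have "free_object Sig Multicat multicat_forget M \<longleftrightarrow>
        (\<exists>a\<in>Obj Sig. \<exists>e. universal_arrow Sig Multicat multicat_forget a M e)"
      by (rule free_object_iff[OF U]) (rule exM)
    moreover have "free_object An AnMonad anmonad_forget (fst (snd (s M))) \<longleftrightarrow>
        (\<exists>a\<in>Obj An. \<exists>e. universal_arrow An AnMonad anmonad_forget a (fst (snd (s M))) e)"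
      by (rule free_object_iff[OF V]) (rule exT)
    ultimately show ?thesis unfolding sM(3)
    proof (elim ssubst, intro iffI)
      assume "\<exists>a\<in>Obj Sig. \<exists>e. universal_arrow Sig Multicat multicat_forget a M e"
      then obtain a e where a: "a \<in> Obj Sig" "universal_arrow Sig Multicat multicat_forget a M e" by blast
      obtain k where k: "k \<in> An_keys" "fst k = a" using X.l_ex[OF a(1)] by blast
      show "\<exists>a\<in>Obj An. \<exists>e. universal_arrow An AnMonad anmonad_forget a (fst (snd (s M))) e"
        using transport[OF k(1) sM(1), of e] a(2) X.r_obj[OF k(1)] unfolding k(2) sM(2) by blast
    next
      assume "\<exists>a\<in>Obj An. \<exists>e. universal_arrow An AnMonad anmonad_forget a (fst (snd (s M))) e"
      then obtain P e where P: "P \<in> Obj An" "universal_arrow An AnMonad anmonad_forget P (fst (snd (s M))) e" by blast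
      obtain k where k: "k \<in> An_keys" "fst (snd k) = P" using X.r_ex[OF P(1)] by blast
      show "\<exists>a\<in>Obj Sig. \<exists>e. universal_arrow Sig Multicat multicat_forget a M e"
        using transport'[OF k(1) sM(1), of e] P(2) X.l_obj[OF k(1)] unfolding k(2) sM(2) by blast
    qed
  qed
  have "\<exists>L. left_adjoint (Sig :: ('v sig, 'v sig_map) category) Multicat L multicat_forget"
    by (rule left_adjoint_exists[OF U]) (rule exM)
  moreover have "\<exists>L. left_adjoint (An :: ('v anfunc, 'v an_map) category) AnMonad L anmonad_forget"
    by (rule left_adjoint_exists[OF V]) (rule exT)
  moreover have "fibration_equivalence Sets Multicat colours_func AnMonad base_func (Y.E s)"
    by (rule Y.E_fibration_equivalence[OF fibration_Multicat s])
  ultimately show ?thesis using free by blast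
qed

end
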